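(* Let $d\ge1$, $r\geq 2$, let $\mathbb{F}_r$ be the free group on $a_1,\dots,a_r$, let $\rho:\mathbb{F}_r\to\mathrm{GL}_d(\mathbb{Z})$ be a homomorphism, and let $G=\mathbb{Z}^d\rtimes\mathbb{F}_r$ be the semidirect product in which $\gamma\in\mathbb{F}_r$ acts on $\mathbb{Z}^d$ by $\rho(\gamma)$. With $G_v$, $\mathrm{Conj}(G_v)$, $\mathcal{P}_{\mathscr{C}}$ and $\mathcal{D}_{\mathscr{C}}$ as defined in the context, there is a $G$-invariant countable partition \[\mathcal{K}(G)=\bigsqcup_{\mathscr{C}\in \mathrm{Conj}(G_v)}\mathcal{P}_{\mathscr{C}}\] into $F_\sigma$-subsets of $\mathcal{K}(G)$ and, for every $\mathscr{C}\in \mathrm{Conj}(G_v)$, the set $\mathcal{D}_{\mathscr{C}}\subseteq\mathcal{P}_{\mathscr{C}}$ is a countable $G$-invariant subset, open in $\mathcal{P}_{\mathscr{C}}$ for the induced topology, such that there exists a dense orbit (for the action of $G$ by conjugation) in $\mathcal{P}_{\mathscr{C}}\setminus\mathcal{D}_{\mathscr{C}}$. Moreover, writing $\mathscr{C}=\{\rho(\gamma)\Lambda_0 \mid \gamma\in\mathbb{F}_r\}$ for some $\Lambda_0\leq\mathbb{Z}^d$: \begin{enumerate} \item if $\Lambda_0$ has finite index in $\mathbb{Z}^d$, then $\mathcal{P}_{\mathscr{C}}$ is a clopen subset of $\mathcal{K}(G)$; \item $\mathcal{P}_{\mathscr{C}}$ is closed if and only if $\mathrm{Stab}_{\mathbb{F}_r}(\Lambda_0)$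 has finite index in $\mathbb{F}_r$; \item if $\mathrm{Stab}_{\mathbb{F}_r}(\Lambda_0)$ either is infinitely generated or has finite index in $\mathbb{F}_r$, then $\mathcal{D}_{\mathscr{C}}=\emptyset$. \end{enumerate}
   Context: For a countable group $\Gamma$, $\mathrm{Sub}(\Gamma)$ is the set of subgroups of $\Gamma$ with the Chabauty topology (induced from $\{0,1\}^\Gamma$), on which $\Gamma$ acts by conjugation. The perfect kernel $\mathcal{K}(\Gamma)$ is the largest closed subset of $\mathrm{Sub}(\Gamma)$ without isolated points (possibly empty). Write $G_v=\mathbb{Z}^d\times\{1\}\leq G$, identified with $\mathbb{Z}^d$, and let $\pi:G\to\mathbb{F}_r$ be the projection. $\mathbb{F}_r$ acts on $\mathrm{Sub}(G_v)$ by $\gamma\cdot\Lambda=\rho(\gamma)\Lambda$, and $\mathrm{Stab}_{\mathbb{F}_r}(\Lambda)$ is the stabilizer of $\Lambda$ for this action. $\mathrm{Conj}(G_v)$ is the set of orbits for the action of $G$ on $\mathrm{Sub}(G_v)$ by conjugation; these are the sets $\{\rho(\gamma)\Lambda_0\mid\gamma\in\mathbb{F}_r\}$ with $\Lambda_0\leq\mathbb{Z}^d$. For $\mathscr{C}\in \mathrm{Conj}(G_v)$, \[\mathcal{P}_{\mathscr{C}}=\{H\in\mathcal{K}(G)\mid H\cap G_v\in\mathscr{C}\},\] \[\mathcal{D}_{\mathscr{C}}=\{H\in\mathcal{P}_{\mathscr{C}}\mid \pi(H)\notin\mathcal{K}(\mathrm{Stab}_{\mathbb{F}_r}(H\cap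 G_v))\}.\] (One always has $\pi(H)\leq\mathrm{Stab}_{\mathbb{F}_r}(H\cap G_v)$.)
   Formalization: The dense orbit in P_C \ D_C is asserted only when K(Stab(Λ_0)) is nonempty; when it is empty (e.g. Stab(Λ_0) infinite cyclic), D_C = P_C, so P_C \ D_C is empty and contains no orbit. *)

theory Defs
  imports
    "HOL-Analysis.Analysis"
    "HOL-Algebra.Group_Action"
    "HOL-Algebra.Generated_Groups"
begin

section \<open>Free groups\<close>

text \<open>
  The letter \<open>(a, True)\<close> stands for the generator \<open>a\<close> and \<open>(a, False)\<close> for its inverse.
  Elements of the free group on \<open>A\<close> are the reduced words with letters from \<open>A\<close>.
\<close>

type_synonym 'a fword = "('a \<times> bool) list"

fun letter_inv :: "'a \<times> bool \<Rightarrow> 'a \<times> bool" where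
  "letter_inv (a, b) = (a, \<not> b)"

fun reduced_word :: "'a fword \<Rightarrow> bool" where
  "reduced_word [] = True"
| "reduced_word [x] = True"
| "reduced_word (x # y # w) = (y \<noteq> letter_inv x \<and> reduced_word (y # w))"

fun rcons :: "'a \<times> bool \<Rightarrow> 'a fword \<Rightarrow> 'a fword" where
  "rcons x [] = [x]"
| "rcons x (y # w) = (if y = letter_inv x then w else x # y # w)"

definition free_group :: "'a set \<Rightarrow> 'a fword monoid" where
  "free_group A =
     \<lparr>carrier = {w. reduced_word w \<and> fst ` set w \<subseteq> A},
      mult = (\<lambda>u v. foldr rcons u v),
      one = []\<rparr>"

lemma letter_inv_inv [simp]: "letter_inv (letter_inv x) = x"
  by (cases x) auto

lemma letter_inv_neq [simp]: "letter_inv x \<noteq> x" "x \<noteq> letter_inv x"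
  by (cases x; auto)+

lemma fst_letter_inv [simp]: "fst (letter_inv x) = fst x"
  by (cases x) auto

lemma letter_inv_eq_iff: "x = letter_inv y \<longleftrightarrow> y = letter_inv x"
  by (cases x; cases y) auto

lemma reduced_Cons: "reduced_word (x # w) \<longleftrightarrow> (w = [] \<or> hd w \<noteq> letter_inv x) \<and> reduced_word w"
  by (cases w) auto

lemma reduced_rcons: "reduced_word w \<Longrightarrow> reduced_word (rcons x w)"
  by (cases w) (auto simp: reduced_Cons)

lemma reduced_foldr_rcons: "reduced_word w \<Longrightarrow> reduced_word (foldr rcons u w)"
  by (induction u) (auto simp: reduced_rcons)

lemma rcons_cancel: "reduced_word w \<Longrightarrow> rcons (letter_inv x) (rcons x w) = w"
  by (cases w rule: reduced_word.cases) auto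

lemma rcons_cancel': "reduced_word w \<Longrightarrow> rcons x (rcons (letter_inv x) w) = w"
  using rcons_cancel[of w "letter_inv x"] by simp

lemma set_rcons: "set (rcons x w) \<subseteq> insert x (set w)"
  by (cases w) auto

lemma set_foldr_rcons: "set (foldr rcons u w) \<subseteq> set u \<union> set w"
proof (induction u)
  case (Cons x u)
  then show ?case using set_rcons[of x "foldr rcons u w"] by auto
qed simp

lemma fst_foldr_rcons:
  "fst ` set u \<subseteq> A \<Longrightarrow> fst ` set v \<subseteq> A \<Longrightarrow> fst ` set (foldr rcons u v) \<subseteq> A"
  using image_mono[OF set_foldr_rcons[of u v], of fst] by (simp only: image_Un) blast

lemma rcons_reduced: "reduced_word (x # w) \<Longrightarrow> rcons x w = x # w"
  by (cases w) auto

lemma foldr_rcons_Nil: "reduced_word u \<Longrightarrow> foldr rcons u [] = u"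
  by (induction u) (auto simp: reduced_Cons rcons_reduced)

lemma foldr_rcons_rcons:
  "reduced_word w \<Longrightarrow> foldr rcons (rcons x u) w = rcons x (foldr rcons u w)"
  by (cases u) (auto simp: rcons_cancel' reduced_foldr_rcons)

lemma foldr_rcons_assoc:
  "reduced_word w \<Longrightarrow> foldr rcons (foldr rcons u v) w = foldr rcons u (foldr rcons v w)"
  by (induction u) (auto simp: foldr_rcons_rcons)

lemma foldr_rcons_inverse:
  "reduced_word w \<Longrightarrow> foldr rcons (rev (map letter_inv u)) (foldr rcons u w) = w"
  by (induction u arbitrary: w) (auto simp: rcons_cancel reduced_foldr_rcons)

lemma group_free_group: "group (free_group A)"
proof (rule groupI)
  fix u v assume "u \<in> carrier (free_group A)" "v \<in> carrier (free_group A)"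
  then show "u \<otimes>\<^bsub>free_group A\<^esub> v \<in> carrier (free_group A)"
    using fst_foldr_rcons[of u A v] by (auto simp: free_group_def reduced_foldr_rcons)
next
  fix u assume u: "u \<in> carrier (free_group A)"
  let ?v = "foldr rcons (rev (map letter_inv u)) []"
  have "set ?v \<subseteq> letter_inv ` set u"
    using set_foldr_rcons[of "rev (map letter_inv u)" "[]"] by simp
  then have "fst ` set ?v \<subseteq> fst ` set u" using image_mono[of "set ?v" "letter_inv ` set u" fst] by (simp add: image_image)
  then have "?v \<in> carrier (free_group A)"
    using u by (auto simp: free_group_def reduced_foldr_rcons)
  moreover have "?v \<otimes>\<^bsub>free_group A\<^esub> u = \<one>\<^bsub>free_group A\<^esub>"
    using u foldr_rcons_inverse[of "[]" u] foldr_rcons_assoc[of u "rev (map letter_inv u)" "[]"]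
    by (simp add: free_group_def foldr_rcons_Nil)
  ultimately show "\<exists>v\<in>carrier (free_group A). v \<otimes>\<^bsub>free_group A\<^esub> u = \<one>\<^bsub>free_group A\<^esub>" by blast
qed (auto simp: free_group_def foldr_rcons_assoc)

theorem free_group_universal:
  assumes H: "group H" and f: "\<And>a. a \<in> A \<Longrightarrow> f a \<in> carrier H"
  shows "\<exists>h\<in>hom (free_group A) H. (\<forall>a\<in>A. h [(a, True)] = f a) \<and>
    (\<forall>k\<in>hom (free_group A) H. (\<forall>a\<in>A. k [(a, True)] = f a) \<longrightarrow>
      (\<forall>w\<in>carrier (free_group A). k w = h w))"
proof -
  interpret H: group H by (rule H)
  interpret F: group "free_group A" by (rule group_free_group)
  define ev where "ev x = (if snd x then f (fst x) else inv\<^bsub>H\<^esub> f (fst x))" for x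
  define h where "h w = foldr (\<lambda>x y. ev x \<otimes>\<^bsub>H\<^esub> y) w \<one>\<^bsub>H\<^esub>" for w
  have ev_cl: "ev x \<in> carrier H" if "fst x \<in> A" for x
    using that f by (auto simp: ev_def)
  have ev_inv: "ev (letter_inv x) = inv\<^bsub>H\<^esub> ev x" if "fst x \<in> A" for x
    using that f by (cases x) (auto simp: ev_def)
  have h_cl: "h w \<in> carrier H" if "fst ` set w \<subseteq> A" for w
    using that by (induction w) (auto simp: h_def ev_cl)
  have h_rcons: "h (rcons x w) = ev x \<otimes>\<^bsub>H\<^esub> h w" if "fst ` set (x # w) \<subseteq> A" for x w
  proof (cases w)
    case (Cons y v)
    show ?thesis
    proof (cases "y = letter_inv x")
      case True
      have "ev x \<otimes>\<^bsub>H\<^esub> h w = ev x \<otimes>\<^bsub>H\<^esub> (inv\<^bsub>H\<^esub> ev x \<otimes>\<^bsub>H\<^esub> h v)"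
        using Cons True that by (simp add: h_def ev_inv)
      also have "\<dots> = h v"
        using that Cons h_cl[of v] ev_cl[of x] by (simp add: H.m_assoc[symmetric])
      finally show ?thesis using Cons True by simp
    qed (simp add: h_def Cons)
  qed (simp add: h_def)
  have h_mult: "h (foldr rcons u v) = h u \<otimes>\<^bsub>H\<^esub> h v"
    if "fst ` set u \<subseteq> A" "fst ` set v \<subseteq> A" for u v
    using that
  proof (induction u)
    case Nil
    then show ?case using h_cl[of v] by (simp add: h_def)
  next
    case (Cons x u)
    have "fst ` set (foldr rcons u v) \<subseteq> A"
      using fst_foldr_rcons[of u A v] Cons.prems by simp
    then have "h (foldr rcons (x # u) v) = ev x \<otimes>\<^bsub>H\<^esub> (h u \<otimes>\<^bsub>H\<^esub> h v)"
      using Cons by (simp add: h_rcons)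
    also have "\<dots> = (ev x \<otimes>\<^bsub>H\<^esub> h u) \<otimes>\<^bsub>H\<^esub> h v"
      using Cons.prems h_cl[of u] h_cl[of v] ev_cl[of x] by (simp add: H.m_assoc)
    finally show ?case by (simp add: h_def)
  qed
  have hom: "h \<in> hom (free_group A) H"
    by (rule homI) (auto simp: free_group_def h_mult h_cl)
  have gen: "h [(a, True)] = f a" if "a \<in> A" for a
    using f[OF that] by (simp add: h_def ev_def)
  have uniq: "k w = h w"
    if k: "k \<in> hom (free_group A) H" "\<forall>a\<in>A. k [(a, True)] = f a"
      and w: "w \<in> carrier (free_group A)" for k w
  proof -
    interpret K: group_hom "free_group A" H k
      using k(1) F.group_axioms H by (simp add: group_hom_def group_hom_axioms_def)
    have k_letter: "k [x] = ev x" if "fst x \<in> A" for x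
    proof (cases x)
      case (Pair a b)
      show ?thesis
      proof (cases b)
        case False
        have c: "[(a, True)] \<in> carrier (free_group A)" "[(a, False)] \<in> carrier (free_group A)"
          using that Pair by (auto simp: free_group_def)
        have "[(a, False)] \<otimes>\<^bsub>free_group A\<^esub> [(a, True)] = \<one>\<^bsub>free_group A\<^esub>"
          by (simp add: free_group_def)
        then have "[(a, False)] = inv\<^bsub>free_group A\<^esub> [(a, True)]"
          using c F.inv_equality by metis
        then show ?thesis using k(2) that Pair False c by (simp add: ev_def)
      qed (use k(2) that Pair in \<open>simp add: ev_def\<close>)
    qed
    show ?thesis using w
    proof (induction w)
      case Nil
      then show ?case using K.hom_one by (simp add: free_group_def h_def)
    next
      case (Cons x w)
      then have c: "w \<in> carrier (free_group A)" "[x] \<in> carrier (free_group A)"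
        by (auto simp: free_group_def reduced_Cons)
      have "x # w = [x] \<otimes>\<^bsub>free_group A\<^esub> w"
        using Cons.prems by (simp add: free_group_def rcons_reduced)
      then have "k (x # w) = k [x] \<otimes>\<^bsub>H\<^esub> k w" using c by simp
      then show ?case using Cons c k_letter[of x] by (simp add: h_def free_group_def)
    qed
  qed
  show ?thesis using hom gen uniq by blast
qed


section \<open>The space of subgroups and its perfect kernel\<close>

text \<open>A subgroup is identified with its indicator function in \<open>{0,1}\<^sup>\<Gamma>\<close>.\<close>

definition chabauty :: "('g, 'm) monoid_scheme \<Rightarrow> 'g set topology" where
  "chabauty \<Gamma> = pullback_topology {H. subgroup H \<Gamma>} (\<lambda>H. \<lambda>g\<in>carrier \<Gamma>. g \<in> H)
     (product_topology (\<lambda>_. discrete_topology (UNIV :: bool set)) (carrier \<Gamma>))"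

definition perfect_kernel_of :: "'a topology \<Rightarrow> 'a set" where
  "perfect_kernel_of X = (GREATEST C. closedin X C \<and> C \<subseteq> X derived_set_of C)"

definition perfect_kernel :: "('g, 'm) monoid_scheme \<Rightarrow> 'g set set" where
  "perfect_kernel \<Gamma> = perfect_kernel_of (chabauty \<Gamma>)"

definition conj_subgroup :: "('g, 'm) monoid_scheme \<Rightarrow> 'g \<Rightarrow> 'g set \<Rightarrow> 'g set" where
  "conj_subgroup \<Gamma> g H = g <#\<^bsub>\<Gamma>\<^esub> H #>\<^bsub>\<Gamma>\<^esub> (inv\<^bsub>\<Gamma>\<^esub> g)"

definition conj_invariant :: "('g, 'm) monoid_scheme \<Rightarrow> 'g set set \<Rightarrow> bool" where
  "conj_invariant \<Gamma> S \<longleftrightarrow> (\<forall>g\<in>carrier \<Gamma>. \<forall>H\<in>S. conj_subgroup \<Gamma> g H \<in> S)"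

definition finite_index :: "'g set \<Rightarrow> ('g, 'm) monoid_scheme \<Rightarrow> bool" where
  "finite_index H \<Gamma> \<longleftrightarrow> finite (rcosets\<^bsub>\<Gamma>\<^esub> H)"

definition finitely_generated :: "('g, 'm) monoid_scheme \<Rightarrow> bool" where
  "finitely_generated \<Gamma> \<longleftrightarrow> (\<exists>S. finite S \<and> S \<subseteq> carrier \<Gamma> \<and> generate \<Gamma> S = carrier \<Gamma>)"

lemma topspace_chabauty: "topspace (chabauty \<Gamma>) = {H. subgroup H \<Gamma>}"
  by (auto simp: chabauty_def topspace_pullback_topology)

lemma openin_chabauty_basic:
  assumes "g \<in> carrier \<Gamma>"
  shows "openin (chabauty \<Gamma>) {H. subgroup H \<Gamma> \<and> g \<in> H}"
    and "openin (chabauty \<Gamma>) {H. subgroup H \<Gamma> \<and> g \<notin> H}"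
proof -
  let ?T = "product_topology (\<lambda>_. discrete_topology (UNIV :: bool set)) (carrier \<Gamma>)"
  have "openin ?T {f \<in> topspace ?T. f g \<in> {b}}" for b
    using assms by (intro openin_continuous_map_preimage[OF continuous_map_product_projection]) auto
  from this[of True] this[of False]
  have "openin ?T {f \<in> topspace ?T. f g}" "openin ?T {f \<in> topspace ?T. \<not> f g}" by auto
  moreover have
    "{H. subgroup H \<Gamma> \<and> g \<in> H} =
       (\<lambda>H. \<lambda>g\<in>carrier \<Gamma>. g \<in> H) -` {f \<in> topspace ?T. f g} \<inter> {H. subgroup H \<Gamma>}"
    "{H. subgroup H \<Gamma> \<and> g \<notin> H} =
       (\<lambda>H. \<lambda>g\<in>carrier \<Gamma>. g \<in> H) -` {f \<in> topspace ?T. \<not> f g} \<inter> {H. subgroup H \<Gamma>}"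
    using assms by auto
  ultimately show "openin (chabauty \<Gamma>) {H. subgroup H \<Gamma> \<and> g \<in> H}"
    and "openin (chabauty \<Gamma>) {H. subgroup H \<Gamma> \<and> g \<notin> H}"
    unfolding chabauty_def openin_pullback_topology by blast+
qed

text \<open>The largest closed subset without isolated points always exists.\<close>

lemma perfect_kernel_of:
  shows closedin_perfect_kernel_of: "closedin X (perfect_kernel_of X)"
    and perfect_kernel_of_subset_derived:
      "perfect_kernel_of X \<subseteq> X derived_set_of (perfect_kernel_of X)"
    and perfect_kernel_of_greatest:
      "closedin X C \<Longrightarrow> C \<subseteq> X derived_set_of C \<Longrightarrow> C \<subseteq> perfect_kernel_of X"
    and perfect_kernel_of_eq_Union:
      "perfect_kernel_of X = \<Union>{C. closedin X C \<and> C \<subseteq> X derived_set_of C}"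
proof -
  let ?P = "\<lambda>C. closedin X C \<and> C \<subseteq> X derived_set_of C"
  let ?U = "\<Union>{C. ?P C}"
  have U: "?U \<subseteq> X derived_set_of ?U"
  proof (rule Union_least)
    fix C assume "C \<in> {C. ?P C}"
    then have "C \<subseteq> X derived_set_of C" "C \<subseteq> ?U" by auto
    then show "C \<subseteq> X derived_set_of ?U" using derived_set_of_mono by blast
  qed
  have top: "?U \<subseteq> topspace X" by (auto dest: closedin_subset)
  have "X closure_of ?U \<subseteq> X derived_set_of ?U"
    using U unfolding closure_of by (rule_tac le_infI2, rule_tac Un_least) (assumption, rule order_refl)
  also have "\<dots> \<subseteq> X derived_set_of (X closure_of ?U)"
    by (rule derived_set_of_mono[OF closure_of_subset[OF top]])
  finally have "X closure_of ?U \<subseteq> X derived_set_of (X closure_of ?U)" .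
  then have "?P (X closure_of ?U)" using closedin_closure_of by blast
  then have "X closure_of ?U \<subseteq> ?U" by blast
  then have "X closure_of ?U = ?U" using closure_of_subset[OF top] by (rule subset_antisym)
  then have "?P ?U" using \<open>?P (X closure_of ?U)\<close> by (simp only:)
  then have eq: "perfect_kernel_of X = ?U"
    unfolding perfect_kernel_of_def by (intro Greatest_equality) auto
  show "perfect_kernel_of X = ?U" by (rule eq)
  show "closedin X (perfect_kernel_of X)"
    and "perfect_kernel_of X \<subseteq> X derived_set_of (perfect_kernel_of X)"
    using \<open>?P ?U\<close> unfolding eq by blast+
  show "C \<subseteq> perfect_kernel_of X" if "closedin X C" "C \<subseteq> X derived_set_of C"
    using that unfolding eq by blast
qed


section \<open>Semidirect products of integer lattices\<close>

definition zlattice :: "(int ^ 'd) monoid" where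
  "zlattice = \<lparr>carrier = UNIV, mult = (+), one = 0\<rparr>"

definition GL_int :: "(int ^ 'd ^ 'd) monoid" where
  "GL_int = \<lparr>carrier = {A. invertible A}, mult = (**), one = mat 1\<rparr>"

definition semidirect ::
  "('g, 'm) monoid_scheme \<Rightarrow> ('g \<Rightarrow> int ^ 'd ^ 'd) \<Rightarrow> ((int ^ 'd) \<times> 'g) monoid" where
  "semidirect F \<rho> =
     \<lparr>carrier = UNIV \<times> carrier F,
      mult = (\<lambda>(v, \<gamma>) (w, \<delta>). (v + \<rho> \<gamma> *v w, \<gamma> \<otimes>\<^bsub>F\<^esub> \<delta>)),
      one = (0, \<one>\<^bsub>F\<^esub>)\<rparr>"

definition vertex_group :: "('g, 'm) monoid_scheme \<Rightarrow> ((int ^ 'd) \<times> 'g) set" where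
  "vertex_group F = UNIV \<times> {\<one>\<^bsub>F\<^esub>}"

definition lattice_act :: "('g \<Rightarrow> int ^ 'd ^ 'd) \<Rightarrow> 'g \<Rightarrow> (int ^ 'd) set \<Rightarrow> (int ^ 'd) set" where
  "lattice_act \<rho> \<gamma> \<Lambda> = (\<lambda>v. \<rho> \<gamma> *v v) ` \<Lambda>"

definition lattice_stab ::
  "('g, 'm) monoid_scheme \<Rightarrow> ('g \<Rightarrow> int ^ 'd ^ 'd) \<Rightarrow> (int ^ 'd) set \<Rightarrow> 'g set" where
  "lattice_stab F \<rho> \<Lambda> = stabilizer F (lattice_act \<rho>) \<Lambda>"

definition vertex_conj ::
  "('g, 'm) monoid_scheme \<Rightarrow> ('g \<Rightarrow> int ^ 'd ^ 'd) \<Rightarrow> ((int ^ 'd) \<times> 'g) set set set" where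
  "vertex_conj F \<rho> =
     orbits (semidirect F \<rho>) {L. subgroup L (semidirect F \<rho>) \<and> L \<subseteq> vertex_group F}
       (conj_subgroup (semidirect F \<rho>))"

definition kernel_piece ::
  "('g, 'm) monoid_scheme \<Rightarrow> ('g \<Rightarrow> int ^ 'd ^ 'd) \<Rightarrow> ((int ^ 'd) \<times> 'g) set set
    \<Rightarrow> ((int ^ 'd) \<times> 'g) set set" where
  "kernel_piece F \<rho> \<C> = {H \<in> perfect_kernel (semidirect F \<rho>). H \<inter> vertex_group F \<in> \<C>}"

text \<open>
  The map \<^const>\<open>snd\<close> is the projection onto \<open>F\<close>, and \<open>fst ` (H \<inter> vertex_group F)\<close> is
  \<open>H \<inter> vertex_group F\<close> seen as a subgroup of the lattice.
\<close>

definition exceptional_piece ::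
  "('g, 'm) monoid_scheme \<Rightarrow> ('g \<Rightarrow> int ^ 'd ^ 'd) \<Rightarrow> ((int ^ 'd) \<times> 'g) set set
    \<Rightarrow> ((int ^ 'd) \<times> 'g) set set" where
  "exceptional_piece F \<rho> \<C> =
     {H \<in> kernel_piece F \<rho> \<C>.
        snd ` H \<notin> perfect_kernel (F\<lparr>carrier := lattice_stab F \<rho> (fst ` (H \<inter> vertex_group F))\<rparr>)}"

lemma group_zlattice: "group zlattice"
  by (rule groupI) (auto simp: zlattice_def add.assoc intro: exI[of _ "- _"])

lemma group_GL_int: "group (GL_int :: (int ^ 'd ^ 'd) monoid)"
proof (rule groupI)
  fix A assume "A \<in> carrier (GL_int :: (int ^ 'd ^ 'd) monoid)"
  then show "\<exists>B\<in>carrier GL_int. B \<otimes>\<^bsub>GL_int\<^esub> A = \<one>\<^bsub>GL_int\<^esub>"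
    by (auto simp: GL_int_def invertible_def)
next
  fix A B :: "int ^ 'd ^ 'd"
  assume "A \<in> carrier GL_int" "B \<in> carrier GL_int"
  then obtain A' B' where *: "A ** A' = mat 1" "A' ** A = mat 1" "B ** B' = mat 1" "B' ** B = mat 1"
    by (auto simp: GL_int_def invertible_def)
  have "(A ** B) ** (B' ** A') = mat 1" "(B' ** A') ** (A ** B) = mat 1"
    using * by (metis matrix_mul_assoc matrix_mul_rid)+
  then show "A \<otimes>\<^bsub>GL_int\<^esub> B \<in> carrier GL_int"
    by (auto simp: GL_int_def invertible_def)
next
  show "\<one>\<^bsub>GL_int\<^esub> \<in> carrier (GL_int :: (int ^ 'd ^ 'd) monoid)"
    by (auto simp: GL_int_def invertible_def intro: exI[of _ "mat 1"])
qed (auto simp: GL_int_def matrix_mul_assoc)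

context
  fixes F :: "('g, 'm) monoid_scheme" and \<rho> :: "'g \<Rightarrow> int ^ 'd ^ 'd"
  assumes F: "group F" and \<rho>: "\<rho> \<in> hom F GL_int"
begin

interpretation F: group F by (rule F)

interpretation \<rho>: group_hom F GL_int \<rho>
  using F \<rho> group_GL_int by (simp add: group_hom_def group_hom_axioms_def)

lemma rho_mult: "\<gamma> \<in> carrier F \<Longrightarrow> \<delta> \<in> carrier F \<Longrightarrow> \<rho> (\<gamma> \<otimes>\<^bsub>F\<^esub> \<delta>) = \<rho> \<gamma> ** \<rho> \<delta>"
  using \<rho>.hom_mult by (simp add: GL_int_def)

lemma rho_one: "\<rho> \<one>\<^bsub>F\<^esub> = mat 1"
  using \<rho>.hom_one by (simp add: GL_int_def)

lemma rho_mult_vec: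
  "\<gamma> \<in> carrier F \<Longrightarrow> \<delta> \<in> carrier F \<Longrightarrow> \<rho> (\<gamma> \<otimes>\<^bsub>F\<^esub> \<delta>) *v v = \<rho> \<gamma> *v (\<rho> \<delta> *v v)"
  by (simp add: rho_mult matrix_vector_mul_assoc del: \<rho>.hom_mult)

lemma group_semidirect: "group (semidirect F \<rho>)"
proof (rule groupI)
  fix x assume x: "x \<in> carrier (semidirect F \<rho>)"
  obtain v \<gamma> where "x = (v, \<gamma>)" "\<gamma> \<in> carrier F"
    using x by (cases x) (auto simp: semidirect_def)
  then have "(- (\<rho> (inv\<^bsub>F\<^esub> \<gamma>) *v v), inv\<^bsub>F\<^esub> \<gamma>) \<otimes>\<^bsub>semidirect F \<rho>\<^esub> x = \<one>\<^bsub>semidirect F \<rho>\<^esub>"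
    and "(- (\<rho> (inv\<^bsub>F\<^esub> \<gamma>) *v v), inv\<^bsub>F\<^esub> \<gamma>) \<in> carrier (semidirect F \<rho>)"
    by (auto simp: semidirect_def)
  then show "\<exists>y\<in>carrier (semidirect F \<rho>). y \<otimes>\<^bsub>semidirect F \<rho>\<^esub> x = \<one>\<^bsub>semidirect F \<rho>\<^esub>" by blast
qed (auto simp: semidirect_def rho_one F.m_assoc rho_mult_vec matrix_vector_right_distrib add.assoc
     simp del: \<rho>.hom_one \<rho>.hom_mult)

lemma mult_semidirect [simp]:
  "(v, \<gamma>) \<otimes>\<^bsub>semidirect F \<rho>\<^esub> (w, \<delta>) = (v + \<rho> \<gamma> *v w, \<gamma> \<otimes>\<^bsub>F\<^esub> \<delta>)"
  by (simp add: semidirect_def)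

lemma carrier_semidirect [simp]: "carrier (semidirect F \<rho>) = UNIV \<times> carrier F"
  by (simp add: semidirect_def)

lemma one_semidirect [simp]: "\<one>\<^bsub>semidirect F \<rho>\<^esub> = (0, \<one>\<^bsub>F\<^esub>)"
  by (simp add: semidirect_def)

lemma inv_semidirect:
  assumes "\<gamma> \<in> carrier F"
  shows "inv\<^bsub>semidirect F \<rho>\<^esub> (v, \<gamma>) = (- (\<rho> (inv\<^bsub>F\<^esub> \<gamma>) *v v), inv\<^bsub>F\<^esub> \<gamma>)"
  using assms
  by (intro group.inv_equality[OF group_semidirect]) (auto simp: semidirect_def)

lemma conj_subgroup_vertex:
  assumes "\<gamma> \<in> carrier F"
  shows "conj_subgroup (semidirect F \<rho>) (w, \<gamma>) (\<Lambda> \<times> {\<one>\<^bsub>F\<^esub>}) = lattice_act \<rho> \<gamma> \<Lambda> \<times> {\<one>\<^bsub>F\<^esub>}"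
proof -
  have *: "w + \<rho> \<gamma> *v v + \<rho> \<gamma> *v (- (\<rho> (inv\<^bsub>F\<^esub> \<gamma>) *v w)) = \<rho> \<gamma> *v v" for v
  proof -
    have "\<rho> \<gamma> *v (\<rho> (inv\<^bsub>F\<^esub> \<gamma>) *v w) = w"
      using assms rho_mult_vec[of \<gamma> "inv\<^bsub>F\<^esub> \<gamma>" w] by (simp add: rho_one del: \<rho>.hom_one \<rho>.hom_inv)
    moreover have "\<rho> \<gamma> *v (- u) = - (\<rho> \<gamma> *v u)" for u
      by (metis add.right_inverse add_eq_0_iff matrix_vector_mult_0_right
          matrix_vector_right_distrib)
    ultimately show ?thesis by simp
  qed
  show ?thesis
    using assms unfolding conj_subgroup_def l_coset_def r_coset_def lattice_act_def
    by (auto simp: inv_semidirect * simp del: \<rho>.hom_inv)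
qed

lemma subgroup_vertex_iff:
  "subgroup L (semidirect F \<rho>) \<and> L \<subseteq> vertex_group F \<longleftrightarrow>
     (\<exists>\<Lambda>. subgroup \<Lambda> zlattice \<and> L = \<Lambda> \<times> {\<one>\<^bsub>F\<^esub>})"
proof -
  have invz: "inv\<^bsub>zlattice\<^esub> v = - v" for v :: "int ^ 'd"
    by (rule group.inv_equality[OF group_zlattice]) (auto simp: zlattice_def)
  have inv1: "inv\<^bsub>semidirect F \<rho>\<^esub> (v, \<one>\<^bsub>F\<^esub>) = (- v, \<one>\<^bsub>F\<^esub>)" for v
    by (simp add: inv_semidirect rho_one del: \<rho>.hom_one)
  have iff: "subgroup (\<Lambda> \<times> {\<one>\<^bsub>F\<^esub>}) (semidirect F \<rho>) \<longleftrightarrow> subgroup \<Lambda> zlattice" for \<Lambda>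
  proof
    assume "subgroup (\<Lambda> \<times> {\<one>\<^bsub>F\<^esub>}) (semidirect F \<rho>)"
    then interpret S: subgroup "\<Lambda> \<times> {\<one>\<^bsub>F\<^esub>}" "semidirect F \<rho>" .
    show "subgroup \<Lambda> zlattice"
    proof
      fix v w assume "v \<in> \<Lambda>" "w \<in> \<Lambda>"
      then show "v \<otimes>\<^bsub>zlattice\<^esub> w \<in> \<Lambda>"
        using S.m_closed[of "(v, \<one>\<^bsub>F\<^esub>)" "(w, \<one>\<^bsub>F\<^esub>)"]
        by (auto simp: zlattice_def semidirect_def rho_one simp del: \<rho>.hom_one)
    next
      fix v assume "v \<in> \<Lambda>"
      then show "inv\<^bsub>zlattice\<^esub> v \<in> \<Lambda>"
        using S.m_inv_closed[of "(v, \<one>\<^bsub>F\<^esub>)"] by (auto simp: invz inv1)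
    qed (use S.one_closed in \<open>auto simp: zlattice_def semidirect_def\<close>)
  next
    assume "subgroup \<Lambda> zlattice"
    then interpret S: subgroup \<Lambda> zlattice .
    show "subgroup (\<Lambda> \<times> {\<one>\<^bsub>F\<^esub>}) (semidirect F \<rho>)"
    proof
      fix x y assume "x \<in> \<Lambda> \<times> {\<one>\<^bsub>F\<^esub>}" "y \<in> \<Lambda> \<times> {\<one>\<^bsub>F\<^esub>}"
      then obtain v w where xy: "x = (v, \<one>\<^bsub>F\<^esub>)" "y = (w, \<one>\<^bsub>F\<^esub>)" "v \<in> \<Lambda>" "w \<in> \<Lambda>" by auto
      then have "v + w \<in> \<Lambda>" using S.m_closed[of v w] by (simp add: zlattice_def)
      then show "x \<otimes>\<^bsub>semidirect F \<rho>\<^esub> y \<in> \<Lambda> \<times> {\<one>\<^bsub>F\<^esub>}"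
        using xy by (simp add: rho_one del: \<rho>.hom_one)
    next
      fix x assume "x \<in> \<Lambda> \<times> {\<one>\<^bsub>F\<^esub>}"
      then show "inv\<^bsub>semidirect F \<rho>\<^esub> x \<in> \<Lambda> \<times> {\<one>\<^bsub>F\<^esub>}"
        using S.m_inv_closed[of "fst x"] by (cases x) (simp add: invz inv1)
    qed (use S.one_closed in \<open>auto simp: zlattice_def semidirect_def\<close>)
  qed
  show ?thesis
  proof
    assume L: "subgroup L (semidirect F \<rho>) \<and> L \<subseteq> vertex_group F"
    then have "L = (fst ` L) \<times> {\<one>\<^bsub>F\<^esub>}" by (force simp: vertex_group_def)
    then show "\<exists>\<Lambda>. subgroup \<Lambda> zlattice \<and> L = \<Lambda> \<times> {\<one>\<^bsub>F\<^esub>}" using iff L by metis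
  qed (auto simp: iff vertex_group_def)
qed

lemma orbit_vertex:
  "orbit (semidirect F \<rho>) (conj_subgroup (semidirect F \<rho>)) (\<Lambda> \<times> {\<one>\<^bsub>F\<^esub>}) =
     (\<lambda>L. L \<times> {\<one>\<^bsub>F\<^esub>}) ` orbit F (lattice_act \<rho>) \<Lambda>"
proof -
  have "orbit (semidirect F \<rho>) (conj_subgroup (semidirect F \<rho>)) (\<Lambda> \<times> {\<one>\<^bsub>F\<^esub>}) =
      (\<lambda>(w, \<gamma>). conj_subgroup (semidirect F \<rho>) (w, \<gamma>) (\<Lambda> \<times> {\<one>\<^bsub>F\<^esub>})) ` (UNIV \<times> carrier F)"
    unfolding orbit_def by auto
  also have "\<dots> = (\<lambda>(w :: int ^ 'd, \<gamma>). lattice_act \<rho> \<gamma> \<Lambda> \<times> {\<one>\<^bsub>F\<^esub>}) ` (UNIV \<times> carrier F)"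
    by (intro image_cong refl) (auto simp: conj_subgroup_vertex)
  also have "\<dots> = (\<lambda>L. L \<times> {\<one>\<^bsub>F\<^esub>}) ` orbit F (lattice_act \<rho>) \<Lambda>"
    unfolding orbit_def by (auto simp: image_iff)
  finally show ?thesis .
qed

lemma vertex_conj_eq:
  "vertex_conj F \<rho> =
     {(\<lambda>L. L \<times> {\<one>\<^bsub>F\<^esub>}) ` orbit F (lattice_act \<rho>) \<Lambda> | \<Lambda>. subgroup \<Lambda> zlattice}"
  unfolding vertex_conj_def orbits_def subgroup_vertex_iff
  by (auto simp: orbit_vertex[symmetric])

end

end

theory Submission
  imports Defs "HOL-Library.Sublist"
begin

text \<open>
  A subgroup \<open>H\<close> of \<open>G\<close> meets \<open>\<int>\<^sup>d\<close> in a lattice \<open>\<Lambda>\<close> and projects to a subgroup \<open>\<Gamma>\<close> of the stabilizer \<open>S\<close>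
  of \<open>\<Lambda>\<close>. If \<open>\<Gamma>\<close> has finite index in the free group, then every subgroup containing \<open>H\<close> is finitely
  generated, so a maximal element above \<open>H\<close> of a closed set is isolated in it and \<open>H\<close> is not in the perfect
  kernel. Every other \<open>H\<close> is a limit of subgroups whose lattice has finite index and whose projection is
  finitely generated of infinite index, and these form a set without isolated points.

  Both this and the dense orbit come from a ping-pong argument. The stabilizer \<open>S\<close> is free, and if it is not
  cyclic, two subgroups \<open>H\<^sub>1\<close>, \<open>H\<^sub>2\<close> over the same \<open>\<Lambda>\<close> with finitely generated projections of infinite
  index in \<open>S\<close> admit some \<open>g\<close> for which \<open>H\<^sub>1\<close> and \<open>g H\<^sub>2 g\<^sup>-\<^sup>1\<close> generate their amalgam over \<open>\<Lambda>\<close>: an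
  alternating product moves a base point of the tree of reduced words into a cone not containing it, so it
  projects nontrivially. The projection of the join again has infinite index, and \<open>g\<close> can be chosen such that
  the join avoids given finite sets. Joining suitable conjugates of representatives of a countable
  base yields one subgroup with a dense orbit.

  The remaining topological claims rest on the ascending chain condition in \<open>\<int>\<^sup>d\<close>: \<open>\<Lambda> \<subseteq> \<gamma>\<Lambda>\<close> forces
  \<open>\<Lambda> = \<gamma>\<Lambda>\<close>. The exceptional subgroups are finitely generated, and those
  containing a given one share its lattice; likewise an infinite orbit of lattices cannot contain its own
  accumulation points.
\<close>

section \<open>Finite index and finite generation\<close>

text \<open>The two kinds of perfect kernel obey different criteria. In \<open>G\<close> only the
  index of the projection in the whole free group counts, since finite rank makes finite index
  entail finite generation; in a stabilizer, which may have infinite rank, both properties have to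
  be asked for. Over a noncyclic stabilizer the exceptional subgroups are exactly this discrepancy.
  A cyclic stabilizer leaves no room for ping-pong, so a kernel element over such a lattice cannot
  be perturbed with its lattice fixed. Adding N times the full lattice helps: this subgroup is
  invariant under every integral matrix, leaves the projection alone and makes the stabilizer of
  finite index, hence noncyclic. A Chabauty neighbourhood prescribes absent elements as well as
  present ones, so it is not enough that a join is an amalgam. The ping-pong statement is therefore
  quantitative: finitely many arbitrary elements must be unable to imitate an alternating product,
  which is why the base point lies far from both ends of the conjugator. Since stabilizers can be
  infinitely generated, ping-pong runs in a free group on a basis of unknown size, where only two
  letters are at hand.\<close>

lemma (in group) finite_index_iff:
  assumes "subgroup H G"
  shows "finite_index H G \<longleftrightarrow>
    (\<exists>T. finite T \<and> T \<subseteq> carrier G \<and> (\<forall>x\<in>carrier G. \<exists>t\<in>T. x \<otimes> inv t \<in> H))"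
proof -
  interpret H: subgroup H G by fact
  have mem: "x \<in> H #>\<^bsub>G\<^esub> t \<longleftrightarrow> x \<otimes> inv t \<in> H" if "x \<in> carrier G" "t \<in> carrier G" for x t
  proof
    assume "x \<in> H #>\<^bsub>G\<^esub> t"
    then obtain h where "h \<in> H" "x = h \<otimes> t" by (auto simp: r_coset_def)
    then show "x \<otimes> inv t \<in> H" using that by (simp add: m_assoc)
  next
    assume "x \<otimes> inv t \<in> H"
    moreover have "x = (x \<otimes> inv t) \<otimes> t" using that by (simp add: m_assoc)
    ultimately show "x \<in> H #>\<^bsub>G\<^esub> t" by (auto simp: r_coset_def)
  qed
  show ?thesis
  proof
    assume "finite_index H G"
    then have fin: "finite (rcosets H)" by (simp add: finite_index_def)
    define T where "T = (\<lambda>C. SOME t. t \<in> C) ` (rcosets H)"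
    have some: "(SOME t. t \<in> C) \<in> C" if "C \<in> rcosets H" for C
      using that rcos_self[OF _ assms] by (auto simp: some_in_eq RCOSETS_def)
    have "C \<subseteq> carrier G" if "C \<in> rcosets H" for C
      using that r_coset_subset_G[OF H.subset] by (auto simp: RCOSETS_def)
    then have "T \<subseteq> carrier G" using some by (auto simp: T_def)
    moreover have "\<exists>t\<in>T. x \<otimes> inv t \<in> H" if x: "x \<in> carrier G" for x
    proof -
      let ?C = "H #>\<^bsub>G\<^esub> x"
      have C: "?C \<in> rcosets H" using x by (auto simp: RCOSETS_def)
      define t where "t = (SOME t. t \<in> ?C)"
      have "t \<in> ?C" "t \<in> T" using some[OF C] C by (auto simp: t_def T_def)
      then have tc: "t \<in> carrier G" "t \<otimes> inv x \<in> H" using mem[of t x] x \<open>T \<subseteq> carrier G\<close> by auto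
      then have "inv (t \<otimes> inv x) \<in> H" by blast
      then have "x \<otimes> inv t \<in> H" using x tc by (simp add: inv_mult_group)
      then show ?thesis using \<open>t \<in> T\<close> by blast
    qed
    moreover have "finite T" using fin by (simp add: T_def)
    ultimately show "\<exists>T. finite T \<and> T \<subseteq> carrier G \<and> (\<forall>x\<in>carrier G. \<exists>t\<in>T. x \<otimes> inv t \<in> H)"
      by blast
  next
    assume "\<exists>T. finite T \<and> T \<subseteq> carrier G \<and> (\<forall>x\<in>carrier G. \<exists>t\<in>T. x \<otimes> inv t \<in> H)"
    then obtain T where T: "finite T" "T \<subseteq> carrier G" "\<And>x. x \<in> carrier G \<Longrightarrow> \<exists>t\<in>T. x \<otimes> inv t \<in> H"
      by blast
    have "rcosets H \<subseteq> (\<lambda>t. H #> t) ` T"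
    proof
      fix C assume "C \<in> rcosets H"
      then obtain x where x: "x \<in> carrier G" "C = H #> x" by (auto simp: RCOSETS_def)
      then obtain t where t: "t \<in> T" "x \<in> H #> t" using T mem by blast
      then have "H #> t = H #> x" using repr_independence[OF t(2)] T assms by blast
      then show "C \<in> (\<lambda>t. H #> t) ` T" using x t by auto
    qed
    then show "finite_index H G" unfolding finite_index_def using T(1) finite_surj by blast
  qed
qed

context group
begin

lemma finite_index_subgroup_iff:
  assumes S: "subgroup S G" and H: "subgroup H G" "H \<subseteq> S"
  shows "finite_index H (G\<lparr>carrier := S\<rparr>) \<longleftrightarrow>
    (\<exists>T. finite T \<and> T \<subseteq> S \<and> (\<forall>x\<in>S. \<exists>t\<in>T. x \<otimes> inv t \<in> H))"
proof -
  have "(\<forall>x\<in>S. \<exists>t\<in>T. x \<otimes> inv\<^bsub>G\<lparr>carrier := S\<rparr>\<^esub> t \<in> H) \<longleftrightarrow> (\<forall>x\<in>S. \<exists>t\<in>T. x \<otimes> inv t \<in> H)"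
    if "T \<subseteq> S" for T
    using that m_inv_consistent[OF S] by (metis subset_iff)
  then show ?thesis
    using group.finite_index_iff[OF subgroup_imp_group[OF S] subgroup_incl[OF H(1) S H(2)]]
    by (simp cong: conj_cong)
qed

lemma finite_index_mono:
  assumes "subgroup H G" "subgroup K G" "H \<subseteq> K" "finite_index H G"
  shows "finite_index K G"
proof -
  obtain T where "finite T" "T \<subseteq> carrier G" "\<forall>x\<in>carrier G. \<exists>t\<in>T. x \<otimes> inv t \<in> H"
    using assms(4) finite_index_iff[OF assms(1)] by blast
  moreover from this have "\<forall>x\<in>carrier G. \<exists>t\<in>T. x \<otimes> inv t \<in> K" using assms(3) by (meson subsetD)
  ultimately show ?thesis unfolding finite_index_iff[OF assms(2)] by blast
qed

text \<open>Representatives chosen in the ambient group need not lie in \<open>S\<close>. Each coset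
  of \<open>H\<close> that meets \<open>S\<close> gets a new representative \<open>f t\<close>
  inside \<open>S\<close>; the other cosets are dropped.\<close>

lemma finite_index_subgroup:
  assumes S: "subgroup S G" and H: "subgroup H G" "H \<subseteq> S" and fin: "finite_index H G"
  shows "finite_index H (G\<lparr>carrier := S\<rparr>)"
proof -
  obtain T where T: "finite T" "T \<subseteq> carrier G" "\<And>x. x \<in> carrier G \<Longrightarrow> \<exists>t\<in>T. x \<otimes> inv t \<in> H"
    using fin finite_index_iff[OF H(1)] by blast
  define f where "f t = (SOME s. s \<in> S \<and> s \<otimes> inv t \<in> H)" for t
  let ?T = "f ` {t\<in>T. \<exists>s\<in>S. s \<otimes> inv t \<in> H}"
  have f: "f t \<in> S \<and> f t \<otimes> inv t \<in> H" if "\<exists>s\<in>S. s \<otimes> inv t \<in> H" for t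
    unfolding f_def using that someI_ex[of "\<lambda>s. s \<in> S \<and> s \<otimes> inv t \<in> H"] by blast
  interpret H: subgroup H G by fact
  interpret S: subgroup S G by fact
  have "\<exists>t\<in>?T. x \<otimes> inv t \<in> H" if x: "x \<in> S" for x
  proof -
    obtain t where t: "t \<in> T" "x \<otimes> inv t \<in> H" using T(3) x S.mem_carrier by blast
    then have ft: "f t \<in> S" "f t \<otimes> inv t \<in> H" using f x by auto
    have "(x \<otimes> inv t) \<otimes> inv (f t \<otimes> inv t) \<in> H" using t ft by blast
    moreover have "(x \<otimes> inv t) \<otimes> inv (f t \<otimes> inv t) = x \<otimes> inv (f t)"
    proof -
      have c: "x \<in> carrier G" "t \<in> carrier G" "f t \<in> carrier G"
        using x t ft T S.mem_carrier by auto
      then have "inv (f t \<otimes> inv t) = t \<otimes> inv (f t)" by (simp add: inv_mult_group)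
      then show ?thesis using c by (simp add: inv_solve_right m_assoc[symmetric]) (simp add: m_assoc)
    qed
    ultimately show ?thesis using t x by auto
  qed
  moreover have "finite ?T" "?T \<subseteq> S" using T(1) f by auto
  ultimately show ?thesis unfolding finite_index_subgroup_iff[OF S H] by blast
qed

lemma finite_index_trans:
  assumes S: "subgroup S G" and H: "subgroup H G" "H \<subseteq> S"
    and fin: "finite_index H (G\<lparr>carrier := S\<rparr>)" "finite_index S G"
  shows "finite_index H G"
proof -
  obtain T where T: "finite T" "T \<subseteq> S" "\<And>x. x \<in> S \<Longrightarrow> \<exists>t\<in>T. x \<otimes> inv t \<in> H"
    using fin(1) finite_index_subgroup_iff[OF S H] by blast
  obtain T' where T': "finite T'" "T' \<subseteq> carrier G" "\<And>x. x \<in> carrier G \<Longrightarrow> \<exists>t\<in>T'. x \<otimes> inv t \<in> S"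
    using fin(2) finite_index_iff[OF S] by blast
  interpret S: subgroup S G by fact
  let ?T = "(\<lambda>(t, t'). t \<otimes> t') ` (T \<times> T')"
  have "\<exists>u\<in>?T. x \<otimes> inv u \<in> H" if x: "x \<in> carrier G" for x
  proof -
    obtain t' where t': "t' \<in> T'" "x \<otimes> inv t' \<in> S" using T' x by blast
    obtain t where t: "t \<in> T" "(x \<otimes> inv t') \<otimes> inv t \<in> H" using T t' by blast
    have "t \<in> carrier G" "t' \<in> carrier G" using t t' T T' S.mem_carrier by auto
    then have "x \<otimes> inv (t \<otimes> t') \<in> H" using t x by (simp add: inv_mult_group m_assoc)
    then show ?thesis using t t' by auto
  qed
  moreover have "finite ?T" using T T' by simp
  moreover have "?T \<subseteq> carrier G"
  proof (clarify)
    fix t t' assume "t \<in> T" "t' \<in> T'"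
    then show "t \<otimes> t' \<in> carrier G" using T(2) T'(2) S.subset by (intro m_closed) blast+
  qed
  ultimately show ?thesis unfolding finite_index_iff[OF H(1)] by blast
qed

text \<open>By the pigeonhole principle two different powers of \<open>x\<close> fall into the same
  coset, and their quotient is a positive power in \<open>H\<close>.\<close>

lemma finite_index_pow:
  assumes H: "subgroup H G" "finite_index H G" and x: "x \<in> carrier G"
  obtains m :: nat where "m > 0" "x [^] m \<in> H"
proof -
  obtain T where T: "finite T" "T \<subseteq> carrier G" "\<And>x. x \<in> carrier G \<Longrightarrow> \<exists>t\<in>T. x \<otimes> inv t \<in> H"
    using H finite_index_iff[OF H(1)] by blast
  obtain f where f: "\<And>n::nat. f n \<in> T \<and> x [^] n \<otimes> inv (f n) \<in> H"
    using T(3)[OF nat_pow_closed[OF x]] by metis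
  have "\<not> inj f" using f T(1) by (metis finite_subset image_subsetI infinite_UNIV_nat finite_imageD)
  then obtain i j where ij: "f i = f j" "i \<noteq> j" by (auto simp: inj_on_def)
  have key: "\<exists>m::nat. m > 0 \<and> x [^] m \<in> H" if "f i = f j" "i < j" for i j :: nat
  proof -
    interpret H: subgroup H G by fact
    have c: "f i \<in> carrier G" using f T by blast
    have "(x [^] j \<otimes> inv (f i)) \<otimes> inv (x [^] i \<otimes> inv (f i)) \<in> H" using f that(1) by (metis H.m_closed H.m_inv_closed)
    moreover have "(x [^] j \<otimes> inv (f i)) \<otimes> inv (x [^] i \<otimes> inv (f i)) = x [^] j \<otimes> inv (x [^] i)"
      using c x by (simp add: inv_mult_group m_assoc) (simp add: m_assoc[symmetric])
    moreover have "x [^] j = x [^] (j - i) \<otimes> x [^] i" using x that(2) by (simp add: nat_pow_mult)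
    ultimately have "x [^] (j - i) \<in> H" using x by (simp add: m_assoc)
    then show ?thesis using that by (intro exI[of _ "j - i"]) auto
  qed
  show ?thesis using key[of i j] key[of j i] ij that by (metis linorder_neqE_nat)
qed

end

section \<open>Finitely generated subgroups\<close>

text \<open>Generation is taken in the ambient group, so that images, joins and conjugates need no
  change of carrier; \<open>fg_subgroup_in_subgroup_iff\<close> shows that the choice of ambient
  group is immaterial.\<close>

definition fg_subgroup :: "('g, 'm) monoid_scheme \<Rightarrow> 'g set \<Rightarrow> bool" where
  "fg_subgroup G H \<longleftrightarrow> (\<exists>A. finite A \<and> A \<subseteq> carrier G \<and> generate G A = H)"

context group
begin

lemma fg_subgroupI: "finite A \<Longrightarrow> A \<subseteq> carrier G \<Longrightarrow> fg_subgroup G (generate G A)"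
  by (auto simp: fg_subgroup_def)

lemma fg_subgroupE:
  assumes "fg_subgroup G H"
  obtains A where "finite A" "A \<subseteq> H" "H \<subseteq> carrier G" "generate G A = H"
proof -
  obtain A where A: "finite A" "A \<subseteq> carrier G" "generate G A = H"
    using assms unfolding fg_subgroup_def by blast
  moreover have "A \<subseteq> generate G A" by (auto intro: generate.incl)
  ultimately show ?thesis using that generate_incl[OF A(2)] by simp
qed

lemma fg_subgroup_is_subgroup: "fg_subgroup G H \<Longrightarrow> subgroup H G"
  by (auto simp: fg_subgroup_def generate_is_subgroup)

lemma fg_subgroup_in_subgroup_iff:
  assumes "subgroup S G" "H \<subseteq> S"
  shows "fg_subgroup (G\<lparr>carrier := S\<rparr>) H \<longleftrightarrow> fg_subgroup G H"
proof
  assume "fg_subgroup (G\<lparr>carrier := S\<rparr>) H"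
  then obtain A where "finite A" "A \<subseteq> S" "generate (G\<lparr>carrier := S\<rparr>) A = H"
    by (auto simp: fg_subgroup_def)
  then show "fg_subgroup G H"
    using generate_consistent[OF _ assms(1), of A] subgroup.subset[OF assms(1)] by (auto simp: fg_subgroup_def)
next
  assume "fg_subgroup G H"
  then obtain A where "finite A" "A \<subseteq> H" "generate G A = H" by (rule fg_subgroupE)
  then show "fg_subgroup (G\<lparr>carrier := S\<rparr>) H"
    using generate_consistent[OF _ assms(1), of A] assms(2) by (auto simp: fg_subgroup_def)
qed

lemma finitely_generated_subgroup_iff:
  assumes "subgroup S G"
  shows "finitely_generated (G\<lparr>carrier := S\<rparr>) \<longleftrightarrow> fg_subgroup G S"
  unfolding fg_subgroup_in_subgroup_iff[OF assms order_refl, symmetric]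
  by (simp add: finitely_generated_def fg_subgroup_def)

lemma fg_subgroup_over:
  assumes K: "subgroup K G" and H: "fg_subgroup G H" "H \<subseteq> K"
    and T: "finite T" "T \<subseteq> K" "\<And>x. x \<in> K \<Longrightarrow> \<exists>t\<in>T. x \<otimes> inv t \<in> H"
  shows "fg_subgroup G K"
proof -
  obtain A where A: "finite A" "A \<subseteq> H" "H \<subseteq> carrier G" "generate G A = H"
    using H(1) by (rule fg_subgroupE)
  interpret K: subgroup K G by fact
  have sub: "A \<union> T \<subseteq> K" using A H T by blast
  then have c: "A \<union> T \<subseteq> carrier G" using K.subset by blast
  interpret g: subgroup "generate G (A \<union> T)" G using generate_is_subgroup[OF c] .
  have "K \<subseteq> generate G (A \<union> T)"
  proof
    fix x assume x: "x \<in> K"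
    then obtain t where t: "t \<in> T" "x \<otimes> inv t \<in> H" using T by blast
    have "x \<otimes> inv t \<in> generate G (A \<union> T)" using t A mono_generate[of A "A \<union> T"] by blast
    moreover have "t \<in> generate G (A \<union> T)" using t by (simp add: generate.incl)
    ultimately have "(x \<otimes> inv t) \<otimes> t \<in> generate G (A \<union> T)" by (rule g.m_closed)
    then show "x \<in> generate G (A \<union> T)" using x K.mem_carrier[of x] K.mem_carrier[of t] t(1) sub by (auto simp: m_assoc)
  qed
  then have "generate G (A \<union> T) = K" using generate_subgroup_incl[OF sub K] by blast
  then show ?thesis using c A T by (auto simp: fg_subgroup_def)
qed

text \<open>\<open>H\<close> has finite index in \<open>K\<close> too, and finitely many coset
  representatives added to generators of \<open>H\<close> generate \<open>K\<close>. This supplies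
  the finite generation of all overgroups that \<open>not_in_perfect_kernel\<close> asks
  for.\<close>

lemma fg_subgroup_finite_index_over:
  assumes S: "subgroup S G" and K: "subgroup K G" "K \<subseteq> S" and H: "fg_subgroup G H" "H \<subseteq> K"
    and fin: "finite_index H (G\<lparr>carrier := S\<rparr>)"
  shows "fg_subgroup G K"
proof -
  interpret S: group "G\<lparr>carrier := S\<rparr>" using subgroup_imp_group[OF S] .
  note sH = fg_subgroup_is_subgroup[OF H(1)]
  have sub: "subgroup H (G\<lparr>carrier := S\<rparr>)" "subgroup K (G\<lparr>carrier := S\<rparr>)"
    using subgroup_incl[OF sH S] subgroup_incl[OF K(1) S] K H by auto
  have "finite_index H (G\<lparr>carrier := K\<rparr>)"
    using S.finite_index_subgroup[OF sub(2) sub(1) H(2) fin] by simp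
  then obtain T where "finite T" "T \<subseteq> K" "\<And>x. x \<in> K \<Longrightarrow> \<exists>t\<in>T. x \<otimes> inv t \<in> H"
    using finite_index_subgroup_iff[OF K(1) sH H(2)] by blast
  then show ?thesis using fg_subgroup_over[OF K(1) H] by blast
qed

text \<open>A finite generating set of the union already lies in one member of the chain. This is
  the ascending chain condition, in the form in which it serves Zorn's lemma, chains of lattices and
  chains of projections.\<close>

lemma fg_subgroup_chain:
  assumes "fg_subgroup G H" "H = \<Union>\<C>" "\<C> \<noteq> {}" "\<And>K. K \<in> \<C> \<Longrightarrow> subgroup K G"
    and chain: "\<And>K L. K \<in> \<C> \<Longrightarrow> L \<in> \<C> \<Longrightarrow> K \<subseteq> L \<or> L \<subseteq> K"
  shows "H \<in> \<C>"
proof -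
  obtain A where A: "finite A" "A \<subseteq> \<Union>\<C>" "generate G A = H"
    using assms(1,2) by (auto elim: fg_subgroupE)
  have "subset.chain UNIV \<C>" using chain by (auto simp: subset_chain_def)
  then obtain K where K: "K \<in> \<C>" "A \<subseteq> K"
    using finite_subset_Union_chain[OF A(1,2) assms(3)] by blast
  then have "H \<subseteq> K" using A generate_subgroup_incl[OF K(2) assms(4)[OF K(1)]] by blast
  then show ?thesis using K assms(2) by (metis Union_upper subset_antisym)
qed

lemma countable_fg_subgroups:
  assumes "countable (carrier G)"
  shows "countable {H. fg_subgroup G H}"
proof -
  have "{H. fg_subgroup G H} \<subseteq> generate G ` {A. A \<subseteq> carrier G \<and> finite A}"
    by (auto simp: fg_subgroup_def)
  then show ?thesis
    using countable_subset[OF _ countable_image[OF countable_Collect_finite_subset[OF assms]]]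
    by (simp add: conj_commute)
qed

lemma subgroup_Union_chain:
  assumes "\<C> \<noteq> {}" "\<And>K. K \<in> \<C> \<Longrightarrow> subgroup K G"
    and chain: "\<And>K L. K \<in> \<C> \<Longrightarrow> L \<in> \<C> \<Longrightarrow> K \<subseteq> L \<or> L \<subseteq> K"
  shows "subgroup (\<Union>\<C>) G"
proof (rule subgroupI)
  show "\<Union>\<C> \<subseteq> carrier G" using assms(2) subgroup.subset by blast
  show "\<Union>\<C> \<noteq> {}" using assms(1,2) subgroup.one_closed by blast
  show "inv a \<in> \<Union>\<C>" if "a \<in> \<Union>\<C>" for a
    using that subgroup.m_inv_closed[OF assms(2)] by (meson UnionE UnionI)
  show "a \<otimes> b \<in> \<Union>\<C>" if ab: "a \<in> \<Union>\<C>" "b \<in> \<Union>\<C>" for a b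
  proof -
    obtain K L where KL: "K \<in> \<C>" "a \<in> K" "L \<in> \<C>" "b \<in> L" using ab by blast
    then obtain M where "M \<in> \<C>" "a \<in> M" "b \<in> M" using chain[of K L] by blast
    then show ?thesis using subgroup.m_closed[OF assms(2)] by (meson UnionI)
  qed
qed

end

lemma (in group_hom) fg_subgroup_img:
  assumes "fg_subgroup G K" shows "fg_subgroup H (h ` K)"
proof -
  obtain A where A: "finite A" "A \<subseteq> carrier G" "generate G A = K" using assms by (auto simp: fg_subgroup_def)
  then have "generate H (h ` A) = h ` K" using generate_img[OF A(2)] by simp
  moreover have "h ` A \<subseteq> carrier H" using A by auto
  ultimately show ?thesis using A(1) unfolding fg_subgroup_def by blast
qed

text \<open>The least positive exponent occurring in \<open>H\<close> generates it, by division with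
  remainder; without such an exponent \<open>H\<close> is trivial.\<close>

lemma (in group) fg_subgroup_of_cyclic:
  assumes s: "s \<in> carrier G" and H: "subgroup H G" "H \<subseteq> generate G {s}"
  shows "fg_subgroup G H"
proof -
  interpret H: subgroup H G by fact
  have gen: "generate G {s} = {s [^] k | k. k \<in> (UNIV :: int set)}" using generate_pow[OF s] .
  show ?thesis
  proof (cases "\<exists>k::int. k > 0 \<and> s [^] k \<in> H")
    case False
    have "H \<subseteq> {\<one>}"
    proof
      fix x assume x: "x \<in> H"
      then obtain k :: int where k: "x = s [^] k" using H gen by blast
      have "s [^] (- k) \<in> H" using x k s H.m_inv_closed[of x] by (simp add: int_pow_neg)
      then have "k = 0" using False x k by (metis neg_0_less_iff_less linorder_neqE_linordered_idom)
      then show "x \<in> {\<one>}" using k by simp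
    qed
    then have "H = generate G {}" using H.one_closed generate_empty by auto
    then show ?thesis using fg_subgroupI[of "{}"] by simp
  next
    case True
    define n where "n = (LEAST n::nat. n > 0 \<and> s [^] (int n) \<in> H)"
    have "\<exists>n::nat. n > 0 \<and> s [^] (int n) \<in> H" using True by (metis pos_int_cases of_nat_0_less_iff)
    then have n: "n > 0" "s [^] (int n) \<in> H" unfolding n_def by (metis (mono_tags, lifting) LeastI)+
    have min: "s [^] (int m) \<notin> H" if "0 < m" "m < n" for m
      using not_less_Least[of m "\<lambda>n. n > 0 \<and> s [^] (int n) \<in> H"] that by (auto simp: n_def)
    have "H \<subseteq> generate G {s [^] (int n)}"
    proof
      fix x assume x: "x \<in> H"
      then obtain k :: int where k: "x = s [^] k" using H gen by blast
      have e: "s [^] (int n * (k div int n)) = (s [^] (int n)) [^] (k div int n)"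
        using s by (simp add: int_pow_pow)
      then have q: "s [^] (int n * (k div int n)) \<in> H" using n subgroup_int_pow_closed[OF H(1)] by metis
      have "x = s [^] (int n * (k div int n)) \<otimes> s [^] (k mod int n)"
        using s k by (simp add: int_pow_mult[symmetric])
      then have "s [^] (k mod int n) = inv (s [^] (int n * (k div int n))) \<otimes> x"
        using s by (metis int_pow_closed inv_solve_left m_closed)
      then have r: "s [^] (k mod int n) \<in> H" using q x by simp
      have "k mod int n = 0"
      proof (rule ccontr)
        assume "k mod int n \<noteq> 0"
        moreover have b: "0 \<le> k mod int n" "k mod int n < int n" using n(1) by simp_all
        ultimately have "0 < nat (k mod int n)" "nat (k mod int n) < n" by linarith+
        then show False using min[of "nat (k mod int n)"] r b(1) by simp
      qed
      then have "x = (s [^] (int n)) [^] (k div int n)" using e k by (metis add_0_right mult_div_mod_eq)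
      then show "x \<in> generate G {s [^] (int n)}"
        unfolding generate_pow[OF int_pow_closed[OF s]] by blast
    qed
    moreover have "generate G {s [^] (int n)} \<subseteq> H" using n generate_subgroup_incl[OF _ H(1)] by simp
    ultimately have "H = generate G {s [^] (int n)}" by blast
    then show ?thesis using s fg_subgroupI[of "{s [^] (int n)}"] by simp
  qed
qed

section \<open>Cones in free groups\<close>

lemma (in group) inv_cancel_left:
  "x \<in> carrier G \<Longrightarrow> y \<in> carrier G \<Longrightarrow> inv x \<otimes> (x \<otimes> y) = y"
  "x \<in> carrier G \<Longrightarrow> y \<in> carrier G \<Longrightarrow> x \<otimes> (inv x \<otimes> y) = y"
  by (simp_all add: m_assoc[symmetric])

lemma (in group) not_finite_indexE:
  assumes "subgroup H G" "\<not> finite_index H G" "finite T" "T \<subseteq> carrier G"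
  obtains x where "x \<in> carrier G" "\<And>t. t \<in> T \<Longrightarrow> x \<otimes> inv t \<notin> H"
proof (rule ccontr)
  assume "\<not> thesis"
  then have "\<forall>x\<in>carrier G. \<exists>t\<in>T. x \<otimes> inv t \<in> H" using that by metis
  then have "finite_index H G" unfolding finite_index_iff[OF assms(1)] using assms(3,4) by (intro exI[of _ T]) simp
  then show False using assms(2) by simp
qed

section \<open>Inverses, concatenation and cancellation of reduced words\<close>

abbreviation winv :: "'a fword \<Rightarrow> 'a fword" where
  "winv u \<equiv> rev (map letter_inv u)"

lemma winv_winv [simp]: "winv (winv u) = u"
  by (induction u) auto

lemma letter_inv_inject [simp]: "letter_inv x = letter_inv y \<longleftrightarrow> x = y"
  by (metis letter_inv_inv)

lemma reduced_append:
  "reduced_word (u @ v) \<longleftrightarrow>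
     reduced_word u \<and> reduced_word v \<and> (u = [] \<or> v = [] \<or> hd v \<noteq> letter_inv (last u))"
  by (induction u) (auto simp: reduced_Cons)

lemma reduced_winv: "reduced_word u \<Longrightarrow> reduced_word (winv u)"
  by (induction u) (auto simp: reduced_Cons reduced_append last_rev hd_map)

lemma reduced_replicate: "reduced_word (replicate n x)"
  by (induction n) (auto simp: reduced_Cons hd_replicate)

lemma mult_free_group [simp]: "u \<otimes>\<^bsub>free_group A\<^esub> v = foldr rcons u v"
  by (simp add: free_group_def)

lemma one_free_group [simp]: "\<one>\<^bsub>free_group A\<^esub> = []"
  by (simp add: free_group_def)

lemma carrier_free_group: "u \<in> carrier (free_group A) \<longleftrightarrow> reduced_word u \<and> fst ` set u \<subseteq> A"
  by (simp add: free_group_def)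

lemma inv_free_group:
  assumes "u \<in> carrier (free_group A)"
  shows "inv\<^bsub>free_group A\<^esub> u = winv u"
proof (rule group.inv_equality[OF group_free_group])
  show "winv u \<otimes>\<^bsub>free_group A\<^esub> u = \<one>\<^bsub>free_group A\<^esub>"
    using foldr_rcons_inverse[of "[]" u] assms by (simp add: foldr_rcons_Nil carrier_free_group)
  show "winv u \<in> carrier (free_group A)"
    using assms by (auto simp: carrier_free_group reduced_winv image_iff)
qed (use assms in auto)

lemma winv_in_free_group: "u \<in> carrier (free_group A) \<Longrightarrow> winv u \<in> carrier (free_group A)"
  by (auto simp: carrier_free_group reduced_winv image_iff)

lemma append_in_free_group:
  "u @ v \<in> carrier (free_group A) \<Longrightarrow> u \<in> carrier (free_group A)"
  "u @ v \<in> carrier (free_group A) \<Longrightarrow> v \<in> carrier (free_group A)"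
  by (auto simp: carrier_free_group reduced_append)

lemma foldr_rcons_append: "reduced_word (u @ v) \<Longrightarrow> foldr rcons u v = u @ v"
  by (induction u) (auto simp: reduced_Cons rcons_reduced)

lemma length_rcons: "length (rcons x w) \<le> Suc (length w)"
  by (cases w) auto

lemma length_foldr_rcons: "length (foldr rcons u v) \<le> length u + length v"
proof (induction u)
  case (Cons x u)
  then show ?case using length_rcons[of x "foldr rcons u v"] by simp
qed simp

text \<open>\<open>c\<close> is the part that cancels; \<open>a @ b\<close> is again reduced, being
  a product with a reduced word. All prefix and length arguments below are read off this
  decomposition.\<close>

lemma free_mult_cancel:
  assumes "reduced_word u" "reduced_word v"
  shows "\<exists>a b c. u = a @ c \<and> v = winv c @ b \<and> foldr rcons u v = a @ b"
  using assms(1)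
proof (induction u)
    case (Cons x u)
    then obtain a b c where *: "u = a @ c" "v = winv c @ b" "foldr rcons u v = a @ b"
      by (auto simp: reduced_Cons)
    show ?case
    proof (cases "a = []")
      case False
      then have "hd (a @ b) \<noteq> letter_inv x" "a @ b \<noteq> []" using Cons.prems * by (auto simp: reduced_Cons)
      then have "rcons x (a @ b) = x # a @ b" by (cases "a @ b") auto
      then show ?thesis using * by (intro exI[of _ "x # a"] exI[of _ b] exI[of _ c]) simp
    next
      case a: True
      show ?thesis
      proof (cases "b \<noteq> [] \<and> hd b = letter_inv x")
        case True
        then obtain b' where "b = letter_inv x # b'" by (cases b) auto
        then show ?thesis using * a by (intro exI[of _ "[]"] exI[of _ b'] exI[of _ "x # c"]) simp
      next
        case False
        then have "rcons x b = x # b" by (cases b) auto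
        then show ?thesis using * a by (intro exI[of _ "[x]"] exI[of _ b] exI[of _ c]) simp
      qed
    qed
qed simp

text \<open>The cone of \<open>q\<close> consists of the reduced words with prefix \<open>q\<close>.\<close>

definition cone_free :: "'a fword set \<Rightarrow> 'a fword \<Rightarrow> bool" where
  "cone_free \<Gamma> q \<longleftrightarrow> q \<noteq> [] \<and> (\<forall>\<gamma>\<in>\<Gamma>. \<not> prefix q \<gamma>) \<and>
     (\<forall>\<gamma>\<in>\<Gamma>. \<forall>u. \<gamma> \<noteq> [] \<longrightarrow> reduced_word u \<longrightarrow> prefix q u \<longrightarrow> \<not> prefix q (foldr rcons \<gamma> u))"

text \<open>Quasiconvexity: the prefixes of \<open>\<gamma>\<close> are the vertices on the geodesic from the identity to \<open>\<gamma>\<close>.\<close>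

lemma fg_prefixes_finite_cosets:
  assumes fg: "fg_subgroup (free_group A) \<Gamma>"
  obtains T where "finite T" "T \<subseteq> carrier (free_group A)" "[] \<in> T"
    "\<And>\<gamma> p. \<gamma> \<in> \<Gamma> \<Longrightarrow> prefix p \<gamma> \<Longrightarrow> \<exists>t\<in>T. p \<otimes>\<^bsub>free_group A\<^esub> inv\<^bsub>free_group A\<^esub> t \<in> \<Gamma>"
proof -
  interpret E: group "free_group A" by (rule group_free_group)
  let ?E = "free_group A"
  obtain X where X: "finite X" "X \<subseteq> carrier ?E" "generate ?E X = \<Gamma>"
    using fg by (auto simp: fg_subgroup_def)
  interpret \<Gamma>: subgroup \<Gamma> ?E using E.fg_subgroup_is_subgroup[OF fg] .
  define T where "T = insert [] (\<Union>x\<in>X \<union> winv ` X. set (prefixes x))"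
  have TX: "p \<in> T" if "prefix p x" "x \<in> X \<union> winv ` X" for p x
    using that unfolding T_def insert_iff UN_iff in_set_prefixes by blast
  have Xc: "X \<union> winv ` X \<subseteq> carrier ?E" using X winv_in_free_group by blast
  have T: "T \<subseteq> carrier ?E"
  proof
    fix p assume "p \<in> T"
    then consider "p = []" | x where "x \<in> X \<union> winv ` X" "prefix p x"
      unfolding T_def insert_iff UN_iff in_set_prefixes by blast
    then show "p \<in> carrier ?E"
    proof cases
      case 2
      then obtain r where "x = p @ r" "x \<in> carrier ?E" using Xc by (auto simp only: prefix_def)
      then show ?thesis using append_in_free_group(1)[of p r A] by simp
    qed (simp add: carrier_free_group)
  qed
  have fin: "finite T" using X(1) by (simp add: T_def)
  have base: "\<exists>t\<in>T. p \<otimes>\<^bsub>?E\<^esub> inv\<^bsub>?E\<^esub> t \<in> \<Gamma>" if "p \<in> T" for p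
  proof
    have "p \<otimes>\<^bsub>?E\<^esub> inv\<^bsub>?E\<^esub> p = \<one>\<^bsub>?E\<^esub>" using T that by (intro E.r_inv) blast
    then show "p \<otimes>\<^bsub>?E\<^esub> inv\<^bsub>?E\<^esub> p \<in> \<Gamma>" using \<Gamma>.one_closed by simp
  qed fact
  have "\<forall>p. prefix p \<gamma> \<longrightarrow> (\<exists>t\<in>T. p \<otimes>\<^bsub>?E\<^esub> inv\<^bsub>?E\<^esub> t \<in> \<Gamma>)" if "\<gamma> \<in> generate ?E X" for \<gamma>
    using that
  proof (induction rule: generate.induct)
    case one
    then show ?case using base[of "[]"] by (auto simp: T_def)
  next
    case (incl h)
    then show ?case using base TX by blast
  next
    case (inv h)
    then have "inv\<^bsub>?E\<^esub> h = winv h" using inv_free_group X by blast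
    then show ?case using base TX inv by auto
  next
    case (eng h1 h2)
    have h: "h1 \<in> carrier ?E" "h2 \<in> carrier ?E" "h1 \<in> \<Gamma>" using eng X E.generate_in_carrier by blast+
    obtain a b c where abc: "h1 = a @ c" "h2 = winv c @ b" "foldr rcons h1 h2 = a @ b"
      using free_mult_cancel[of h1 h2] h(1,2) carrier_free_group by blast
    show ?case
    proof (intro allI impI)
      \<comment> \<open>A prefix of \<open>a @ b\<close> either ends inside \<open>a\<close>, and is
        a prefix of \<open>h1\<close>, or equals \<open>a @ s\<close>, which is \<open>h1\<close>
        times the prefix \<open>winv c @ s\<close> of \<open>h2\<close>. Left multiplication by
        \<open>h1 \<in> \<Gamma>\<close> does not change the coset.\<close>
      fix p assume "prefix p (h1 \<otimes>\<^bsub>?E\<^esub> h2)"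
      then consider "prefix p a" | s where "p = a @ s" "prefix s b" using abc by (auto simp: prefix_append)
      then show "\<exists>t\<in>T. p \<otimes>\<^bsub>?E\<^esub> inv\<^bsub>?E\<^esub> t \<in> \<Gamma>"
      proof cases
        case 1
        then show ?thesis using eng.IH(1) abc by auto
      next
        case 2
        then have "prefix (winv c @ s) h2" using abc by simp
        then obtain t where t: "t \<in> T" "(winv c @ s) \<otimes>\<^bsub>?E\<^esub> inv\<^bsub>?E\<^esub> t \<in> \<Gamma>" using eng.IH(2) by blast
        obtain s' where s': "b = s @ s'" using 2 by (auto simp: prefix_def)
        have c: "a \<in> carrier ?E" "c \<in> carrier ?E" "winv c @ s \<in> carrier ?E"
          using h(1) h(2) append_in_free_group[of a c A] append_in_free_group(1)[of "winv c @ s" s' A]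
          unfolding abc s' by simp_all
        have ab: "a @ s \<in> carrier ?E"
          using E.m_closed[OF h(1,2)] append_in_free_group(1)[of "a @ s" s' A] abc s' by simp
        have sc: "s \<in> carrier ?E" using c(3) by (rule append_in_free_group(2))
        have "winv c @ s = inv\<^bsub>?E\<^esub> c \<otimes>\<^bsub>?E\<^esub> s" "a @ s = a \<otimes>\<^bsub>?E\<^esub> s" "h1 = a \<otimes>\<^bsub>?E\<^esub> c"
          using c ab h by (auto simp: inv_free_group foldr_rcons_append carrier_free_group abc)
        then have "p = h1 \<otimes>\<^bsub>?E\<^esub> (winv c @ s)"
          using c sc 2 by (simp del: mult_free_group add: E.m_assoc E.inv_cancel_left)
        then have "p \<otimes>\<^bsub>?E\<^esub> inv\<^bsub>?E\<^esub> t = h1 \<otimes>\<^bsub>?E\<^esub> ((winv c @ s) \<otimes>\<^bsub>?E\<^esub> inv\<^bsub>?E\<^esub> t)"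
          using E.m_assoc[OF h(1) c(3) E.inv_closed[OF subsetD[OF T t(1)]]] by simp
        then show ?thesis using t(1) \<Gamma>.m_closed[OF h(3) t(2)] by metis
      qed
    qed
  qed
  then show ?thesis using that[OF fin T] X by (auto simp: T_def)
qed

text \<open>A shortest word in a coset far away from the subgroup spans a cone that the subgroup moves off itself.\<close>

lemma cone_free_exists:
  assumes fg: "fg_subgroup (free_group A) \<Gamma>" and inf: "\<not> finite_index \<Gamma> (free_group A)"
  obtains q where "q \<in> carrier (free_group A)" "cone_free \<Gamma> q"
proof -
  interpret E: group "free_group A" by (rule group_free_group)
  let ?E = "free_group A"
  have sub: "subgroup \<Gamma> ?E" using E.fg_subgroup_is_subgroup[OF fg] .
  interpret \<Gamma>: subgroup \<Gamma> ?E by (rule sub)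
  obtain T where T: "finite T" "T \<subseteq> carrier ?E" "[] \<in> T"
    "\<And>\<gamma> p. \<gamma> \<in> \<Gamma> \<Longrightarrow> prefix p \<gamma> \<Longrightarrow> \<exists>t\<in>T. p \<otimes>\<^bsub>?E\<^esub> inv\<^bsub>?E\<^esub> t \<in> \<Gamma>"
    using fg_prefixes_finite_cosets[OF fg] by metis
  obtain x where x: "x \<in> carrier ?E" "\<And>t. t \<in> T \<Longrightarrow> x \<otimes>\<^bsub>?E\<^esub> inv\<^bsub>?E\<^esub> t \<notin> \<Gamma>"
    using E.not_finite_indexE[OF sub inf T(1,2)] by metis
  let ?P = "\<lambda>y. y \<in> carrier ?E \<and> y \<otimes>\<^bsub>?E\<^esub> inv\<^bsub>?E\<^esub> x \<in> \<Gamma>"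
  have "?P x" using x(1) \<Gamma>.one_closed E.r_inv by metis
  then obtain q where q: "?P q" "\<And>y. ?P y \<Longrightarrow> length q \<le> length y"
    using ex_has_least_nat[of ?P x length] by blast
  have qc: "q \<in> carrier ?E" using q by blast
  have min: "length q \<le> length (\<gamma> \<otimes>\<^bsub>?E\<^esub> q)" if "\<gamma> \<in> \<Gamma>" for \<gamma>
  proof (rule q(2))
    have "(\<gamma> \<otimes>\<^bsub>?E\<^esub> q) \<otimes>\<^bsub>?E\<^esub> inv\<^bsub>?E\<^esub> x = \<gamma> \<otimes>\<^bsub>?E\<^esub> (q \<otimes>\<^bsub>?E\<^esub> inv\<^bsub>?E\<^esub> x)"
      using that q(1) x(1) by (simp del: mult_free_group add: E.m_assoc)
    then show "?P (\<gamma> \<otimes>\<^bsub>?E\<^esub> q)"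
      using \<Gamma>.m_closed[OF that, of "q \<otimes>\<^bsub>?E\<^esub> inv\<^bsub>?E\<^esub> x"] E.m_closed[OF \<Gamma>.mem_carrier[OF that] qc] q(1) by simp
  qed
  \<comment> \<open>\<open>q\<close> lies in the coset of \<open>x\<close>, so it inherits from
    \<open>x\<close> that it misses the cosets of \<open>T\<close>. As these contain all prefixes of
    elements of \<open>\<Gamma>\<close>, no element of \<open>\<Gamma>\<close> enters the cone of
    \<open>q\<close>.\<close>
  have far: "q \<otimes>\<^bsub>?E\<^esub> inv\<^bsub>?E\<^esub> t \<notin> \<Gamma>" if "t \<in> T" for t
  proof
    assume "q \<otimes>\<^bsub>?E\<^esub> inv\<^bsub>?E\<^esub> t \<in> \<Gamma>"
    then have "inv\<^bsub>?E\<^esub> (q \<otimes>\<^bsub>?E\<^esub> inv\<^bsub>?E\<^esub> x) \<otimes>\<^bsub>?E\<^esub> (q \<otimes>\<^bsub>?E\<^esub> inv\<^bsub>?E\<^esub> t) \<in> \<Gamma>"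
      using q(1) \<Gamma>.m_closed \<Gamma>.m_inv_closed by metis
    moreover have "inv\<^bsub>?E\<^esub> (q \<otimes>\<^bsub>?E\<^esub> inv\<^bsub>?E\<^esub> x) \<otimes>\<^bsub>?E\<^esub> (q \<otimes>\<^bsub>?E\<^esub> inv\<^bsub>?E\<^esub> t) = x \<otimes>\<^bsub>?E\<^esub> inv\<^bsub>?E\<^esub> t"
      using qc x(1) T(2) that
      by (simp del: mult_free_group add: E.m_assoc E.inv_mult_group E.inv_cancel_left subset_iff)
    ultimately show False using x(2)[OF that] by simp
  qed
  have pre: "\<not> prefix q \<gamma>" if "\<gamma> \<in> \<Gamma>" for \<gamma> using T(4)[OF that] far by blast
  have "q \<noteq> []"
    using far[OF T(3)] \<Gamma>.one_closed E.inv_one by auto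
  moreover have "\<not> prefix q (foldr rcons \<gamma> u)"
    if \<gamma>: "\<gamma> \<in> \<Gamma>" "\<gamma> \<noteq> []" and u: "reduced_word u" "prefix q u" for \<gamma> u
  proof
    assume pu: "prefix q (foldr rcons \<gamma> u)"
    have \<gamma>c: "\<gamma> \<in> carrier ?E" using \<Gamma>.mem_carrier[OF \<gamma>(1)] .
    obtain a b c where abc: "\<gamma> = a @ c" "u = winv c @ b" "foldr rcons \<gamma> u = a @ b"
      using free_mult_cancel[of \<gamma> u] \<gamma>c u(1) carrier_free_group by blast
    \<comment> \<open>\<open>winv c\<close> is a prefix of the inverse of \<open>\<gamma>\<close>,
      so if it reached the end of \<open>q\<close>, an element of \<open>\<Gamma>\<close> would lie
      in the cone. Cancellation thus stops inside \<open>q\<close>.\<close>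
    have "winv \<gamma> \<in> \<Gamma>" using \<gamma> \<gamma>c \<Gamma>.m_inv_closed inv_free_group by metis
    then have "\<not> prefix q (winv c)" using pre abc by (metis prefix_prefix map_append rev_append prefix_order.trans prefixI)
    then obtain s where s: "q = winv c @ s" "prefix s b" using u(2) abc by (auto simp: prefix_append)
    have cc: "c \<in> carrier ?E" "a \<in> carrier ?E" "s \<in> carrier ?E"
      using \<gamma>c qc append_in_free_group[of a c A] append_in_free_group(2)[of "winv c" s A]
      unfolding abc s by simp_all
    have red: "reduced_word (a @ b)" using abc u reduced_foldr_rcons by metis
    have step: "\<gamma> \<otimes>\<^bsub>?E\<^esub> (winv c @ r) = a @ r" if pr: "prefix r s" for r
    proof -
      obtain r'' where rs: "s = r @ r''" using pr by (auto simp: prefix_def)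
      moreover obtain s'' where "b = s @ s''" using s(2) by (auto simp: prefix_def)
      ultimately have "b = r @ r'' @ s''" by simp
      then have "reduced_word ((a @ r) @ (r'' @ s''))" using red by simp
      then have ar: "reduced_word (a @ r)" unfolding reduced_append[of "a @ r"] by blast
      have rc: "winv c @ r \<in> carrier ?E" "r \<in> carrier ?E"
        using qc append_in_free_group(1)[of "winv c @ r" r'' A] append_in_free_group(2)[of "winv c" r A]
        unfolding s rs by simp_all
      have "winv c @ r = inv\<^bsub>?E\<^esub> c \<otimes>\<^bsub>?E\<^esub> r" "a @ r = a \<otimes>\<^bsub>?E\<^esub> r" "\<gamma> = a \<otimes>\<^bsub>?E\<^esub> c"
        using cc rc ar \<gamma>c by (auto simp: inv_free_group foldr_rcons_append carrier_free_group abc)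
      then show ?thesis using cc rc by (simp del: mult_free_group add: E.m_assoc E.inv_cancel_left)
    qed
    have as: "\<gamma> \<otimes>\<^bsub>?E\<^esub> q = a @ s" using step[of s] s by simp
    \<comment> \<open>Both \<open>q\<close> and \<open>a @ s\<close>, which is the translate of
      \<open>q\<close> by \<open>\<gamma>\<close>, are prefixes of \<open>a @ b\<close>; minimality
      of \<open>q\<close> makes \<open>q\<close> the shorter one.\<close>
    have "prefix (a @ s) (a @ b)" using s by simp
    then have "prefix q (a @ s)"
      using pu abc min[OF \<gamma>(1)] as by (metis prefix_length_prefix)
    moreover have "\<not> prefix q a" using pre[OF \<gamma>(1)] abc by (metis prefixI prefix_order.trans)
    ultimately obtain r where r: "q = a @ r" "prefix r s" by (auto simp: prefix_append)
    have "\<gamma> \<otimes>\<^bsub>?E\<^esub> (winv c @ r) = q" using step r by simp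
    moreover have rc: "winv c @ r \<in> carrier ?E"
    proof -
      obtain r'' where "s = r @ r''" using r(2) by (auto simp: prefix_def)
      then show ?thesis using qc append_in_free_group(1)[of "winv c @ r" r'' A] unfolding s by simp
    qed
    \<comment> \<open>\<open>winv c @ r\<close> is a translate of \<open>q\<close> by an element of
      \<open>\<Gamma>\<close>, so minimality applies a second time. It forces \<open>r = s\<close>,
      and then \<open>\<gamma>\<close> fixes \<open>q\<close>.\<close>
    ultimately have "winv c @ r = inv\<^bsub>?E\<^esub> \<gamma> \<otimes>\<^bsub>?E\<^esub> q"
      using \<gamma>c by (metis E.inv_cancel_left(1))
    then have "length q \<le> length (winv c @ r)" using min[OF \<Gamma>.m_inv_closed[OF \<gamma>(1)]] by simp
    then have "length s \<le> length r" using s by simp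
    then have "r = s" using r(2) by (auto simp: prefix_def)
    then have "\<gamma> \<otimes>\<^bsub>?E\<^esub> q = q" using as r by simp
    then have "\<gamma> = \<one>\<^bsub>?E\<^esub>" using E.r_cancel_one[OF qc \<gamma>c] by blast
    then show False using \<gamma> by simp
  qed
  ultimately have "cone_free \<Gamma> q" using pre by (auto simp: cone_free_def)
  then show ?thesis using that qc by blast
qed

section \<open>Ping-pong with cones\<close>

text \<open>To touch \<open>k\<close>, the cancellation would first have to consume all of
  \<open>winv q\<close>, and then \<open>w\<close> would start with \<open>q\<close>.\<close>

lemma prefix_mult_outside_cone:
  assumes "k @ winv q \<in> carrier (free_group A)" "w \<in> carrier (free_group A)" "\<not> prefix q w"
  shows "prefix k ((k @ winv q) \<otimes>\<^bsub>free_group A\<^esub> w)"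
proof -
  obtain a b c where abc: "k @ winv q = a @ c" "w = winv c @ b" "foldr rcons (k @ winv q) w = a @ b"
    using free_mult_cancel[of "k @ winv q" w] assms(1,2) carrier_free_group by blast
  have "prefix k a"
  proof (rule ccontr)
    assume "\<not> prefix k a"
    then obtain us where "c = us @ winv q" using abc(1) by (auto simp: append_eq_append_conv2 prefix_def)
    then have "winv c = q @ winv us" by simp
    then show False using assms(3) abc(2) by simp
  qed
  then show ?thesis using abc(3) by (simp add: prefix_def) (metis append.assoc)
qed

text \<open>The cancelled part of \<open>u\<close> is a prefix of an element of
  \<open>\<Gamma>\<close>, hence shorter than \<open>q\<close>. So an element of
  \<open>\<Gamma>\<close> cannot bring a long word of the cone close to the identity.\<close>

lemma length_mult_cone:
  assumes "subgroup \<Gamma> (free_group A)" "cone_free \<Gamma> q" "\<gamma> \<in> \<Gamma>" "u \<in> carrier (free_group A)" "prefix q u"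
  shows "length u \<le> length (\<gamma> \<otimes>\<^bsub>free_group A\<^esub> u) + length q"
proof -
  interpret \<Gamma>: subgroup \<Gamma> "free_group A" by fact
  have \<gamma>c: "\<gamma> \<in> carrier (free_group A)" using \<Gamma>.mem_carrier[OF assms(3)] .
  obtain a b c where abc: "\<gamma> = a @ c" "u = winv c @ b" "foldr rcons \<gamma> u = a @ b"
    using free_mult_cancel[of \<gamma> u] assms(4) \<gamma>c carrier_free_group by blast
  have "winv \<gamma> \<in> \<Gamma>" using \<gamma>c assms(3) \<Gamma>.m_inv_closed inv_free_group by metis
  then have "\<not> prefix q (winv c)"
    using assms(2) abc unfolding cone_free_def by (metis map_append rev_append prefix_order.trans prefixI)
  then obtain s where s: "q = winv c @ s" "prefix s b" using assms(5) abc by (auto simp: prefix_append)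
  then show ?thesis using abc by simp
qed

text \<open>\<open>U\<close> is the complement of a cone that nontrivial elements of
  \<open>\<Gamma>\<close> move off itself, \<open>V\<close> is the translate by \<open>g\<close> of
  such a complement for \<open>\<Delta>\<close>, and \<open>M\<close> is the cone of
  \<open>p\<close>. The clauses on \<open>C\<close> and \<open>D\<close> rule out the two ways in
  which an alternating product outside the given factor can move \<open>p\<close>: into the set of
  the other factor, or to \<open>\<gamma>\<close> times a point of that set, with
  \<open>\<gamma>\<close> in the given factor.\<close>

lemma free_pingpong:
  fixes A :: "'a set"
  defines "E \<equiv> free_group A"
  assumes \<alpha>\<beta>: "\<alpha> \<in> A" "\<beta> \<in> A" "\<alpha> \<noteq> \<beta>"
    and \<Gamma>: "fg_subgroup E \<Gamma>" "\<not> finite_index \<Gamma> E" and \<Delta>: "fg_subgroup E \<Delta>" "\<not> finite_index \<Delta> E"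
    and C: "finite C" "C \<subseteq> carrier E" and D: "finite D" "D \<subseteq> carrier E"
  obtains g p M U V where "g \<in> carrier E" "p \<in> M" "infinite M"
    "M \<subseteq> carrier E" "U \<subseteq> carrier E" "V \<subseteq> carrier E" "U \<inter> V = {}" "M \<inter> U = {}" "M \<inter> V = {}"
    "\<And>\<gamma> u. \<gamma> \<in> \<Gamma> \<Longrightarrow> \<gamma> \<noteq> \<one>\<^bsub>E\<^esub> \<Longrightarrow> u \<in> V \<union> M \<Longrightarrow> \<gamma> \<otimes>\<^bsub>E\<^esub> u \<in> U"
    "\<And>\<delta> u. \<delta> \<in> \<Delta> \<Longrightarrow> \<delta> \<noteq> \<one>\<^bsub>E\<^esub> \<Longrightarrow> u \<in> U \<union> M \<Longrightarrow> g \<otimes>\<^bsub>E\<^esub> \<delta> \<otimes>\<^bsub>E\<^esub> inv\<^bsub>E\<^esub> g \<otimes>\<^bsub>E\<^esub> u \<in> V"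
    "\<And>c. c \<in> C \<Longrightarrow> c \<otimes>\<^bsub>E\<^esub> p \<notin> V"
    "\<And>c \<gamma> u. c \<in> C \<Longrightarrow> \<gamma> \<in> \<Gamma> \<Longrightarrow> u \<in> V \<Longrightarrow> c \<otimes>\<^bsub>E\<^esub> p \<noteq> \<gamma> \<otimes>\<^bsub>E\<^esub> u"
    "\<And>c. c \<in> D \<Longrightarrow> g \<otimes>\<^bsub>E\<^esub> c \<otimes>\<^bsub>E\<^esub> inv\<^bsub>E\<^esub> g \<otimes>\<^bsub>E\<^esub> p \<notin> U"
    "\<And>c \<delta> u. c \<in> D \<Longrightarrow> \<delta> \<in> \<Delta> \<Longrightarrow> u \<in> U \<Longrightarrow>
       g \<otimes>\<^bsub>E\<^esub> c \<otimes>\<^bsub>E\<^esub> inv\<^bsub>E\<^esub> g \<otimes>\<^bsub>E\<^esub> p \<noteq> g \<otimes>\<^bsub>E\<^esub> \<delta> \<otimes>\<^bsub>E\<^esub> inv\<^bsub>E\<^esub> g \<otimes>\<^bsub>E\<^esub> u"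
proof -
  interpret E: group E unfolding E_def by (rule group_free_group)
  have mE [simp]: "u \<otimes>\<^bsub>E\<^esub> v = foldr rcons u v" for u v by (simp add: E_def)
  have inE: "u \<in> carrier E \<longleftrightarrow> reduced_word u \<and> fst ` set u \<subseteq> A" for u
    by (simp add: E_def carrier_free_group)
  have invE: "inv\<^bsub>E\<^esub> u = winv u" if "u \<in> carrier E" for u using that inv_free_group by (simp add: E_def)
  have s\<Gamma>: "subgroup \<Gamma> E" and s\<Delta>: "subgroup \<Delta> E"
    using E.fg_subgroup_is_subgroup \<Gamma> \<Delta> by auto
  interpret \<Gamma>: subgroup \<Gamma> E by (rule s\<Gamma>)
  interpret \<Delta>: subgroup \<Delta> E by (rule s\<Delta>)
  obtain q where q: "q \<in> carrier E" "cone_free \<Gamma> q" using cone_free_exists \<Gamma> unfolding E_def by metis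
  obtain s where s: "s \<in> carrier E" "cone_free \<Delta> s" using cone_free_exists \<Delta> unfolding E_def by metis
  have ne: "q \<noteq> []" "s \<noteq> []" using q s by (auto simp: cone_free_def)
  \<comment> \<open>Two generators give three distinct letters, one more than can be forbidden. This
    is the only use of noncyclicity in the ping-pong.\<close>
  have letters: "\<exists>x. fst x \<in> A \<and> x \<noteq> u \<and> x \<noteq> v" for u v :: "'a \<times> bool"
  proof -
    have "card {(\<alpha>, True), (\<alpha>, False), (\<beta>, True)} = 3" using \<alpha>\<beta> by simp
    moreover have "card {u, v} \<le> 2" by (simp add: card_insert_if)
    ultimately have "\<not> {(\<alpha>, True), (\<alpha>, False), (\<beta>, True)} \<subseteq> {u, v}"
      using card_mono[of "{u, v}" "{(\<alpha>, True), (\<alpha>, False), (\<beta>, True)}"] by force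
    then show ?thesis using \<alpha>\<beta> by auto
  qed
  \<comment> \<open>\<open>z \<noteq> last s\<close> keeps \<open>Z @ winv s\<close> reduced; the
    conditions on \<open>y\<close> do the same at the two ends of \<open>Y\<close>. \<open>x\<close>
    does not cancel against \<open>y\<close>, and \<open>x \<noteq> z\<close> makes \<open>p\<close>
    branch off from \<open>g\<close>.\<close>
  obtain z where z: "fst z \<in> A" "z \<noteq> last s" using letters by blast
  obtain y where y: "fst y \<in> A" "y \<noteq> letter_inv (last q)" "y \<noteq> letter_inv z" using letters by blast
  obtain x where x: "fst x \<in> A" "x \<noteq> letter_inv y" "x \<noteq> z" using letters by blast
  \<comment> \<open>The base point \<open>p\<close> branches off halfway along \<open>g = q y\<^sup>n z\<^sup>n s\<^sup>-\<^sup>1\<close>; for large \<open>n\<close> it is too far from both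
    ends of \<open>g\<close> for the finitely many elements of \<open>C\<close> and \<open>D\<close> to move it beyond them.\<close>
  define n where "n = length q + length s + (\<Sum>c\<in>C \<union> D. length c) + 2"
  have n0: "n > 0" and nC: "c \<in> C \<union> D \<Longrightarrow> length c + length q + length s + 2 \<le> n" for c
    using member_le_sum[of c "C \<union> D" length] C D by (auto simp: n_def)
  define Y where "Y = replicate n y"
  define Z where "Z = replicate n z"
  have YZ: "length Y = n" "length Z = n" "Y \<noteq> []" "Z \<noteq> []" "hd Y = y" "last Y = y" "hd Z = z" "last Z = z"
    "reduced_word Y" "reduced_word Z" "fst ` set Y \<subseteq> A" "fst ` set Z \<subseteq> A"
    using n0 y z by (auto simp: Y_def Z_def reduced_replicate)
  define g where "g = q @ Y @ Z @ winv s"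
  define k where "k = q @ Y @ Z"
  define k' where "k' = s @ winv Z @ winv Y"
  define p where "p = q @ Y @ [x]"
  have rs: "reduced_word (winv s)" "fst ` set (winv s) \<subseteq> A" "hd (winv s) = letter_inv (last s)" "winv s \<noteq> []"
    using s ne by (auto simp: inE reduced_winv hd_rev last_map)
  have zy: "z \<noteq> letter_inv y" using y(3) by (metis letter_inv_inv)
  have "reduced_word (Z @ winv s)" using YZ rs z(2) by (simp add: reduced_append)
  then have "reduced_word (Y @ Z @ winv s)" using YZ zy by (simp add: reduced_append)
  then have "reduced_word (q @ Y @ Z @ winv s)" using YZ y(2) q(1) by (simp add: reduced_append inE)
  moreover have "fst ` set (q @ Y @ Z @ winv s) \<subseteq> A"
    using YZ rs(2) q(1) unfolding inE by (simp only: set_append image_Un) blast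
  ultimately have g: "g \<in> carrier E" by (simp only: g_def inE)
  have p: "p \<in> carrier E" using q YZ x y ne by (auto simp: p_def inE reduced_append)
  have gk: "g = k @ winv s" by (simp add: g_def k_def)
  have g': "inv\<^bsub>E\<^esub> g = k' @ winv q" using invE[OF g] by (simp add: g_def k'_def)
  have g'c: "k' @ winv q \<in> carrier E" using g g' by (metis E.inv_closed)
  define U where "U = {w \<in> carrier E. \<not> prefix q w}"
  define V where "V = {w \<in> carrier E. \<not> prefix s (inv\<^bsub>E\<^esub> g \<otimes>\<^bsub>E\<^esub> w)}"
  define M where "M = {w \<in> carrier E. prefix p w}"
  \<comment> \<open>\<open>g\<close> is \<open>k @ winv s\<close>, and a word outside the cone of
    \<open>s\<close> cannot cancel back into \<open>k\<close>. So \<open>V\<close> lies in the cone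
    of \<open>k\<close>; symmetrically, the translate of \<open>U\<close> by the inverse of
    \<open>g\<close> lies in the cone of \<open>k'\<close>.\<close>
  have V: "prefix k w" if "w \<in> V" for w
  proof -
    have w: "w \<in> carrier E" "\<not> prefix s (inv\<^bsub>E\<^esub> g \<otimes>\<^bsub>E\<^esub> w)" using that by (auto simp: V_def)
    then have "prefix k (g \<otimes>\<^bsub>E\<^esub> (inv\<^bsub>E\<^esub> g \<otimes>\<^bsub>E\<^esub> w))"
      using prefix_mult_outside_cone[of k s A "inv\<^bsub>E\<^esub> g \<otimes>\<^bsub>E\<^esub> w"] g gk
      by (metis E.inv_closed E.m_closed E_def)
    then show ?thesis using E.inv_cancel_left(2)[OF g w(1)] by simp
  qed
  have U: "prefix k' (inv\<^bsub>E\<^esub> g \<otimes>\<^bsub>E\<^esub> w)" if "w \<in> U" for w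
    using prefix_mult_outside_cone[of k' q A w] g'c that g' by (auto simp: U_def E_def)
  have Vq: "prefix q w" if "w \<in> V \<union> M" for w
    using that V[of w] unfolding M_def p_def k_def by (auto simp: prefix_def)
  have MV: "M \<inter> V = {}"
  proof (rule ccontr)
    assume "M \<inter> V \<noteq> {}"
    then obtain w where "prefix p w" "prefix k w" using V by (auto simp: M_def)
    then obtain t t' where "p @ t = k @ t'" by (auto simp: prefix_def)
    then have "x # t = Z @ t'" by (simp add: p_def k_def)
    then show False using x YZ by (metis hd_append2 list.sel(1))
  qed
  have UV: "U \<inter> V = {}" using Vq by (auto simp: U_def)
  have MU: "M \<inter> U = {}" using Vq by (auto simp: U_def)
  have Us: "prefix s (inv\<^bsub>E\<^esub> g \<otimes>\<^bsub>E\<^esub> w)" if "w \<in> U \<union> M" for w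
    using that UV MV by (auto simp: V_def U_def M_def)
  have sub: "M \<subseteq> carrier E" "U \<subseteq> carrier E" "V \<subseteq> carrier E" by (auto simp: M_def U_def V_def)
  have pM: "p \<in> M" using p by (simp add: M_def)
  have infM: "infinite M"
  proof -
    have "p @ replicate m x \<in> M" for m
    proof -
      have "last p = x" by (simp add: p_def)
      then show ?thesis
        using p x reduced_replicate[of m x] by (cases m) (auto simp: M_def inE reduced_append)
    qed
    moreover have "inj (\<lambda>m. p @ replicate m x)" by (auto simp: inj_def)
    ultimately show ?thesis by (meson finite_subset image_subsetI infinite_UNIV_nat finite_imageD)
  qed
  have lp: "length p = length q + n + 1" using YZ by (simp add: p_def)
  \<comment> \<open>\<open>g\<close> and \<open>p\<close> share the prefix \<open>q @ Y\<close>, so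
    only \<open>Z\<close>, \<open>winv s\<close> and the letter \<open>x\<close> contribute to the
    length.\<close>
  have lp': "length (inv\<^bsub>E\<^esub> g \<otimes>\<^bsub>E\<^esub> p) \<le> length s + n + 1"
  proof -
    have c: "q @ Y \<in> carrier E" "Z @ winv s \<in> carrier E" "[x] \<in> carrier E"
      using g p append_in_free_group[of "q @ Y" "Z @ winv s" A] x
      by (auto simp: g_def E_def carrier_free_group)
    have "g = (q @ Y) \<otimes>\<^bsub>E\<^esub> (Z @ winv s)" "p = (q @ Y) \<otimes>\<^bsub>E\<^esub> [x]"
      using g p foldr_rcons_append[of "q @ Y" "Z @ winv s"] foldr_rcons_append[of "q @ Y" "[x]"]
      by (simp_all del: foldr_append add: g_def p_def inE)
    then have "inv\<^bsub>E\<^esub> g \<otimes>\<^bsub>E\<^esub> p = inv\<^bsub>E\<^esub> (Z @ winv s) \<otimes>\<^bsub>E\<^esub> [x]"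
      using c by (simp del: mE add: E.inv_mult_group E.m_assoc E.inv_cancel_left)
    also have "length \<dots> \<le> length (inv\<^bsub>E\<^esub> (Z @ winv s)) + 1" using length_foldr_rcons[of _ "[x]"] by simp
    also have "\<dots> = length s + n + 1" using invE[OF c(2)] YZ by simp
    finally show ?thesis .
  qed
  have lk: "length k = length q + 2 * n" "length k' = length s + 2 * n" using YZ by (auto simp: k_def k'_def)
  have gc: "inv\<^bsub>E\<^esub> g \<otimes>\<^bsub>E\<^esub> (g \<otimes>\<^bsub>E\<^esub> c \<otimes>\<^bsub>E\<^esub> inv\<^bsub>E\<^esub> g \<otimes>\<^bsub>E\<^esub> w) = c \<otimes>\<^bsub>E\<^esub> (inv\<^bsub>E\<^esub> g \<otimes>\<^bsub>E\<^esub> w)"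
    if "c \<in> carrier E" "w \<in> carrier E" for c w
    using that g by (simp del: mE add: E.m_assoc E.inv_cancel_left)
  show ?thesis
  proof (rule that[OF g pM infM sub UV MU MV])
    fix \<gamma> u assume *: "\<gamma> \<in> \<Gamma>" "\<gamma> \<noteq> \<one>\<^bsub>E\<^esub>" "u \<in> V \<union> M"
    have uc: "u \<in> carrier E" using * sub by blast
    then have "reduced_word u" unfolding inE by blast
    then have "\<not> prefix q (\<gamma> \<otimes>\<^bsub>E\<^esub> u)"
      using q(2) Vq[OF *(3)] *(1,2) unfolding cone_free_def by (simp add: E_def)
    then show "\<gamma> \<otimes>\<^bsub>E\<^esub> u \<in> U"
      using E.m_closed[OF \<Gamma>.mem_carrier[OF *(1)] uc] by (simp add: U_def)
  next
    fix \<delta> u assume *: "\<delta> \<in> \<Delta>" "\<delta> \<noteq> \<one>\<^bsub>E\<^esub>" "u \<in> U \<union> M"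
    have uc: "u \<in> carrier E" using * sub by blast
    have "reduced_word (inv\<^bsub>E\<^esub> g \<otimes>\<^bsub>E\<^esub> u)"
      using E.m_closed[OF E.inv_closed[OF g] uc] unfolding inE by blast
    then have "\<not> prefix s (\<delta> \<otimes>\<^bsub>E\<^esub> (inv\<^bsub>E\<^esub> g \<otimes>\<^bsub>E\<^esub> u))"
      using s(2) Us[OF *(3)] *(1,2) unfolding cone_free_def by (simp add: E_def)
    then show "g \<otimes>\<^bsub>E\<^esub> \<delta> \<otimes>\<^bsub>E\<^esub> inv\<^bsub>E\<^esub> g \<otimes>\<^bsub>E\<^esub> u \<in> V"
      using gc[OF \<Delta>.mem_carrier[OF *(1)] uc] g uc \<Delta>.mem_carrier[OF *(1)] by (simp del: mE add: V_def)
  next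
    fix c assume c: "c \<in> C"
    show "c \<otimes>\<^bsub>E\<^esub> p \<notin> V"
    proof
      assume "c \<otimes>\<^bsub>E\<^esub> p \<in> V"
      then have "length k \<le> length (c \<otimes>\<^bsub>E\<^esub> p)" using V prefix_length_le by blast
      then show False using length_foldr_rcons[of c p] lp lk nC[of c] c by simp
    qed
    fix \<gamma> u assume *: "\<gamma> \<in> \<Gamma>" "u \<in> V"
    show "c \<otimes>\<^bsub>E\<^esub> p \<noteq> \<gamma> \<otimes>\<^bsub>E\<^esub> u"
    proof
      assume e: "c \<otimes>\<^bsub>E\<^esub> p = \<gamma> \<otimes>\<^bsub>E\<^esub> u"
      have "length u \<le> length (\<gamma> \<otimes>\<^bsub>E\<^esub> u) + length q"
        using length_mult_cone[of \<Gamma> A q \<gamma> u] s\<Gamma> q(2) * Vq sub by (auto simp: E_def)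
      moreover have "length k \<le> length u" using V[OF *(2)] prefix_length_le by blast
      ultimately show False using e length_foldr_rcons[of c p] lp lk nC[of c] c by simp
    qed
  next
    fix c assume c: "c \<in> D"
    then have cc: "c \<in> carrier E" using D by blast
    let ?w = "g \<otimes>\<^bsub>E\<^esub> c \<otimes>\<^bsub>E\<^esub> inv\<^bsub>E\<^esub> g \<otimes>\<^bsub>E\<^esub> p"
    have lw: "length (inv\<^bsub>E\<^esub> g \<otimes>\<^bsub>E\<^esub> ?w) \<le> length c + (length s + n + 1)"
      unfolding gc[OF cc p] using length_foldr_rcons[of c "inv\<^bsub>E\<^esub> g \<otimes>\<^bsub>E\<^esub> p"] lp' by simp
    show "?w \<notin> U"
    proof
      assume "?w \<in> U"
      then have "length k' \<le> length (inv\<^bsub>E\<^esub> g \<otimes>\<^bsub>E\<^esub> ?w)" using U prefix_length_le by blast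
      then show False using lw lk nC[of c] c by simp
    qed
    fix \<delta> u assume *: "\<delta> \<in> \<Delta>" "u \<in> U"
    show "?w \<noteq> g \<otimes>\<^bsub>E\<^esub> \<delta> \<otimes>\<^bsub>E\<^esub> inv\<^bsub>E\<^esub> g \<otimes>\<^bsub>E\<^esub> u"
    proof
      assume e: "?w = g \<otimes>\<^bsub>E\<^esub> \<delta> \<otimes>\<^bsub>E\<^esub> inv\<^bsub>E\<^esub> g \<otimes>\<^bsub>E\<^esub> u"
      have uc: "u \<in> carrier E" using * sub by blast
      let ?u = "inv\<^bsub>E\<^esub> g \<otimes>\<^bsub>E\<^esub> u"
      have e': "inv\<^bsub>E\<^esub> g \<otimes>\<^bsub>E\<^esub> ?w = \<delta> \<otimes>\<^bsub>E\<^esub> ?u"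
        unfolding e using gc[OF \<Delta>.mem_carrier[OF *(1)] uc] .
      have "?u \<in> carrier E" "prefix s ?u" using g uc Us[of u] * by (auto simp del: mE)
      then have "length ?u \<le> length (\<delta> \<otimes>\<^bsub>E\<^esub> ?u) + length s"
        using length_mult_cone[of \<Delta> A s \<delta> ?u] s\<Delta> s(2) *(1) by (auto simp: E_def)
      moreover have "length k' \<le> length ?u" using U[OF *(2)] prefix_length_le by blast
      ultimately show False using e' lw lk nC[of c] c by (simp del: mE)
    qed
  qed
qed

section \<open>Subgroups of free groups\<close>

lemma generate_letters:
  "generate (free_group A) ((\<lambda>a. [(a, True)]) ` A) = carrier (free_group A)"
proof -
  interpret E: group "free_group A" by (rule group_free_group)
  have sub: "(\<lambda>a. [(a, True)]) ` A \<subseteq> carrier (free_group A)" by (auto simp: carrier_free_group)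
  have "w \<in> generate (free_group A) ((\<lambda>a. [(a, True)]) ` A)" if "w \<in> carrier (free_group A)" for w
    using that
  proof (induction w)
    case Nil
    then show ?case using generate.one[of "free_group A"] by simp
  next
    case (Cons x w)
    then have w: "w \<in> carrier (free_group A)" "fst x \<in> A" "x # w = [x] \<otimes>\<^bsub>free_group A\<^esub> w"
      by (auto simp: carrier_free_group reduced_Cons rcons_reduced)
    have "[(fst x, True)] \<in> carrier (free_group A)" using w by (simp add: carrier_free_group)
    then have "inv\<^bsub>free_group A\<^esub> [(fst x, True)] = [(fst x, False)]" by (simp add: inv_free_group)
    then have "[x] \<in> generate (free_group A) ((\<lambda>a. [(a, True)]) ` A)"
      using generate.incl[of "[(fst x, True)]" "(\<lambda>a. [(a, True)]) ` A" "free_group A"]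
        generate.inv[of "[(fst x, True)]" "(\<lambda>a. [(a, True)]) ` A" "free_group A"] w(2)
      by (cases x; cases "snd x") auto
    then show ?case using Cons.IH[OF w(1)] w(3) generate.eng by metis
  qed
  then show ?thesis using E.generate_incl[OF sub] by blast
qed

lemma fg_free_group:
  assumes "finite A" shows "fg_subgroup (free_group A) (carrier (free_group A))"
proof -
  have "(\<lambda>a. [(a, True)]) ` A \<subseteq> carrier (free_group A)" by (auto simp: carrier_free_group)
  from group.fg_subgroupI[OF group_free_group _ this] assms show ?thesis
    unfolding generate_letters by simp
qed

section \<open>Schreier transversals and the Nielsen-Schreier theorem\<close>

text \<open>Only a partial transversal: that every coset is met is left out, so that unions of
  chains stay admissible and Zorn's lemma applies.\<close>

definition schreier_transversal :: "'a set \<Rightarrow> 'a fword set \<Rightarrow> 'a fword set \<Rightarrow> bool" where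
  "schreier_transversal A S T \<longleftrightarrow> T \<subseteq> carrier (free_group A) \<and> [] \<in> T
     \<and> (\<forall>u x. u @ [x] \<in> T \<longrightarrow> u \<in> T)
     \<and> (\<forall>t\<in>T. \<forall>t'\<in>T. t \<otimes>\<^bsub>free_group A\<^esub> inv\<^bsub>free_group A\<^esub> t' \<in> S \<longrightarrow> t = t')"

lemma schreier_transversalD:
  assumes "schreier_transversal A S T"
  shows "t \<in> T \<Longrightarrow> t \<in> carrier (free_group A)" "[] \<in> T" "u @ [x] \<in> T \<Longrightarrow> u \<in> T"
    "t \<in> T \<Longrightarrow> t' \<in> T \<Longrightarrow> t \<otimes>\<^bsub>free_group A\<^esub> inv\<^bsub>free_group A\<^esub> t' \<in> S \<Longrightarrow> t = t'"
proof -
  have *: "T \<subseteq> carrier (free_group A)" "[] \<in> T" "\<forall>u x. u @ [x] \<in> T \<longrightarrow> u \<in> T"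
    "\<forall>t\<in>T. \<forall>t'\<in>T. t \<otimes>\<^bsub>free_group A\<^esub> inv\<^bsub>free_group A\<^esub> t' \<in> S \<longrightarrow> t = t'"
    using assms unfolding schreier_transversal_def by simp_all
  show "t \<in> T \<Longrightarrow> t \<in> carrier (free_group A)" using subsetD[OF *(1)] .
  show "[] \<in> T" by fact
  show "u @ [x] \<in> T \<Longrightarrow> u \<in> T" using *(3) by metis
  show "t \<in> T \<Longrightarrow> t' \<in> T \<Longrightarrow> t \<otimes>\<^bsub>free_group A\<^esub> inv\<^bsub>free_group A\<^esub> t' \<in> S \<Longrightarrow> t = t'"
    using *(4) by simp
qed

text \<open>A maximal partial transversal meets all cosets, by induction on the word: if
  \<open>t\<close> represents \<open>u\<close> and the coset of \<open>u @ [x]\<close> were missed,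
  then \<open>t\<close> followed by \<open>x\<close> could be added.\<close>

lemma schreier_transversal_exists:
  assumes S: "subgroup S (free_group A)"
  obtains T where "schreier_transversal A S T"
    "\<And>w. w \<in> carrier (free_group A) \<Longrightarrow> \<exists>t\<in>T. w \<otimes>\<^bsub>free_group A\<^esub> inv\<^bsub>free_group A\<^esub> t \<in> S"
proof -
  let ?E = "free_group A"
  interpret E: group ?E by (rule group_free_group)
  interpret S: subgroup S ?E by fact
  let ?\<A> = "{T. schreier_transversal A S T}"
  have "{[]} \<in> ?\<A>" by (auto simp: schreier_transversal_def carrier_free_group)
  then have "\<exists>M\<in>?\<A>. \<forall>X\<in>?\<A>. M \<subseteq> X \<longrightarrow> X = M"
  proof (rule subset_Zorn_nonempty[OF ex_in_conv[THEN iffD1, OF exI]])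
    fix \<C> assume \<C>: "\<C> \<noteq> {}" "subset.chain ?\<A> \<C>"
    then have sub: "\<And>T. T \<in> \<C> \<Longrightarrow> schreier_transversal A S T" by (auto simp: subset_chain_def)
    show "\<Union>\<C> \<in> ?\<A>"
      unfolding mem_Collect_eq schreier_transversal_def
    proof (intro conjI subsetI allI impI ballI)
      fix t t' assume t: "t \<in> \<Union>\<C>" "t' \<in> \<Union>\<C>" "t \<otimes>\<^bsub>?E\<^esub> inv\<^bsub>?E\<^esub> t' \<in> S"
      then obtain T T' where "T \<in> \<C>" "t \<in> T" "T' \<in> \<C>" "t' \<in> T'" by blast
      then obtain T'' where "T'' \<in> \<C>" "t \<in> T''" "t' \<in> T''" using \<C>(2) unfolding subset_chain_def by blast
      then show "t = t'" using schreier_transversalD(4)[OF sub] t(3) by blast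
    next
      fix t assume "t \<in> \<Union>\<C>"
      then obtain T where "T \<in> \<C>" "t \<in> T" by blast
      then show "t \<in> carrier ?E" using schreier_transversalD(1)[OF sub] by blast
    next
      obtain T where "T \<in> \<C>" using \<C>(1) by blast
      then show "[] \<in> \<Union>\<C>" using schreier_transversalD(2)[OF sub] by blast
    next
      fix u x assume "u @ [x] \<in> \<Union>\<C>"
      then obtain T where T: "T \<in> \<C>" "u @ [x] \<in> T" by blast
      then show "u \<in> \<Union>\<C>" using schreier_transversalD(3)[OF sub[OF T(1)] T(2)] by blast
    qed
  qed
  then obtain T where T: "schreier_transversal A S T"
    and max: "\<And>X. schreier_transversal A S X \<Longrightarrow> T \<subseteq> X \<Longrightarrow> X = T" by auto
  have Tc: "T \<subseteq> carrier ?E" "[] \<in> T" "\<And>u x. u @ [x] \<in> T \<Longrightarrow> u \<in> T"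
    "\<And>t t'. t \<in> T \<Longrightarrow> t' \<in> T \<Longrightarrow> t \<otimes>\<^bsub>?E\<^esub> inv\<^bsub>?E\<^esub> t' \<in> S \<Longrightarrow> t = t'"
    by (rule subsetI, erule schreier_transversalD[OF T]) (rule schreier_transversalD[OF T]; assumption)+
  have "\<exists>t\<in>T. w \<otimes>\<^bsub>?E\<^esub> inv\<^bsub>?E\<^esub> t \<in> S" if "w \<in> carrier ?E" for w
    using that
  proof (induction w rule: rev_induct)
    case Nil
    have "[] \<otimes>\<^bsub>?E\<^esub> inv\<^bsub>?E\<^esub> [] = \<one>\<^bsub>?E\<^esub>" using E.r_inv[OF E.one_closed] by simp
    then show ?case using Tc(2) S.one_closed by metis
  next
    case (snoc x u)
    have u: "u \<in> carrier ?E" "[x] \<in> carrier ?E" using append_in_free_group[OF snoc.prems] by auto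
    then obtain t where t: "t \<in> T" "u \<otimes>\<^bsub>?E\<^esub> inv\<^bsub>?E\<^esub> t \<in> S" using snoc.IH by blast
    define v where "v = t \<otimes>\<^bsub>?E\<^esub> [x]"
    define w where "w = u \<otimes>\<^bsub>?E\<^esub> [x]"
    have tc: "t \<in> carrier ?E" using t Tc by blast
    have vc: "v \<in> carrier ?E" "w \<in> carrier ?E" unfolding v_def w_def using tc u by blast+
    have wv: "w \<otimes>\<^bsub>?E\<^esub> inv\<^bsub>?E\<^esub> v \<in> S"
    proof -
      have "w \<otimes>\<^bsub>?E\<^esub> inv\<^bsub>?E\<^esub> v = u \<otimes>\<^bsub>?E\<^esub> inv\<^bsub>?E\<^esub> t"
        using u tc by (simp del: mult_free_group add: v_def w_def E.inv_mult_group E.m_assoc E.inv_cancel_left)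
      then show ?thesis using t by simp
    qed
    have w: "u @ [x] = w" using snoc.prems by (simp add: w_def foldr_rcons_append carrier_free_group)
    show ?case
    proof (rule ccontr)
      assume no: "\<not> (\<exists>t\<in>T. (u @ [x]) \<otimes>\<^bsub>?E\<^esub> inv\<^bsub>?E\<^esub> t \<in> S)"
      then have vT: "v \<notin> T" using wv w by auto
      \<comment> \<open>If \<open>x\<close> cancelled against the last letter of \<open>t\<close>,
        then \<open>v\<close> would be a prefix of \<open>t\<close> and so already in
        \<open>T\<close>.\<close>
      have red: "reduced_word (t @ [x])"
      proof (rule ccontr)
        assume "\<not> reduced_word (t @ [x])"
        then have "t \<noteq> []" "x = letter_inv (last t)" using tc by (auto simp: reduced_append carrier_free_group)
        then obtain t' where t': "t = t' @ [letter_inv x]" by (metis append_butlast_last_id letter_inv_inv)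
        then have "v = foldr rcons t' []" by (simp add: v_def)
        also have "\<dots> = t'" using tc t' by (intro foldr_rcons_Nil) (simp add: carrier_free_group reduced_append)
        finally show False using vT t Tc(3) t' by simp
      qed
      then have v: "v = t @ [x]" by (simp add: v_def foldr_rcons_append)
      have new: "v \<otimes>\<^bsub>?E\<^esub> inv\<^bsub>?E\<^esub> t' \<notin> S" if "t' \<in> T" for t'
      proof
        assume *: "v \<otimes>\<^bsub>?E\<^esub> inv\<^bsub>?E\<^esub> t' \<in> S"
        have "t' \<in> carrier ?E" using that Tc by blast
        then have "(w \<otimes>\<^bsub>?E\<^esub> inv\<^bsub>?E\<^esub> v) \<otimes>\<^bsub>?E\<^esub> (v \<otimes>\<^bsub>?E\<^esub> inv\<^bsub>?E\<^esub> t') = w \<otimes>\<^bsub>?E\<^esub> inv\<^bsub>?E\<^esub> t'"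
          using vc by (simp del: mult_free_group add: E.m_assoc E.inv_cancel_left)
        then show False using no that S.m_closed[OF wv *] w by auto
      qed
      have new': "t' \<otimes>\<^bsub>?E\<^esub> inv\<^bsub>?E\<^esub> v \<notin> S" if "t' \<in> T" for t'
      proof
        assume *: "t' \<otimes>\<^bsub>?E\<^esub> inv\<^bsub>?E\<^esub> v \<in> S"
        have "t' \<in> carrier ?E" using that Tc by blast
        then have "inv\<^bsub>?E\<^esub> (t' \<otimes>\<^bsub>?E\<^esub> inv\<^bsub>?E\<^esub> v) = v \<otimes>\<^bsub>?E\<^esub> inv\<^bsub>?E\<^esub> t'"
          using vc by (simp del: mult_free_group add: E.inv_mult_group)
        then show False using new[OF that] S.m_inv_closed[OF *] by simp
      qed
      have "schreier_transversal A S (insert v T)"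
        unfolding schreier_transversal_def
      proof (intro conjI allI impI ballI)
        fix u' x' assume "u' @ [x'] \<in> insert v T"
        then show "u' \<in> insert v T" using Tc(3)[of u' x'] v t by auto
      next
        fix t t' assume "t \<in> insert v T" "t' \<in> insert v T" "t \<otimes>\<^bsub>?E\<^esub> inv\<^bsub>?E\<^esub> t' \<in> S"
        then show "t = t'" using Tc(4)[of t t'] new new' by blast
      qed (use Tc vc in auto)
      then show False using max[of "insert v T"] vT by blast
    qed
  qed
  then show ?thesis using that[OF T] by blast
qed

locale schreier =
  fixes A :: "'a set" and S T
  assumes S: "subgroup S (free_group A)"
    and T: "schreier_transversal A S T"
    and cover: "w \<in> carrier (free_group A) \<Longrightarrow> \<exists>t\<in>T. w \<otimes>\<^bsub>free_group A\<^esub> inv\<^bsub>free_group A\<^esub> t \<in> S"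
begin

abbreviation "E \<equiv> free_group A"

sublocale E: group E by (rule group_free_group)
sublocale S: subgroup S E by (rule S)

lemma T_carrier: "t \<in> T \<Longrightarrow> t \<in> carrier E"
  and Nil_T: "[] \<in> T"
  and T_butlast: "u @ [x] \<in> T \<Longrightarrow> u \<in> T"
  and T_unique: "t \<in> T \<Longrightarrow> t' \<in> T \<Longrightarrow> t \<otimes>\<^bsub>E\<^esub> inv\<^bsub>E\<^esub> t' \<in> S \<Longrightarrow> t = t'"
  by (rule schreier_transversalD[OF T]; assumption)+

definition "rep w = (SOME t. t \<in> T \<and> w \<otimes>\<^bsub>E\<^esub> inv\<^bsub>E\<^esub> t \<in> S)"

lemma rep: "w \<in> carrier E \<Longrightarrow> rep w \<in> T" "w \<in> carrier E \<Longrightarrow> w \<otimes>\<^bsub>E\<^esub> inv\<^bsub>E\<^esub> rep w \<in> S"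
  using someI_ex[of "\<lambda>t. t \<in> T \<and> w \<otimes>\<^bsub>E\<^esub> inv\<^bsub>E\<^esub> t \<in> S"] cover[of w] unfolding rep_def by blast+

lemma rep_carrier [simp]: "w \<in> carrier E \<Longrightarrow> rep w \<in> carrier E"
  using rep(1) T_carrier by blast

lemma rep_eqI:
  assumes "w \<in> carrier E" "t \<in> T" "w \<otimes>\<^bsub>E\<^esub> inv\<^bsub>E\<^esub> t \<in> S" shows "rep w = t"
proof -
  note c = assms(1) T_carrier[OF assms(2)] rep_carrier[OF assms(1)]
  have "inv\<^bsub>E\<^esub> (w \<otimes>\<^bsub>E\<^esub> inv\<^bsub>E\<^esub> rep w) \<otimes>\<^bsub>E\<^esub> (w \<otimes>\<^bsub>E\<^esub> inv\<^bsub>E\<^esub> t) = rep w \<otimes>\<^bsub>E\<^esub> inv\<^bsub>E\<^esub> t"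
    using c by (simp del: mult_free_group add: E.inv_mult_group E.m_assoc E.inv_cancel_left)
  then have "rep w \<otimes>\<^bsub>E\<^esub> inv\<^bsub>E\<^esub> t \<in> S"
    using S.m_closed[OF S.m_inv_closed[OF rep(2)[OF assms(1)]] assms(3)] by simp
  then show ?thesis using T_unique rep(1)[OF assms(1)] assms(2) by blast
qed

lemma rep_T: "t \<in> T \<Longrightarrow> rep t = t"
  using rep_eqI[of t t] T_carrier[of t] S.one_closed E.r_inv[of t] by metis

lemma rep_S: "s \<in> S \<Longrightarrow> rep s = []"
proof (rule rep_eqI)
  assume "s \<in> S"
  moreover have "s \<otimes>\<^bsub>E\<^esub> inv\<^bsub>E\<^esub> \<one>\<^bsub>E\<^esub> = s" using \<open>s \<in> S\<close> by (simp del: mult_free_group one_free_group)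
  ultimately show "s \<otimes>\<^bsub>E\<^esub> inv\<^bsub>E\<^esub> [] \<in> S" by simp
qed (auto simp: Nil_T)

text \<open>The right action of the free group on the cosets of \<open>S\<close>, written on
  representatives: \<open>T\<close> is the vertex set of the Schreier graph, and the letter
  \<open>x\<close> leads from \<open>t\<close> to the representative of \<open>t\<close> times
  \<open>x\<close>.\<close>

lemma rep_rep_mult:
  assumes "w \<in> carrier E" "v \<in> carrier E"
  shows "rep (rep w \<otimes>\<^bsub>E\<^esub> v) = rep (w \<otimes>\<^bsub>E\<^esub> v)"
proof (rule rep_eqI)
  show "rep w \<otimes>\<^bsub>E\<^esub> v \<in> carrier E" "rep (w \<otimes>\<^bsub>E\<^esub> v) \<in> T"
    using assms E.m_closed rep(1) rep_carrier by blast+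
  let ?r = "rep (w \<otimes>\<^bsub>E\<^esub> v)"
  have r: "?r \<in> carrier E" "(w \<otimes>\<^bsub>E\<^esub> v) \<otimes>\<^bsub>E\<^esub> inv\<^bsub>E\<^esub> ?r \<in> S" using assms E.m_closed rep(2) rep_carrier by blast+
  have "inv\<^bsub>E\<^esub> (w \<otimes>\<^bsub>E\<^esub> inv\<^bsub>E\<^esub> rep w) \<otimes>\<^bsub>E\<^esub> ((w \<otimes>\<^bsub>E\<^esub> v) \<otimes>\<^bsub>E\<^esub> inv\<^bsub>E\<^esub> ?r) = (rep w \<otimes>\<^bsub>E\<^esub> v) \<otimes>\<^bsub>E\<^esub> inv\<^bsub>E\<^esub> ?r"
    using assms r(1) rep_carrier[OF assms(1)]
    by (simp del: mult_free_group add: E.inv_mult_group E.m_assoc E.inv_cancel_left)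
  then show "(rep w \<otimes>\<^bsub>E\<^esub> v) \<otimes>\<^bsub>E\<^esub> inv\<^bsub>E\<^esub> ?r \<in> S"
    using S.m_closed[OF S.m_inv_closed[OF rep(2)[OF assms(1)]] r(2)] by simp
qed

text \<open>The positively labelled edges of the Schreier graph outside the spanning tree
  \<open>T\<close>. If the edge belongs to the tree, then its end, as a word, is again in
  \<open>T\<close>, whichever end is closer to the root.\<close>

definition B :: "('a fword \<times> 'a) set" where
  "B = {(t, a). t \<in> T \<and> a \<in> A \<and> t \<otimes>\<^bsub>E\<^esub> [(a, True)] \<notin> T}"

abbreviation "FB \<equiv> free_group B"

sublocale FB: group FB by (rule group_free_group)

text \<open>
  A letter read at the vertex \<open>t\<close> of the Schreier graph contributes a basis element unless it runs along
  the spanning tree \<open>T\<close>. Reading whole words inverts the map sending the basis element \<open>(t, a)\<close> to the loop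
  \<open>t a (rep (t a))\<^sup>-\<^sup>1\<close>.
\<close>

definition lab :: "'a fword \<Rightarrow> 'a \<times> bool \<Rightarrow> ('a fword \<times> 'a) fword" where
  "lab t x = (let b = (if snd x then t else rep (t \<otimes>\<^bsub>E\<^esub> [x]), fst x) in if b \<in> B then [(b, snd x)] else [])"

primrec walk :: "'a fword \<Rightarrow> 'a fword \<Rightarrow> ('a fword \<times> 'a) fword" where
  "walk [] t = []"
| "walk (x # w) t = lab t x \<otimes>\<^bsub>FB\<^esub> walk w (rep (t \<otimes>\<^bsub>E\<^esub> [x]))"

lemma lab_carrier: "lab t x \<in> carrier FB"
  by (auto simp: lab_def Let_def carrier_free_group)

lemma letter_carrier: "fst x \<in> A \<Longrightarrow> [x] \<in> carrier E"
  by (simp add: carrier_free_group)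

lemma walk_carrier: "walk w t \<in> carrier FB"
proof (induction w arbitrary: t)
  case (Cons x w)
  show ?case unfolding walk.simps using FB.m_closed[OF lab_carrier Cons.IH] .
qed (use FB.one_closed in simp)

lemma letter_mult_inv:
  assumes "t \<in> carrier E" "fst x \<in> A"
  shows "t \<otimes>\<^bsub>E\<^esub> [x] \<otimes>\<^bsub>E\<^esub> [letter_inv x] = t"
proof -
  have "[letter_inv x] = inv\<^bsub>E\<^esub> [x]" using inv_free_group[OF letter_carrier[OF assms(2)]] by simp
  then show ?thesis using assms letter_carrier[OF assms(2)]
    by (simp del: mult_free_group one_free_group add: E.m_assoc)
qed

lemma rep_back:
  assumes t: "t \<in> T" and x: "fst x \<in> A"
  shows "rep (rep (t \<otimes>\<^bsub>E\<^esub> [x]) \<otimes>\<^bsub>E\<^esub> [letter_inv x]) = t"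
  using rep_rep_mult[of "t \<otimes>\<^bsub>E\<^esub> [x]" "[letter_inv x]"] letter_mult_inv[OF T_carrier[OF t] x]
    rep_T[OF t] E.m_closed[OF T_carrier[OF t] letter_carrier[OF x]] letter_carrier[of "letter_inv x"] x
  by simp

lemma lab_back:
  assumes t: "t \<in> T" and x: "fst x \<in> A"
  shows "lab t x \<otimes>\<^bsub>FB\<^esub> lab (rep (t \<otimes>\<^bsub>E\<^esub> [x])) (letter_inv x) = \<one>\<^bsub>FB\<^esub>"
  using rep_back[OF t x] by (cases x) (auto simp: lab_def Let_def)

text \<open>A cancelling pair of letters crosses an edge and returns, contributing a label and its
  inverse. Hence reading is compatible with free reduction.\<close>

lemma walk_rcons:
  assumes t: "t \<in> T" and x: "fst x \<in> A"
  shows "walk (rcons x w) t = lab t x \<otimes>\<^bsub>FB\<^esub> walk w (rep (t \<otimes>\<^bsub>E\<^esub> [x]))"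
proof (cases "\<exists>v. w = letter_inv x # v")
  case True
  then obtain v where w: "w = letter_inv x # v" by blast
  let ?t = "rep (t \<otimes>\<^bsub>E\<^esub> [x])"
  have "lab t x \<otimes>\<^bsub>FB\<^esub> walk w ?t = (lab t x \<otimes>\<^bsub>FB\<^esub> lab ?t (letter_inv x)) \<otimes>\<^bsub>FB\<^esub> walk v t"
    unfolding w walk.simps rep_back[OF t x]
    by (rule FB.m_assoc[symmetric]) (rule lab_carrier walk_carrier)+
  also have "\<dots> = walk v t" unfolding lab_back[OF t x] using FB.l_one[OF walk_carrier] .
  finally show ?thesis using w by simp
next
  case False
  then have "rcons x w = x # w" by (cases w) auto
  then show ?thesis by simp
qed

text \<open>A cocycle identity. For the root as start and \<open>u\<close> in \<open>S\<close> the
  walk returns to the root, so reading becomes a homomorphism on \<open>S\<close>.\<close>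

lemma walk_mult:
  assumes "u \<in> carrier E" "v \<in> carrier E" "t \<in> T"
  shows "walk (u \<otimes>\<^bsub>E\<^esub> v) t = walk u t \<otimes>\<^bsub>FB\<^esub> walk v (rep (t \<otimes>\<^bsub>E\<^esub> u))"
  using assms(1,3)
proof (induction u arbitrary: t)
  case Nil
  have "t \<otimes>\<^bsub>E\<^esub> [] = t" using E.r_one[OF T_carrier[OF Nil(2)]] by simp
  then show ?case using rep_T[OF Nil(2)] by simp
next
  case (Cons x u)
  have x: "fst x \<in> A" and u: "u \<in> carrier E" and tc: "t \<in> carrier E"
    using Cons.prems T_carrier by (auto simp: carrier_free_group reduced_Cons)
  have xu: "x # u = [x] \<otimes>\<^bsub>E\<^esub> u" using Cons.prems by (simp add: carrier_free_group rcons_reduced)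
  let ?t = "rep (t \<otimes>\<^bsub>E\<^esub> [x])"
  have tx: "t \<otimes>\<^bsub>E\<^esub> [x] \<in> carrier E" using E.m_closed[OF tc letter_carrier[OF x]] .
  have "walk ((x # u) \<otimes>\<^bsub>E\<^esub> v) t = walk (rcons x (u \<otimes>\<^bsub>E\<^esub> v)) t" by simp
  also have "\<dots> = lab t x \<otimes>\<^bsub>FB\<^esub> walk (u \<otimes>\<^bsub>E\<^esub> v) ?t" by (rule walk_rcons[OF Cons.prems(2) x])
  also have "walk (u \<otimes>\<^bsub>E\<^esub> v) ?t = walk u ?t \<otimes>\<^bsub>FB\<^esub> walk v (rep (?t \<otimes>\<^bsub>E\<^esub> u))"
    by (rule Cons.IH[OF u rep(1)[OF tx]])
  also have "rep (?t \<otimes>\<^bsub>E\<^esub> u) = rep (t \<otimes>\<^bsub>E\<^esub> (x # u))"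
    unfolding rep_rep_mult[OF tx u] xu using E.m_assoc[OF tc letter_carrier[OF x] u] by simp
  also have "lab t x \<otimes>\<^bsub>FB\<^esub> (walk u ?t \<otimes>\<^bsub>FB\<^esub> walk v (rep (t \<otimes>\<^bsub>E\<^esub> (x # u)))) =
      walk (x # u) t \<otimes>\<^bsub>FB\<^esub> walk v (rep (t \<otimes>\<^bsub>E\<^esub> (x # u)))"
    unfolding walk.simps by (rule FB.m_assoc[symmetric]) (rule lab_carrier walk_carrier)+
  finally show ?case .
qed

text \<open>All prefixes of \<open>t\<close> are in \<open>T\<close>, so the walk from the root to
  \<open>t\<close> stays in the tree and meets no basis edge, whatever the orientation of the last
  letter.\<close>

lemma walk_T: "t \<in> T \<Longrightarrow> walk t [] = []"
proof (induction t rule: rev_induct)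
  case (snoc x u)
  have u: "u \<in> T" "u \<in> carrier E" using T_butlast[OF snoc.prems] T_carrier by auto
  have ux: "u @ [x] \<in> carrier E" using T_carrier[OF snoc.prems] .
  then have x: "fst x \<in> A" and e: "u \<otimes>\<^bsub>E\<^esub> [x] = u @ [x]"
    by (auto simp: carrier_free_group foldr_rcons_append)
  have ru: "rep ([] \<otimes>\<^bsub>E\<^esub> u) = u" using rep_T[OF u(1)] by simp
  have "walk (u @ [x]) [] = walk u [] \<otimes>\<^bsub>FB\<^esub> walk [x] u"
    using walk_mult[OF u(2) letter_carrier[OF x] Nil_T] ru e by simp
  also have "\<dots> = lab u x" using snoc.IH[OF u(1)] FB.r_one[OF lab_carrier] by simp
  also have "\<dots> = []"
  proof (cases "snd x")
    case True
    then have "[(fst x, True)] = [x]" by (cases x) simp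
    then have "(u, fst x) \<notin> B" using e snoc.prems by (simp add: B_def)
    then show ?thesis using True by (simp add: lab_def)
  next
    case False
    have r: "rep (u \<otimes>\<^bsub>E\<^esub> [x]) = u @ [x]" using e rep_T[OF snoc.prems] by simp
    have "[(fst x, True)] = [letter_inv x]" using False by (cases x) simp
    then have "(u @ [x]) \<otimes>\<^bsub>E\<^esub> [(fst x, True)] = u" using letter_mult_inv[OF u(2) x] e by simp
    then have "(u @ [x], fst x) \<notin> B" using u by (simp add: B_def)
    then show ?thesis using False r by (simp add: lab_def)
  qed
  finally show ?case .
qed simp

lemma nielsen_schreier_iso:
  obtains \<psi> where "\<psi> \<in> iso FB (E\<lparr>carrier := S\<rparr>)"
proof -
  let ?S = "E\<lparr>carrier := S\<rparr>"
  interpret GS: group ?S using E.subgroup_imp_group[OF S] .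
  define f where "f = (\<lambda>(t, a). t \<otimes>\<^bsub>E\<^esub> [(a, True)] \<otimes>\<^bsub>E\<^esub> inv\<^bsub>E\<^esub> rep (t \<otimes>\<^bsub>E\<^esub> [(a, True)]))"
  have edge: "t \<otimes>\<^bsub>E\<^esub> [x] \<in> carrier E" if "t \<in> T" "fst x \<in> A" for t x
    using E.m_closed[OF T_carrier[OF that(1)] letter_carrier[OF that(2)]] .
  have fS: "f b \<in> carrier ?S" if "b \<in> B" for b
    using that rep(2)[OF edge] unfolding B_def f_def by auto
  obtain \<psi> where hom: "\<psi> \<in> hom FB ?S" and gen: "\<And>b. b \<in> B \<Longrightarrow> \<psi> [(b, True)] = f b"
    using free_group_universal[of ?S B f, OF GS.group_axioms fS] by blast
  interpret \<psi>: group_hom FB ?S \<psi>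
    using hom GS.group_axioms FB.group_axioms by (simp add: group_hom_def group_hom_axioms_def)
  have \<psi>S: "\<psi> u \<in> S" if "u \<in> carrier FB" for u using \<psi>.hom_closed[OF that] by simp
  have \<psi>m: "\<psi> (u \<otimes>\<^bsub>FB\<^esub> v) = \<psi> u \<otimes>\<^bsub>E\<^esub> \<psi> v" if "u \<in> carrier FB" "v \<in> carrier FB" for u v
    using \<psi>.hom_mult[OF that] by simp
  have \<psi>1: "\<psi> [] = []" using \<psi>.hom_one by simp
  have bc: "[(b, e)] \<in> carrier FB" if "b \<in> B" for b e using that by (simp add: carrier_free_group)
  have genF: "\<psi> [(b, False)] = inv\<^bsub>E\<^esub> f b" if "b \<in> B" for b
  proof -
    have "[(b, False)] = inv\<^bsub>FB\<^esub> [(b, True)]" using inv_free_group[OF bc[OF that]] by simp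
    then have "\<psi> [(b, False)] = inv\<^bsub>?S\<^esub> f b" using \<psi>.hom_inv[OF bc[OF that, of True]] gen[OF that] by simp
    then show ?thesis using E.m_inv_consistent[OF S] fS[OF that] by simp
  qed
  have lab: "\<psi> (lab t x) = t \<otimes>\<^bsub>E\<^esub> [x] \<otimes>\<^bsub>E\<^esub> inv\<^bsub>E\<^esub> rep (t \<otimes>\<^bsub>E\<^esub> [x])" if t: "t \<in> T" and x: "fst x \<in> A" for t x
  proof (cases "snd x")
    case True
    then have x': "[(fst x, True)] = [x]" by (cases x) simp
    show ?thesis
    proof (cases "(t, fst x) \<in> B")
      case True
      then show ?thesis using gen[OF True] x' \<open>snd x\<close> by (simp add: lab_def f_def)
    next
      case False
      then have "t \<otimes>\<^bsub>E\<^esub> [x] \<in> T" using t x x' by (auto simp: B_def)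
      then have "rep (t \<otimes>\<^bsub>E\<^esub> [x]) = t \<otimes>\<^bsub>E\<^esub> [x]" by (rule rep_T)
      then show ?thesis using False True \<psi>1 E.r_inv[OF edge[OF t x]] by (simp add: lab_def)
    qed
  next
    case False
    then have x': "[(fst x, True)] = [letter_inv x]" by (cases x) simp
    define t' where "t' = rep (t \<otimes>\<^bsub>E\<^esub> [x])"
    have t': "t' \<in> T" unfolding t'_def using rep(1)[OF edge[OF t x]] .
    have bk: "rep (t' \<otimes>\<^bsub>E\<^esub> [letter_inv x]) = t" unfolding t'_def by (rule rep_back[OF t x])
    have c: "t \<in> carrier E" "t' \<in> carrier E" "[x] \<in> carrier E" "[letter_inv x] \<in> carrier E"
      using T_carrier[OF t] T_carrier[OF t'] x letter_carrier by auto
    have ix: "[letter_inv x] = inv\<^bsub>E\<^esub> [x]" using inv_free_group[OF c(3)] by simp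
    show ?thesis
    proof (cases "(t', fst x) \<in> B")
      case True
      have "\<psi> (lab t x) = inv\<^bsub>E\<^esub> f (t', fst x)"
        using genF[OF True] True False by (simp add: lab_def t'_def)
      also have "f (t', fst x) = t' \<otimes>\<^bsub>E\<^esub> inv\<^bsub>E\<^esub> [x] \<otimes>\<^bsub>E\<^esub> inv\<^bsub>E\<^esub> t"
        using bk by (simp add: f_def x' ix)
      also have "inv\<^bsub>E\<^esub> \<dots> = t \<otimes>\<^bsub>E\<^esub> [x] \<otimes>\<^bsub>E\<^esub> inv\<^bsub>E\<^esub> t'"
        using c by (simp del: mult_free_group add: E.inv_mult_group E.m_assoc)
      finally show ?thesis by (simp add: t'_def)
    next
      case b: False
      then have "t' \<otimes>\<^bsub>E\<^esub> [letter_inv x] \<in> T" using t' x x' by (auto simp: B_def)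
      then have "t' \<otimes>\<^bsub>E\<^esub> [letter_inv x] = t" using bk rep_T by simp
      then have "t \<otimes>\<^bsub>E\<^esub> [x] = t'"
        using c ix by (metis E.inv_solve_right' E.m_closed)
      then have "t \<otimes>\<^bsub>E\<^esub> [x] \<otimes>\<^bsub>E\<^esub> inv\<^bsub>E\<^esub> t' = \<one>\<^bsub>E\<^esub>" using E.r_inv[OF c(2)] by metis
      moreover have "lab t x = []" using b False by (simp add: lab_def t'_def)
      ultimately show ?thesis using \<psi>1 by (simp add: t'_def)
    qed
  qed
  \<comment> \<open>The contributions of consecutive letters telescope: the return from each
    intermediate vertex to the root cancels against the way out to it.\<close>
  have walk: "\<psi> (walk w t) = t \<otimes>\<^bsub>E\<^esub> w \<otimes>\<^bsub>E\<^esub> inv\<^bsub>E\<^esub> rep (t \<otimes>\<^bsub>E\<^esub> w)" if "w \<in> carrier E" "t \<in> T" for w t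
    using that
  proof (induction w arbitrary: t)
    case Nil
    have "t \<otimes>\<^bsub>E\<^esub> [] = t" using E.r_one[OF T_carrier[OF Nil(2)]] by simp
    then show ?case using rep_T[OF Nil(2)] \<psi>1 E.r_inv[OF T_carrier[OF Nil(2)]] by simp
  next
    case (Cons x w)
    have x: "fst x \<in> A" and w: "w \<in> carrier E" and tc: "t \<in> carrier E"
      using Cons.prems T_carrier by (auto simp: carrier_free_group reduced_Cons)
    have xw: "x # w = [x] \<otimes>\<^bsub>E\<^esub> w" using Cons.prems by (simp add: carrier_free_group rcons_reduced)
    define t' where "t' = rep (t \<otimes>\<^bsub>E\<^esub> [x])"
    have t': "t' \<in> T" "t' \<in> carrier E" using rep(1)[OF edge[OF Cons.prems(2) x]] T_carrier unfolding t'_def by blast+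
    have r: "rep (t' \<otimes>\<^bsub>E\<^esub> w) = rep (t \<otimes>\<^bsub>E\<^esub> (x # w))"
      unfolding t'_def rep_rep_mult[OF edge[OF Cons.prems(2) x] w] xw
      using E.m_assoc[OF tc letter_carrier[OF x] w] by simp
    have rc: "rep (t \<otimes>\<^bsub>E\<^esub> (x # w)) \<in> carrier E" using E.m_closed[OF tc Cons.prems(1)] by (rule rep_carrier)
    have "\<psi> (walk (x # w) t) = \<psi> (lab t x) \<otimes>\<^bsub>E\<^esub> \<psi> (walk w t')"
      unfolding walk.simps t'_def[symmetric] using \<psi>m[OF lab_carrier walk_carrier] .
    also have "\<dots> = (t \<otimes>\<^bsub>E\<^esub> [x] \<otimes>\<^bsub>E\<^esub> inv\<^bsub>E\<^esub> t') \<otimes>\<^bsub>E\<^esub> (t' \<otimes>\<^bsub>E\<^esub> w \<otimes>\<^bsub>E\<^esub> inv\<^bsub>E\<^esub> rep (t \<otimes>\<^bsub>E\<^esub> (x # w)))"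
      unfolding lab[OF Cons.prems(2) x] Cons.IH[OF w t'(1)] r t'_def[symmetric] ..
    also have "\<dots> = t \<otimes>\<^bsub>E\<^esub> (x # w) \<otimes>\<^bsub>E\<^esub> inv\<^bsub>E\<^esub> rep (t \<otimes>\<^bsub>E\<^esub> (x # w))"
      unfolding xw using tc t'(2) w letter_carrier[OF x] rc[unfolded xw]
      by (simp del: mult_free_group add: E.m_assoc E.inv_cancel_left)
    finally show ?case .
  qed
  have \<psi>\<phi>: "\<psi> (walk s []) = s" if "s \<in> S" for s
  proof -
    have s: "s \<in> carrier E" using that by (rule S.mem_carrier)
    have "\<psi> (walk s []) = s \<otimes>\<^bsub>E\<^esub> inv\<^bsub>E\<^esub> []" using walk[OF s Nil_T] rep_S[OF that] by simp
    then show ?thesis using E.r_one[OF s] E.inv_one by simp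
  qed
  have walkS: "walk (u \<otimes>\<^bsub>E\<^esub> v) [] = walk u [] \<otimes>\<^bsub>FB\<^esub> walk v []" if "u \<in> S" "v \<in> S" for u v
    using walk_mult[OF S.mem_carrier[OF that(1)] S.mem_carrier[OF that(2)] Nil_T] rep_S[OF that(1)] by simp
  \<comment> \<open>The loop runs along the tree to \<open>t\<close>, across the edge
    \<open>b\<close>, and back along the tree from \<open>t'\<close>. The way back reads nothing,
    because together with the way out to \<open>t'\<close>, which reads nothing, it spells the
    identity; only the crossing remains.\<close>
  have genT: "walk (f b) [] = [(b, True)]" if bB: "b \<in> B" for b
  proof -
    obtain t a where b: "b = (t, a)" "t \<in> T" "a \<in> A" using bB by (auto simp: B_def)
    let ?x = "(a, True)"
    define t' where "t' = rep (t \<otimes>\<^bsub>E\<^esub> [?x])"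
    have t': "t' \<in> T" "t' \<in> carrier E" using rep(1)[OF edge[OF b(2)]] T_carrier b(3) unfolding t'_def by auto
    have tc: "t \<in> carrier E" "[?x] \<in> carrier E" "t \<otimes>\<^bsub>E\<^esub> [?x] \<in> carrier E"
      using T_carrier[OF b(2)] letter_carrier[of ?x] edge[OF b(2), of ?x] b(3) by auto
    have "\<one>\<^bsub>FB\<^esub> = walk (t' \<otimes>\<^bsub>E\<^esub> inv\<^bsub>E\<^esub> t') []" using E.r_inv[OF t'(2)] by simp
    also have "\<dots> = walk t' [] \<otimes>\<^bsub>FB\<^esub> walk (inv\<^bsub>E\<^esub> t') (rep ([] \<otimes>\<^bsub>E\<^esub> t'))"
      by (rule walk_mult[OF t'(2) E.inv_closed[OF t'(2)] Nil_T])
    also have "\<dots> = walk (inv\<^bsub>E\<^esub> t') t'" using walk_T[OF t'(1)] rep_T[OF t'(1)] by simp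
    finally have inv: "walk (inv\<^bsub>E\<^esub> t') t' = []" by simp
    have "walk (f b) [] = walk (t \<otimes>\<^bsub>E\<^esub> [?x]) [] \<otimes>\<^bsub>FB\<^esub> walk (inv\<^bsub>E\<^esub> t') (rep ([] \<otimes>\<^bsub>E\<^esub> (t \<otimes>\<^bsub>E\<^esub> [?x])))"
      unfolding b f_def prod.case t'_def[symmetric] by (rule walk_mult[OF tc(3) E.inv_closed[OF t'(2)] Nil_T])
    also have "\<dots> = walk (t \<otimes>\<^bsub>E\<^esub> [?x]) [] \<otimes>\<^bsub>FB\<^esub> \<one>\<^bsub>FB\<^esub>"
      using inv by (simp add: t'_def)
    also have "\<dots> = walk (t \<otimes>\<^bsub>E\<^esub> [?x]) []" by (rule FB.r_one[OF walk_carrier])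
    also have "\<dots> = walk t [] \<otimes>\<^bsub>FB\<^esub> walk [?x] (rep ([] \<otimes>\<^bsub>E\<^esub> t))" by (rule walk_mult[OF tc(1,2) Nil_T])
    also have "\<dots> = lab t ?x" using walk_T[OF b(2)] rep_T[OF b(2)] FB.r_one[OF lab_carrier] by simp
    also have "\<dots> = [(b, True)]" using bB b by (simp add: lab_def)
    finally show ?thesis .
  qed
  have gen\<phi>: "walk (\<psi> [y]) [] = [y]" if "fst y \<in> B" for y
  proof (cases "snd y")
    case True
    then show ?thesis using gen[OF that] genT[OF that] by (cases y) simp
  next
    case False
    then have y: "[y] = [(fst y, False)]" by (cases y) simp
    have fs: "f (fst y) \<in> S" using fS[OF that] by simp
    have fc: "f (fst y) \<in> carrier E" using fs by (rule S.mem_carrier)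
    have "walk (f (fst y)) [] \<otimes>\<^bsub>FB\<^esub> walk (inv\<^bsub>E\<^esub> f (fst y)) [] = \<one>\<^bsub>FB\<^esub>"
      using walkS[OF fs S.m_inv_closed[OF fs]] E.r_inv[OF fc] by simp
    then have "walk (inv\<^bsub>E\<^esub> f (fst y)) [] = inv\<^bsub>FB\<^esub> [(fst y, True)]"
      unfolding genT[OF that] using FB.inv_equality[OF FB.inv_comm[OF _ bc[OF that] walk_carrier] bc[OF that] walk_carrier]
      by metis
    then show ?thesis unfolding y genF[OF that] using inv_free_group[OF bc[OF that, of True]] by simp
  qed
  have \<phi>\<psi>: "walk (\<psi> u) [] = u" if "u \<in> carrier FB" for u
    using that
  proof (induction u)
    case Nil
    then show ?case using \<psi>1 by simp
  next
    case (Cons y u)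
    have y: "fst y \<in> B" "[y] \<in> carrier FB" and u: "u \<in> carrier FB"
      using Cons.prems by (auto simp: carrier_free_group reduced_Cons)
    have yu: "y # u = [y] \<otimes>\<^bsub>FB\<^esub> u" using Cons.prems by (simp add: carrier_free_group rcons_reduced)
    show ?case
      unfolding yu \<psi>m[OF y(2) u] walkS[OF \<psi>S[OF y(2)] \<psi>S[OF u]] gen\<phi>[OF y(1)] Cons.IH[OF u] ..
  qed
  have "bij_betw \<psi> (carrier FB) (carrier ?S)"
    by (rule bij_betw_byWitness[where f' = "\<lambda>s. walk s []"]) (use \<psi>\<phi> \<phi>\<psi> \<psi>S walk_carrier in auto)
  then have "\<psi> \<in> iso FB ?S" using hom by (simp add: iso_def)
  then show ?thesis by (rule that)
qed

text \<open>Each element of \<open>T\<close> is the representative of some element of a finite set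
  meeting all cosets, so \<open>T\<close> is finite and so is the set of edges leaving it.\<close>

lemma finite_basis:
  assumes "finite A" "finite_index S E"
  shows "finite B"
proof -
  obtain U where U: "finite U" "U \<subseteq> carrier E" "\<And>x. x \<in> carrier E \<Longrightarrow> \<exists>t\<in>U. x \<otimes>\<^bsub>E\<^esub> inv\<^bsub>E\<^esub> t \<in> S"
    using assms(2) unfolding E.finite_index_iff[OF S] by metis
  have "T \<subseteq> rep ` U"
  proof
    fix t assume t: "t \<in> T"
    then obtain u where u: "u \<in> U" "t \<otimes>\<^bsub>E\<^esub> inv\<^bsub>E\<^esub> u \<in> S" using U(3) T_carrier by blast
    have c: "t \<in> carrier E" "u \<in> carrier E" using T_carrier[OF t] U(2) u by auto
    have "inv\<^bsub>E\<^esub> (t \<otimes>\<^bsub>E\<^esub> inv\<^bsub>E\<^esub> u) = u \<otimes>\<^bsub>E\<^esub> inv\<^bsub>E\<^esub> t" using c by (simp del: mult_free_group add: E.inv_mult_group)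
    then have "rep u = t" using rep_eqI[OF c(2) t] S.m_inv_closed[OF u(2)] by simp
    then show "t \<in> rep ` U" using u by blast
  qed
  then have "finite T" using U(1) finite_surj by blast
  moreover have "B \<subseteq> T \<times> A" by (auto simp: B_def)
  ultimately show ?thesis using assms(1) finite_subset by blast
qed

end

theorem nielsen_schreier:
  fixes A :: "'a set"
  assumes "subgroup S (free_group A)"
  obtains B :: "('a fword \<times> 'a) set" and \<psi>
  where "\<psi> \<in> iso (free_group B) (free_group A\<lparr>carrier := S\<rparr>)"
    "finite A \<Longrightarrow> finite_index S (free_group A) \<Longrightarrow> finite B"
proof -
  obtain T where "schreier_transversal A S T"
    "\<And>w. w \<in> carrier (free_group A) \<Longrightarrow> \<exists>t\<in>T. w \<otimes>\<^bsub>free_group A\<^esub> inv\<^bsub>free_group A\<^esub> t \<in> S"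
    using schreier_transversal_exists[OF assms] by metis
  then interpret schreier A S T using assms by (simp add: schreier_def)
  obtain \<psi> where "\<psi> \<in> iso FB (free_group A\<lparr>carrier := S\<rparr>)" using nielsen_schreier_iso by metis
  then show ?thesis by (rule that) (rule finite_basis)
qed

section \<open>Cyclic subgroups and subgroups of finite index\<close>

lemma (in group_hom) finite_index_img:
  assumes surj: "h ` carrier G = carrier H" and K: "subgroup K G" "finite_index K G"
  shows "finite_index (h ` K) H"
proof -
  obtain T where T: "finite T" "T \<subseteq> carrier G" "\<And>x. x \<in> carrier G \<Longrightarrow> \<exists>t\<in>T. x \<otimes> inv t \<in> K"
    using K(2) unfolding G.finite_index_iff[OF K(1)] by metis
  have "\<exists>t\<in>h ` T. y \<otimes>\<^bsub>H\<^esub> inv\<^bsub>H\<^esub> t \<in> h ` K" if y: "y \<in> carrier H" for y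
  proof -
    obtain x where x: "x \<in> carrier G" "y = h x" using y surj by (metis imageE)
    obtain t where t: "t \<in> T" "x \<otimes> inv t \<in> K" using T(3)[OF x(1)] by blast
    have "t \<in> carrier G" using t(1) T(2) by (rule subsetD[rotated])
    then have "h (x \<otimes> inv t) = y \<otimes>\<^bsub>H\<^esub> inv\<^bsub>H\<^esub> h t" using x by simp
    then have "y \<otimes>\<^bsub>H\<^esub> inv\<^bsub>H\<^esub> h t \<in> h ` K" using t(2) by (metis imageI)
    then show ?thesis using t(1) by blast
  qed
  moreover have "finite (h ` T)" "h ` T \<subseteq> carrier H" using T(1,2) by auto
  ultimately show ?thesis unfolding H.finite_index_iff[OF subgroup_img_is_subgroup[OF K(1)]] by blast
qed

text \<open>The trivial subgroup is included. Inside a free group these are the subgroups of rank at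
  most one, which offer no two basis letters for ping-pong.\<close>

definition cyclic_subgroup :: "('g, 'm) monoid_scheme \<Rightarrow> 'g set \<Rightarrow> bool" where
  "cyclic_subgroup G S \<longleftrightarrow> (\<exists>s\<in>carrier G. S = generate G {s})"

context group
begin

lemma cyclic_subgroup_commute:
  assumes "cyclic_subgroup G S" "x \<in> S" "y \<in> S"
  shows "x \<otimes> y = y \<otimes> x"
proof -
  obtain s where s: "s \<in> carrier G" "S = generate G {s}" using assms(1) by (auto simp: cyclic_subgroup_def)
  obtain i j :: int where "x = s [^] i" "y = s [^] j" using assms s generate_pow[OF s(1)] by blast
  then show ?thesis using s(1) by (simp add: int_pow_mult[symmetric] add.commute)
qed

lemma cyclic_subgroup_trivial: "cyclic_subgroup G {\<one>}"
  unfolding cyclic_subgroup_def using generate_one by (metis one_closed)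

lemma fg_subgroup_join:
  assumes "fg_subgroup G H" "fg_subgroup G K"
  shows "fg_subgroup G (generate G (H \<union> K))"
proof -
  obtain X where X: "finite X" "X \<subseteq> H" "H \<subseteq> carrier G" "generate G X = H" using assms(1) by (rule fg_subgroupE)
  obtain Y where Y: "finite Y" "Y \<subseteq> K" "K \<subseteq> carrier G" "generate G Y = K" using assms(2) by (rule fg_subgroupE)
  have c: "X \<union> Y \<subseteq> carrier G" using X Y by blast
  have "H \<union> K \<subseteq> generate G (X \<union> Y)" using X(4) Y(4) mono_generate[of X "X \<union> Y"] mono_generate[of Y "X \<union> Y"] by blast
  then have "generate G (H \<union> K) \<subseteq> generate G (X \<union> Y)"
    by (rule generate_subgroup_incl[OF _ generate_is_subgroup[OF c]])
  moreover have "generate G (X \<union> Y) \<subseteq> generate G (H \<union> K)" using X(2) Y(2) by (intro mono_generate) blast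
  ultimately have "generate G (H \<union> K) = generate G (X \<union> Y)" by blast
  then show ?thesis using fg_subgroupI[OF _ c] X(1) Y(1) by simp
qed

end

lemma iso_generate_image:
  assumes "group G" "group H" "\<psi> \<in> iso G H" "X \<subseteq> carrier G" "generate G X = carrier G"
  shows "generate H (\<psi> ` X) = carrier H"
proof -
  interpret group_hom G H \<psi> using assms by (simp add: group_hom_def group_hom_axioms_def iso_def)
  show ?thesis using generate_img[OF assms(4)] assms(3,5) by (simp add: iso_def bij_betw_def)
qed

text \<open>A basis with at most one element would generate \<open>S\<close> by at most one
  element.\<close>

lemma free_subgroup_noncyclic:
  fixes A :: "'a set"
  assumes S: "subgroup S (free_group A)" and nc: "\<not> cyclic_subgroup (free_group A) S"
  obtains B :: "('a fword \<times> 'a) set" and \<psi> \<alpha> \<beta>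
  where "\<psi> \<in> iso (free_group B) (free_group A\<lparr>carrier := S\<rparr>)" "\<alpha> \<in> B" "\<beta> \<in> B" "\<alpha> \<noteq> \<beta>"
proof -
  interpret E: group "free_group A" by (rule group_free_group)
  have gS: "group (free_group A\<lparr>carrier := S\<rparr>)" using E.subgroup_imp_group[OF S] .
  obtain B :: "('a fword \<times> 'a) set" and \<psi> where
    iso: "\<psi> \<in> iso (free_group B) (free_group A\<lparr>carrier := S\<rparr>)" using nielsen_schreier[OF S] by metis
  have "\<exists>\<alpha>\<in>B. \<exists>\<beta>\<in>B. \<alpha> \<noteq> \<beta>"
  proof (rule ccontr)
    assume one: "\<not> (\<exists>\<alpha>\<in>B. \<exists>\<beta>\<in>B. \<alpha> \<noteq> \<beta>)"
    define X where "X = (\<lambda>a. [(a, True)]) ` B"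
    have Xc: "X \<subseteq> carrier (free_group B)" by (auto simp: X_def carrier_free_group)
    have "\<psi> ` X \<subseteq> S" using Xc iso by (auto simp: iso_def bij_betw_def)
    have gen: "generate (free_group A) (\<psi> ` X) = S"
      using iso_generate_image[OF group_free_group gS iso Xc] generate_letters[of B]
        E.generate_consistent[OF \<open>\<psi> ` X \<subseteq> S\<close> S] by (simp add: X_def)
    show False
    proof (cases "B = {}")
      case True
      then have "S = {\<one>\<^bsub>free_group A\<^esub>}" using gen E.generate_empty by (simp add: X_def)
      then show False using nc E.cyclic_subgroup_trivial by simp
    next
      case False
      then obtain b where "b \<in> B" by blast
      then have "B = {b}" using one by blast
      then have "S = generate (free_group A) {\<psi> [(b, True)]}" using gen by (simp add: X_def)
      moreover have "\<psi> [(b, True)] \<in> carrier (free_group A)"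
        using \<open>\<psi> ` X \<subseteq> S\<close> \<open>b \<in> B\<close> subgroup.subset[OF S] by (auto simp: X_def)
      ultimately show False using nc by (auto simp: cyclic_subgroup_def)
    qed
  qed
  then show ?thesis using that[OF iso] by blast
qed

lemma free_fg_of_finite_index:
  fixes A :: "'a set"
  assumes "finite A" "subgroup S (free_group A)" "finite_index S (free_group A)"
  shows "fg_subgroup (free_group A) S"
proof -
  interpret E: group "free_group A" by (rule group_free_group)
  have gS: "group (free_group A\<lparr>carrier := S\<rparr>)" using E.subgroup_imp_group[OF assms(2)] .
  obtain B :: "('a fword \<times> 'a) set" and \<psi> where
    iso: "\<psi> \<in> iso (free_group B) (free_group A\<lparr>carrier := S\<rparr>)" and "finite B"
    using nielsen_schreier[OF assms(2)] assms by metis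
  interpret group_hom "free_group B" "free_group A\<lparr>carrier := S\<rparr>" \<psi>
    using iso gS group_free_group[of B] by (simp add: group_hom_def group_hom_axioms_def iso_def)
  have "fg_subgroup (free_group A\<lparr>carrier := S\<rparr>) S"
    using fg_subgroup_img[OF fg_free_group[OF \<open>finite B\<close>]] iso by (simp add: iso_def bij_betw_def)
  then show ?thesis using E.fg_subgroup_in_subgroup_iff[OF assms(2)] by simp
qed

lemma pow_letter: "[x] [^]\<^bsub>free_group A\<^esub> (n :: nat) = replicate n x"
proof (induction n)
  case (Suc n)
  interpret E: group "free_group A" by (rule group_free_group)
  have "reduced_word (replicate n x @ [x])"
    using reduced_replicate[of "Suc n" x] by (simp add: replicate_append_same)
  then show ?case
    unfolding E.nat_pow_Suc Suc mult_free_group by (simp only: foldr_rcons_append replicate_append_same replicate_Suc)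
qed simp

text \<open>A subgroup of finite index contains positive powers of both letters, and these do not
  commute.\<close>

lemma free_commuting_infinite_index:
  assumes \<alpha>\<beta>: "\<alpha> \<in> A" "\<beta> \<in> A" "\<alpha> \<noteq> \<beta>" and H: "subgroup H (free_group A)"
    and comm: "\<And>x y. x \<in> H \<Longrightarrow> y \<in> H \<Longrightarrow> x \<otimes>\<^bsub>free_group A\<^esub> y = y \<otimes>\<^bsub>free_group A\<^esub> x"
  shows "\<not> finite_index H (free_group A)"
proof
  assume fin: "finite_index H (free_group A)"
  interpret E: group "free_group A" by (rule group_free_group)
  let ?a = "(\<alpha>, True)" and ?b = "(\<beta>, True)"
  have ab: "[?a] \<in> carrier (free_group A)" "[?b] \<in> carrier (free_group A)"
    using \<alpha>\<beta> by (auto simp: carrier_free_group)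
  obtain m :: nat where m: "m > 0" "replicate m ?a \<in> H"
    using E.finite_index_pow[OF H fin ab(1)] unfolding pow_letter by metis
  obtain n :: nat where n: "n > 0" "replicate n ?b \<in> H"
    using E.finite_index_pow[OF H fin ab(2)] unfolding pow_letter by metis
  have red: "reduced_word (replicate m ?a @ replicate n ?b)" "reduced_word (replicate n ?b @ replicate m ?a)"
    using m n \<alpha>\<beta> by (auto simp: reduced_append reduced_replicate)
  have "replicate m ?a @ replicate n ?b = replicate n ?b @ replicate m ?a"
    using comm[OF m(2) n(2)] foldr_rcons_append[OF red(1)] foldr_rcons_append[OF red(2)]
    by (simp only: mult_free_group)
  then have "hd (replicate m ?a @ replicate n ?b) = hd (replicate n ?b @ replicate m ?a)" by (rule arg_cong)
  then show False using m n \<alpha>\<beta> by (simp add: hd_append)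
qed

section \<open>Alternating products\<close>

text \<open>The normal form in an amalgam of \<open>K True\<close> and \<open>K False\<close> over
  \<open>L\<close>, without chosen coset representatives and without any claim of uniqueness. The
  index is the factor of the leftmost letter.\<close>

inductive alt_product :: "('g, 'm) monoid_scheme \<Rightarrow> (bool \<Rightarrow> 'g set) \<Rightarrow> 'g set \<Rightarrow> bool \<Rightarrow> 'g \<Rightarrow> bool"
  for G K L where
  single: "k \<in> K i \<Longrightarrow> k \<notin> L \<Longrightarrow> alt_product G K L i k"
| step: "k \<in> K i \<Longrightarrow> k \<notin> L \<Longrightarrow> alt_product G K L (\<not> i) h \<Longrightarrow> alt_product G K L i (k \<otimes>\<^bsub>G\<^esub> h)"

context group
begin

context
  fixes K :: "bool \<Rightarrow> 'a set" and L
  assumes K: "\<And>i. subgroup (K i) G" and L: "subgroup L G" "\<And>i. L \<subseteq> K i"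
begin

lemma alt_product_carrier: "alt_product G K L i h \<Longrightarrow> h \<in> carrier G"
  by (induction rule: alt_product.induct) (auto intro: subgroup.mem_carrier[OF K])

lemma not_in_L_mult:
  assumes "l \<in> L" "k \<in> K i" "k \<notin> L" shows "l \<otimes> k \<notin> L"
proof
  assume "l \<otimes> k \<in> L"
  then have "inv l \<otimes> (l \<otimes> k) \<in> L" using assms(1) L(1) subgroup.m_closed subgroup.m_inv_closed by metis
  moreover have "l \<in> carrier G" "k \<in> carrier G"
    using assms subgroup.mem_carrier[OF L(1)] subgroup.mem_carrier[OF K] by auto
  ultimately show False using assms(3) by (simp add: inv_cancel_left)
qed

text \<open>The element of \<open>L\<close> is merged into the first letter, which stays in its
  factor and outside \<open>L\<close>.\<close>

lemma alt_product_absorb: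
  assumes "alt_product G K L i h" "l \<in> L" shows "alt_product G K L i (l \<otimes> h)"
  using assms(1)
proof cases
  case single
  have "l \<otimes> h \<in> K i" using subgroup.m_closed[OF K] L(2) assms(2) single(1) by blast
  then show ?thesis using not_in_L_mult[OF assms(2) single] by (rule alt_product.single)
next
  case (step k h')
  have "l \<otimes> k \<in> K i" using subgroup.m_closed[OF K] L(2) assms(2) step(2) by blast
  then have "alt_product G K L i ((l \<otimes> k) \<otimes> h')"
    using not_in_L_mult[OF assms(2) step(2,3)] step(4) by (rule alt_product.step)
  moreover have "l \<in> carrier G" "k \<in> carrier G" "h' \<in> carrier G"
    using assms(2) step subgroup.mem_carrier[OF L(1)] subgroup.mem_carrier[OF K] alt_product_carrier by auto
  ultimately show ?thesis using step(1) by (simp add: m_assoc)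
qed

text \<open>The only delicate case is a letter of the same factor that merges with the first letter
  to an element of \<open>L\<close>: this element is then absorbed by the tail, which starts in the
  other factor.\<close>

lemma alt_product_mult:
  assumes "alt_product G K L i h" "k \<in> K j"
  shows "k \<otimes> h \<in> L \<or> (\<exists>i. alt_product G K L i (k \<otimes> h))"
proof (cases "k \<in> L")
  case True
  then show ?thesis using alt_product_absorb[OF assms(1)] by blast
next
  case kL: False
  show ?thesis
  proof (cases "j = i")
    case False
    then have "i = (\<not> j)" by simp
    then have "alt_product G K L j (k \<otimes> h)" using alt_product.step[of k K j L G h] assms kL by simp
    then show ?thesis by blast
  next
    case ji: True
    from assms(1) show ?thesis
    proof cases
      case single
      have "k \<otimes> h \<in> K i" using subgroup.m_closed[OF K] assms(2) single(1) ji by blast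
      then show ?thesis using alt_product.single[of "k \<otimes> h" K i L G] by blast
    next
      case (step k' h')
      have kk: "k \<otimes> k' \<in> K i" using subgroup.m_closed[OF K] assms(2) step(2) ji by blast
      have "k \<in> carrier G" "k' \<in> carrier G" "h' \<in> carrier G"
        using assms(2) step subgroup.mem_carrier[OF K] alt_product_carrier by auto
      then have e: "k \<otimes> h = (k \<otimes> k') \<otimes> h'" using step(1) by (simp add: m_assoc)
      show ?thesis
      proof (cases "k \<otimes> k' \<in> L")
        case True
        then show ?thesis using alt_product_absorb[OF step(4)] e by metis
      next
        case False
        then show ?thesis using alt_product.step[OF kk False step(4)] e by metis
      qed
    qed
  qed
qed

lemma generate_alt_product:
  assumes "h \<in> generate G (K True \<union> K False)"
  shows "h \<in> L \<or> (\<exists>i. alt_product G K L i h)"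
proof -
  define N where "N h \<longleftrightarrow> h \<in> L \<or> (\<exists>i. alt_product G K L i h)" for h
  have Nc: "x \<in> carrier G" if "N x" for x
    using that alt_product_carrier subgroup.mem_carrier[OF L(1)] by (auto simp: N_def)
  have KN: "N (k \<otimes> x)" if "k \<in> K j" "N x" for k j x
  proof (cases "x \<in> L")
    case True
    then have "k \<otimes> x \<in> K j" using subgroup.m_closed[OF K] L(2) that(1) by blast
    then show ?thesis using alt_product.single[of "k \<otimes> x" K j L G] unfolding N_def by blast
  next
    case False
    then show ?thesis using that alt_product_mult unfolding N_def by blast
  qed
  have sub: "K True \<union> K False \<subseteq> carrier G" using subgroup.subset[OF K] by blast
  \<comment> \<open>The claim is strengthened to left multiplication of arbitrary normal forms. Then
    the case of a product is mere composition, and no product of two normal forms has to be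
    computed.\<close>
  have "\<forall>x. N x \<longrightarrow> N (h \<otimes> x)"
    using assms
  proof (induction rule: generate.induct)
    case one
    then show ?case using Nc by simp
  next
    case (incl h)
    then show ?case using KN by blast
  next
    case (inv h)
    then have "inv h \<in> K True \<or> inv h \<in> K False" using subgroup.m_inv_closed[OF K] by blast
    then show ?case using KN by blast
  next
    case (eng h1 h2)
    have "h1 \<in> carrier G" "h2 \<in> carrier G" using eng(1,2) generate_in_carrier[OF sub] by auto
    then show ?case using eng.IH Nc by (simp add: m_assoc)
  qed
  moreover have "N \<one>" using subgroup.one_closed[OF L(1)] by (simp add: N_def)
  ultimately have "N (h \<otimes> \<one>)" by blast
  then show ?thesis using generate_in_carrier[OF sub assms] by (simp add: N_def)
qed

text \<open>The last disjunction records more than ping-pong usually does: a product of at least two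
  letters sends points of \<open>M\<close> to \<open>\<theta> k\<close> times points of the other
  set. This is what later separates the join from elements outside the factor.
  \<open>\<theta>\<close> is a homomorphism on \<open>D\<close> only, because it is the projection
  followed by coordinates on the stabilizer.\<close>

lemma alt_product_pingpong:
  assumes E: "group E" and D: "subgroup D G" "\<And>i. K i \<subseteq> D"
    and \<theta>: "\<theta> \<in> hom (G\<lparr>carrier := D\<rparr>) E"
    and sub: "\<And>i. U i \<subseteq> carrier E" "M \<subseteq> carrier E"
    and pp: "\<And>i k u. k \<in> K i \<Longrightarrow> k \<notin> L \<Longrightarrow> u \<in> U (\<not> i) \<union> M \<Longrightarrow> \<theta> k \<otimes>\<^bsub>E\<^esub> u \<in> U i"
    and h: "alt_product G K L i h"
  shows "h \<in> D \<and> (\<forall>m\<in>M. \<theta> h \<otimes>\<^bsub>E\<^esub> m \<in> U i) \<and>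
    (h \<in> K i \<or> (\<exists>k\<in>K i. \<forall>m\<in>M. \<exists>u\<in>U (\<not> i). \<theta> h \<otimes>\<^bsub>E\<^esub> m = \<theta> k \<otimes>\<^bsub>E\<^esub> u))"
  using h
proof (induction rule: alt_product.induct)
  case (single k i)
  then show ?case using D(2) pp by blast
next
  case (step k i h)
  interpret E: group E by (rule E)
  have kD: "k \<in> D" using step.hyps D(2) by blast
  have hD: "h \<in> D" using step.IH by blast
  have c: "\<theta> k \<in> carrier E" "\<theta> h \<in> carrier E" "\<theta> (k \<otimes> h) = \<theta> k \<otimes>\<^bsub>E\<^esub> \<theta> h"
    using \<theta> kD hD by (auto simp: hom_def)
  have e: "\<theta> (k \<otimes> h) \<otimes>\<^bsub>E\<^esub> m = \<theta> k \<otimes>\<^bsub>E\<^esub> (\<theta> h \<otimes>\<^bsub>E\<^esub> m)" if "m \<in> M" for m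
  proof -
    have "m \<in> carrier E" using that sub(2) by blast
    then show ?thesis using c by (simp add: E.m_assoc)
  qed
  have u: "\<theta> h \<otimes>\<^bsub>E\<^esub> m \<in> U (\<not> i)" if "m \<in> M" for m using step.IH that by blast
  have "k \<otimes> h \<in> D" using subgroup.m_closed[OF D(1) kD hD] .
  moreover have "\<theta> (k \<otimes> h) \<otimes>\<^bsub>E\<^esub> m \<in> U i" if "m \<in> M" for m
    unfolding e[OF that] using pp[OF step.hyps(1,2)] u[OF that] by blast
  ultimately show ?case using step.hyps(1) e u by metis
qed

end

end

section \<open>Conjugation\<close>

lemma conj_subgroup_image: "conj_subgroup G g H = (\<lambda>h. g \<otimes>\<^bsub>G\<^esub> h \<otimes>\<^bsub>G\<^esub> inv\<^bsub>G\<^esub> g) ` H"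
  unfolding conj_subgroup_def l_coset_def r_coset_def by auto

lemma conj_subgroup_mono: "H \<subseteq> K \<Longrightarrow> conj_subgroup G g H \<subseteq> conj_subgroup G g K"
  unfolding conj_subgroup_image by (rule image_mono)

context group
begin

lemma conj_hom:
  assumes "g \<in> carrier G" shows "group_hom G G (\<lambda>h. g \<otimes> h \<otimes> inv g)"
proof -
  have "g \<otimes> (x \<otimes> y) \<otimes> inv g = (g \<otimes> x \<otimes> inv g) \<otimes> (g \<otimes> y \<otimes> inv g)"
    if "x \<in> carrier G" "y \<in> carrier G" for x y
    using assms that by (simp add: m_assoc inv_cancel_left)
  then show ?thesis using assms group_axioms
    by (auto simp: group_hom_def group_hom_axioms_def hom_def)
qed

lemma subgroup_conj:
  assumes "g \<in> carrier G" "subgroup H G" shows "subgroup (conj_subgroup G g H) G"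
  unfolding conj_subgroup_image using group_hom.subgroup_img_is_subgroup[OF conj_hom[OF assms(1)] assms(2)] .

lemma fg_subgroup_conj:
  assumes "g \<in> carrier G" "fg_subgroup G H" shows "fg_subgroup G (conj_subgroup G g H)"
  unfolding conj_subgroup_image using group_hom.fg_subgroup_img[OF conj_hom[OF assms(1)] assms(2)] .

lemma conj_subgroup_mult:
  assumes "g \<in> carrier G" "h \<in> carrier G" "H \<subseteq> carrier G"
  shows "conj_subgroup G (g \<otimes> h) H = conj_subgroup G g (conj_subgroup G h H)"
  unfolding conj_subgroup_image image_image
proof (rule image_cong)
  fix x assume "x \<in> H"
  then have "x \<in> carrier G" using assms(3) by blast
  then show "g \<otimes> h \<otimes> x \<otimes> inv (g \<otimes> h) = g \<otimes> (h \<otimes> x \<otimes> inv h) \<otimes> inv g"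
    using assms(1,2) by (simp add: m_assoc inv_mult_group)
qed simp

lemma conj_subgroup_one:
  assumes "H \<subseteq> carrier G" shows "conj_subgroup G \<one> H = H"
proof -
  have "(\<lambda>h. \<one> \<otimes> h \<otimes> inv \<one>) ` H = (\<lambda>h. h) ` H"
    using assms by (intro image_cong) auto
  then show ?thesis by (simp add: conj_subgroup_image)
qed

lemma conj_subgroup_inv:
  assumes "g \<in> carrier G" "H \<subseteq> carrier G"
  shows "conj_subgroup G (inv g) (conj_subgroup G g H) = H" "conj_subgroup G g (conj_subgroup G (inv g) H) = H"
  using conj_subgroup_mult[of "inv g" g H] conj_subgroup_mult[of g "inv g" H] conj_subgroup_one[of H] assms by auto

lemma conj_subgroup_carrier: "g \<in> carrier G \<Longrightarrow> H \<subseteq> carrier G \<Longrightarrow> conj_subgroup G g H \<subseteq> carrier G"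
  unfolding conj_subgroup_image by auto

lemma conj_subgroup_mem_iff:
  assumes g: "g \<in> carrier G" and x: "x \<in> carrier G" and H: "H \<subseteq> carrier G"
  shows "x \<in> conj_subgroup G g H \<longleftrightarrow> inv g \<otimes> x \<otimes> g \<in> H"
proof
  assume "x \<in> conj_subgroup G g H"
  then obtain h where h: "h \<in> H" "x = g \<otimes> h \<otimes> inv g" by (auto simp: conj_subgroup_image)
  then have "h \<in> carrier G" using H by blast
  then have "inv g \<otimes> x \<otimes> g = h" using g h(2) by (simp add: m_assoc inv_cancel_left)
  then show "inv g \<otimes> x \<otimes> g \<in> H" using h by simp
next
  assume "inv g \<otimes> x \<otimes> g \<in> H"
  moreover have "x = g \<otimes> (inv g \<otimes> x \<otimes> g) \<otimes> inv g" using g x by (simp add: m_assoc inv_cancel_left)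
  ultimately show "x \<in> conj_subgroup G g H" unfolding conj_subgroup_image by (rule rev_image_eqI)
qed

lemma conj_subgroup_Int:
  assumes "g \<in> carrier G" "H \<subseteq> carrier G" "K \<subseteq> carrier G"
  shows "conj_subgroup G g (H \<inter> K) = conj_subgroup G g H \<inter> conj_subgroup G g K"
proof -
  have "H \<inter> K \<subseteq> carrier G" using assms by blast
  then have iff: "x \<in> conj_subgroup G g (H \<inter> K) \<longleftrightarrow> x \<in> conj_subgroup G g H \<inter> conj_subgroup G g K"
    if "x \<in> carrier G" for x
    using that \<open>H \<inter> K \<subseteq> carrier G\<close> assms by (simp add: conj_subgroup_mem_iff)
  have sub: "conj_subgroup G g (H \<inter> K) \<subseteq> carrier G" "conj_subgroup G g H \<subseteq> carrier G"
    using conj_subgroup_carrier[OF assms(1)] assms \<open>H \<inter> K \<subseteq> carrier G\<close> by simp_all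
  show ?thesis
  proof (rule Set.set_eqI)
    fix x
    show "x \<in> conj_subgroup G g (H \<inter> K) \<longleftrightarrow> x \<in> conj_subgroup G g H \<inter> conj_subgroup G g K"
      using iff[of x] sub by blast
  qed
qed

lemma finite_index_conj:
  assumes g: "g \<in> carrier G" and S: "subgroup S G" and H: "subgroup H G" "H \<subseteq> S"
    and fin: "finite_index H (G\<lparr>carrier := S\<rparr>)"
  shows "finite_index (conj_subgroup G g H) (G\<lparr>carrier := conj_subgroup G g S\<rparr>)"
proof -
  obtain T where T: "finite T" "T \<subseteq> S" "\<And>x. x \<in> S \<Longrightarrow> \<exists>t\<in>T. x \<otimes> inv t \<in> H"
    using fin unfolding finite_index_subgroup_iff[OF S H] by metis
  have "\<exists>t\<in>conj_subgroup G g T. y \<otimes> inv t \<in> conj_subgroup G g H" if y: "y \<in> conj_subgroup G g S" for y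
  proof -
    obtain x where x: "x \<in> S" "y = g \<otimes> x \<otimes> inv g" using y by (auto simp: conj_subgroup_image)
    obtain t where t: "t \<in> T" "x \<otimes> inv t \<in> H" using T(3)[OF x(1)] by blast
    have c: "x \<in> carrier G" "t \<in> carrier G" using x t T(2) subgroup.mem_carrier[OF S] by auto
    have "y \<otimes> inv (g \<otimes> t \<otimes> inv g) = g \<otimes> (x \<otimes> inv t) \<otimes> inv g"
      using x(2) c g by (simp add: m_assoc inv_mult_group inv_cancel_left)
    then show ?thesis using t unfolding conj_subgroup_image by blast
  qed
  moreover have "finite (conj_subgroup G g T)" "conj_subgroup G g T \<subseteq> conj_subgroup G g S"
    using T by (auto simp: conj_subgroup_image)
  ultimately show ?thesis
    unfolding finite_index_subgroup_iff[OF subgroup_conj[OF g S] subgroup_conj[OF g H(1)] conj_subgroup_mono[OF H(2)]]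
    by blast
qed

lemma cyclic_subgroup_conj:
  assumes g: "g \<in> carrier G" and S: "cyclic_subgroup G S"
  shows "cyclic_subgroup G (conj_subgroup G g S)"
proof -
  obtain s where s: "s \<in> carrier G" "S = generate G {s}" using S by (auto simp: cyclic_subgroup_def)
  have "conj_subgroup G g S = generate G {g \<otimes> s \<otimes> inv g}"
    using group_hom.generate_img[OF conj_hom[OF g], of "{s}"] s by (simp add: conj_subgroup_image)
  then show ?thesis using g s unfolding cyclic_subgroup_def by blast
qed

end

section \<open>Joining subgroups of the semidirect product\<close>

locale lattice_by_free =
  fixes A :: "'a set" and \<rho> :: "'a fword \<Rightarrow> int ^ 'd ^ 'd"
  assumes \<rho>: "\<rho> \<in> hom (free_group A) GL_int"
begin

abbreviation "F \<equiv> free_group A"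
abbreviation "G \<equiv> semidirect F \<rho>"
abbreviation V :: "((int ^ 'd) \<times> 'a fword) set" where "V \<equiv> vertex_group F"

sublocale F: group F by (rule group_free_group)
sublocale G: group G by (rule group_semidirect[OF F.group_axioms \<rho>])

lemma carrier_G: "carrier G = UNIV \<times> carrier F"
  and mult_G: "(v, \<gamma>) \<otimes>\<^bsub>G\<^esub> (w, \<delta>) = (v + \<rho> \<gamma> *v w, \<gamma> \<otimes>\<^bsub>F\<^esub> \<delta>)"
  and one_G: "\<one>\<^bsub>G\<^esub> = (0, \<one>\<^bsub>F\<^esub>)"
  by (simp_all add: semidirect_def)

sublocale proj: group_hom G F snd
  by unfold_locales (auto simp: hom_def carrier_G mult_G)

lemma mem_V: "x \<in> V \<longleftrightarrow> snd x = \<one>\<^bsub>F\<^esub>"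
  by (cases x) (auto simp: vertex_group_def)

lemma subgroup_V: "subgroup V G"
proof -
  have "V = kernel G F snd" by (auto simp: kernel_def vertex_group_def carrier_G carrier_free_group)
  then show ?thesis using proj.subgroup_kernel by simp
qed

lemma snd_conj: "g \<in> carrier G \<Longrightarrow> h \<in> carrier G \<Longrightarrow>
    snd (g \<otimes>\<^bsub>G\<^esub> h \<otimes>\<^bsub>G\<^esub> inv\<^bsub>G\<^esub> g) = snd g \<otimes>\<^bsub>F\<^esub> snd h \<otimes>\<^bsub>F\<^esub> inv\<^bsub>F\<^esub> snd g"
  by (simp del: mult_free_group)

lemma snd_conj_subgroup:
  assumes "g \<in> carrier G" "H \<subseteq> carrier G"
  shows "snd ` conj_subgroup G g H = conj_subgroup F (snd g) (snd ` H)"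
  unfolding conj_subgroup_image image_image
  using assms by (intro image_cong refl snd_conj) auto

text \<open>Finite generation leaves only countably many such \<open>H\<close>, and with infinite
  index in \<open>S\<close> it provides the cones for ping-pong. All the conditions survive the
  joins of \<open>tame_join\<close>, so joining can be iterated.\<close>

definition tame :: "'a fword set \<Rightarrow> ((int ^ 'd) \<times> 'a fword) set \<Rightarrow> ((int ^ 'd) \<times> 'a fword) set \<Rightarrow> bool" where
  "tame S L H \<longleftrightarrow> subgroup H G \<and> H \<inter> V = L \<and> snd ` H \<subseteq> S \<and> fg_subgroup F (snd ` H)
     \<and> \<not> finite_index (snd ` H) (F\<lparr>carrier := S\<rparr>)"

text \<open>Ping-pong is played in the free group \<open>E\<close> on a basis of \<open>S\<close>,
  through the map \<open>\<theta>\<close> that projects and then takes coordinates. It sees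
  everything except the lattice, since on \<open>H1\<close> and \<open>H2\<close> only the elements
  of \<open>L\<close> become trivial.\<close>

lemma tame_join:
  assumes S: "subgroup S F" "\<not> cyclic_subgroup F S"
    and L: "\<And>g. g \<in> carrier G \<Longrightarrow> snd g \<in> S \<Longrightarrow> conj_subgroup G g L = L"
    and H1: "tame S L H1" and H2: "tame S L H2"
    and C1: "finite C1" "C1 \<subseteq> carrier G" "C1 \<inter> H1 = {}" and C2: "finite C2" "C2 \<subseteq> carrier G" "C2 \<inter> H2 = {}"
  obtains g where "g \<in> carrier G" "snd g \<in> S"
    "tame S L (generate G (H1 \<union> conj_subgroup G g H2))"
    "generate G (H1 \<union> conj_subgroup G g H2) \<inter> C1 = {}"
    "generate G (H1 \<union> conj_subgroup G g H2) \<inter> conj_subgroup G g C2 = {}"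
    "H1 \<inter> conj_subgroup G g H2 \<subseteq> L"
proof -
  let ?FS = "F\<lparr>carrier := S\<rparr>"
  interpret S: subgroup S F by (rule S(1))
  obtain B :: "('a fword \<times> 'a) set" and \<psi> \<alpha> \<beta>
    where \<psi>: "\<psi> \<in> iso (free_group B) ?FS" and \<alpha>\<beta>: "\<alpha> \<in> B" "\<beta> \<in> B" "\<alpha> \<noteq> \<beta>"
    using free_subgroup_noncyclic[OF S] by metis
  define E where "E = free_group B"
  define \<phi> where "\<phi> = inv_into (carrier E) \<psi>"
  interpret E: group E unfolding E_def by (rule group_free_group)
  have gS: "group ?FS" using F.subgroup_imp_group[OF S(1)] .
  have bij: "bij_betw \<psi> (carrier E) S" using \<psi> by (simp add: iso_def E_def)
  have "\<phi> \<in> iso ?FS E" using E.iso_set_sym[of \<psi> ?FS] \<psi> by (simp add: \<phi>_def E_def)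
  then interpret \<phi>: group_hom ?FS E \<phi>
    using gS E.group_axioms by (simp add: group_hom_def group_hom_axioms_def iso_def)
  interpret \<psi>: group_hom E ?FS \<psi>
    using \<psi> gS E.group_axioms by (simp add: group_hom_def group_hom_axioms_def iso_def E_def)
  have \<phi>\<psi>: "\<phi> (\<psi> x) = x" if "x \<in> carrier E" for x
    unfolding \<phi>_def using bij_betw_inv_into_left[OF bij that] .
  have \<psi>\<phi>: "\<psi> (\<phi> s) = s" if "s \<in> S" for s
    unfolding \<phi>_def using bij_betw_inv_into_right[OF bij that] .
  have \<phi>c: "\<phi> s \<in> carrier E" if "s \<in> S" for s using \<phi>.hom_closed that by simp
  have \<psi>S: "\<psi> x \<in> S" if "x \<in> carrier E" for x using \<psi>.hom_closed[OF that] by simp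
  have \<phi>m: "\<phi> (s \<otimes>\<^bsub>F\<^esub> t) = \<phi> s \<otimes>\<^bsub>E\<^esub> \<phi> t" if "s \<in> S" "t \<in> S" for s t
    using \<phi>.hom_mult[of s t] that by simp
  have \<phi>i: "\<phi> (inv\<^bsub>F\<^esub> s) = inv\<^bsub>E\<^esub> \<phi> s" if "s \<in> S" for s
    using \<phi>.hom_inv[of s] that F.m_inv_consistent[OF S(1) that] by simp
  have \<phi>1: "\<phi> s = \<one>\<^bsub>E\<^esub> \<longleftrightarrow> s = \<one>\<^bsub>F\<^esub>" if "s \<in> S" for s
    using \<psi>\<phi>[OF that] \<psi>.hom_one \<phi>.hom_one by auto
  have fgE: "fg_subgroup E (\<phi> ` snd ` H) \<and> \<not> finite_index (\<phi> ` snd ` H) E \<and> subgroup H G \<and> H \<inter> V = L \<and> snd ` H \<subseteq> S"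
    if "tame S L H" for H
  proof -
    have H: "subgroup H G" "H \<inter> V = L" "snd ` H \<subseteq> S" "fg_subgroup F (snd ` H)" "\<not> finite_index (snd ` H) ?FS"
      using that by (auto simp: tame_def)
    have fg: "fg_subgroup ?FS (snd ` H)" using F.fg_subgroup_in_subgroup_iff[OF S(1) H(3)] H(4) by blast
    have fgE: "fg_subgroup E (\<phi> ` snd ` H)" using \<phi>.fg_subgroup_img[OF fg] .
    have "\<psi> ` \<phi> ` snd ` H = snd ` H"
    proof -
      have "(\<lambda>x. \<psi> (\<phi> x)) ` snd ` H = (\<lambda>x. x) ` snd ` H" using H(3) \<psi>\<phi> by (intro image_cong) auto
      then show ?thesis by (simp add: image_image)
    qed
    moreover have "\<psi> ` carrier E = carrier ?FS" using bij by (simp add: bij_betw_def)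
    ultimately have "\<not> finite_index (\<phi> ` snd ` H) E"
      using \<psi>.finite_index_img[OF _ E.fg_subgroup_is_subgroup[OF fgE]] H(5) by auto
    then show ?thesis using H fgE by blast
  qed
  define \<Gamma> where "\<Gamma> = \<phi> ` snd ` H1"
  define \<Delta> where "\<Delta> = \<phi> ` snd ` H2"
  define D where "D = {x \<in> carrier G. snd x \<in> S}"
  define \<theta> where "\<theta> x = \<phi> (snd x)" for x :: "(int ^ 'd) \<times> 'a fword"
  note h1 = fgE[OF H1, folded \<Gamma>_def] and h2 = fgE[OF H2, folded \<Delta>_def]
  \<comment> \<open>Elements of \<open>C1\<close> and \<open>C2\<close> outside \<open>D\<close>
    need no attention, because the join stays inside \<open>D\<close>.\<close>
  define X1 where "X1 = \<theta> ` (C1 \<inter> D)"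
  define X2 where "X2 = \<theta> ` (C2 \<inter> D)"
  have X: "finite X1" "X1 \<subseteq> carrier E" "finite X2" "X2 \<subseteq> carrier E"
    using C1 C2 \<phi>c by (auto simp: X1_def X2_def \<theta>_def D_def)
  have fg12: "fg_subgroup E \<Gamma>" "\<not> finite_index \<Gamma> E" "fg_subgroup E \<Delta>" "\<not> finite_index \<Delta> E"
    using h1 h2 by auto
  obtain g0 p M U W where g0: "g0 \<in> carrier E" and pM: "p \<in> M" and infM: "infinite M"
    and sub: "M \<subseteq> carrier E" "U \<subseteq> carrier E" "W \<subseteq> carrier E"
    and disj: "U \<inter> W = {}" "M \<inter> U = {}" "M \<inter> W = {}"
    and pp1: "\<And>\<gamma> u. \<gamma> \<in> \<Gamma> \<Longrightarrow> \<gamma> \<noteq> \<one>\<^bsub>E\<^esub> \<Longrightarrow> u \<in> W \<union> M \<Longrightarrow> \<gamma> \<otimes>\<^bsub>E\<^esub> u \<in> U"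
    and pp2: "\<And>\<delta> u. \<delta> \<in> \<Delta> \<Longrightarrow> \<delta> \<noteq> \<one>\<^bsub>E\<^esub> \<Longrightarrow> u \<in> U \<union> M \<Longrightarrow> g0 \<otimes>\<^bsub>E\<^esub> \<delta> \<otimes>\<^bsub>E\<^esub> inv\<^bsub>E\<^esub> g0 \<otimes>\<^bsub>E\<^esub> u \<in> W"
    and av1: "\<And>c. c \<in> X1 \<Longrightarrow> c \<otimes>\<^bsub>E\<^esub> p \<notin> W"
    and av2: "\<And>c \<gamma> u. c \<in> X1 \<Longrightarrow> \<gamma> \<in> \<Gamma> \<Longrightarrow> u \<in> W \<Longrightarrow> c \<otimes>\<^bsub>E\<^esub> p \<noteq> \<gamma> \<otimes>\<^bsub>E\<^esub> u"
    and av3: "\<And>c. c \<in> X2 \<Longrightarrow> g0 \<otimes>\<^bsub>E\<^esub> c \<otimes>\<^bsub>E\<^esub> inv\<^bsub>E\<^esub> g0 \<otimes>\<^bsub>E\<^esub> p \<notin> U"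
    and av4: "\<And>c \<delta> u. c \<in> X2 \<Longrightarrow> \<delta> \<in> \<Delta> \<Longrightarrow> u \<in> U \<Longrightarrow>
       g0 \<otimes>\<^bsub>E\<^esub> c \<otimes>\<^bsub>E\<^esub> inv\<^bsub>E\<^esub> g0 \<otimes>\<^bsub>E\<^esub> p \<noteq> g0 \<otimes>\<^bsub>E\<^esub> \<delta> \<otimes>\<^bsub>E\<^esub> inv\<^bsub>E\<^esub> g0 \<otimes>\<^bsub>E\<^esub> u"
    by (rule free_pingpong[OF \<alpha>\<beta>, folded E_def, OF fg12 X that])
  \<comment> \<open>Any lift of \<open>\<psi> g0\<close> would do; what matters is that it projects
    into \<open>S\<close>, so that conjugation by it preserves \<open>L\<close>.\<close>
  define g :: "(int ^ 'd) \<times> 'a fword" where "g = (0, \<psi> g0)"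
  have gS': "snd g \<in> S" using \<psi>S[OF g0] by (simp add: g_def)
  have gc: "g \<in> carrier G" using S.mem_carrier[OF gS'] by (simp add: g_def carrier_G)
  have \<theta>g: "\<phi> (snd g) = g0" using \<phi>\<psi>[OF g0] by (simp add: g_def)
  have sH: "subgroup H1 G" "subgroup H2 G" using h1 h2 by auto
  have Hc: "H1 \<subseteq> carrier G" "H2 \<subseteq> carrier G" using subgroup.subset[OF sH(1)] subgroup.subset[OF sH(2)] .
  have Dsub: "subgroup D G"
  proof (rule G.subgroupI)
    show "D \<subseteq> carrier G" by (auto simp: D_def)
    have "\<one>\<^bsub>G\<^esub> \<in> D" using G.one_closed S.one_closed unfolding D_def by (simp add: one_G carrier_G)
    then show "D \<noteq> {}" by blast
  next
    fix a assume "a \<in> D"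
    then have "a \<in> carrier G" "snd a \<in> S" by (auto simp only: D_def)
    then show "inv\<^bsub>G\<^esub> a \<in> D" using S.m_inv_closed[of "snd a"] proj.hom_inv[of a] unfolding D_def by simp
  next
    fix a b assume "a \<in> D" "b \<in> D"
    then have "a \<in> carrier G" "snd a \<in> S" "b \<in> carrier G" "snd b \<in> S" by (auto simp only: D_def)
    then show "a \<otimes>\<^bsub>G\<^esub> b \<in> D"
      using S.m_closed proj.hom_mult[of a b] G.m_closed[of a b] unfolding D_def by (simp del: mult_free_group)
  qed
  have \<theta>hom: "\<theta> \<in> hom (G\<lparr>carrier := D\<rparr>) E"
  proof (rule homI)
    fix x assume "x \<in> carrier (G\<lparr>carrier := D\<rparr>)"
    then show "\<theta> x \<in> carrier E" using \<phi>c by (simp add: D_def \<theta>_def)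
  next
    fix x y assume "x \<in> carrier (G\<lparr>carrier := D\<rparr>)" "y \<in> carrier (G\<lparr>carrier := D\<rparr>)"
    then have "x \<in> carrier G" "snd x \<in> S" "y \<in> carrier G" "snd y \<in> S" by (simp_all add: D_def)
    then show "\<theta> (x \<otimes>\<^bsub>G\<lparr>carrier := D\<rparr>\<^esub> y) = \<theta> x \<otimes>\<^bsub>E\<^esub> \<theta> y"
      using proj.hom_mult[of x y] \<phi>m[of "snd x" "snd y"] by (simp del: mult_free_group add: \<theta>_def)
  qed
  define H2' where "H2' = conj_subgroup G g H2"
  have sH2': "subgroup H2' G" unfolding H2'_def using G.subgroup_conj[OF gc sH(2)] .
  have Lsub: "L \<subseteq> carrier G" "L \<subseteq> V" "L \<subseteq> H1" "L \<subseteq> H2" using h1 h2 Hc by auto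
  have LH2': "L \<subseteq> H2'" using conj_subgroup_mono[OF Lsub(4), of G g] L[OF gc gS'] by (simp add: H2'_def)
  have sL: "subgroup L G" using G.subgroups_Inter_pair[OF sH(1) subgroup_V] h1 by simp
  define K where "K i = (if i then H1 else H2')" for i
  have K: "K True = H1" "K False = H2'" by (simp_all add: K_def)
  have sK: "subgroup (K i) G" for i using sH sH2' by (simp add: K_def)
  have LK: "L \<subseteq> K i" for i using Lsub LH2' by (simp add: K_def)
  have H1D: "H1 \<subseteq> D" and H2D: "H2 \<subseteq> D" using h1 h2 Hc by (auto simp: D_def)
  have gD: "g \<in> D" using gc gS' by (simp add: D_def)
  have conj\<theta>: "\<theta> (g \<otimes>\<^bsub>G\<^esub> h \<otimes>\<^bsub>G\<^esub> inv\<^bsub>G\<^esub> g) = g0 \<otimes>\<^bsub>E\<^esub> \<theta> h \<otimes>\<^bsub>E\<^esub> inv\<^bsub>E\<^esub> g0" if "h \<in> D" for h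
  proof -
    have h: "h \<in> carrier G" "snd h \<in> S" using that by (auto simp only: D_def mem_Collect_eq)
    show ?thesis
      unfolding \<theta>_def snd_conj[OF gc h(1)] using \<phi>m[OF S.m_closed[OF gS' h(2)] S.m_inv_closed[OF gS']]
        \<phi>m[OF gS' h(2)] \<phi>i[OF gS'] \<theta>g by simp
  qed
  have gDc: "g \<otimes>\<^bsub>G\<^esub> h \<otimes>\<^bsub>G\<^esub> inv\<^bsub>G\<^esub> g \<in> D \<longleftrightarrow> h \<in> D" if "h \<in> carrier G" for h
  proof
    show "h \<in> D \<Longrightarrow> g \<otimes>\<^bsub>G\<^esub> h \<otimes>\<^bsub>G\<^esub> inv\<^bsub>G\<^esub> g \<in> D"
      using gD Dsub by (intro subgroup.m_closed subgroup.m_inv_closed)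
    assume *: "g \<otimes>\<^bsub>G\<^esub> h \<otimes>\<^bsub>G\<^esub> inv\<^bsub>G\<^esub> g \<in> D"
    have "inv\<^bsub>G\<^esub> g \<otimes>\<^bsub>G\<^esub> (g \<otimes>\<^bsub>G\<^esub> h \<otimes>\<^bsub>G\<^esub> inv\<^bsub>G\<^esub> g) \<otimes>\<^bsub>G\<^esub> g \<in> D"
      by (rule subgroup.m_closed[OF Dsub subgroup.m_closed[OF Dsub subgroup.m_inv_closed[OF Dsub gD] *] gD])
    then show "h \<in> D" using gc that by (simp add: G.m_assoc G.inv_cancel_left)
  qed
  have H2'E: "\<exists>h\<in>H2. k = g \<otimes>\<^bsub>G\<^esub> h \<otimes>\<^bsub>G\<^esub> inv\<^bsub>G\<^esub> g" if "k \<in> H2'" for k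
    using that unfolding H2'_def conj_subgroup_image by blast
  have KD: "K i \<subseteq> D" for i
  proof (cases i)
    case False
    have "k \<in> D" if "k \<in> H2'" for k using H2'E[OF that] gDc H2D Hc(2) by blast
    then show ?thesis using False by (auto simp: K_def)
  qed (use H1D in \<open>simp add: K_def\<close>)
  have nontriv: "\<theta> h \<noteq> \<one>\<^bsub>E\<^esub>" if "h \<in> H" "h \<notin> L" "H = H1 \<or> H = H2" for h H
  proof -
    have "h \<notin> V" "snd h \<in> S" using that h1 h2 by auto
    then show ?thesis using \<phi>1 by (simp add: \<theta>_def mem_V)
  qed
  define UU where "UU i = (if i then U else W)" for i
  have pp: "\<theta> k \<otimes>\<^bsub>E\<^esub> u \<in> UU i" if k: "k \<in> K i" "k \<notin> L" and u: "u \<in> UU (\<not> i) \<union> M" for i k u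
  proof (cases i)
    case True
    then have "k \<in> H1" "u \<in> W \<union> M" using k u by (auto simp: K_def UU_def)
    moreover from this have "\<theta> k \<in> \<Gamma>" by (auto simp: \<Gamma>_def \<theta>_def)
    ultimately show ?thesis using pp1[of "\<theta> k" u] nontriv[of k H1] k True by (simp add: UU_def)
  next
    case False
    then have "k \<in> H2'" and u': "u \<in> U \<union> M" using k u by (auto simp: K_def UU_def)
    then obtain h where h: "h \<in> H2" "k = g \<otimes>\<^bsub>G\<^esub> h \<otimes>\<^bsub>G\<^esub> inv\<^bsub>G\<^esub> g" using H2'E by blast
    have "h \<notin> L"
    proof
      assume "h \<in> L"
      then have "k \<in> conj_subgroup G g L" using h by (auto simp: conj_subgroup_image)
      then show False using k L[OF gc gS'] by simp
    qed
    moreover have "\<theta> h \<in> \<Delta>" using h by (auto simp: \<Delta>_def \<theta>_def)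
    ultimately have "g0 \<otimes>\<^bsub>E\<^esub> \<theta> h \<otimes>\<^bsub>E\<^esub> inv\<^bsub>E\<^esub> g0 \<otimes>\<^bsub>E\<^esub> u \<in> W" using pp2 nontriv[of h H2] h u' by blast
    then show ?thesis using conj\<theta>[of h] h H2D False by (auto simp: UU_def)
  qed
  have UUc: "UU i \<subseteq> carrier E" for i using sub by (simp add: UU_def)
  have MUU: "M \<inter> UU i = {}" for i using disj by (simp add: UU_def)
  define J where "J = generate G (H1 \<union> H2')"
  have J: "h \<in> L \<or> (\<exists>i. alt_product G K L i h)" if "h \<in> J" for h
    using G.generate_alt_product[OF sK sL LK, of h] that by (simp add: J_def K)
  have alt: "h \<in> D \<and> (\<forall>m\<in>M. \<theta> h \<otimes>\<^bsub>E\<^esub> m \<in> UU i) \<and>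
    (h \<in> K i \<or> (\<exists>k\<in>K i. \<forall>m\<in>M. \<exists>u\<in>UU (\<not> i). \<theta> h \<otimes>\<^bsub>E\<^esub> m = \<theta> k \<otimes>\<^bsub>E\<^esub> u))" if "alt_product G K L i h" for i h
    by (rule G.alt_product_pingpong[OF sK sL LK E.group_axioms Dsub KD \<theta>hom UUc sub(1) pp that])
  have sub12: "H1 \<union> H2' \<subseteq> carrier G" using Hc subgroup.subset[OF sH2'] by blast
  have sJ: "subgroup J G" unfolding J_def using G.generate_is_subgroup[OF sub12] .
  have H1J: "H1 \<subseteq> J" by (auto simp: J_def intro: generate.incl)
  have JD: "J \<subseteq> D" unfolding J_def using G.generate_subgroup_incl[OF _ Dsub] KD[of True] KD[of False] K by auto
  \<comment> \<open>An alternating product moves the base point out of \<open>M\<close>, so it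
    cannot act trivially. Hence the join meets \<open>V\<close> in \<open>L\<close> only.\<close>
  have alt1: False if "alt_product G K L i h" "\<theta> h = \<one>\<^bsub>E\<^esub>" for i h
  proof -
    have "\<theta> h \<otimes>\<^bsub>E\<^esub> p \<in> UU i" using alt[OF that(1)] pM by blast
    then have "p \<in> UU i" using that(2) sub(1) pM by (simp add: subset_iff)
    then show False using MUU pM by blast
  qed
  have JV: "J \<inter> V = L"
  proof
    show "L \<subseteq> J \<inter> V" using Lsub H1J by blast
    show "J \<inter> V \<subseteq> L"
    proof
      fix h assume h: "h \<in> J \<inter> V"
      then have "\<theta> h = \<one>\<^bsub>E\<^esub>" using \<phi>1[OF S.one_closed] by (simp add: \<theta>_def mem_V)
      then show "h \<in> L" using J[of h] alt1 h by blast
    qed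
  qed
  have JS: "snd ` J \<subseteq> S" using JD by (auto simp: D_def)
  have fgJ: "fg_subgroup F (snd ` J)"
  proof -
    have "snd ` J = generate F (snd ` (H1 \<union> H2'))" unfolding J_def using proj.generate_img[OF sub12] by simp
    also have "snd ` (H1 \<union> H2') = snd ` H1 \<union> conj_subgroup F (snd g) (snd ` H2)"
      unfolding H2'_def image_Un snd_conj_subgroup[OF gc Hc(2)] ..
    finally show ?thesis
      using F.fg_subgroup_join F.fg_subgroup_conj[OF S.mem_carrier[OF gS']] H1 H2 by (simp add: tame_def)
  qed
  \<comment> \<open>\<open>M\<close> is infinite, so finite index would put two of its points into
    one coset. The quotient would be an element of the join moving one point of \<open>M\<close> to
    another, whereas alternating products move \<open>M\<close> off itself.\<close>
  have infJ: "\<not> finite_index (snd ` J) ?FS"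
  proof
    assume "finite_index (snd ` J) ?FS"
    then obtain T where T: "finite T" "T \<subseteq> S" "\<And>x. x \<in> S \<Longrightarrow> \<exists>t\<in>T. x \<otimes>\<^bsub>F\<^esub> inv\<^bsub>F\<^esub> t \<in> snd ` J"
      unfolding F.finite_index_subgroup_iff[OF S(1) F.fg_subgroup_is_subgroup[OF fgJ] JS] by metis
    have "\<forall>m\<in>M. \<exists>t. t \<in> T \<and> \<psi> m \<otimes>\<^bsub>F\<^esub> inv\<^bsub>F\<^esub> t \<in> snd ` J"
    proof
      fix m assume "m \<in> M"
      then have "\<psi> m \<in> S" using \<psi>S sub(1) by (simp add: subset_iff)
      then show "\<exists>t. t \<in> T \<and> \<psi> m \<otimes>\<^bsub>F\<^esub> inv\<^bsub>F\<^esub> t \<in> snd ` J" using T(3) by (simp only: Bex_def)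
    qed
    from bchoice[OF this] obtain f where f: "\<And>m. m \<in> M \<Longrightarrow> f m \<in> T \<and> \<psi> m \<otimes>\<^bsub>F\<^esub> inv\<^bsub>F\<^esub> f m \<in> snd ` J" by metis
    have "\<not> inj_on f M" using infM T(1) f by (metis finite_subset image_subsetI finite_imageD)
    then obtain m m' where m: "m \<in> M" "m' \<in> M" "m \<noteq> m'" "f m = f m'" by (auto simp: inj_on_def)
    have mS: "\<psi> m \<in> S" "\<psi> m' \<in> S" "f m \<in> S" using m \<psi>S sub(1) f T(2) by blast+
    interpret sJ: subgroup "snd ` J" F using F.fg_subgroup_is_subgroup[OF fgJ] .
    have "(\<psi> m \<otimes>\<^bsub>F\<^esub> inv\<^bsub>F\<^esub> f m) \<otimes>\<^bsub>F\<^esub> inv\<^bsub>F\<^esub> (\<psi> m' \<otimes>\<^bsub>F\<^esub> inv\<^bsub>F\<^esub> f m) \<in> snd ` J"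
      using f[OF m(1)] f[OF m(2)] m(4) sJ.m_closed sJ.m_inv_closed by metis
    moreover have "(\<psi> m \<otimes>\<^bsub>F\<^esub> inv\<^bsub>F\<^esub> f m) \<otimes>\<^bsub>F\<^esub> inv\<^bsub>F\<^esub> (\<psi> m' \<otimes>\<^bsub>F\<^esub> inv\<^bsub>F\<^esub> f m) = \<psi> m \<otimes>\<^bsub>F\<^esub> inv\<^bsub>F\<^esub> \<psi> m'"
      using mS[THEN S.mem_carrier] by (simp del: mult_free_group add: F.inv_mult_group F.m_assoc F.inv_cancel_left)
    ultimately obtain h where h: "h \<in> J" "snd h = \<psi> m \<otimes>\<^bsub>F\<^esub> inv\<^bsub>F\<^esub> \<psi> m'" by (metis imageE)
    have mc: "m \<in> carrier E" "m' \<in> carrier E" using m sub(1) by auto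
    have "\<theta> h = m \<otimes>\<^bsub>E\<^esub> inv\<^bsub>E\<^esub> m'"
      unfolding \<theta>_def h(2) using \<phi>m[OF mS(1) S.m_inv_closed[OF mS(2)]] \<phi>i[OF mS(2)] \<phi>\<psi> mc by simp
    then have \<theta>m: "\<theta> h \<otimes>\<^bsub>E\<^esub> m' = m" using mc by (simp add: E.m_assoc)
    from J[OF h(1)] show False
    proof
      assume "h \<in> L"
      then have "snd h = \<one>\<^bsub>F\<^esub>" using Lsub by (auto simp: mem_V)
      then have "\<theta> h = \<one>\<^bsub>E\<^esub>" using \<phi>1[OF S.one_closed] by (simp add: \<theta>_def)
      then show False using \<theta>m mc m(3) by simp
    next
      assume "\<exists>i. alt_product G K L i h"
      then obtain i where "alt_product G K L i h" by blast
      then have "\<theta> h \<otimes>\<^bsub>E\<^esub> m' \<in> UU i" using alt m(2) by blast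
      then show False using \<theta>m m(1) MUU by auto
    qed
  qed
  have tame: "tame S L J" using sJ JV JS fgJ infJ by (simp add: tame_def)
  have "J \<inter> C1 = {}"
  proof (rule ccontr)
    assume "J \<inter> C1 \<noteq> {}"
    then obtain b where b: "b \<in> J" "b \<in> C1" by blast
    have bX: "\<theta> b \<in> X1" using b JD by (auto simp: X1_def)
    have b1: "b \<notin> H1" using b C1 by blast
    \<comment> \<open>Since \<open>b \<notin> H1\<close>, the product either starts in the conjugate
      of \<open>H2\<close>, sending \<open>p\<close> into \<open>W\<close>, or starts in
      \<open>H1\<close> and has at least two letters, sending \<open>p\<close> to a translate of a
      point of \<open>W\<close>. Both are excluded for the elements of \<open>X1\<close>.\<close>
    then obtain i where i: "alt_product G K L i b" using J[OF b(1)] Lsub by blast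
    show False
    proof (cases i)
      case True
      then obtain k u where "k \<in> H1" "u \<in> W" "\<theta> b \<otimes>\<^bsub>E\<^esub> p = \<theta> k \<otimes>\<^bsub>E\<^esub> u"
        using alt[OF i] b1 pM by (auto simp: K_def UU_def)
      then show False using av2[OF bX, of "\<theta> k" u] by (auto simp: \<Gamma>_def \<theta>_def)
    next
      case False
      then have "\<theta> b \<otimes>\<^bsub>E\<^esub> p \<in> W" using alt[OF i] pM by (auto simp: UU_def)
      then show False using av1[OF bX] by blast
    qed
  qed
  moreover have "J \<inter> conj_subgroup G g C2 = {}"
  proof (rule ccontr)
    assume "J \<inter> conj_subgroup G g C2 \<noteq> {}"
    then obtain b c where b: "b \<in> J" "c \<in> C2" "b = g \<otimes>\<^bsub>G\<^esub> c \<otimes>\<^bsub>G\<^esub> inv\<^bsub>G\<^esub> g"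
      unfolding conj_subgroup_image by blast
    have cc: "c \<in> carrier G" "c \<notin> H2" using b C2 by auto
    have cD: "c \<in> D" using b JD gDc[OF cc(1)] by blast
    then have cX: "\<theta> c \<in> X2" using b by (auto simp: X2_def)
    have \<theta>b: "\<theta> b = g0 \<otimes>\<^bsub>E\<^esub> \<theta> c \<otimes>\<^bsub>E\<^esub> inv\<^bsub>E\<^esub> g0" using conj\<theta>[OF cD] b by simp
    have bH2': "b \<notin> H2'"
    proof
      assume "b \<in> H2'"
      then have "inv\<^bsub>G\<^esub> g \<otimes>\<^bsub>G\<^esub> b \<otimes>\<^bsub>G\<^esub> g \<in> H2"
        using G.conj_subgroup_mem_iff[OF gc _ Hc(2), of b] sub12 unfolding H2'_def by blast
      moreover have "inv\<^bsub>G\<^esub> g \<otimes>\<^bsub>G\<^esub> b \<otimes>\<^bsub>G\<^esub> g = c"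
        using b(3) gc cc(1) by (simp add: G.m_assoc G.inv_cancel_left)
      ultimately show False using cc by simp
    qed
    then obtain i where i: "alt_product G K L i b" using J[OF b(1)] LH2' by blast
    show False
    proof (cases i)
      case True
      then have "\<theta> b \<otimes>\<^bsub>E\<^esub> p \<in> U" using alt[OF i] pM by (auto simp: UU_def)
      then show False using av3[OF cX] \<theta>b by simp
    next
      case False
      then obtain k u where k: "k \<in> H2'" "u \<in> U" "\<theta> b \<otimes>\<^bsub>E\<^esub> p = \<theta> k \<otimes>\<^bsub>E\<^esub> u"
        using alt[OF i] bH2' pM by (auto simp: K_def UU_def)
      obtain h where h: "h \<in> H2" "k = g \<otimes>\<^bsub>G\<^esub> h \<otimes>\<^bsub>G\<^esub> inv\<^bsub>G\<^esub> g" using H2'E k by blast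
      have "\<theta> k = g0 \<otimes>\<^bsub>E\<^esub> \<theta> h \<otimes>\<^bsub>E\<^esub> inv\<^bsub>E\<^esub> g0" using conj\<theta> h H2D by blast
      moreover have "\<theta> h \<in> \<Delta>" using h by (auto simp: \<Delta>_def \<theta>_def)
      ultimately show False using av4[OF cX _ k(2)] k(3) \<theta>b by metis
    qed
  qed
  \<comment> \<open>A common element outside \<open>L\<close> would send \<open>p\<close> into both
    \<open>U\<close> and \<open>W\<close>. With this clause \<open>tame_extend\<close> recognizes
    that a join is strictly larger.\<close>
  moreover have "H1 \<inter> H2' \<subseteq> L"
  proof (rule ccontr)
    assume "\<not> H1 \<inter> H2' \<subseteq> L"
    then obtain h where h: "h \<in> K True" "h \<in> K False" "h \<notin> L" by (auto simp: K)
    have "\<theta> h \<otimes>\<^bsub>E\<^esub> p \<in> UU True" "\<theta> h \<otimes>\<^bsub>E\<^esub> p \<in> UU False"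
      using pp[OF h(1,3), of p] pp[OF h(2,3), of p] pM by auto
    then show False using disj(1) by (auto simp: UU_def)
  qed
  ultimately show ?thesis using that[OF gc gS'] tame unfolding J_def H2'_def by blast
qed

end

section \<open>The Chabauty topology\<close>

lemma openin_chabauty_trace:
  assumes "finite A" "A \<subseteq> carrier \<Gamma>"
  shows "openin (chabauty \<Gamma>) {H'. subgroup H' \<Gamma> \<and> H' \<inter> A = H \<inter> A}"
  using assms
proof (induction A rule: finite_induct)
  case empty
  then show ?case using openin_topspace[of "chabauty \<Gamma>"] by (simp add: topspace_chabauty)
next
  case (insert a A)
  let ?N = "if a \<in> H then {H. subgroup H \<Gamma> \<and> a \<in> H} else {H. subgroup H \<Gamma> \<and> a \<notin> H}"
  have "openin (chabauty \<Gamma>) ?N" using openin_chabauty_basic[of a \<Gamma>] insert.prems by simp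
  then have "openin (chabauty \<Gamma>) ({H'. subgroup H' \<Gamma> \<and> H' \<inter> A = H \<inter> A} \<inter> ?N)"
    using insert by (intro openin_Int) auto
  moreover have "{H'. subgroup H' \<Gamma> \<and> H' \<inter> A = H \<inter> A} \<inter> ?N = {H'. subgroup H' \<Gamma> \<and> H' \<inter> insert a A = H \<inter> insert a A}"
    using insert.hyps(2) by (cases "a \<in> H") auto
  ultimately show ?case by simp
qed

text \<open>A basic open set of the product constrains finitely many coordinates, so neighbourhoods
  are described by traces on finite sets. All later topology uses this form.\<close>

lemma openin_chabauty_iff:
  "openin (chabauty \<Gamma>) U \<longleftrightarrow> U \<subseteq> {H. subgroup H \<Gamma>} \<and>
     (\<forall>H\<in>U. \<exists>A. finite A \<and> A \<subseteq> carrier \<Gamma> \<and> (\<forall>H'. subgroup H' \<Gamma> \<longrightarrow> H' \<inter> A = H \<inter> A \<longrightarrow> H' \<in> U))"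
proof
  assume U: "openin (chabauty \<Gamma>) U"
  let ?f = "\<lambda>H. \<lambda>g\<in>carrier \<Gamma>. g \<in> H"
  let ?T = "product_topology (\<lambda>_. discrete_topology (UNIV :: bool set)) (carrier \<Gamma>)"
  obtain W where W: "openin ?T W" "U = ?f -` W \<inter> {H. subgroup H \<Gamma>}"
    using U unfolding chabauty_def openin_pullback_topology by blast
  show "U \<subseteq> {H. subgroup H \<Gamma>} \<and>
     (\<forall>H\<in>U. \<exists>A. finite A \<and> A \<subseteq> carrier \<Gamma> \<and> (\<forall>H'. subgroup H' \<Gamma> \<longrightarrow> H' \<inter> A = H \<inter> A \<longrightarrow> H' \<in> U))"
  proof (intro conjI ballI)
    show "U \<subseteq> {H. subgroup H \<Gamma>}" using W by blast
    fix H assume "H \<in> U"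
    then have "?f H \<in> W" using W by blast
    then obtain X where X: "finite {i \<in> carrier \<Gamma>. X i \<noteq> UNIV}" "?f H \<in> Pi\<^sub>E (carrier \<Gamma>) X" "Pi\<^sub>E (carrier \<Gamma>) X \<subseteq> W"
      using W(1) unfolding openin_product_topology_alt by force
    let ?A = "{i \<in> carrier \<Gamma>. X i \<noteq> UNIV}"
    have "H' \<in> U" if H': "subgroup H' \<Gamma>" "H' \<inter> ?A = H \<inter> ?A" for H'
    proof -
      have "?f H' i \<in> X i" if i: "i \<in> carrier \<Gamma>" for i
      proof (cases "X i = UNIV")
        case False
        then have "i \<in> H' \<longleftrightarrow> i \<in> H" using H'(2) i by blast
        then show ?thesis using X(2) i by (auto simp: PiE_iff)
      qed simp
      then have "?f H' \<in> Pi\<^sub>E (carrier \<Gamma>) X" by (auto simp: PiE_iff)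
      then show ?thesis using X(3) W(2) H'(1) by blast
    qed
    then show "\<exists>A. finite A \<and> A \<subseteq> carrier \<Gamma> \<and> (\<forall>H'. subgroup H' \<Gamma> \<longrightarrow> H' \<inter> A = H \<inter> A \<longrightarrow> H' \<in> U)"
      using X(1) by (intro exI[of _ ?A]) auto
  qed
next
  assume U: "U \<subseteq> {H. subgroup H \<Gamma>} \<and>
     (\<forall>H\<in>U. \<exists>A. finite A \<and> A \<subseteq> carrier \<Gamma> \<and> (\<forall>H'. subgroup H' \<Gamma> \<longrightarrow> H' \<inter> A = H \<inter> A \<longrightarrow> H' \<in> U))"
  show "openin (chabauty \<Gamma>) U"
  proof (subst openin_subopen, intro ballI)
    fix H assume H: "H \<in> U"
    then obtain A where A: "finite A" "A \<subseteq> carrier \<Gamma>" "\<forall>H'. subgroup H' \<Gamma> \<longrightarrow> H' \<inter> A = H \<inter> A \<longrightarrow> H' \<in> U"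
      using U by blast
    then show "\<exists>T. openin (chabauty \<Gamma>) T \<and> H \<in> T \<and> T \<subseteq> U"
      using openin_chabauty_trace[OF A(1,2), of H] H U
      by (intro exI[of _ "{H'. subgroup H' \<Gamma> \<and> H' \<inter> A = H \<inter> A}"]) auto
  qed
qed

lemma in_closure_chabauty:
  "H \<in> chabauty \<Gamma> closure_of Y \<longleftrightarrow> subgroup H \<Gamma> \<and>
     (\<forall>A. finite A \<longrightarrow> A \<subseteq> carrier \<Gamma> \<longrightarrow> (\<exists>H'\<in>Y. subgroup H' \<Gamma> \<and> H' \<inter> A = H \<inter> A))"
proof
  assume *: "H \<in> chabauty \<Gamma> closure_of Y"
  show "subgroup H \<Gamma> \<and> (\<forall>A. finite A \<longrightarrow> A \<subseteq> carrier \<Gamma> \<longrightarrow> (\<exists>H'\<in>Y. subgroup H' \<Gamma> \<and> H' \<inter> A = H \<inter> A))"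
  proof (intro conjI allI impI)
    show H: "subgroup H \<Gamma>" using * by (simp add: in_closure_of topspace_chabauty)
    fix A assume A: "finite A" "A \<subseteq> carrier \<Gamma>"
    have "\<exists>y. y \<in> Y \<and> y \<in> T" if "H \<in> T" "openin (chabauty \<Gamma>) T" for T
      using * that by (simp add: in_closure_of)
    from this[OF _ openin_chabauty_trace[OF A, of H]] H
    show "\<exists>H'\<in>Y. subgroup H' \<Gamma> \<and> H' \<inter> A = H \<inter> A" by auto
  qed
next
  assume *: "subgroup H \<Gamma> \<and> (\<forall>A. finite A \<longrightarrow> A \<subseteq> carrier \<Gamma> \<longrightarrow> (\<exists>H'\<in>Y. subgroup H' \<Gamma> \<and> H' \<inter> A = H \<inter> A))"
  show "H \<in> chabauty \<Gamma> closure_of Y"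
    unfolding in_closure_of topspace_chabauty
  proof (intro conjI allI impI)
    fix T assume "H \<in> T \<and> openin (chabauty \<Gamma>) T"
    then obtain A where "finite A" "A \<subseteq> carrier \<Gamma>" "\<forall>H'. subgroup H' \<Gamma> \<longrightarrow> H' \<inter> A = H \<inter> A \<longrightarrow> H' \<in> T"
      unfolding openin_chabauty_iff by blast
    moreover from this * obtain H' where "H' \<in> Y" "subgroup H' \<Gamma>" "H' \<inter> A = H \<inter> A" by metis
    ultimately show "\<exists>y. y \<in> Y \<and> y \<in> T" by metis
  qed (use * in simp)
qed

lemma perfect_kernel_subset: "H \<in> perfect_kernel \<Gamma> \<Longrightarrow> subgroup H \<Gamma>"
  using closedin_subset[OF closedin_perfect_kernel_of[of "chabauty \<Gamma>"]]
  by (auto simp: perfect_kernel_def topspace_chabauty)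

text \<open>The closure of a set without isolated points has none either, so \<open>Y\<close> itself
  need not be closed.\<close>

lemma closure_subset_perfect_kernel:
  assumes sub: "\<And>H. H \<in> Y \<Longrightarrow> subgroup H \<Gamma>"
    and dense: "\<And>H A. H \<in> Y \<Longrightarrow> finite A \<Longrightarrow> A \<subseteq> carrier \<Gamma> \<Longrightarrow> \<exists>H'\<in>Y. H' \<noteq> H \<and> H' \<inter> A = H \<inter> A"
  shows "chabauty \<Gamma> closure_of Y \<subseteq> perfect_kernel \<Gamma>"
proof -
  let ?X = "chabauty \<Gamma>"
  have top: "Y \<subseteq> topspace ?X" using sub by (auto simp: topspace_chabauty)
  have "Y \<subseteq> ?X derived_set_of Y"
  proof
    fix H assume H: "H \<in> Y"
    show "H \<in> ?X derived_set_of Y"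
      unfolding in_derived_set_of
    proof (intro conjI allI impI)
      fix T assume "H \<in> T \<and> openin ?X T"
      then obtain A where A: "finite A" "A \<subseteq> carrier \<Gamma>" "\<forall>H'. subgroup H' \<Gamma> \<longrightarrow> H' \<inter> A = H \<inter> A \<longrightarrow> H' \<in> T"
        unfolding openin_chabauty_iff by blast
      obtain H' where "H' \<in> Y" "H' \<noteq> H" "H' \<inter> A = H \<inter> A" using dense[OF H A(1,2)] by blast
      then show "\<exists>y. y \<noteq> H \<and> y \<in> Y \<and> y \<in> T" using A(3) sub by blast
    qed (use H top in blast)
  qed
  then have "?X closure_of Y \<subseteq> ?X derived_set_of Y" using top by (auto simp: closure_of)
  also have "\<dots> \<subseteq> ?X derived_set_of (?X closure_of Y)"
    by (rule derived_set_of_mono[OF closure_of_subset[OF top]])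
  finally show ?thesis unfolding perfect_kernel_def by (rule perfect_kernel_of_greatest[OF closedin_closure_of])
qed

text \<open>
  Above such an \<open>H\<close> the ascending chain condition holds, so a set containing \<open>H\<close> has a maximal element
  above \<open>H\<close>; being finitely generated, this element is isolated.
\<close>

lemma (in group) not_in_perfect_kernel:
  assumes fg: "\<And>H'. subgroup H' G \<Longrightarrow> H \<subseteq> H' \<Longrightarrow> fg_subgroup G H'"
  shows "H \<notin> perfect_kernel G"
proof
  assume H: "H \<in> perfect_kernel G"
  let ?\<A> = "{H' \<in> perfect_kernel G. H \<subseteq> H'}"
  have ne: "?\<A> \<noteq> {}" using H by blast
  have "\<exists>M\<in>?\<A>. \<forall>X\<in>?\<A>. M \<subseteq> X \<longrightarrow> X = M"
  proof (rule subset_Zorn_nonempty[OF ne])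
    fix \<C> assume \<C>: "\<C> \<noteq> {}" "subset.chain ?\<A> \<C>"
    have sub: "\<And>K. K \<in> \<C> \<Longrightarrow> subgroup K G" "\<And>K. K \<in> \<C> \<Longrightarrow> H \<subseteq> K"
      using \<C>(2) perfect_kernel_subset[of _ G] by (auto simp: subset_chain_def)
    have ch: "\<And>K L. K \<in> \<C> \<Longrightarrow> L \<in> \<C> \<Longrightarrow> K \<subseteq> L \<or> L \<subseteq> K"
      using \<C>(2) by (auto simp: subset_chain_def)
    have "subgroup (\<Union>\<C>) G" by (rule subgroup_Union_chain[OF \<C>(1) sub(1) ch])
    moreover have "H \<subseteq> \<Union>\<C>" using \<C>(1) sub(2) by blast
    \<comment> \<open>The union contains \<open>H\<close>, hence is finitely generated and equal to
      a member of the chain, which also puts it into the perfect kernel.\<close>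
    ultimately have "\<Union>\<C> \<in> \<C>" using fg_subgroup_chain[OF fg refl \<C>(1) sub(1) ch] by blast
    then show "\<Union>\<C> \<in> ?\<A>" using \<C>(2) unfolding subset_chain_def by blast
  qed
  then obtain M where M': "M \<in> ?\<A>" "\<forall>X\<in>?\<A>. M \<subseteq> X \<longrightarrow> X = M" by (rule bexE)
  then have M: "M \<in> perfect_kernel G" "H \<subseteq> M" by simp_all
  have max: "X = M" if "X \<in> perfect_kernel G" "M \<subseteq> X" for X
    using M'(2) M(2) that by simp
  obtain A where A: "finite A" "A \<subseteq> M" "M \<subseteq> carrier G" "generate G A = M"
    using fg[OF perfect_kernel_subset[OF M(1)] M(2)] by (rule fg_subgroupE)
  have "M \<in> chabauty G derived_set_of perfect_kernel G"
    using perfect_kernel_of_subset_derived[of "chabauty G"] M(1) by (auto simp: perfect_kernel_def)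
  then have der: "\<exists>y. y \<noteq> M \<and> y \<in> perfect_kernel G \<and> y \<in> T" if "M \<in> T" "openin (chabauty G) T" for T
    using that by (simp add: in_derived_set_of)
  have "openin (chabauty G) {H'. subgroup H' G \<and> H' \<inter> A = M \<inter> A}"
    using openin_chabauty_trace[OF A(1) subset_trans[OF A(2,3)]] .
  from der[OF _ this] obtain X where X: "X \<noteq> M" "X \<in> perfect_kernel G" "subgroup X G" "X \<inter> A = M \<inter> A"
    using perfect_kernel_subset[OF M(1)] by auto
  have "A \<subseteq> X" using A(2) X(4) by blast
  then have "M \<subseteq> X" using A(4) generate_subgroup_incl[OF \<open>A \<subseteq> X\<close> X(3)] by simp
  then show False using max[OF X(2)] X(1) by simp
qed

section \<open>Subgroups of integer lattices\<close>

lemma zlattice_simps [simp]: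
  "carrier zlattice = UNIV" "v \<otimes>\<^bsub>zlattice\<^esub> w = v + w" "\<one>\<^bsub>zlattice\<^esub> = 0"
  by (simp_all add: zlattice_def)

lemma inv_zlattice [simp]: "inv\<^bsub>zlattice\<^esub> v = - v"
  by (rule group.inv_equality[OF group_zlattice]) auto

lemma subgroup_zlatticeD:
  assumes "subgroup \<Lambda> zlattice"
  shows "0 \<in> \<Lambda>" "v \<in> \<Lambda> \<Longrightarrow> w \<in> \<Lambda> \<Longrightarrow> v + w \<in> \<Lambda>" "v \<in> \<Lambda> \<Longrightarrow> - v \<in> \<Lambda>" "v \<in> \<Lambda> \<Longrightarrow> w \<in> \<Lambda> \<Longrightarrow> v - w \<in> \<Lambda>"
    "v \<in> \<Lambda> \<Longrightarrow> k *s v \<in> \<Lambda>"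
proof -
  show 0: "0 \<in> \<Lambda>" using subgroup.one_closed[OF assms] by simp
  show add: "v + w \<in> \<Lambda>" if "v \<in> \<Lambda>" "w \<in> \<Lambda>" for v w using subgroup.m_closed[OF assms that] by simp
  show neg: "- v \<in> \<Lambda>" if "v \<in> \<Lambda>" for v using subgroup.m_inv_closed[OF assms that] by simp
  show "v - w \<in> \<Lambda>" if "v \<in> \<Lambda>" "w \<in> \<Lambda>" using add[OF that(1) neg[OF that(2)]] by simp
  have nat: "int n *s v \<in> \<Lambda>" if "v \<in> \<Lambda>" for n v
  proof (induction n)
    case (Suc n)
    have "int (Suc n) *s v = int n *s v + v" by (simp add: vec_eq_iff algebra_simps)
    then show ?case using add[OF Suc that] by (simp only:)
  qed (use 0 in \<open>simp add: vec_eq_iff zero_vec_def\<close>)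
  show "k *s v \<in> \<Lambda>" if "v \<in> \<Lambda>"
  proof (cases "k \<ge> 0")
    case True
    then show ?thesis using nat[OF that, of "nat k"] by simp
  next
    case False
    then have "k *s v = - (int (nat (- k)) *s v)" by (simp add: vec_eq_iff)
    then show ?thesis using neg[OF nat[OF that, of "nat (- k)"]] by simp
  qed
qed

lemma subgroup_zlatticeI:
  assumes "0 \<in> \<Lambda>" "\<And>v w. v \<in> \<Lambda> \<Longrightarrow> w \<in> \<Lambda> \<Longrightarrow> v - w \<in> \<Lambda>"
  shows "subgroup \<Lambda> zlattice"
proof (rule group.subgroupI[OF group_zlattice])
  have neg: "- v \<in> \<Lambda>" if "v \<in> \<Lambda>" for v using assms(2)[OF assms(1) that] by simp
  show "inv\<^bsub>zlattice\<^esub> v \<in> \<Lambda>" if "v \<in> \<Lambda>" for v using neg[OF that] by simp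
  show "v \<otimes>\<^bsub>zlattice\<^esub> w \<in> \<Lambda>" if "v \<in> \<Lambda>" "w \<in> \<Lambda>" for v w using assms(2)[OF that(1) neg[OF that(2)]] by simp
qed (use assms(1) in auto)

text \<open>The \<open>i\<close>-th coordinates of \<open>\<Lambda>\<close> form an ideal of the
  integers; \<open>w\<close> realizes a generator, found as a nonzero coordinate of least absolute
  value.\<close>

lemma coordinate_generator:
  fixes \<Lambda> :: "(int ^ 'd) set"
  assumes \<Lambda>: "subgroup \<Lambda> zlattice" and ne: "\<exists>v\<in>\<Lambda>. v $ i \<noteq> 0"
  obtains w where "w \<in> \<Lambda>" "w $ i \<noteq> 0" "\<And>v. v \<in> \<Lambda> \<Longrightarrow> w $ i dvd v $ i"
proof -
  obtain v where v: "v \<in> \<Lambda>" "v $ i \<noteq> 0" using ne by blast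
  obtain w where w: "w \<in> \<Lambda> \<and> w $ i \<noteq> 0"
    and min: "\<And>u. u \<in> \<Lambda> \<and> u $ i \<noteq> 0 \<Longrightarrow> nat \<bar>w $ i\<bar> \<le> nat \<bar>u $ i\<bar>"
    using ex_has_least_nat[of "\<lambda>w. w \<in> \<Lambda> \<and> w $ i \<noteq> 0" v "\<lambda>w. nat \<bar>w $ i\<bar>"] v by blast
  have "w $ i dvd u $ i" if "u \<in> \<Lambda>" for u
  proof -
    define r where "r = u - (u $ i div w $ i) *s w"
    have "r \<in> \<Lambda>"
      unfolding r_def using subgroup_zlatticeD(4)[OF \<Lambda> that subgroup_zlatticeD(5)[OF \<Lambda>]] w by simp
    moreover have ri: "r $ i = u $ i mod w $ i" by (simp add: r_def minus_div_mult_eq_mod)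
    moreover have "\<bar>u $ i mod w $ i\<bar> < \<bar>w $ i\<bar>" using w by (intro abs_mod_less) simp
    ultimately have "r $ i = 0" using min[of r] by force
    then show ?thesis using ri by auto
  qed
  then show ?thesis using that w by blast
qed

text \<open>Induction on the set \<open>I\<close> of coordinates that may be nonzero: a vector
  realizing the generator of the \<open>i\<close>-th coordinates is added to generators of the
  subgroup where that coordinate vanishes.\<close>

lemma fg_subgroup_zlattice:
  fixes \<Lambda> :: "(int ^ 'd) set"
  assumes "subgroup \<Lambda> zlattice"
  shows "fg_subgroup zlattice \<Lambda>"
proof -
  have "\<exists>A. finite A \<and> A \<subseteq> \<Lambda> \<and> (\<forall>M. subgroup M zlattice \<longrightarrow> A \<subseteq> M \<longrightarrow> \<Lambda> \<subseteq> M)"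
    if "finite I" "subgroup \<Lambda> zlattice" "\<And>v i. v \<in> \<Lambda> \<Longrightarrow> i \<notin> I \<Longrightarrow> v $ i = 0" for I and \<Lambda> :: "(int ^ 'd) set"
    using that
  proof (induction I arbitrary: \<Lambda> rule: finite_induct)
    case empty
    then have "v = 0" if "v \<in> \<Lambda>" for v using that by (simp add: vec_eq_iff)
    then have "\<Lambda> \<subseteq> {0}" by blast
    then show ?case using subgroup_zlatticeD(1) by (intro exI[of _ "{}"]) blast
  next
    case (insert i I)
    show ?case
    proof (cases "\<exists>v\<in>\<Lambda>. v $ i \<noteq> 0")
      case False
      then have "v $ j = 0" if "v \<in> \<Lambda>" "j \<notin> I" for v j
        using that insert.prems(2)[of v j] by (cases "j = i") auto
      then show ?thesis by (rule insert.IH[OF insert.prems(1)])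
    next
      case True
      then obtain w where w: "w \<in> \<Lambda>" "w $ i \<noteq> 0" "\<And>v. v \<in> \<Lambda> \<Longrightarrow> w $ i dvd v $ i"
        using coordinate_generator[OF insert.prems(1)] by metis
      define \<Lambda>' where "\<Lambda>' = {v \<in> \<Lambda>. v $ i = 0}"
      have "subgroup \<Lambda>' zlattice"
        using subgroup_zlatticeD[OF insert.prems(1)] by (intro subgroup_zlatticeI) (auto simp: \<Lambda>'_def)
      moreover have "v $ j = 0" if "v \<in> \<Lambda>'" "j \<notin> I" for v j
        using that insert.prems(2)[of v j] by (cases "j = i") (auto simp: \<Lambda>'_def)
      ultimately have "\<exists>A. finite A \<and> A \<subseteq> \<Lambda>' \<and> (\<forall>M. subgroup M zlattice \<longrightarrow> A \<subseteq> M \<longrightarrow> \<Lambda>' \<subseteq> M)"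
        by (rule insert.IH)
      then obtain A where A: "finite A" "A \<subseteq> \<Lambda>'" "\<And>M. subgroup M zlattice \<Longrightarrow> A \<subseteq> M \<Longrightarrow> \<Lambda>' \<subseteq> M"
        by auto
      have "\<Lambda> \<subseteq> M" if M: "subgroup M zlattice" "insert w A \<subseteq> M" for M
      proof
        fix v assume v: "v \<in> \<Lambda>"
        obtain k where k: "v $ i = w $ i * k" using w(3)[OF v] by (auto simp: dvd_def)
        have "v - k *s w \<in> \<Lambda>'"
          using subgroup_zlatticeD[OF insert.prems(1)] v w(1) k by (simp add: \<Lambda>'_def)
        then have "v - k *s w \<in> M" using A(3)[of M] M by blast
        moreover have "k *s w \<in> M" using M subgroup_zlatticeD(5)[OF M(1)] by blast
        ultimately have "(v - k *s w) + k *s w \<in> M" by (rule subgroup_zlatticeD(2)[OF M(1)])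
        then show "v \<in> M" by simp
      qed
      moreover have "insert w A \<subseteq> \<Lambda>" using A w by (auto simp: \<Lambda>'_def)
      ultimately show ?thesis using A(1) by (intro exI[of _ "insert w A"]) auto
    qed
  qed
  from this[OF finite[of UNIV] assms] obtain A
    where A: "finite A" "A \<subseteq> \<Lambda>" "\<And>M. subgroup M zlattice \<Longrightarrow> A \<subseteq> M \<Longrightarrow> \<Lambda> \<subseteq> M" by auto
  interpret Z: group "zlattice :: (int ^ 'd) monoid" by (rule group_zlattice)
  have "subgroup (generate zlattice A) zlattice" by (rule Z.generate_is_subgroup) simp
  moreover have "A \<subseteq> generate zlattice A" by (auto intro: generate.incl)
  ultimately have "generate zlattice A = \<Lambda>" using A Z.generate_subgroup_incl[OF A(2) assms] by blast
  then show ?thesis using A(1) by (auto simp: fg_subgroup_def)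
qed

text \<open>The quotient by \<open>\<Lambda>\<close> is residually finite: some \<open>n\<close>
  keeps \<open>v\<close> out of the sum of \<open>\<Lambda>\<close> and \<open>n\<close> times the
  full lattice. The induction runs over the coordinates allowed to be nonzero, and the shift
  \<open>z\<close> is restricted to them as well.\<close>

lemma zlattice_residually_finite:
  fixes \<Lambda> :: "(int ^ 'd) set"
  assumes "subgroup \<Lambda> zlattice" "v \<notin> \<Lambda>"
  obtains n :: int where "n > 0" "\<And>z. v - n *s z \<notin> \<Lambda>"
proof -
  have "\<exists>n>0. \<forall>z. (\<forall>i. i \<notin> I \<longrightarrow> z $ i = 0) \<longrightarrow> v - n *s z \<notin> \<Lambda>"
    if "finite I" "subgroup \<Lambda> zlattice" "\<And>v i. v \<in> \<Lambda> \<Longrightarrow> i \<notin> I \<Longrightarrow> v $ i = 0"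
      "\<And>i. i \<notin> I \<Longrightarrow> v $ i = 0" "v \<notin> \<Lambda>" for I and \<Lambda> :: "(int ^ 'd) set" and v
    using that
  proof (induction I arbitrary: \<Lambda> v rule: finite_induct)
    case empty
    then have "v = 0" by (simp add: vec_eq_iff)
    then show ?case using empty subgroup_zlatticeD(1) by blast
  next
    case (insert i I)
    note \<Lambda> = subgroup_zlatticeD[OF insert.prems(1)]
    define \<Lambda>' where "\<Lambda>' = {v \<in> \<Lambda>. v $ i = 0}"
    have s\<Lambda>': "subgroup \<Lambda>' zlattice" using \<Lambda> by (intro subgroup_zlatticeI) (auto simp: \<Lambda>'_def)
    have supp: "u $ j = 0" if "u \<in> \<Lambda>'" "j \<notin> I" for u j
      using that insert.prems(2)[of u j] by (cases "j = i") (auto simp: \<Lambda>'_def)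
    show ?case
    proof (cases "\<exists>u\<in>\<Lambda>. u $ i \<noteq> 0")
      case False
      show ?thesis
      proof (cases "v $ i = 0")
        case True
        then have vI: "\<And>j. j \<notin> I \<Longrightarrow> v $ j = 0" using insert.prems(3) by (metis insertE)
        have "v \<notin> \<Lambda>'" using insert.prems(4) by (simp add: \<Lambda>'_def)
        from insert.IH[OF s\<Lambda>' supp vI this]
        obtain n where n: "n > 0" "\<And>z. (\<forall>j. j \<notin> I \<longrightarrow> z $ j = 0) \<Longrightarrow> v - n *s z \<notin> \<Lambda>'"
          by auto
        have "v - n *s z \<notin> \<Lambda>" if z: "\<forall>j. j \<notin> insert i I \<longrightarrow> z $ j = 0" for z
        proof
          assume *: "v - n *s z \<in> \<Lambda>"
          then have e: "(v - n *s z) $ i = 0" using False by blast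
          then have "z $ i = 0" using True n(1) by simp
          then have "\<forall>j. j \<notin> I \<longrightarrow> z $ j = 0" using z by auto
          moreover have "v - n *s z \<in> \<Lambda>'" using * e unfolding \<Lambda>'_def by blast
          ultimately show False using n(2) by blast
        qed
        then show ?thesis using n(1) by blast
      next
        case vi: False
        \<comment> \<open>Here the \<open>i\<close>-th coordinate vanishes on
          \<open>\<Lambda>\<close>, so membership would make the modulus divide
          \<open>v $ i\<close>. The factor 2 excludes this even if \<open>v $ i\<close> is a
          unit.\<close>
        have "v - (2 * \<bar>v $ i\<bar>) *s z \<notin> \<Lambda>" for z
        proof
          assume "v - (2 * \<bar>v $ i\<bar>) *s z \<in> \<Lambda>"
          then have "(v - (2 * \<bar>v $ i\<bar>) *s z) $ i = 0" using False by blast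
          then have "v $ i = 2 * \<bar>v $ i\<bar> * z $ i" by simp
          then have "2 * \<bar>v $ i\<bar> dvd v $ i" by (metis dvd_triv_left)
          then have "\<bar>2 * \<bar>v $ i\<bar>\<bar> \<le> \<bar>v $ i\<bar>" using vi by (intro dvd_imp_le_int)
          then show False using vi by simp
        qed
        then show ?thesis using vi by (intro exI[of _ "2 * \<bar>v $ i\<bar>"]) auto
      qed
    next
      case True
      then obtain w where w: "w \<in> \<Lambda>" "w $ i \<noteq> 0" "\<And>v. v \<in> \<Lambda> \<Longrightarrow> w $ i dvd v $ i"
        using coordinate_generator[OF insert.prems(1)] by metis
      show ?thesis
      proof (cases "w $ i dvd v $ i")
        case False
        have "v - \<bar>w $ i\<bar> *s z \<notin> \<Lambda>" for z
        proof
          assume "v - \<bar>w $ i\<bar> *s z \<in> \<Lambda>"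
          then have "w $ i dvd v $ i - \<bar>w $ i\<bar> * z $ i" using w(3) by fastforce
          then have "w $ i dvd (v $ i - \<bar>w $ i\<bar> * z $ i) + \<bar>w $ i\<bar> * z $ i" by (intro dvd_add) auto
          then have "w $ i dvd v $ i" by simp
          then show False using False by blast
        qed
        then show ?thesis using w(2) by (intro exI[of _ "\<bar>w $ i\<bar>"]) auto
      next
        case True
        then obtain k where k: "v $ i = w $ i * k" by (auto simp: dvd_def)
        \<comment> \<open>Subtracting a multiple of \<open>w \<in> \<Lambda>\<close> clears the
          \<open>i\<close>-th coordinate without changing membership in \<open>\<Lambda>\<close>, so
          the induction hypothesis applies.\<close>
        define u where "u = v - k *s w"
        have "u \<notin> \<Lambda>"
        proof
          assume "u \<in> \<Lambda>"
          then have "u + k *s w \<in> \<Lambda>" using \<Lambda>(2,5) w(1) by blast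
          then show False using insert.prems(4) by (simp add: u_def)
        qed
        then have u\<Lambda>: "u \<notin> \<Lambda>'" by (simp add: \<Lambda>'_def)
        have uI: "u $ j = 0" if "j \<notin> I" for j
          using that insert.prems(3)[of j] insert.prems(2)[OF w(1), of j] k by (cases "j = i") (auto simp: u_def)
        from insert.IH[OF s\<Lambda>' supp uI u\<Lambda>]
        obtain n where n: "n > 0" "\<And>z. (\<forall>j. j \<notin> I \<longrightarrow> z $ j = 0) \<Longrightarrow> u - n *s z \<notin> \<Lambda>'"
          by auto
        \<comment> \<open>The extra factor \<open>\<bar>w $ i\<bar>\<close> makes the
          \<open>i\<close>-th coordinate of the shift divisible by \<open>w $ i\<close>, so an
          integral multiple of \<open>w\<close> can remove it.\<close>
        have "v - (\<bar>w $ i\<bar> * n) *s z \<notin> \<Lambda>" if z: "\<forall>j. j \<notin> insert i I \<longrightarrow> z $ j = 0" for z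
        proof
          assume *: "v - (\<bar>w $ i\<bar> * n) *s z \<in> \<Lambda>"
          define m where "m = sgn (w $ i) * n * z $ i"
          \<comment> \<open>Adding this multiple of \<open>w\<close> clears the \<open>i\<close>-th coordinate.\<close>
          define y where "y = \<bar>w $ i\<bar> *s z - (sgn (w $ i) * z $ i) *s w"
          have e: "u - n *s y = (v - (\<bar>w $ i\<bar> * n) *s z) + (m - k) *s w"
            by (simp add: u_def y_def m_def vec_eq_iff algebra_simps)
          have "u - n *s y \<in> \<Lambda>" unfolding e using * \<Lambda>(2,5) w(1) by blast
          moreover have yi: "y $ i = 0" by (simp add: y_def abs_sgn algebra_simps)
          moreover have "u $ i = 0" using k by (simp add: u_def)
          ultimately have "u - n *s y \<in> \<Lambda>'" by (simp add: \<Lambda>'_def)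
          moreover have "y $ j = 0" if "j \<notin> I" for j
            using that z insert.prems(2)[OF w(1), of j] yi by (cases "j = i") (auto simp: y_def)
          ultimately show False using n(2) by blast
        qed
        then show ?thesis using w(2) n(1) by (intro exI[of _ "\<bar>w $ i\<bar> * n"]) auto
      qed
    qed
  qed
  from this[of UNIV \<Lambda> v] assms show ?thesis using that by auto
qed

text \<open>Some positive multiple of each unit vector lies in \<open>\<Lambda>\<close>, and
  \<open>m\<close> is the product of the factors. Finite index is used in this form because the
  multiples of \<open>m\<close> are preserved by every integral matrix.\<close>

lemma finite_index_zlattice_multiple:
  fixes \<Lambda> :: "(int ^ 'd) set"
  assumes \<Lambda>: "subgroup \<Lambda> zlattice" and fin: "finite_index \<Lambda> zlattice"
  obtains m :: int where "m > 0" "\<And>v. m *s v \<in> \<Lambda>"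
proof -
  interpret Z: group "zlattice :: (int ^ 'd) monoid" by (rule group_zlattice)
  have pow: "v [^]\<^bsub>zlattice\<^esub> n = int n *s v" for v :: "int ^ 'd" and n :: nat
  proof (induction n)
    case (Suc n)
    then show ?case by (simp add: vec_eq_iff algebra_simps)
  qed (simp add: vec_eq_iff)
  have "\<exists>n>0. int n *s v \<in> \<Lambda>" for v :: "int ^ 'd"
    using Z.finite_index_pow[OF \<Lambda> fin, of v] by (metis UNIV_I zlattice_simps(1) pow)
  then have "\<forall>i::'d. \<exists>n::nat. n > 0 \<and> int n *s axis i 1 \<in> \<Lambda>" by blast
  from choice[OF this] obtain n :: "'d \<Rightarrow> nat" where n: "\<And>i. n i > 0 \<and> int (n i) *s axis i 1 \<in> \<Lambda>" by blast
  define m where "m = (\<Prod>i\<in>UNIV. int (n i))"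
  have m0: "m > 0" unfolding m_def using n by (intro prod_pos) simp
  have mi: "m *s axis i 1 \<in> \<Lambda>" for i
  proof -
    have "int (n i) dvd m" unfolding m_def by (intro dvd_prodI) auto
    then obtain k where "m = k * int (n i)" by (metis dvd_def mult.commute)
    then have "m *s axis i 1 = k *s (int (n i) *s axis i 1)" by (simp add: vec_eq_iff algebra_simps)
    then show ?thesis using subgroup_zlatticeD(5)[OF \<Lambda>] n by metis
  qed
  have "m *s v \<in> \<Lambda>" for v
  proof -
    have trm: "(m *s v) $ i *s axis i 1 \<in> \<Lambda>" for i
    proof -
      have "(m *s v) $ i *s axis i 1 = v $ i *s (m *s axis i 1)" by (simp add: vec_eq_iff algebra_simps)
      then show ?thesis using subgroup_zlatticeD(5)[OF \<Lambda> mi] by (simp only:)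
    qed
    have sum: "(\<Sum>i\<in>I. (m *s v) $ i *s axis i 1) \<in> \<Lambda>" if "finite I" for I
      using that
    proof (induction I rule: finite_induct)
      case (insert i I)
      show ?case unfolding sum.insert[OF insert.hyps] by (rule subgroup_zlatticeD(2)[OF \<Lambda> trm insert.IH])
    qed (use subgroup_zlatticeD(1)[OF \<Lambda>] in simp)
    show ?thesis using sum[OF finite[of UNIV]] unfolding basis_expansion .
  qed
  then show ?thesis using that m0 by blast
qed

lemma matrix_vector_scale: "(M :: int ^ 'd ^ 'd) *v (n *s z) = n *s (M *v z)"
  by (simp add: vec_eq_iff matrix_vector_mult_def sum_distrib_left algebra_simps)

lemma subgroup_UNIV: "subgroup UNIV (zlattice :: (int ^ 'd) monoid)"
  by (rule subgroup_zlatticeI) simp_all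

text \<open>Reducing coordinates modulo \<open>m\<close> shows that such a subgroup is determined by
  its trace on the finite box \<open>X\<close>.\<close>

lemma finite_subgroups_above:
  assumes m: "m > (0 :: int)"
  shows "finite {\<Lambda> :: (int ^ 'd) set. subgroup \<Lambda> zlattice \<and> (\<forall>v. m *s v \<in> \<Lambda>)}" (is "finite ?C")
proof -
  define X :: "(int ^ 'd) set" where "X = {v. \<forall>i. v $ i \<in> {0..<m}}"
  have "X \<subseteq> (\<lambda>f. \<chi> i. f i) ` (UNIV \<rightarrow>\<^sub>E {0..<m})"
  proof
    fix v assume "v \<in> X"
    then have "v = (\<chi> i. (($) v) i)" "(($) v) \<in> UNIV \<rightarrow>\<^sub>E {0..<m}" by (auto simp: X_def)
    then show "v \<in> (\<lambda>f. \<chi> i. f i) ` (UNIV \<rightarrow>\<^sub>E {0..<m})" by (rule image_eqI)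
  qed
  then have finX: "finite X" by (rule finite_subset) (simp add: finite_PiE)
  have "inj_on (\<lambda>\<Lambda>. \<Lambda> \<inter> X) ?C"
  proof (rule inj_onI)
    have key: "v \<in> \<Lambda>'" if L: "\<Lambda> \<in> ?C" "\<Lambda>' \<in> ?C" "\<Lambda> \<inter> X = \<Lambda>' \<inter> X" "v \<in> \<Lambda>" for \<Lambda> \<Lambda>' v
    proof -
      define q where "q = (\<chi> i. v $ i div m)"
      define r where "r = v - m *s q"
      have "r \<in> X" using m by (simp add: r_def q_def X_def minus_mult_div_eq_mod)
      moreover have "r \<in> \<Lambda>" using L(1,4) subgroup_zlatticeD(4) unfolding r_def by blast
      ultimately have "r \<in> \<Lambda>'" using L(3) by blast
      moreover have "m *s q \<in> \<Lambda>'" using L(2) by blast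
      ultimately have "r + m *s q \<in> \<Lambda>'" using L(2) subgroup_zlatticeD(2) by blast
      then show ?thesis by (simp add: r_def)
    qed
    fix \<Lambda> \<Lambda>' assume "\<Lambda> \<in> ?C" "\<Lambda>' \<in> ?C" "\<Lambda> \<inter> X = \<Lambda>' \<inter> X"
    then show "\<Lambda> = \<Lambda>'" using key[of \<Lambda> \<Lambda>'] key[of \<Lambda>' \<Lambda>] by (intro subset_antisym subsetI) metis+
  qed
  moreover have "(\<lambda>\<Lambda>. \<Lambda> \<inter> X) ` ?C \<subseteq> Pow X" by blast
  ultimately show ?thesis using finX by (meson finite_Pow_iff finite_subset finite_imageD)
qed

section \<open>The perfect kernels\<close>

text \<open>In coordinates on \<open>S\<close> with two basis letters this is
  \<open>free_commuting_infinite_index\<close>. It makes the trivial and the cyclic subgroups of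
  \<open>S\<close> admissible projections of tame subgroups.\<close>

lemma noncyclic_commuting_infinite_index:
  fixes A :: "'a set"
  assumes S: "subgroup S (free_group A)" "\<not> cyclic_subgroup (free_group A) S"
    and C: "subgroup C (free_group A)" "C \<subseteq> S"
    and comm: "\<And>x y. x \<in> C \<Longrightarrow> y \<in> C \<Longrightarrow> x \<otimes>\<^bsub>free_group A\<^esub> y = y \<otimes>\<^bsub>free_group A\<^esub> x"
  shows "\<not> finite_index C (free_group A\<lparr>carrier := S\<rparr>)"
proof
  let ?FS = "free_group A\<lparr>carrier := S\<rparr>"
  assume fin: "finite_index C ?FS"
  interpret F: group "free_group A" by (rule group_free_group)
  obtain B :: "('a fword \<times> 'a) set" and \<psi> \<alpha> \<beta>
    where \<psi>: "\<psi> \<in> iso (free_group B) ?FS" and \<alpha>\<beta>: "\<alpha> \<in> B" "\<beta> \<in> B" "\<alpha> \<noteq> \<beta>"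
    using free_subgroup_noncyclic[OF S] by metis
  define \<phi> where "\<phi> = inv_into (carrier (free_group B)) \<psi>"
  have gS: "group ?FS" using F.subgroup_imp_group[OF S(1)] .
  have iso: "\<phi> \<in> iso ?FS (free_group B)"
    using group.iso_set_sym[OF group_free_group \<psi>] by (simp add: \<phi>_def)
  then interpret \<phi>: group_hom ?FS "free_group B" \<phi>
    using gS group_free_group[of B] by (simp add: group_hom_def group_hom_axioms_def iso_def)
  have sC: "subgroup C ?FS" using F.subgroup_incl[OF C(1) S(1) C(2)] .
  have "\<phi> ` carrier ?FS = carrier (free_group B)" using iso by (simp add: iso_def bij_betw_def)
  then have "finite_index (\<phi> ` C) (free_group B)" using \<phi>.finite_index_img[OF _ sC fin] by simp
  moreover have "\<phi> x \<otimes>\<^bsub>free_group B\<^esub> \<phi> y = \<phi> y \<otimes>\<^bsub>free_group B\<^esub> \<phi> x" if "x \<in> C" "y \<in> C" for x y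
    using \<phi>.hom_mult[of x y] \<phi>.hom_mult[of y x] comm[OF that] that C(2) by (simp add: subset_iff)
  ultimately show False
    using free_commuting_infinite_index[OF \<alpha>\<beta> \<phi>.subgroup_img_is_subgroup[OF sC]] by blast
qed

lemma (in group) conj_subgroup_self:
  assumes "subgroup H G" "h \<in> H" shows "conj_subgroup G h H = H"
proof
  interpret H: subgroup H G by fact
  show "conj_subgroup G h H \<subseteq> H" using assms(2) by (auto simp: conj_subgroup_image)
  show "H \<subseteq> conj_subgroup G h H"
  proof
    fix x assume x: "x \<in> H"
    have "inv h \<otimes> x \<otimes> h \<in> H" using x assms(2) by blast
    then show "x \<in> conj_subgroup G h H"
      using conj_subgroup_mem_iff[OF H.mem_carrier[OF assms(2)] H.mem_carrier[OF x] H.subset] by blast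
  qed
qed

section \<open>Lattice, projection and stabilizer of a subgroup of the semidirect product\<close>

context lattice_by_free
begin

lemma rho_mult_vec': "\<gamma> \<in> carrier F \<Longrightarrow> \<delta> \<in> carrier F \<Longrightarrow> \<rho> (\<gamma> \<otimes>\<^bsub>F\<^esub> \<delta>) *v v = \<rho> \<gamma> *v (\<rho> \<delta> *v v)"
  using rho_mult_vec[OF F.group_axioms \<rho>] .

lemma rho_one_vec: "\<rho> \<one>\<^bsub>F\<^esub> *v v = v"
  using rho_one[OF F.group_axioms \<rho>] by simp

lemma inv_G: "\<gamma> \<in> carrier F \<Longrightarrow> inv\<^bsub>G\<^esub> (v, \<gamma>) = (- (\<rho> (inv\<^bsub>F\<^esub> \<gamma>) *v v), inv\<^bsub>F\<^esub> \<gamma>)"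
  using inv_semidirect[OF F.group_axioms \<rho>] .

lemma lattice_act_mult:
  "\<gamma> \<in> carrier F \<Longrightarrow> \<delta> \<in> carrier F \<Longrightarrow> lattice_act \<rho> (\<gamma> \<otimes>\<^bsub>F\<^esub> \<delta>) \<Lambda> = lattice_act \<rho> \<gamma> (lattice_act \<rho> \<delta> \<Lambda>)"
  unfolding lattice_act_def image_image by (rule image_cong[OF refl]) (rule rho_mult_vec')

lemma lattice_act_one: "lattice_act \<rho> \<one>\<^bsub>F\<^esub> \<Lambda> = \<Lambda>"
  unfolding lattice_act_def rho_one_vec by simp

lemma lattice_act_inv:
  "\<gamma> \<in> carrier F \<Longrightarrow> lattice_act \<rho> (inv\<^bsub>F\<^esub> \<gamma>) (lattice_act \<rho> \<gamma> \<Lambda>) = \<Lambda>"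
  "\<gamma> \<in> carrier F \<Longrightarrow> lattice_act \<rho> \<gamma> (lattice_act \<rho> (inv\<^bsub>F\<^esub> \<gamma>) \<Lambda>) = \<Lambda>"
  using lattice_act_mult[of "inv\<^bsub>F\<^esub> \<gamma>" \<gamma> \<Lambda>] lattice_act_mult[of \<gamma> "inv\<^bsub>F\<^esub> \<gamma>" \<Lambda>] lattice_act_one[of \<Lambda>]
  by (simp_all del: mult_free_group one_free_group)

lemma mem_lattice_stab: "\<gamma> \<in> lattice_stab F \<rho> \<Lambda> \<longleftrightarrow> \<gamma> \<in> carrier F \<and> lattice_act \<rho> \<gamma> \<Lambda> = \<Lambda>"
  by (auto simp: lattice_stab_def stabilizer_def)

lemma subgroup_lattice_stab: "subgroup (lattice_stab F \<rho> \<Lambda>) F"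
proof (rule F.subgroupI)
  show "lattice_stab F \<rho> \<Lambda> \<subseteq> carrier F" by (auto simp: mem_lattice_stab)
  have "\<one>\<^bsub>F\<^esub> \<in> lattice_stab F \<rho> \<Lambda>" using lattice_act_one F.one_closed by (simp only: mem_lattice_stab)
  then show "lattice_stab F \<rho> \<Lambda> \<noteq> {}" by blast
next
  fix a assume a: "a \<in> lattice_stab F \<rho> \<Lambda>"
  then have "lattice_act \<rho> (inv\<^bsub>F\<^esub> a) \<Lambda> = \<Lambda>" using lattice_act_inv(1)[of a \<Lambda>] by (simp add: mem_lattice_stab)
  then show "inv\<^bsub>F\<^esub> a \<in> lattice_stab F \<rho> \<Lambda>" using a by (simp add: mem_lattice_stab)
next
  fix a b assume "a \<in> lattice_stab F \<rho> \<Lambda>" "b \<in> lattice_stab F \<rho> \<Lambda>"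
  then show "a \<otimes>\<^bsub>F\<^esub> b \<in> lattice_stab F \<rho> \<Lambda>"
    using lattice_act_mult[of a b \<Lambda>] F.m_closed[of a b] by (simp add: mem_lattice_stab)
qed

lemma conj_vertex:
  assumes "g \<in> carrier G"
  shows "conj_subgroup G g (\<Lambda> \<times> {\<one>\<^bsub>F\<^esub>}) = lattice_act \<rho> (snd g) \<Lambda> \<times> {\<one>\<^bsub>F\<^esub>}"
  using conj_subgroup_vertex[OF F.group_axioms \<rho>, of "snd g" "fst g" \<Lambda>] assms by (auto simp: carrier_G)

lemma V_subset: "V \<subseteq> carrier G"
  using subgroup.subset[OF subgroup_V] .

lemma conj_V:
  assumes "g \<in> carrier G" shows "conj_subgroup G g V = V"
proof -
  have "lattice_act \<rho> (snd g) UNIV = UNIV"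
  proof -
    have "v \<in> lattice_act \<rho> (snd g) UNIV" for v
    proof -
      have "v = \<rho> (snd g) *v (\<rho> (inv\<^bsub>F\<^esub> snd g) *v v)"
        using rho_mult_vec'[of "snd g" "inv\<^bsub>F\<^esub> snd g" v] assms rho_one_vec[of v]
        by (simp add: carrier_G mem_Times_iff del: mult_free_group one_free_group)
      then show ?thesis unfolding lattice_act_def by blast
    qed
    then show ?thesis by blast
  qed
  then show ?thesis using conj_vertex[OF assms, of UNIV] by (simp add: vertex_group_def)
qed

lemma Int_V_eq: "H \<inter> V = fst ` (H \<inter> V) \<times> {\<one>\<^bsub>F\<^esub>}"
  by (force simp: vertex_group_def)

lemma subgroup_fst_Int_V: "subgroup H G \<Longrightarrow> subgroup (fst ` (H \<inter> V)) zlattice"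
proof -
  assume "subgroup H G"
  then have "subgroup (H \<inter> V) G \<and> H \<inter> V \<subseteq> V" using G.subgroups_Inter_pair[OF _ subgroup_V] by blast
  then obtain \<Lambda> where "subgroup \<Lambda> zlattice" "H \<inter> V = \<Lambda> \<times> {\<one>\<^bsub>F\<^esub>}"
    using subgroup_vertex_iff[OF F.group_axioms \<rho>, of "H \<inter> V"] by blast
  then show ?thesis by simp
qed

lemma conj_Int_V:
  assumes "subgroup H G" "g \<in> carrier G"
  shows "conj_subgroup G g H \<inter> V = conj_subgroup G g (H \<inter> V)"
  using G.conj_subgroup_Int[OF assms(2) subgroup.subset[OF assms(1)] V_subset] conj_V[OF assms(2)] by simp

text \<open>An element of \<open>H\<close> normalizes both \<open>H\<close> and \<open>V\<close>,
  hence their intersection, on which it acts through its projection.\<close>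

lemma proj_subset_stab:
  assumes "subgroup H G" shows "snd ` H \<subseteq> lattice_stab F \<rho> (fst ` (H \<inter> V))"
proof
  fix \<gamma> assume "\<gamma> \<in> snd ` H"
  then obtain h where h: "h \<in> H" "\<gamma> = snd h" by blast
  have hc: "h \<in> carrier G" using subgroup.mem_carrier[OF assms h(1)] .
  let ?\<Lambda> = "fst ` (H \<inter> V)"
  have "conj_subgroup G h (H \<inter> V) = H \<inter> V"
    using conj_Int_V[OF assms hc] G.conj_subgroup_self[OF assms h(1)] by simp
  then have "lattice_act \<rho> (snd h) ?\<Lambda> \<times> {\<one>\<^bsub>F\<^esub>} = ?\<Lambda> \<times> {\<one>\<^bsub>F\<^esub>}"
    using conj_vertex[OF hc, of ?\<Lambda>] Int_V_eq[of H] by simp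
  then have "lattice_act \<rho> (snd h) ?\<Lambda> = ?\<Lambda>" by (simp add: times_eq_iff) blast
  then show "\<gamma> \<in> lattice_stab F \<rho> ?\<Lambda>" using h(2) hc by (simp add: mem_lattice_stab carrier_G mem_Times_iff)
qed

lemma subgroup_proj: "subgroup H G \<Longrightarrow> subgroup (snd ` H) F"
  by (rule proj.subgroup_img_is_subgroup)

text \<open>\<open>H\<close> is an extension of its projection by a lattice, and lattices are
  finitely generated: lifts of generators of the projection together with generators of the lattice
  suffice.\<close>

lemma fg_subgroup_G:
  assumes H: "subgroup H G" and fg: "fg_subgroup F (snd ` H)"
  shows "fg_subgroup G H"
proof -
  obtain X where X: "finite X" "X \<subseteq> snd ` H" "generate F X = snd ` H" using fg by (rule F.fg_subgroupE)
  obtain X' where X': "X' \<subseteq> H" "finite X'" "X = snd ` X'" using finite_subset_image[OF X(1,2)] by blast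
  obtain B where B: "finite B" "B \<subseteq> fst ` (H \<inter> V)" "generate zlattice B = fst ` (H \<inter> V)"
    using group.fg_subgroupE[OF group_zlattice fg_subgroup_zlattice[OF subgroup_fst_Int_V[OF H]]] by metis
  define B' where "B' = (\<lambda>v. (v, \<one>\<^bsub>F\<^esub>)) ` B"
  have B': "B' \<subseteq> H"
    using B(2) Int_V_eq[of H] unfolding B'_def by blast
  interpret H: subgroup H G by fact
  have sub: "X' \<union> B' \<subseteq> H" "X' \<union> B' \<subseteq> carrier G" "X' \<subseteq> carrier G" using X'(1) B' H.subset by auto
  define J where "J = generate G (X' \<union> B')"
  have sJ: "subgroup J G" unfolding J_def by (rule G.generate_is_subgroup[OF sub(2)])
  interpret J: subgroup J G by (rule sJ)
  have JH: "J \<subseteq> H" unfolding J_def by (rule G.generate_subgroup_incl[OF sub(1) H])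
  have "B' \<subseteq> J" unfolding J_def by (auto intro: generate.incl)
  then have "B \<subseteq> fst ` (J \<inter> V)" by (force simp: B'_def vertex_group_def)
  then have "fst ` (H \<inter> V) \<subseteq> fst ` (J \<inter> V)"
    using group.generate_subgroup_incl[OF group_zlattice _ subgroup_fst_Int_V[OF sJ]] B(3) by metis
  then have "fst ` (H \<inter> V) \<times> {\<one>\<^bsub>F\<^esub>} \<subseteq> fst ` (J \<inter> V) \<times> {\<one>\<^bsub>F\<^esub>}" by (intro Sigma_mono) simp_all
  then have VJ: "H \<inter> V \<subseteq> J" unfolding Int_V_eq[symmetric] by (rule order_trans) simp
  have "H \<subseteq> J"
  proof
    fix h assume h: "h \<in> H"
    have "snd h \<in> snd ` generate G X'" using h X(3) X'(3) proj.generate_img[OF sub(3)] by blast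
    then obtain j where j: "j \<in> generate G X'" "snd j = snd h" by (metis imageE)
    have jJ: "j \<in> J" using j(1) G.mono_generate[of X' "X' \<union> B'"] by (auto simp: J_def)
    have jc: "j \<in> carrier G" "h \<in> carrier G" using jJ J.mem_carrier h H.mem_carrier by auto
    have "h \<otimes>\<^bsub>G\<^esub> inv\<^bsub>G\<^esub> j \<in> H" using h jJ JH by blast
    moreover have "snd (h \<otimes>\<^bsub>G\<^esub> inv\<^bsub>G\<^esub> j) = \<one>\<^bsub>F\<^esub>"
      using jc j(2) proj.hom_closed[OF jc(2)] by (simp del: mult_free_group one_free_group)
    ultimately have "h \<otimes>\<^bsub>G\<^esub> inv\<^bsub>G\<^esub> j \<in> J" using VJ mem_V by blast
    then have "(h \<otimes>\<^bsub>G\<^esub> inv\<^bsub>G\<^esub> j) \<otimes>\<^bsub>G\<^esub> j \<in> J" using jJ by (rule J.m_closed)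
    then show "h \<in> J" using jc by (simp add: G.m_assoc)
  qed
  then have "generate G (X' \<union> B') = H" using JH by (simp add: J_def)
  moreover have "finite (X' \<union> B')" using X'(2) B(1) by (simp add: B'_def)
  ultimately show ?thesis using G.fg_subgroupI[OF _ sub(2)] by metis
qed

lemma subgroup_Times:
  assumes \<Lambda>: "subgroup \<Lambda> zlattice" and \<Gamma>: "subgroup \<Gamma> F" "\<Gamma> \<subseteq> lattice_stab F \<rho> \<Lambda>"
  shows "subgroup (\<Lambda> \<times> \<Gamma>) G"
proof -
  interpret \<Gamma>: subgroup \<Gamma> F by (rule \<Gamma>(1))
  note L = subgroup_zlatticeD[OF \<Lambda>]
  have act: "\<rho> \<gamma> *v v \<in> \<Lambda>" if "\<gamma> \<in> \<Gamma>" "v \<in> \<Lambda>" for \<gamma> v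
  proof -
    have "lattice_act \<rho> \<gamma> \<Lambda> = \<Lambda>" using that \<Gamma>(2) mem_lattice_stab by blast
    then show ?thesis using that(2) unfolding lattice_act_def by blast
  qed
  show ?thesis
  proof (rule G.subgroupI)
    show "\<Lambda> \<times> \<Gamma> \<subseteq> carrier G" using \<Gamma>.subset by (auto simp: carrier_G)
    show "\<Lambda> \<times> \<Gamma> \<noteq> {}" using L(1) \<Gamma>.one_closed by blast
  next
    fix x assume "x \<in> \<Lambda> \<times> \<Gamma>"
    then obtain v \<gamma> where x: "x = (v, \<gamma>)" "v \<in> \<Lambda>" "\<gamma> \<in> \<Gamma>" by blast
    have "inv\<^bsub>F\<^esub> \<gamma> \<in> \<Gamma>" using x(3) by (rule \<Gamma>.m_inv_closed)
    then show "inv\<^bsub>G\<^esub> x \<in> \<Lambda> \<times> \<Gamma>"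
      unfolding x(1) inv_G[OF \<Gamma>.mem_carrier[OF x(3)]] using act[OF _ x(2)] L(3) by simp
  next
    fix x y assume "x \<in> \<Lambda> \<times> \<Gamma>" "y \<in> \<Lambda> \<times> \<Gamma>"
    then obtain v \<gamma> w \<delta> where x: "x = (v, \<gamma>)" "v \<in> \<Lambda>" "\<gamma> \<in> \<Gamma>" and y: "y = (w, \<delta>)" "w \<in> \<Lambda>" "\<delta> \<in> \<Gamma>" by blast
    show "x \<otimes>\<^bsub>G\<^esub> y \<in> \<Lambda> \<times> \<Gamma>"
      unfolding x(1) y(1) mult_G using L(2)[OF x(2) act[OF x(3) y(2)]] \<Gamma>.m_closed[OF x(3) y(3)] by blast
  qed
qed

lemma Times_Int_V: "\<one>\<^bsub>F\<^esub> \<in> \<Gamma> \<Longrightarrow> (\<Lambda> \<times> \<Gamma>) \<inter> V = \<Lambda> \<times> {\<one>\<^bsub>F\<^esub>}"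
  by (auto simp: vertex_group_def)

lemma snd_Times: "subgroup \<Lambda> zlattice \<Longrightarrow> snd ` (\<Lambda> \<times> \<Gamma>) = \<Gamma>"
  using subgroup_zlatticeD(1) by force

lemma tame_vertex_conj:
  assumes "S \<subseteq> lattice_stab F \<rho> \<Lambda>" "g \<in> carrier G" "snd g \<in> S"
  shows "conj_subgroup G g (\<Lambda> \<times> {\<one>\<^bsub>F\<^esub>}) = \<Lambda> \<times> {\<one>\<^bsub>F\<^esub>}"
  using conj_vertex[OF assms(2), of \<Lambda>] assms(1,3) mem_lattice_stab by fastforce

text \<open>\<open>H\<close> is joined with a conjugate of the split subgroup over a nontrivial
  cyclic \<open>C\<close> in \<open>S\<close>. The join is strictly larger, since the conjugate has
  nontrivial projection and meets \<open>H\<close> in the lattice only. Thus no tame subgroup is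
  isolated among those with the same lattice.\<close>

lemma tame_extend:
  assumes S: "subgroup S F" "\<not> cyclic_subgroup F S" and \<Lambda>: "subgroup \<Lambda> zlattice" "S \<subseteq> lattice_stab F \<rho> \<Lambda>"
    and H: "tame S (\<Lambda> \<times> {\<one>\<^bsub>F\<^esub>}) H" and X: "finite X" "X \<subseteq> carrier G"
  obtains H' where "tame S (\<Lambda> \<times> {\<one>\<^bsub>F\<^esub>}) H'" "H' \<noteq> H" "H' \<inter> X = H \<inter> X"
proof -
  interpret S: subgroup S F by (rule S(1))
  have "S \<noteq> {\<one>\<^bsub>F\<^esub>}" using S(2) F.cyclic_subgroup_trivial by metis
  then obtain f where f: "f \<in> S" "f \<noteq> \<one>\<^bsub>F\<^esub>" using S.one_closed by blast
  define C where "C = generate F {f}"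
  have fc: "{f} \<subseteq> carrier F" using f S.mem_carrier by simp
  have C: "subgroup C F" "C \<subseteq> S" "fg_subgroup F C" "cyclic_subgroup F C" "f \<in> C"
    using F.generate_is_subgroup[OF fc] F.generate_subgroup_incl[OF _ S(1)] f(1) F.fg_subgroupI[OF _ fc] fc
    by (auto simp: C_def cyclic_subgroup_def intro: generate.incl)
  have infC: "\<not> finite_index C (F\<lparr>carrier := S\<rparr>)"
    by (rule noncyclic_commuting_infinite_index[OF S C(1,2)]) (rule F.cyclic_subgroup_commute[OF C(4)])
  let ?L = "\<Lambda> \<times> {\<one>\<^bsub>F\<^esub>}"
  have "(\<Lambda> \<times> C) \<inter> V = ?L" using Times_Int_V[OF subgroup.one_closed[OF C(1)]] .
  then have t: "tame S ?L (\<Lambda> \<times> C)"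
    using subgroup_Times[OF \<Lambda>(1) C(1)] C infC \<Lambda>(2) snd_Times[OF \<Lambda>(1), of C] unfolding tame_def by auto
  \<comment> \<open>It is enough to avoid \<open>X - H\<close>: the elements of \<open>X\<close> in
    \<open>H\<close> stay in the join anyway, so the trace on \<open>X\<close> does not
    change.\<close>
  obtain g where g: "g \<in> carrier G" "snd g \<in> S" "tame S ?L (generate G (H \<union> conj_subgroup G g (\<Lambda> \<times> C)))"
    "generate G (H \<union> conj_subgroup G g (\<Lambda> \<times> C)) \<inter> (X - H) = {}"
    "H \<inter> conj_subgroup G g (\<Lambda> \<times> C) \<subseteq> ?L"
    by (rule tame_join[OF S tame_vertex_conj[OF \<Lambda>(2)] H t, of "X - H" "{}"]) (use X in auto)
  define H' where "H' = generate G (H \<union> conj_subgroup G g (\<Lambda> \<times> C))"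
  have sub: "H \<subseteq> H'" "conj_subgroup G g (\<Lambda> \<times> C) \<subseteq> H'" by (auto simp: H'_def intro: generate.incl)
  have "H' \<noteq> H"
  proof
    assume "H' = H"
    then have *: "conj_subgroup G g (\<Lambda> \<times> C) \<subseteq> ?L" using sub(2) g(5) by blast
    have "(0, f) \<in> \<Lambda> \<times> C" using C(5) subgroup_zlatticeD(1)[OF \<Lambda>(1)] by blast
    then have "g \<otimes>\<^bsub>G\<^esub> (0, f) \<otimes>\<^bsub>G\<^esub> inv\<^bsub>G\<^esub> g \<in> ?L" using * unfolding conj_subgroup_image by blast
    then have e: "snd (g \<otimes>\<^bsub>G\<^esub> (0, f) \<otimes>\<^bsub>G\<^esub> inv\<^bsub>G\<^esub> g) = \<one>\<^bsub>F\<^esub>" by (metis mem_Times_iff singletonD)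
    have c: "snd g \<in> carrier F" "f \<in> carrier F" using g(1) fc by (auto simp: carrier_G mem_Times_iff)
    have "f = inv\<^bsub>F\<^esub> snd g \<otimes>\<^bsub>F\<^esub> (snd g \<otimes>\<^bsub>F\<^esub> f \<otimes>\<^bsub>F\<^esub> inv\<^bsub>F\<^esub> snd g) \<otimes>\<^bsub>F\<^esub> snd g"
      using c by (simp del: mult_free_group one_free_group add: F.m_assoc F.inv_cancel_left)
    also have "snd g \<otimes>\<^bsub>F\<^esub> f \<otimes>\<^bsub>F\<^esub> inv\<^bsub>F\<^esub> snd g = \<one>\<^bsub>F\<^esub>"
      using e snd_conj[OF g(1), of "(0, f)"] c(2) by (simp del: mult_free_group one_free_group add: carrier_G)
    also have "inv\<^bsub>F\<^esub> snd g \<otimes>\<^bsub>F\<^esub> \<one>\<^bsub>F\<^esub> \<otimes>\<^bsub>F\<^esub> snd g = \<one>\<^bsub>F\<^esub>"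
      using c by (simp del: mult_free_group one_free_group)
    finally have "f = \<one>\<^bsub>F\<^esub>" .
    then show False using f(2) by simp
  qed
  moreover have "H' \<inter> X = H \<inter> X" using g(4) sub(1) unfolding H'_def by blast
  ultimately show ?thesis using that[of H'] g(3) by (simp add: H'_def)
qed

end

section \<open>The perfect kernel of a subgroup of the free group\<close>

context lattice_by_free
begin

lemma perfect_kernel_cyclic:
  assumes S: "subgroup S F" "cyclic_subgroup F S"
  shows "perfect_kernel (F\<lparr>carrier := S\<rparr>) = {}"
proof -
  interpret S: group "F\<lparr>carrier := S\<rparr>" using F.subgroup_imp_group[OF S(1)] .
  obtain s where s: "s \<in> carrier F" "S = generate F {s}" using S(2) by (auto simp: cyclic_subgroup_def)
  have "fg_subgroup (F\<lparr>carrier := S\<rparr>) H" if "subgroup H (F\<lparr>carrier := S\<rparr>)" for H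
  proof -
    have H: "subgroup H F" "H \<subseteq> S" using F.incl_subgroup[OF S(1) that] subgroup.subset[OF that] by auto
    then show ?thesis
      using F.fg_subgroup_of_cyclic[OF s(1) H(1)] s(2) F.fg_subgroup_in_subgroup_iff[OF S(1) H(2)] by simp
  qed
  then have "H \<notin> perfect_kernel (F\<lparr>carrier := S\<rparr>)" for H using S.not_in_perfect_kernel by metis
  then show ?thesis by blast
qed

text \<open>With the full lattice, subgroups of the free group become subgroups of \<open>G\<close>,
  so the joins in \<open>G\<close> can be reused for them.\<close>

lemma lattice_stab_UNIV: "lattice_stab F \<rho> UNIV = carrier F"
proof -
  have "lattice_act \<rho> \<gamma> UNIV = UNIV" if "\<gamma> \<in> carrier F" for \<gamma>
  proof -
    have "(0, \<gamma>) \<in> carrier G" using that by (simp add: carrier_G)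
    then have "lattice_act \<rho> \<gamma> UNIV \<times> {\<one>\<^bsub>F\<^esub>} = UNIV \<times> {\<one>\<^bsub>F\<^esub>}"
      using conj_V[of "(0, \<gamma>)"] conj_vertex[of "(0, \<gamma>)" UNIV] by (simp add: vertex_group_def)
    then show ?thesis by (simp add: times_eq_iff)
  qed
  then show ?thesis by (auto simp: mem_lattice_stab)
qed

text \<open>If the finitely generated approximation had finite index in \<open>S\<close>, then
  \<open>\<Gamma>\<close> above it would be finitely generated of finite index as well. So every
  other \<open>\<Gamma>\<close> is a limit of finitely generated subgroups of infinite
  index.\<close>

lemma generate_trace:
  assumes S: "subgroup S F" and \<Gamma>: "subgroup \<Gamma> F" "\<Gamma> \<subseteq> S" "\<not> (fg_subgroup F \<Gamma> \<and> finite_index \<Gamma> (F\<lparr>carrier := S\<rparr>))"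
    and X: "finite X" "X \<subseteq> \<Gamma>"
  shows "fg_subgroup F (generate F X)" "generate F X \<subseteq> \<Gamma>" "\<not> finite_index (generate F X) (F\<lparr>carrier := S\<rparr>)"
proof -
  have Xc: "X \<subseteq> carrier F" using X subgroup.subset[OF \<Gamma>(1)] by blast
  show fg: "fg_subgroup F (generate F X)" using F.fg_subgroupI[OF X(1) Xc] .
  show sub: "generate F X \<subseteq> \<Gamma>" using F.generate_subgroup_incl[OF X(2) \<Gamma>(1)] .
  show "\<not> finite_index (generate F X) (F\<lparr>carrier := S\<rparr>)"
  proof
    assume fin: "finite_index (generate F X) (F\<lparr>carrier := S\<rparr>)"
    interpret S: group "F\<lparr>carrier := S\<rparr>" using F.subgroup_imp_group[OF S] .
    have sX: "subgroup (generate F X) (F\<lparr>carrier := S\<rparr>)" "subgroup \<Gamma> (F\<lparr>carrier := S\<rparr>)"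
      using F.subgroup_incl[OF F.generate_is_subgroup[OF Xc] S] F.subgroup_incl[OF \<Gamma>(1) S \<Gamma>(2)] sub \<Gamma>(2) by auto
    have "fg_subgroup F \<Gamma>" using F.fg_subgroup_finite_index_over[OF S \<Gamma>(1,2) fg sub fin] .
    moreover have "finite_index \<Gamma> (F\<lparr>carrier := S\<rparr>)" using S.finite_index_mono[OF sX sub fin] .
    ultimately show False using \<Gamma>(3) by blast
  qed
qed

text \<open>\<open>Y\<close> consists of the finitely generated subgroups of infinite index. Each is
  perturbed through its preimage \<open>UNIV \<times> \<Gamma>\<close> in \<open>G\<close>, to which
  \<open>tame_extend\<close> applies, and \<open>generate_trace\<close> shows that they are dense in
  the right-hand side.\<close>

lemma perfect_kernel_noncyclic:
  assumes S: "subgroup S F" "\<not> cyclic_subgroup F S"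
  shows "perfect_kernel (F\<lparr>carrier := S\<rparr>) =
    {\<Gamma>. subgroup \<Gamma> F \<and> \<Gamma> \<subseteq> S \<and> \<not> (fg_subgroup F \<Gamma> \<and> finite_index \<Gamma> (F\<lparr>carrier := S\<rparr>))}" (is "_ = ?R")
proof
  let ?FS = "F\<lparr>carrier := S\<rparr>"
  interpret S: group ?FS using F.subgroup_imp_group[OF S(1)] .
  have subS: "subgroup H ?FS \<longleftrightarrow> subgroup H F \<and> H \<subseteq> S" for H
    using F.incl_subgroup[OF S(1)] F.subgroup_incl[OF _ S(1)] subgroup.subset[of H ?FS] by auto
  show "perfect_kernel ?FS \<subseteq> ?R"
  proof
    fix \<Gamma> assume \<Gamma>: "\<Gamma> \<in> perfect_kernel ?FS"
    then have s: "subgroup \<Gamma> F" "\<Gamma> \<subseteq> S" using perfect_kernel_subset subS by blast+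
    have "\<not> (fg_subgroup F \<Gamma> \<and> finite_index \<Gamma> ?FS)"
    proof
      assume *: "fg_subgroup F \<Gamma> \<and> finite_index \<Gamma> ?FS"
      have "fg_subgroup ?FS H" if H: "subgroup H ?FS" "\<Gamma> \<subseteq> H" for H
      proof -
        have H': "subgroup H F" "H \<subseteq> S" using H(1) subS by auto
        show ?thesis
          using F.fg_subgroup_finite_index_over[OF S(1) H' _ H(2)] * F.fg_subgroup_in_subgroup_iff[OF S(1) H'(2)]
          by simp
      qed
      then show False using S.not_in_perfect_kernel[of \<Gamma>] \<Gamma> by blast
    qed
    then show "\<Gamma> \<in> ?R" using s by simp
  qed
  define Y where "Y = {\<Gamma>. fg_subgroup F \<Gamma> \<and> \<Gamma> \<subseteq> S \<and> \<not> finite_index \<Gamma> ?FS}"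
  have "chabauty ?FS closure_of Y \<subseteq> perfect_kernel ?FS"
  proof (rule closure_subset_perfect_kernel)
    fix \<Gamma> assume "\<Gamma> \<in> Y"
    then show "subgroup \<Gamma> ?FS" using subS F.fg_subgroup_is_subgroup unfolding Y_def by simp
  next
    fix \<Gamma> X assume \<Gamma>Y: "\<Gamma> \<in> Y" and X: "finite X" "X \<subseteq> carrier ?FS"
    have \<Gamma>: "fg_subgroup F \<Gamma>" "subgroup \<Gamma> F" "\<Gamma> \<subseteq> S" "\<not> finite_index \<Gamma> ?FS"
      using \<Gamma>Y F.fg_subgroup_is_subgroup unfolding Y_def by auto
    have Sc: "S \<subseteq> carrier F" using subgroup.subset[OF S(1)] .
    then have \<Gamma>st: "\<Gamma> \<subseteq> lattice_stab F \<rho> UNIV" "S \<subseteq> lattice_stab F \<rho> UNIV"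
      using \<Gamma>(3) by (auto simp: lattice_stab_UNIV)
    have "tame S (UNIV \<times> {\<one>\<^bsub>F\<^esub>}) (UNIV \<times> \<Gamma>)"
      using subgroup_Times[OF subgroup_UNIV \<Gamma>(2) \<Gamma>st(1)] Times_Int_V[OF subgroup.one_closed[OF \<Gamma>(2)]]
        snd_Times[OF subgroup_UNIV] \<Gamma> unfolding tame_def by simp
    moreover have "finite ({0} \<times> X)" "{0} \<times> X \<subseteq> carrier G" using X Sc by (auto simp: carrier_G)
    ultimately obtain H where H: "tame S (UNIV \<times> {\<one>\<^bsub>F\<^esub>}) H" "H \<noteq> UNIV \<times> \<Gamma>" "H \<inter> ({0} \<times> X) = UNIV \<times> \<Gamma> \<inter> ({0} \<times> X)"
      using tame_extend[OF S subgroup_UNIV \<Gamma>st(2)] by metis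
    have sH: "subgroup H G" "H \<inter> V = UNIV \<times> {\<one>\<^bsub>F\<^esub>}" using H(1) by (auto simp: tame_def)
    \<comment> \<open>\<open>H\<close> contains the full lattice, so it is determined by its
      projection and a perturbation of \<open>H\<close> is a perturbation of
      \<open>\<Gamma>\<close>.\<close>
    have Heq: "H = UNIV \<times> snd ` H"
    proof (intro Set.set_eqI iffI)
      fix x :: "(int ^ 'd) \<times> 'a fword" assume "x \<in> UNIV \<times> snd ` H"
      then obtain h where h: "h \<in> H" "snd x = snd h" by force
      have "(fst x - fst h, \<one>\<^bsub>F\<^esub>) \<in> H" using sH(2) by blast
      then have "(fst x - fst h, \<one>\<^bsub>F\<^esub>) \<otimes>\<^bsub>G\<^esub> (fst h, snd h) \<in> H" using subgroup.m_closed[OF sH(1)] h(1) by simp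
      moreover have "(fst x - fst h, \<one>\<^bsub>F\<^esub>) \<otimes>\<^bsub>G\<^esub> (fst h, snd h) = x"
        unfolding mult_G rho_one_vec using h(2) by (simp add: prod_eq_iff)
      ultimately show "x \<in> H" by simp
    qed force
    have "snd ` H \<in> Y" using H(1) by (simp add: tame_def Y_def)
    moreover have "snd ` H \<noteq> \<Gamma>" using Heq H(2) by metis
    moreover have "snd ` H \<inter> X = \<Gamma> \<inter> X"
    proof -
      have "(0, x) \<in> H \<longleftrightarrow> x \<in> \<Gamma>" if "x \<in> X" for x using H(3) that by blast
      moreover have "(0, x) \<in> H \<longleftrightarrow> x \<in> snd ` H" for x by (subst Heq) simp
      ultimately show ?thesis by blast
    qed
    ultimately show "\<exists>H'\<in>Y. H' \<noteq> \<Gamma> \<and> H' \<inter> X = \<Gamma> \<inter> X"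
      by (intro bexI[of _ "snd ` H"] conjI)
  qed
  moreover have "?R \<subseteq> chabauty ?FS closure_of Y"
  proof
    fix \<Gamma> assume "\<Gamma> \<in> ?R"
    then have \<Gamma>: "subgroup \<Gamma> F" "\<Gamma> \<subseteq> S" "\<not> (fg_subgroup F \<Gamma> \<and> finite_index \<Gamma> ?FS)" by auto
    have "\<exists>H'\<in>Y. subgroup H' ?FS \<and> H' \<inter> X = \<Gamma> \<inter> X" if X: "finite X" for X
    proof -
      have "finite (\<Gamma> \<inter> X)" "\<Gamma> \<inter> X \<subseteq> \<Gamma>" using X by auto
      note g = generate_trace[OF S(1) \<Gamma> this]
      have "generate F (\<Gamma> \<inter> X) \<in> Y" using g \<Gamma>(2) by (auto simp: Y_def)
      moreover have "subgroup (generate F (\<Gamma> \<inter> X)) ?FS"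
        using subS F.fg_subgroup_is_subgroup[OF g(1)] g(2) \<Gamma>(2) by blast
      moreover have "generate F (\<Gamma> \<inter> X) \<inter> X = \<Gamma> \<inter> X" using g(2) by (auto intro: generate.incl)
      ultimately show ?thesis by (intro bexI[of _ "generate F (\<Gamma> \<inter> X)"] conjI)
    qed
    then show "\<Gamma> \<in> chabauty ?FS closure_of Y" unfolding in_closure_chabauty using subS \<Gamma>(1,2) by simp
  qed
  ultimately show "?R \<subseteq> perfect_kernel ?FS" by (rule order_trans[rotated])
qed

section \<open>Orbits and stabilizers of lattices\<close>

lemma finite_orbit_iff:
  "finite (orbit F (lattice_act \<rho>) \<Lambda>) \<longleftrightarrow> finite_index (lattice_stab F \<rho> \<Lambda>) F"
proof
  let ?O = "orbit F (lattice_act \<rho>) \<Lambda>"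
  have O: "L \<in> ?O \<longleftrightarrow> (\<exists>g\<in>carrier F. L = lattice_act \<rho> g \<Lambda>)" for L by (auto simp: orbit_def)
  assume fin: "finite ?O"
  have "\<forall>L\<in>?O. \<exists>g. g \<in> carrier F \<and> L = lattice_act \<rho> g \<Lambda>" using O by metis
  from bchoice[OF this] obtain f where f: "\<And>L. L \<in> ?O \<Longrightarrow> f L \<in> carrier F \<and> L = lattice_act \<rho> (f L) \<Lambda>" by metis
  \<comment> \<open>The orbit map is constant on left cosets of the stabilizer, while the index
    counts right cosets; inverses exchange the two.\<close>
  define T where "T = (\<lambda>L. inv\<^bsub>F\<^esub> f L) ` ?O"
  have "\<exists>t\<in>T. x \<otimes>\<^bsub>F\<^esub> inv\<^bsub>F\<^esub> t \<in> lattice_stab F \<rho> \<Lambda>" if x: "x \<in> carrier F" for x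
  proof -
    define L where "L = lattice_act \<rho> (inv\<^bsub>F\<^esub> x) \<Lambda>"
    have L: "L \<in> ?O" using O F.inv_closed[OF x] L_def by blast
    have fL: "f L \<in> carrier F" "lattice_act \<rho> (f L) \<Lambda> = L" using f[OF L] by auto
    have "lattice_act \<rho> (x \<otimes>\<^bsub>F\<^esub> f L) \<Lambda> = \<Lambda>"
      unfolding lattice_act_mult[OF x fL(1)] fL(2) using lattice_act_inv(2)[OF x] by (simp add: L_def)
    then have "x \<otimes>\<^bsub>F\<^esub> inv\<^bsub>F\<^esub> (inv\<^bsub>F\<^esub> f L) \<in> lattice_stab F \<rho> \<Lambda>"
      using F.m_closed[OF x fL(1)] fL(1) by (simp add: mem_lattice_stab del: mult_free_group)
    then show ?thesis using L by (auto simp: T_def)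
  qed
  moreover have "finite T" using fin by (simp add: T_def)
  moreover have "T \<subseteq> carrier F"
  proof
    fix t assume "t \<in> T"
    then obtain L where "L \<in> ?O" "t = inv\<^bsub>F\<^esub> f L" unfolding T_def by (rule imageE)
    then show "t \<in> carrier F" using f[of L] by simp
  qed
  ultimately show "finite_index (lattice_stab F \<rho> \<Lambda>) F"
    unfolding F.finite_index_iff[OF subgroup_lattice_stab] by (intro exI[of _ T]) simp
next
  assume "finite_index (lattice_stab F \<rho> \<Lambda>) F"
  then obtain T where T: "finite T" "T \<subseteq> carrier F"
    "\<And>x. x \<in> carrier F \<Longrightarrow> \<exists>t\<in>T. x \<otimes>\<^bsub>F\<^esub> inv\<^bsub>F\<^esub> t \<in> lattice_stab F \<rho> \<Lambda>"
    unfolding F.finite_index_iff[OF subgroup_lattice_stab] by metis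
  have "orbit F (lattice_act \<rho>) \<Lambda> \<subseteq> (\<lambda>t. lattice_act \<rho> (inv\<^bsub>F\<^esub> t) \<Lambda>) ` T"
  proof
    fix L assume "L \<in> orbit F (lattice_act \<rho>) \<Lambda>"
    then obtain g where g: "g \<in> carrier F" "L = lattice_act \<rho> g \<Lambda>" by (auto simp: orbit_def)
    obtain t where t: "t \<in> T" "inv\<^bsub>F\<^esub> g \<otimes>\<^bsub>F\<^esub> inv\<^bsub>F\<^esub> t \<in> lattice_stab F \<rho> \<Lambda>" using T(3)[OF F.inv_closed[OF g(1)]] by blast
    have tc: "inv\<^bsub>F\<^esub> t \<in> carrier F" using t(1) T(2) F.inv_closed by blast
    have "lattice_act \<rho> (inv\<^bsub>F\<^esub> g) (lattice_act \<rho> (inv\<^bsub>F\<^esub> t) \<Lambda>) = \<Lambda>"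
      using t(2) lattice_act_mult[OF F.inv_closed[OF g(1)] tc] mem_lattice_stab by metis
    then have "L = lattice_act \<rho> (inv\<^bsub>F\<^esub> t) \<Lambda>" using g(2) lattice_act_inv(2)[OF g(1)] by metis
    then show "L \<in> (\<lambda>t. lattice_act \<rho> (inv\<^bsub>F\<^esub> t) \<Lambda>) ` T" using t(1) by blast
  qed
  then show "finite (orbit F (lattice_act \<rho>) \<Lambda>)" using T(1) finite_surj by blast
qed

lemma subgroup_lattice_act:
  assumes "subgroup \<Lambda> zlattice"
  shows "subgroup (lattice_act \<rho> \<gamma> \<Lambda>) zlattice"
proof (rule subgroup_zlatticeI)
  have "\<rho> \<gamma> *v 0 \<in> lattice_act \<rho> \<gamma> \<Lambda>" unfolding lattice_act_def using subgroup_zlatticeD(1)[OF assms] by (rule imageI)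
  then show "0 \<in> lattice_act \<rho> \<gamma> \<Lambda>" by simp
  fix v w assume "v \<in> lattice_act \<rho> \<gamma> \<Lambda>" "w \<in> lattice_act \<rho> \<gamma> \<Lambda>"
  then obtain x y where xy: "v = \<rho> \<gamma> *v x" "w = \<rho> \<gamma> *v y" "x \<in> \<Lambda>" "y \<in> \<Lambda>" unfolding lattice_act_def by blast
  have "v - w = \<rho> \<gamma> *v (x - y)" using xy by (simp add: matrix_vector_mult_diff_distrib)
  then show "v - w \<in> lattice_act \<rho> \<gamma> \<Lambda>"
    unfolding lattice_act_def using subgroup_zlatticeD(4)[OF assms xy(3,4)] by (rule image_eqI)
qed

text \<open>Every lattice of the orbit again contains all multiples of \<open>m\<close>, and only
  finitely many lattices do.\<close>

lemma finite_index_stab: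
  assumes \<Lambda>: "subgroup \<Lambda> zlattice" and m: "m > 0" "\<And>v. m *s v \<in> \<Lambda>"
  shows "finite_index (lattice_stab F \<rho> \<Lambda>) F"
proof -
  have "orbit F (lattice_act \<rho>) \<Lambda> \<subseteq> {\<Lambda>. subgroup \<Lambda> zlattice \<and> (\<forall>v. m *s v \<in> \<Lambda>)}"
  proof
    fix L assume "L \<in> orbit F (lattice_act \<rho>) \<Lambda>"
    then obtain g where g: "g \<in> carrier F" "L = lattice_act \<rho> g \<Lambda>" by (auto simp: orbit_def)
    have "m *s v \<in> L" for v
    proof -
      have "v = \<rho> g *v (\<rho> (inv\<^bsub>F\<^esub> g) *v v)"
        using rho_mult_vec'[of g "inv\<^bsub>F\<^esub> g" v] g(1) rho_one_vec[of v] by (simp del: mult_free_group one_free_group)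
      then have "m *s v = \<rho> g *v (m *s (\<rho> (inv\<^bsub>F\<^esub> g) *v v))" by (metis matrix_vector_scale)
      then show ?thesis unfolding g(2) lattice_act_def using m(2) by (rule image_eqI)
    qed
    then show "L \<in> {\<Lambda>. subgroup \<Lambda> zlattice \<and> (\<forall>v. m *s v \<in> \<Lambda>)}"
      using subgroup_lattice_act[OF \<Lambda>] g(2) by simp
  qed
  then show ?thesis using finite_orbit_iff finite_subset[OF _ finite_subgroups_above[OF m(1)]] by blast
qed

section \<open>The perfect kernel of the semidirect product\<close>

lemma fiber_diff:
  assumes "subgroup H G" "(v, \<gamma>) \<in> H" "(w, \<gamma>) \<in> H" shows "v - w \<in> fst ` (H \<inter> V)"
proof -
  have c: "(v, \<gamma>) \<in> carrier G" "(w, \<gamma>) \<in> carrier G"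
    using subgroup.mem_carrier[OF assms(1)] assms(2,3) by simp_all
  have c1: "(v - w, \<one>\<^bsub>F\<^esub>) \<in> carrier G" using F.one_closed by (simp add: carrier_G)
  have "\<one>\<^bsub>F\<^esub> \<otimes>\<^bsub>F\<^esub> \<gamma> = \<gamma>" using c by (simp add: carrier_G)
  then have "(v - w, \<one>\<^bsub>F\<^esub>) \<otimes>\<^bsub>G\<^esub> (w, \<gamma>) = (v, \<gamma>)" unfolding mult_G rho_one_vec by simp
  then have "(v - w, \<one>\<^bsub>F\<^esub>) = (v, \<gamma>) \<otimes>\<^bsub>G\<^esub> inv\<^bsub>G\<^esub> (w, \<gamma>)" using c c1 by (metis G.inv_solve_right')
  also have "\<dots> \<in> H"
    using subgroup.m_closed[OF assms(1,2) subgroup.m_inv_closed[OF assms(1,3)]] .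
  finally have "(v - w, \<one>\<^bsub>F\<^esub>) \<in> H \<inter> V" by (simp add: mem_V)
  then show ?thesis by (rule image_eqI[rotated]) simp
qed

text \<open>\<open>H'\<close> is the product of \<open>H\<close> with the normal subgroup of all
  multiples of \<open>N\<close> in the lattice. It shares the projection of \<open>H\<close>;
  \<open>N\<close> is a common multiple of moduli that keep the finitely many elements of
  \<open>X - H\<close> outside.\<close>

lemma thicken:
  assumes H: "subgroup H G" and X: "finite X" "X \<subseteq> carrier G"
  obtains H' N where "subgroup H' G" "H \<subseteq> H'" "snd ` H' = snd ` H" "H' \<inter> X = H \<inter> X" "N > (0 :: int)" "\<And>z. (N *s z, \<one>\<^bsub>F\<^esub>) \<in> H'"
proof -
  interpret H: subgroup H G by (rule H)
  have "\<forall>a\<in>X - H. \<exists>n::int. n > 0 \<and> (\<forall>z. (fst a - n *s z, snd a) \<notin> H)"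
  proof
    fix a assume a: "a \<in> X - H"
    show "\<exists>n::int. n > 0 \<and> (\<forall>z. (fst a - n *s z, snd a) \<notin> H)"
    proof (cases "\<exists>w. (w, snd a) \<in> H")
      case True
      then obtain w where w: "(w, snd a) \<in> H" by blast
      \<comment> \<open>Comparison with an element of \<open>H\<close> over the same projection
        turns \<open>a \<notin> H\<close> into a statement about the lattice. When no such element
        exists, every modulus works.\<close>
      have "fst a - w \<notin> fst ` (H \<inter> V)"
      proof
        assume "fst a - w \<in> fst ` (H \<inter> V)"
        then have "(fst a - w, \<one>\<^bsub>F\<^esub>) \<in> H" using Int_V_eq[of H] by blast
        then have "(fst a - w, \<one>\<^bsub>F\<^esub>) \<otimes>\<^bsub>G\<^esub> (w, snd a) \<in> H" using w by (rule H.m_closed)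
        moreover have "\<one>\<^bsub>F\<^esub> \<otimes>\<^bsub>F\<^esub> snd a = snd a" using H.mem_carrier[OF w] by (simp add: carrier_G)
        ultimately have "a \<in> H" unfolding mult_G rho_one_vec by simp
        then show False using a by blast
      qed
      then obtain n :: int where n: "n > 0" "\<And>z. fst a - w - n *s z \<notin> fst ` (H \<inter> V)"
        using zlattice_residually_finite[OF subgroup_fst_Int_V[OF H]] by metis
      have "(fst a - n *s z, snd a) \<notin> H" for z
      proof
        assume "(fst a - n *s z, snd a) \<in> H"
        then have "fst a - n *s z - w \<in> fst ` (H \<inter> V)" using w by (rule fiber_diff[OF H])
        moreover have "fst a - n *s z - w = fst a - w - n *s z" by simp
        ultimately show False using n(2)[of z] by simp
      qed
      then show ?thesis using n(1) by blast
    next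
      case False
      then show ?thesis by (intro exI[of _ 1]) simp
    qed
  qed
  from bchoice[OF this] obtain n :: "_ \<Rightarrow> int" where
    n: "\<And>a. a \<in> X - H \<Longrightarrow> n a > 0" "\<And>a z. a \<in> X - H \<Longrightarrow> (fst a - n a *s z, snd a) \<notin> H" by auto
  define N where "N = (\<Prod>a\<in>X - H. n a)"
  have N0: "N > 0" unfolding N_def using n(1) by (rule prod_pos)
  have N: "(fst a - N *s z, snd a) \<notin> H" if a: "a \<in> X - H" for a z
  proof -
    have "n a dvd N" unfolding N_def using X(1) a by (intro dvd_prodI) auto
    then obtain k where "N = n a * k" by (auto simp: dvd_def)
    then have "N *s z = n a *s (k *s z)" by (simp add: vec_eq_iff algebra_simps)
    then show ?thesis using n(2)[OF a, of "k *s z"] by simp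
  qed
  define H' where "H' = {(v, \<gamma>). \<exists>z. (v - N *s z, \<gamma>) \<in> H}"
  have HH': "H \<subseteq> H'"
  proof
    fix h assume h: "h \<in> H"
    have "(fst h - N *s 0, snd h) \<in> H" using h by simp
    then have "\<exists>z. (fst h - N *s z, snd h) \<in> H" by (rule exI)
    then show "h \<in> H'" by (simp add: H'_def split_beta)
  qed
  have "subgroup H' G"
  proof (rule G.subgroupI)
    show "H' \<subseteq> carrier G" using H.subset by (auto simp: H'_def carrier_G)
    show "H' \<noteq> {}" using HH' H.one_closed by blast
  next
    fix x assume "x \<in> H'"
    then obtain v \<gamma> z where x: "x = (v, \<gamma>)" "(v - N *s z, \<gamma>) \<in> H" by (auto simp: H'_def)
    have \<gamma>: "\<gamma> \<in> carrier F" using H.mem_carrier[OF x(2)] by (simp add: carrier_G)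
    have "inv\<^bsub>G\<^esub> (v - N *s z, \<gamma>) \<in> H" using x(2) by (rule H.m_inv_closed)
    moreover have "- (\<rho> (inv\<^bsub>F\<^esub> \<gamma>) *v (v - N *s z)) = - (\<rho> (inv\<^bsub>F\<^esub> \<gamma>) *v v) - N *s (- (\<rho> (inv\<^bsub>F\<^esub> \<gamma>) *v z))"
      unfolding matrix_vector_mult_diff_distrib matrix_vector_scale by (simp add: vec_eq_iff)
    ultimately have "(- (\<rho> (inv\<^bsub>F\<^esub> \<gamma>) *v v) - N *s (- (\<rho> (inv\<^bsub>F\<^esub> \<gamma>) *v z)), inv\<^bsub>F\<^esub> \<gamma>) \<in> H"
      unfolding inv_G[OF \<gamma>] by simp
    then show "inv\<^bsub>G\<^esub> x \<in> H'" unfolding x(1) inv_G[OF \<gamma>] H'_def by blast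
  next
    fix x y assume "x \<in> H'" "y \<in> H'"
    then obtain v \<gamma> z w \<delta> u where x: "x = (v, \<gamma>)" "(v - N *s z, \<gamma>) \<in> H" and y: "y = (w, \<delta>)" "(w - N *s u, \<delta>) \<in> H"
      by (auto simp: H'_def)
    have "(v - N *s z, \<gamma>) \<otimes>\<^bsub>G\<^esub> (w - N *s u, \<delta>) \<in> H" using x(2) y(2) by (rule H.m_closed)
    moreover have "v - N *s z + \<rho> \<gamma> *v (w - N *s u) = v + \<rho> \<gamma> *v w - N *s (z + \<rho> \<gamma> *v u)"
      unfolding matrix_vector_mult_diff_distrib matrix_vector_scale by (simp add: vec_eq_iff algebra_simps)
    ultimately have "(v + \<rho> \<gamma> *v w - N *s (z + \<rho> \<gamma> *v u), \<gamma> \<otimes>\<^bsub>F\<^esub> \<delta>) \<in> H" unfolding mult_G by simp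
    then show "x \<otimes>\<^bsub>G\<^esub> y \<in> H'" unfolding x(1) y(1) mult_G H'_def by blast
  qed
  moreover have "snd ` H' = snd ` H"
  proof
    show "snd ` H \<subseteq> snd ` H'" using HH' by (rule image_mono)
    show "snd ` H' \<subseteq> snd ` H" by (force simp: H'_def)
  qed
  moreover have "H' \<inter> X = H \<inter> X"
  proof -
    have "a \<in> H" if "a \<in> H'" "a \<in> X" for a
    proof (rule ccontr)
      assume "a \<notin> H"
      then show False using that N[of a] by (auto simp: H'_def split: prod.splits)
    qed
    then show ?thesis using HH' by blast
  qed
  moreover have "(N *s z, \<one>\<^bsub>F\<^esub>) \<in> H'" for z
  proof -
    have "(N *s z - N *s z, \<one>\<^bsub>F\<^esub>) \<in> H" using H.one_closed by (simp add: one_G)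
    then show ?thesis unfolding H'_def by blast
  qed
  ultimately show ?thesis using that HH' N0 by blast
qed

lemma subgroup_restrict:
  assumes "subgroup H G" "subgroup \<Gamma> F"
  shows "subgroup (H \<inter> (UNIV \<times> \<Gamma>)) G"
proof -
  have "subgroup (UNIV \<times> \<Gamma>) G"
    using subgroup_Times[OF subgroup_UNIV assms(2)] subgroup.subset[OF assms(2)] by (simp add: lattice_stab_UNIV)
  then show ?thesis using G.subgroups_Inter_pair[OF assms(1)] by blast
qed

lemma restrict_Int_V: "\<one>\<^bsub>F\<^esub> \<in> \<Gamma> \<Longrightarrow> H \<inter> (UNIV \<times> \<Gamma>) \<inter> V = H \<inter> V"
  by (auto simp: vertex_group_def)

lemma snd_restrict: "\<Gamma> \<subseteq> snd ` H \<Longrightarrow> snd ` (H \<inter> (UNIV \<times> \<Gamma>)) = \<Gamma>"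
  by force

text \<open>For \<open>H\<close> in \<open>Y\<close> the lattice contains all multiples of some
  \<open>m\<close>, so its stabilizer has finite index and is noncyclic: this is what allows
  \<open>tame_extend\<close> to perturb \<open>H\<close> with its lattice fixed. In the other
  inclusion finite rank turns finite index into finite generation of all overgroups.\<close>

lemma perfect_kernel_G:
  assumes A: "finite A" "\<alpha> \<in> A" "\<beta> \<in> A" "\<alpha> \<noteq> \<beta>"
  shows "perfect_kernel G = {H. subgroup H G \<and> \<not> finite_index (snd ` H) F}"
proof
  show "perfect_kernel G \<subseteq> {H. subgroup H G \<and> \<not> finite_index (snd ` H) F}"
  proof
    fix H assume H: "H \<in> perfect_kernel G"
    have sH: "subgroup H G" using perfect_kernel_subset[OF H] .
    have "\<not> finite_index (snd ` H) F"
    proof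
      assume fin: "finite_index (snd ` H) F"
      have "fg_subgroup G H'" if "subgroup H' G" "H \<subseteq> H'" for H'
      proof -
        have "finite_index (snd ` H') F"
          using F.finite_index_mono[OF subgroup_proj[OF sH] subgroup_proj[OF that(1)] image_mono[OF that(2)] fin] .
        then show ?thesis
          using fg_subgroup_G[OF that(1)] free_fg_of_finite_index[OF A(1) subgroup_proj[OF that(1)]] by blast
      qed
      then show False using G.not_in_perfect_kernel H by blast
    qed
    then show "H \<in> {H. subgroup H G \<and> \<not> finite_index (snd ` H) F}" using sH by simp
  qed
  define Y where "Y = {H. subgroup H G \<and> fg_subgroup F (snd ` H) \<and> \<not> finite_index (snd ` H) F \<and>
    (\<exists>m::int. m > 0 \<and> (\<forall>v. (m *s v, \<one>\<^bsub>F\<^esub>) \<in> H))}"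
  have "chabauty G closure_of Y \<subseteq> perfect_kernel G"
  proof (rule closure_subset_perfect_kernel)
    fix H assume "H \<in> Y"
    then show "subgroup H G" by (simp add: Y_def)
  next
    fix H X assume HY: "H \<in> Y" and X: "finite X" "X \<subseteq> carrier G"
    obtain m :: int where H: "subgroup H G" "fg_subgroup F (snd ` H)" "\<not> finite_index (snd ` H) F"
      and m: "m > 0" "\<And>v. (m *s v, \<one>\<^bsub>F\<^esub>) \<in> H" using HY by (auto simp: Y_def)
    define \<Lambda> where "\<Lambda> = fst ` (H \<inter> V)"
    define S where "S = lattice_stab F \<rho> \<Lambda>"
    have \<Lambda>: "subgroup \<Lambda> zlattice" unfolding \<Lambda>_def using subgroup_fst_Int_V[OF H(1)] .
    have m\<Lambda>: "m *s v \<in> \<Lambda>" for v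
    proof -
      have "(m *s v, \<one>\<^bsub>F\<^esub>) \<in> H \<inter> V" using m(2) by (simp add: mem_V)
      then show ?thesis unfolding \<Lambda>_def by (rule image_eqI[rotated]) simp
    qed
    have S: "subgroup S F" unfolding S_def by (rule subgroup_lattice_stab)
    have fS: "finite_index S F" unfolding S_def using finite_index_stab[OF \<Lambda> m(1) m\<Lambda>] .
    have nc: "\<not> cyclic_subgroup F S"
      using free_commuting_infinite_index[OF A(2-4) S] F.cyclic_subgroup_commute fS by blast
    have pS: "snd ` H \<subseteq> S" unfolding S_def \<Lambda>_def by (rule proj_subset_stab[OF H(1)])
    have "\<not> finite_index (snd ` H) (F\<lparr>carrier := S\<rparr>)"
      using F.finite_index_trans[OF S subgroup_proj[OF H(1)] pS _ fS] H(3) by blast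
    then have "tame S (\<Lambda> \<times> {\<one>\<^bsub>F\<^esub>}) H"
      using H pS Int_V_eq[of H] by (simp add: tame_def \<Lambda>_def)
    then obtain H' where H': "tame S (\<Lambda> \<times> {\<one>\<^bsub>F\<^esub>}) H'" "H' \<noteq> H" "H' \<inter> X = H \<inter> X"
      using tame_extend[OF S nc \<Lambda> _ _ X] S_def by blast
    have t: "subgroup H' G" "H' \<inter> V = \<Lambda> \<times> {\<one>\<^bsub>F\<^esub>}" "snd ` H' \<subseteq> S" "fg_subgroup F (snd ` H')"
      "\<not> finite_index (snd ` H') (F\<lparr>carrier := S\<rparr>)" using H'(1) by (auto simp: tame_def)
    have "\<not> finite_index (snd ` H') F" using F.finite_index_subgroup[OF S subgroup_proj[OF t(1)] t(3)] t(5) by blast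
    moreover have "(m *s v, \<one>\<^bsub>F\<^esub>) \<in> H'" for v using t(2) m\<Lambda> by blast
    ultimately have "H' \<in> Y" using t(1,4) m(1) by (auto simp: Y_def)
    then show "\<exists>H'\<in>Y. H' \<noteq> H \<and> H' \<inter> X = H \<inter> X" using H'(2,3) by (intro bexI[of _ H'] conjI)
  qed
  moreover have "{H. subgroup H G \<and> \<not> finite_index (snd ` H) F} \<subseteq> chabauty G closure_of Y"
  proof
    fix H assume "H \<in> {H. subgroup H G \<and> \<not> finite_index (snd ` H) F}"
    then have H: "subgroup H G" "\<not> finite_index (snd ` H) F" by auto
    have "\<exists>H'\<in>Y. subgroup H' G \<and> H' \<inter> X = H \<inter> X" if X: "finite X" "X \<subseteq> carrier G" for X
    proof -
      obtain H' N where H': "subgroup H' G" "H \<subseteq> H'" "snd ` H' = snd ` H" "H' \<inter> X = H \<inter> X" "N > (0 :: int)"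
        "\<And>z. (N *s z, \<one>\<^bsub>F\<^esub>) \<in> H'" using thicken[OF H(1) X] by metis
      \<comment> \<open>\<open>H'\<close> has the required lattice, and the restriction to
        \<open>UNIV \<times> \<Gamma>\<close> makes the projection finitely generated. The
        restriction keeps the multiples of \<open>N\<close>, which lie over the identity, and it
        keeps the trace on \<open>X\<close>.\<close>
      define \<Gamma> where "\<Gamma> = generate F (snd ` (H \<inter> X))"
      have finX: "finite (snd ` (H \<inter> X))" "snd ` (H \<inter> X) \<subseteq> snd ` H" using X by auto
      have "\<not> (fg_subgroup F (snd ` H) \<and> finite_index (snd ` H) (F\<lparr>carrier := carrier F\<rparr>))" using H(2) by simp
      from generate_trace[OF F.subgroup_self subgroup_proj[OF H(1)] subgroup.subset[OF subgroup_proj[OF H(1)]] this finX]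
      have \<Gamma>: "fg_subgroup F \<Gamma>" "\<Gamma> \<subseteq> snd ` H" "\<not> finite_index \<Gamma> F" by (simp_all add: \<Gamma>_def)
      have s\<Gamma>: "subgroup \<Gamma> F" using F.fg_subgroup_is_subgroup[OF \<Gamma>(1)] .
      define H'' where "H'' = H' \<inter> (UNIV \<times> \<Gamma>)"
      have "subgroup H'' G" unfolding H''_def by (rule subgroup_restrict[OF H'(1) s\<Gamma>])
      moreover have "snd ` H'' = \<Gamma>" unfolding H''_def using snd_restrict \<Gamma>(2) H'(3) by metis
      moreover have "(N *s z, \<one>\<^bsub>F\<^esub>) \<in> H''" for z
        unfolding H''_def using H'(6) subgroup.one_closed[OF s\<Gamma>] by simp
      moreover have "H'' \<inter> X = H \<inter> X"
      proof -
        have "snd x \<in> \<Gamma>" if "x \<in> H \<inter> X" for x unfolding \<Gamma>_def using that by (intro generate.incl) blast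
        then have "H \<inter> X \<subseteq> UNIV \<times> \<Gamma>" by force
        then show ?thesis unfolding H''_def using H'(4) by blast
      qed
      ultimately show ?thesis using \<Gamma> H'(5) by (intro bexI[of _ H'']) (auto simp: Y_def)
    qed
    then show "H \<in> chabauty G closure_of Y" unfolding in_closure_chabauty using H(1) by simp
  qed
  ultimately show "{H. subgroup H G \<and> \<not> finite_index (snd ` H) F} \<subseteq> perfect_kernel G" by (rule order_trans[rotated])
qed

end

section \<open>A dense orbit\<close>

lemma countable_int_vec: "countable (UNIV :: (int ^ 'd) set)"
proof -
  have "countable (vec_nth ` (UNIV :: (int ^ 'd) set))"
    using countable_subset[OF subset_UNIV countableI_type] .
  moreover have "inj (vec_nth :: int ^ 'd \<Rightarrow> 'd \<Rightarrow> int)" by (simp add: inj_def vec_nth_inject)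
  ultimately show ?thesis by (rule countable_image_inj_on)
qed

lemma countable_subgroups_zlattice: "countable {\<Lambda> :: (int ^ 'd) set. subgroup \<Lambda> zlattice}"
proof -
  have "countable {\<Lambda> :: (int ^ 'd) set. fg_subgroup zlattice \<Lambda>}"
    by (rule group.countable_fg_subgroups[OF group_zlattice]) (simp add: countable_int_vec)
  then show ?thesis by (rule countable_subset[rotated]) (auto intro: fg_subgroup_zlattice)
qed

lemma countable_free_group: "countable A \<Longrightarrow> countable (carrier (free_group A))"
proof -
  assume "countable A"
  then have "countable (lists (A \<times> (UNIV :: bool set)))" by (intro countable_lists countable_SIGMA) auto
  moreover have "carrier (free_group A) \<subseteq> lists (A \<times> UNIV)"
    by (force simp: carrier_free_group in_lists_conv_set image_subset_iff)
  ultimately show ?thesis by (rule countable_subset[rotated])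
qed

context lattice_by_free
begin

lemma countable_G: "countable A \<Longrightarrow> countable (carrier G)"
  unfolding carrier_G using countable_int_vec countable_free_group by (intro countable_SIGMA) auto

lemma tame_fg: "tame S L H \<Longrightarrow> fg_subgroup G H"
  unfolding tame_def using fg_subgroup_G by blast

text \<open>The recursion runs through all pairs of a tame \<open>H\<close> and a finite set
  \<open>X\<close>. At its stage a conjugate of \<open>H\<close> is joined to the subgroup built so
  far, and the conjugate of \<open>X - H\<close> is declared forbidden for all later stages.
  Conjugating the union back then reproduces the trace of \<open>H\<close> on \<open>X\<close>
  exactly.\<close>

lemma dense_orbit_exists:
  fixes \<Lambda> :: "(int ^ 'd) set"
  defines "S \<equiv> lattice_stab F \<rho> \<Lambda>"
  assumes A: "finite A" and \<Lambda>: "subgroup \<Lambda> zlattice" and nc: "\<not> cyclic_subgroup F S"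
  obtains H0 where "subgroup H0 G" "H0 \<inter> V = \<Lambda> \<times> {\<one>\<^bsub>F\<^esub>}" "snd ` H0 \<subseteq> S"
    "\<not> (fg_subgroup F (snd ` H0) \<and> finite_index (snd ` H0) (F\<lparr>carrier := S\<rparr>))"
    "\<not> finite_index (snd ` H0) F"
    "\<And>H X. subgroup H G \<Longrightarrow> H \<inter> V = \<Lambda> \<times> {\<one>\<^bsub>F\<^esub>} \<Longrightarrow> snd ` H \<subseteq> S \<Longrightarrow>
      \<not> (fg_subgroup F (snd ` H) \<and> finite_index (snd ` H) (F\<lparr>carrier := S\<rparr>)) \<Longrightarrow>
      finite X \<Longrightarrow> X \<subseteq> carrier G \<Longrightarrow> \<exists>g\<in>carrier G. conj_subgroup G g H0 \<inter> X = H \<inter> X"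
proof -
  let ?L = "\<Lambda> \<times> {\<one>\<^bsub>F\<^esub>}"
  let ?FS = "F\<lparr>carrier := S\<rparr>"
  have S: "subgroup S F" unfolding S_def by (rule subgroup_lattice_stab)
  have Lc: "conj_subgroup G g ?L = ?L" if "g \<in> carrier G" "snd g \<in> S" for g
    using tame_vertex_conj[OF order_refl, of g \<Lambda>] that by (simp add: S_def)
  define P where "P = {H. tame S ?L H} \<times> {X. X \<subseteq> carrier G \<and> finite X}"
  have cG: "countable (carrier G)" using countable_G A by (simp add: countable_finite)
  have cP: "countable P"
    unfolding P_def
  proof (intro countable_SIGMA)
    have "{H. tame S ?L H} \<subseteq> {H. fg_subgroup G H}" using tame_fg by blast
    then show "countable {H. tame S ?L H}" using G.countable_fg_subgroups[OF cG] by (rule countable_subset)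
    show "countable {X. X \<subseteq> carrier G \<and> finite X}"
      using countable_Collect_finite_subset[OF cG] by (simp add: conj_commute)
  qed
  have triv: "subgroup {\<one>\<^bsub>F\<^esub>} F" by (rule F.triv_subgroup)
  have oneS: "{\<one>\<^bsub>F\<^esub>} \<subseteq> S" using subgroup.one_closed[OF S] by blast
  have fg1: "fg_subgroup F {\<one>\<^bsub>F\<^esub>}"
    using F.fg_subgroupI[of "{}"] F.generate_empty by simp
  have "\<not> finite_index {\<one>\<^bsub>F\<^esub>} ?FS"
    by (rule noncyclic_commuting_infinite_index[OF S nc triv oneS]) simp
  then have t0: "tame S ?L ?L"
    using subgroup_Times[OF \<Lambda> triv] oneS Times_Int_V[of "{\<one>\<^bsub>F\<^esub>}" \<Lambda>] snd_Times[OF \<Lambda>, of "{\<one>\<^bsub>F\<^esub>}"] fg1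
      subgroup_zlatticeD(1)[OF \<Lambda>]
    unfolding tame_def S_def by auto
  then have neP: "P \<noteq> {}" unfolding P_def by blast
  define e where "e = from_nat_into P"
  have e: "tame S ?L (fst (e n))" "snd (e n) \<subseteq> carrier G" "finite (snd (e n))" for n
    using from_nat_into[OF neP, of n] unfolding e_def P_def by auto
  \<comment> \<open>A state is the subgroup built so far together with the finite set of elements
    that must never enter.\<close>
  define ok where "ok s \<longleftrightarrow> tame S ?L (fst s) \<and> finite (snd s) \<and> snd s \<subseteq> carrier G \<and> snd s \<inter> fst s = {}"
    for s :: "((int ^ 'd) \<times> 'a fword) set \<times> ((int ^ 'd) \<times> 'a fword) set"
  define R where "R n s s' \<longleftrightarrow> fst s \<subseteq> fst s' \<and> snd s \<subseteq> snd s' \<and>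
     (\<exists>g\<in>carrier G. conj_subgroup G g (fst (e n)) \<subseteq> fst s' \<and> conj_subgroup G g (snd (e n) - fst (e n)) \<subseteq> snd s')"
    for n s s'
  have "\<exists>f. \<forall>n. ok (f n) \<and> R n (f n) (f (Suc n))"
  proof (rule dependent_nat_choice)
    have "ok (?L, {})" using t0 by (simp add: ok_def)
    then show "\<exists>x. ok x" by (rule exI)
  next
    fix s n assume "ok s"
    then have s: "tame S ?L (fst s)" "finite (snd s)" "snd s \<subseteq> carrier G" "snd s \<inter> fst s = {}"
      by (simp_all add: ok_def)
    have d: "finite (snd (e n) - fst (e n))" "snd (e n) - fst (e n) \<subseteq> carrier G" "(snd (e n) - fst (e n)) \<inter> fst (e n) = {}"
      using e[of n] by auto
    obtain g where g: "g \<in> carrier G" "snd g \<in> S"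
      "tame S ?L (generate G (fst s \<union> conj_subgroup G g (fst (e n))))"
      "generate G (fst s \<union> conj_subgroup G g (fst (e n))) \<inter> snd s = {}"
      "generate G (fst s \<union> conj_subgroup G g (fst (e n))) \<inter> conj_subgroup G g (snd (e n) - fst (e n)) = {}"
      by (rule tame_join[OF S nc Lc s(1) e(1)[of n] s(2-4) d])
    define s' where "s' = (generate G (fst s \<union> conj_subgroup G g (fst (e n))),
      snd s \<union> conj_subgroup G g (snd (e n) - fst (e n)))"
    have "conj_subgroup G g (snd (e n) - fst (e n)) \<subseteq> carrier G" using G.conj_subgroup_carrier[OF g(1) d(2)] .
    moreover have "finite (conj_subgroup G g (snd (e n) - fst (e n)))" using d(1) by (simp add: conj_subgroup_image)
    ultimately have "ok s'" using g(3,4,5) s(2,3) by (auto simp: ok_def s'_def)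
    moreover have "R n s s'"
      unfolding R_def s'_def fst_conv snd_conv
      by (intro conjI bexI[OF _ g(1)]) (auto intro: generate.incl)
    ultimately show "\<exists>y. ok y \<and> R n s y" by blast
  qed
  then obtain f where f: "\<And>n. ok (f n)" "\<And>n. R n (f n) (f (Suc n))" by blast
  define K where "K n = fst (f n)" for n
  define N where "N n = snd (f n)" for n
  have tK: "tame S ?L (K n)" and KN: "N n \<inter> K n = {}" for n using f(1)[of n] by (auto simp: ok_def K_def N_def)
  have step: "K n \<subseteq> K (Suc n)" "N n \<subseteq> N (Suc n)" for n using f(2)[of n] by (auto simp: R_def K_def N_def)
  have mono: "K m \<subseteq> K n" "N m \<subseteq> N n" if "m \<le> n" for m n
    using lift_Suc_mono_le[of K, OF step(1) that] lift_Suc_mono_le[of N, OF step(2) that] by auto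
  have KN': "N m \<inter> K n = {}" for m n
    using mono(1)[of n "max m n"] mono(2)[of m "max m n"] KN[of "max m n"] by fastforce
  define H0 where "H0 = \<Union>(range K)"
  have sK: "subgroup (K n) G" "K n \<inter> V = ?L" "snd ` K n \<subseteq> S" "fg_subgroup F (snd ` K n)"
    "\<not> finite_index (snd ` K n) ?FS" for n using tK[of n] by (auto simp: tame_def)
  have chain: "X \<subseteq> Y \<or> Y \<subseteq> X" if XY: "X \<in> range K" "Y \<in> range K" for X Y
  proof -
    obtain m n where "X = K m" "Y = K n" using XY by blast
    then show ?thesis using mono(1)[of m n] mono(1)[of n m] by (cases "m \<le> n") auto
  qed
  have sH0: "subgroup H0 G" unfolding H0_def by (rule G.subgroup_Union_chain[OF _ _ chain]) (use sK(1) in auto)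
  have VH0: "H0 \<inter> V = ?L" using sK(2) unfolding H0_def by blast
  have SH0: "snd ` H0 \<subseteq> S" using sK(3) unfolding H0_def by blast
  have proj: "snd ` H0 = \<Union>(range (\<lambda>n. snd ` K n))" by (auto simp: H0_def)
  \<comment> \<open>The projections of the stages form a chain. A finitely generated union equals
    one of them, which has infinite index, so the union does not leave the class that it has to
    approximate.\<close>
  have fg0: "\<exists>n. snd ` H0 = snd ` K n" if "fg_subgroup F (snd ` H0)"
  proof -
    have "snd ` H0 \<in> range (\<lambda>n. snd ` K n)"
    proof (rule F.fg_subgroup_chain[OF that proj])
      show "X \<subseteq> Y \<or> Y \<subseteq> X" if XY: "X \<in> range (\<lambda>n. snd ` K n)" "Y \<in> range (\<lambda>n. snd ` K n)" for X Y
      proof -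
        obtain m n where "X = snd ` K m" "Y = snd ` K n" using XY by blast
        then show ?thesis
          using image_mono[OF mono(1)[of m n], of snd] image_mono[OF mono(1)[of n m], of snd] by (metis nat_le_linear)
      qed
    qed (use subgroup_proj[OF sK(1)] in auto)
    then show ?thesis by blast
  qed
  have inf0: "\<not> (fg_subgroup F (snd ` H0) \<and> finite_index (snd ` H0) ?FS)"
  proof
    assume *: "fg_subgroup F (snd ` H0) \<and> finite_index (snd ` H0) ?FS"
    then obtain n where "snd ` H0 = snd ` K n" using fg0 by blast
    then show False using * sK(5)[of n] by simp
  qed
  have infF: "\<not> finite_index (snd ` H0) F"
  proof
    assume fin: "finite_index (snd ` H0) F"
    then have "fg_subgroup F (snd ` H0)" using free_fg_of_finite_index[OF A subgroup_proj[OF sH0]] by blast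
    moreover have "finite_index (snd ` H0) ?FS"
      using F.finite_index_subgroup[OF S subgroup_proj[OF sH0] SH0 fin] .
    ultimately show False using inf0 by blast
  qed
  show ?thesis
  proof (rule that[OF sH0 VH0 SH0 inf0 infF])
    fix H X
    assume H: "subgroup H G" "H \<inter> V = ?L" "snd ` H \<subseteq> S" "\<not> (fg_subgroup F (snd ` H) \<and> finite_index (snd ` H) ?FS)"
      and X: "finite X" "X \<subseteq> carrier G"
    \<comment> \<open>\<open>H\<close> need not be tame. Its restriction to the part of the
      projection generated by the elements of \<open>X\<close> is tame, with the same lattice and
      the same trace on \<open>X\<close>, and therefore occurs in the enumeration.\<close>
    define \<Gamma> where "\<Gamma> = generate F (snd ` (H \<inter> X))"
    have "finite (snd ` (H \<inter> X))" "snd ` (H \<inter> X) \<subseteq> snd ` H" using X by auto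
    from generate_trace[OF S subgroup_proj[OF H(1)] H(3,4) this]
    have \<Gamma>: "fg_subgroup F \<Gamma>" "\<Gamma> \<subseteq> snd ` H" "\<not> finite_index \<Gamma> ?FS" by (simp_all add: \<Gamma>_def)
    have s\<Gamma>: "subgroup \<Gamma> F" using F.fg_subgroup_is_subgroup[OF \<Gamma>(1)] .
    define H1 where "H1 = H \<inter> (UNIV \<times> \<Gamma>)"
    have H1X: "H1 \<inter> X = H \<inter> X"
    proof -
      have "snd x \<in> \<Gamma>" if "x \<in> H \<inter> X" for x unfolding \<Gamma>_def using that by (intro generate.incl) blast
      then have "H \<inter> X \<subseteq> UNIV \<times> \<Gamma>" by force
      then show ?thesis unfolding H1_def by blast
    qed
    have "H1 \<inter> V = ?L" unfolding H1_def using restrict_Int_V[OF subgroup.one_closed[OF s\<Gamma>]] H(2) by simp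
    then have "tame S ?L H1"
      using subgroup_restrict[OF H(1) s\<Gamma>] snd_restrict[OF \<Gamma>(2)] \<Gamma> H(3) unfolding tame_def H1_def by auto
    then have "(H1, X) \<in> P" using X by (simp add: P_def)
    then obtain n where n: "e n = (H1, X)" using from_nat_into_surj[OF cP] unfolding e_def by metis
    obtain g where g: "g \<in> carrier G" "conj_subgroup G g H1 \<subseteq> K (Suc n)" "conj_subgroup G g (X - H1) \<subseteq> N (Suc n)"
      using f(2)[of n] n by (auto simp: R_def K_def N_def)
    have "conj_subgroup G (inv\<^bsub>G\<^esub> g) H0 \<inter> X = H1 \<inter> X"
    proof -
      have "x \<in> conj_subgroup G (inv\<^bsub>G\<^esub> g) H0 \<longleftrightarrow> x \<in> H1" if x: "x \<in> X" for x
      proof -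
        have xc: "x \<in> carrier G" using x X by blast
        have iff: "x \<in> conj_subgroup G (inv\<^bsub>G\<^esub> g) H0 \<longleftrightarrow> g \<otimes>\<^bsub>G\<^esub> x \<otimes>\<^bsub>G\<^esub> inv\<^bsub>G\<^esub> g \<in> H0"
          using G.conj_subgroup_mem_iff[OF G.inv_closed[OF g(1)] xc subgroup.subset[OF sH0]] g(1) by simp
        show ?thesis
        proof (cases "x \<in> H1")
          case True
          then have "g \<otimes>\<^bsub>G\<^esub> x \<otimes>\<^bsub>G\<^esub> inv\<^bsub>G\<^esub> g \<in> conj_subgroup G g H1" unfolding conj_subgroup_image by (rule imageI)
          then show ?thesis using iff True g(2) unfolding H0_def by blast
        next
          case False
          then have "g \<otimes>\<^bsub>G\<^esub> x \<otimes>\<^bsub>G\<^esub> inv\<^bsub>G\<^esub> g \<in> conj_subgroup G g (X - H1)"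
            unfolding conj_subgroup_image using x by (intro imageI) simp
          then have "g \<otimes>\<^bsub>G\<^esub> x \<otimes>\<^bsub>G\<^esub> inv\<^bsub>G\<^esub> g \<in> N (Suc n)" using g(3) by (rule subsetD[rotated])
          then have "g \<otimes>\<^bsub>G\<^esub> x \<otimes>\<^bsub>G\<^esub> inv\<^bsub>G\<^esub> g \<notin> H0" using KN' unfolding H0_def by blast
          then show ?thesis using iff False by blast
        qed
      qed
      then show ?thesis by blast
    qed
    then show "\<exists>g\<in>carrier G. conj_subgroup G g H0 \<inter> X = H \<inter> X"
      using H1X G.inv_closed[OF g(1)] by (intro bexI[of _ "inv\<^bsub>G\<^esub> g"]) simp_all
  qed
qed

end

declare mult_free_group [simp del] one_free_group [simp del]

section \<open>The pieces of the perfect kernel\<close>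

locale lattice_by_finite_rank_free = lattice_by_free A \<rho>
  for A :: "'a set" and \<rho> :: "'a fword \<Rightarrow> int ^ 'd ^ 'd" +
  fixes \<alpha> \<beta>
  assumes finite_A: "finite A" and \<alpha>\<beta>: "\<alpha> \<in> A" "\<beta> \<in> A" "\<alpha> \<noteq> \<beta>"
begin

abbreviation "stab \<Lambda> \<equiv> lattice_stab F \<rho> \<Lambda>"
abbreviation "lat H \<equiv> fst ` (H \<inter> V)"
abbreviation "orb \<Lambda> \<equiv> orbit F (lattice_act \<rho>) \<Lambda>"
abbreviation "vertical O' \<equiv> (\<lambda>L. L \<times> {\<one>\<^bsub>F\<^esub>}) ` O'"
text \<open>For a noncyclic stabilizer this says that the projection lies in the perfect kernel of
  the stabilizer.\<close>

abbreviation "inert H \<equiv> \<not> (fg_subgroup F (snd ` H) \<and> finite_index (snd ` H) (F\<lparr>carrier := stab (lat H)\<rparr>))"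

lemmas kernel_G = perfect_kernel_G[OF finite_A \<alpha>\<beta>]

lemma finite_index_noncyclic: "subgroup S F \<Longrightarrow> finite_index S F \<Longrightarrow> \<not> cyclic_subgroup F S"
  using free_commuting_infinite_index[OF \<alpha>\<beta>, of S] F.cyclic_subgroup_commute by blast

lemma orb_mem: "L \<in> orb \<Lambda> \<longleftrightarrow> (\<exists>g\<in>carrier F. L = lattice_act \<rho> g \<Lambda>)"
  by (auto simp: orbit_def)

lemma orb_refl: "\<Lambda> \<in> orb \<Lambda>"
  unfolding orb_mem using lattice_act_one F.one_closed by metis

lemma orb_act: "L \<in> orb \<Lambda> \<Longrightarrow> \<gamma> \<in> carrier F \<Longrightarrow> lattice_act \<rho> \<gamma> L \<in> orb \<Lambda>"
  unfolding orb_mem using lattice_act_mult F.m_closed by metis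

lemma orb_eq:
  assumes "L \<in> orb \<Lambda>" shows "orb L = orb \<Lambda>"
proof -
  obtain g where g: "g \<in> carrier F" "L = lattice_act \<rho> g \<Lambda>" using assms orb_mem by blast
  have back': "\<Lambda> \<in> orb L"
    unfolding orb_mem using g lattice_act_inv(1)[OF g(1), of \<Lambda>] F.inv_closed[OF g(1)] by metis
  have sub: "orb L \<subseteq> orb M" if LM: "L \<in> orb M" for L M
  proof
    fix x assume "x \<in> orb L"
    then obtain h where "h \<in> carrier F" "x = lattice_act \<rho> h L" using orb_mem by blast
    then show "x \<in> orb M" using orb_act[OF LM] by simp
  qed
  show ?thesis using sub[OF assms] sub[OF back'] by blast
qed

lemma orb_subgroup: "subgroup \<Lambda> zlattice \<Longrightarrow> L \<in> orb \<Lambda> \<Longrightarrow> subgroup L zlattice"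
  unfolding orb_mem using subgroup_lattice_act by blast

lemma vertical_mem: "H \<inter> V \<in> vertical O' \<longleftrightarrow> lat H \<in> O'"
proof
  assume "H \<inter> V \<in> vertical O'"
  then obtain L where "L \<in> O'" "H \<inter> V = L \<times> {\<one>\<^bsub>F\<^esub>}" by blast
  then show "lat H \<in> O'" by simp
next
  assume "lat H \<in> O'"
  then have "lat H \<times> {\<one>\<^bsub>F\<^esub>} \<in> vertical O'" by (rule imageI)
  then show "H \<inter> V \<in> vertical O'" using Int_V_eq[of H] by simp
qed

lemma lat_mem: "v \<in> lat H \<longleftrightarrow> (v, \<one>\<^bsub>F\<^esub>) \<in> H"
  by (force simp: vertex_group_def)

lemma kernel_piece_mem:
  "H \<in> kernel_piece F \<rho> (vertical (orb \<Lambda>)) \<longleftrightarrow> subgroup H G \<and> \<not> finite_index (snd ` H) F \<and> lat H \<in> orb \<Lambda>"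
  unfolding kernel_piece_def kernel_G vertical_mem by simp

text \<open>If the stabilizer is cyclic, its perfect kernel is empty and every \<open>H\<close> over
  it is exceptional; the projection is then automatically finitely generated. So finite generation
  can be asserted in both cases.\<close>

lemma exceptional_piece_mem:
  "H \<in> exceptional_piece F \<rho> (vertical (orb \<Lambda>)) \<longleftrightarrow> H \<in> kernel_piece F \<rho> (vertical (orb \<Lambda>)) \<and>
     fg_subgroup F (snd ` H) \<and> (cyclic_subgroup F (stab (lat H)) \<or> finite_index (snd ` H) (F\<lparr>carrier := stab (lat H)\<rparr>))"
proof (cases "H \<in> kernel_piece F \<rho> (vertical (orb \<Lambda>))")
  case True
  then have H: "subgroup H G" by (simp add: kernel_piece_mem)
  note S = subgroup_lattice_stab[of "lat H"]
  have pS: "snd ` H \<subseteq> stab (lat H)" by (rule proj_subset_stab[OF H])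
  show ?thesis
  proof (cases "cyclic_subgroup F (stab (lat H))")
    case c: True
    then obtain s where "s \<in> carrier F" "stab (lat H) = generate F {s}" by (auto simp: cyclic_subgroup_def)
    then have "fg_subgroup F (snd ` H)" using F.fg_subgroup_of_cyclic[OF _ subgroup_proj[OF H]] pS by metis
    then show ?thesis
      using True c unfolding exceptional_piece_def mem_Collect_eq unfolding perfect_kernel_cyclic[OF S c] by simp
  next
    case False
    then show ?thesis
      using True pS subgroup_proj[OF H] unfolding exceptional_piece_def mem_Collect_eq
      unfolding perfect_kernel_noncyclic[OF S False] by simp
  qed
qed (simp add: exceptional_piece_def)

lemma lat_conj:
  assumes "subgroup H G" "g \<in> carrier G"
  shows "lat (conj_subgroup G g H) = lattice_act \<rho> (snd g) (lat H)"
proof -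
  have "conj_subgroup G g H \<inter> V = lattice_act \<rho> (snd g) (lat H) \<times> {\<one>\<^bsub>F\<^esub>}"
    using conj_Int_V[OF assms] conj_vertex[OF assms(2), of "lat H"] Int_V_eq[of H] by simp
  then show ?thesis by simp
qed

lemma stab_act:
  assumes \<gamma>: "\<gamma> \<in> carrier F"
  shows "stab (lattice_act \<rho> \<gamma> \<Lambda>) = conj_subgroup F \<gamma> (stab \<Lambda>)"
proof (rule Set.set_eqI)
  fix x
  have sub: "stab \<Lambda> \<subseteq> carrier F" using subgroup.subset[OF subgroup_lattice_stab] .
  show "x \<in> stab (lattice_act \<rho> \<gamma> \<Lambda>) \<longleftrightarrow> x \<in> conj_subgroup F \<gamma> (stab \<Lambda>)"
  proof (cases "x \<in> carrier F")
    case x: True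
    have c: "inv\<^bsub>F\<^esub> \<gamma> \<in> carrier F" "x \<otimes>\<^bsub>F\<^esub> \<gamma> \<in> carrier F" "inv\<^bsub>F\<^esub> \<gamma> \<otimes>\<^bsub>F\<^esub> x \<otimes>\<^bsub>F\<^esub> \<gamma> \<in> carrier F"
      using \<gamma> x by simp_all
    have "inv\<^bsub>F\<^esub> \<gamma> \<otimes>\<^bsub>F\<^esub> x \<otimes>\<^bsub>F\<^esub> \<gamma> = inv\<^bsub>F\<^esub> \<gamma> \<otimes>\<^bsub>F\<^esub> (x \<otimes>\<^bsub>F\<^esub> \<gamma>)" using F.m_assoc[OF c(1) x \<gamma>] .
    then have e: "lattice_act \<rho> (inv\<^bsub>F\<^esub> \<gamma> \<otimes>\<^bsub>F\<^esub> x \<otimes>\<^bsub>F\<^esub> \<gamma>) \<Lambda> = lattice_act \<rho> (inv\<^bsub>F\<^esub> \<gamma>) (lattice_act \<rho> x (lattice_act \<rho> \<gamma> \<Lambda>))"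
      using lattice_act_mult[OF c(1,2), of \<Lambda>] lattice_act_mult[OF x \<gamma>, of \<Lambda>] by simp
    have "lattice_act \<rho> x (lattice_act \<rho> \<gamma> \<Lambda>) = lattice_act \<rho> \<gamma> \<Lambda> \<longleftrightarrow>
        lattice_act \<rho> (inv\<^bsub>F\<^esub> \<gamma>) (lattice_act \<rho> x (lattice_act \<rho> \<gamma> \<Lambda>)) = \<Lambda>"
      using lattice_act_inv[OF \<gamma>] by metis
    then show ?thesis
      unfolding F.conj_subgroup_mem_iff[OF \<gamma> x sub] mem_lattice_stab using e x c(3) by simp
  next
    case False
    then show ?thesis using F.conj_subgroup_carrier[OF \<gamma> sub] by (auto simp: mem_lattice_stab)
  qed
qed

lemma finite_index_conj_F:
  assumes "\<gamma> \<in> carrier F" "subgroup \<Gamma> F" "finite_index \<Gamma> F"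
  shows "finite_index (conj_subgroup F \<gamma> \<Gamma>) F"
proof -
  have "conj_subgroup F \<gamma> (carrier F) = carrier F"
    using F.conj_subgroup_self[OF F.subgroup_self assms(1)] .
  then show ?thesis
    using F.finite_index_conj[OF assms(1) F.subgroup_self assms(2) subgroup.subset[OF assms(2)]] assms(3) by simp
qed

lemma finite_index_conj_F_iff:
  assumes "\<gamma> \<in> carrier F" "subgroup \<Gamma> F"
  shows "finite_index (conj_subgroup F \<gamma> \<Gamma>) F \<longleftrightarrow> finite_index \<Gamma> F"
  using finite_index_conj_F[OF assms] finite_index_conj_F[OF F.inv_closed[OF assms(1)] F.subgroup_conj[OF assms]]
    F.conj_subgroup_inv(1)[OF assms(1) subgroup.subset[OF assms(2)]] by metis

lemma cyclic_stab_act: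
  assumes "\<gamma> \<in> carrier F"
  shows "cyclic_subgroup F (stab (lattice_act \<rho> \<gamma> \<Lambda>)) \<longleftrightarrow> cyclic_subgroup F (stab \<Lambda>)"
  using F.cyclic_subgroup_conj[OF assms, of "stab \<Lambda>"]
    F.cyclic_subgroup_conj[OF F.inv_closed[OF assms], of "conj_subgroup F \<gamma> (stab \<Lambda>)"]
    F.conj_subgroup_inv(1)[OF assms subgroup.subset[OF subgroup_lattice_stab]] stab_act[OF assms] by metis

lemma conj_invariant_piece: "conj_invariant G (kernel_piece F \<rho> (vertical (orb \<Lambda>)))"
  unfolding conj_invariant_def
proof (intro ballI)
  fix g H assume g: "g \<in> carrier G" and H: "H \<in> kernel_piece F \<rho> (vertical (orb \<Lambda>))"
  then have H': "subgroup H G" "\<not> finite_index (snd ` H) F" "lat H \<in> orb \<Lambda>" by (simp_all add: kernel_piece_mem)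
  have \<gamma>: "snd g \<in> carrier F" using g by (simp add: carrier_G mem_Times_iff)
  show "conj_subgroup G g H \<in> kernel_piece F \<rho> (vertical (orb \<Lambda>))"
    unfolding kernel_piece_mem lat_conj[OF H'(1) g] snd_conj_subgroup[OF g subgroup.subset[OF H'(1)]]
      finite_index_conj_F_iff[OF \<gamma> subgroup_proj[OF H'(1)]]
    using H' orb_act[OF H'(3) \<gamma>] G.subgroup_conj[OF g H'(1)] by blast
qed

lemma conj_invariant_exceptional: "conj_invariant G (exceptional_piece F \<rho> (vertical (orb \<Lambda>)))"
  unfolding conj_invariant_def
proof (intro ballI)
  fix g H assume g: "g \<in> carrier G" and H: "H \<in> exceptional_piece F \<rho> (vertical (orb \<Lambda>))"
  then have D: "H \<in> kernel_piece F \<rho> (vertical (orb \<Lambda>))" "fg_subgroup F (snd ` H)"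
    "cyclic_subgroup F (stab (lat H)) \<or> finite_index (snd ` H) (F\<lparr>carrier := stab (lat H)\<rparr>)"
    by (auto simp: exceptional_piece_mem)
  have sH: "subgroup H G" using D(1) by (simp add: kernel_piece_mem)
  have \<gamma>: "snd g \<in> carrier F" using g by (simp add: carrier_G mem_Times_iff)
  have P: "conj_subgroup G g H \<in> kernel_piece F \<rho> (vertical (orb \<Lambda>))"
    using conj_invariant_piece D(1) g unfolding conj_invariant_def by blast
  have "cyclic_subgroup F (stab (lat (conj_subgroup G g H)))" if "cyclic_subgroup F (stab (lat H))"
    unfolding lat_conj[OF sH g] cyclic_stab_act[OF \<gamma>] using that .
  moreover have "finite_index (snd ` conj_subgroup G g H) (F\<lparr>carrier := stab (lat (conj_subgroup G g H))\<rparr>)"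
    if "finite_index (snd ` H) (F\<lparr>carrier := stab (lat H)\<rparr>)"
    unfolding lat_conj[OF sH g] stab_act[OF \<gamma>] snd_conj_subgroup[OF g subgroup.subset[OF sH]]
    using F.finite_index_conj[OF \<gamma> subgroup_lattice_stab subgroup_proj[OF sH] proj_subset_stab[OF sH] that] .
  moreover have "fg_subgroup F (snd ` conj_subgroup G g H)"
    unfolding snd_conj_subgroup[OF g subgroup.subset[OF sH]] using F.fg_subgroup_conj[OF \<gamma> D(2)] .
  ultimately show "conj_subgroup G g H \<in> exceptional_piece F \<rho> (vertical (orb \<Lambda>))"
    unfolding exceptional_piece_mem using P D(3) by blast
qed

text \<open>
  If \<open>\<gamma>\<Lambda>\<close> were strictly larger than \<open>\<Lambda>\<close>, the powers of \<open>\<gamma>\<close> would give a strictly ascending chain.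
\<close>

lemma act_superset_eq:
  assumes \<gamma>: "\<gamma> \<in> carrier F" and \<Lambda>: "subgroup \<Lambda> zlattice" and sub: "\<Lambda> \<subseteq> lattice_act \<rho> \<gamma> \<Lambda>"
  shows "lattice_act \<rho> \<gamma> \<Lambda> = \<Lambda>"
proof -
  interpret Z: group "zlattice :: (int ^ 'd) monoid" by (rule group_zlattice)
  define f where "f n = lattice_act \<rho> (\<gamma> [^]\<^bsub>F\<^esub> n) \<Lambda>" for n :: nat
  have pc: "\<gamma> [^]\<^bsub>F\<^esub> n \<in> carrier F" for n :: nat using \<gamma> by simp
  have fS: "f (Suc n) = lattice_act \<rho> (\<gamma> [^]\<^bsub>F\<^esub> n) (lattice_act \<rho> \<gamma> \<Lambda>)" for n
    unfolding f_def F.nat_pow_Suc by (rule lattice_act_mult[OF pc \<gamma>])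
  have "f n \<subseteq> f (Suc n)" for n unfolding fS unfolding f_def lattice_act_def by (rule image_mono) (use sub in \<open>simp add: lattice_act_def\<close>)
  then have mono: "f m \<subseteq> f n" if "m \<le> n" for m n using that by (rule lift_Suc_mono_le)
  have chain: "X \<subseteq> Y \<or> Y \<subseteq> X" if XY: "X \<in> range f" "Y \<in> range f" for X Y
  proof -
    obtain m n where "X = f m" "Y = f n" using XY by blast
    then show ?thesis using mono[of m n] mono[of n m] by (metis nat_le_linear)
  qed
  have sf: "subgroup X zlattice" if X: "X \<in> range f" for X
  proof -
    obtain n where "X = f n" using X by blast
    then show ?thesis using subgroup_lattice_act[OF \<Lambda>] by (simp add: f_def)
  qed
  have ne: "range f \<noteq> {}" by simp
  have "\<Union>(range f) \<in> range f"
    by (rule Z.fg_subgroup_chain[OF fg_subgroup_zlattice[OF Z.subgroup_Union_chain[OF ne sf chain]] refl ne sf chain])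
  then obtain n where n: "\<Union>(range f) = f n" by blast
  then have "f (Suc n) \<subseteq> f n" by blast
  then have "lattice_act \<rho> (inv\<^bsub>F\<^esub> (\<gamma> [^]\<^bsub>F\<^esub> n)) (f (Suc n)) \<subseteq> lattice_act \<rho> (inv\<^bsub>F\<^esub> (\<gamma> [^]\<^bsub>F\<^esub> n)) (f n)"
    unfolding lattice_act_def by (rule image_mono)
  then have "lattice_act \<rho> \<gamma> \<Lambda> \<subseteq> \<Lambda>" unfolding fS unfolding f_def lattice_act_inv(1)[OF pc] .
  then show ?thesis using sub by blast
qed

lemma orb_superset_eq:
  assumes "subgroup \<Lambda> zlattice" "L \<in> orb \<Lambda>" "L' \<in> orb \<Lambda>" "L \<subseteq> L'"
  shows "L' = L"
proof -
  have "L' \<in> orb L" using orb_eq[OF assms(2)] assms(3) by simp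
  then obtain \<gamma> where "\<gamma> \<in> carrier F" "L' = lattice_act \<rho> \<gamma> L" using orb_mem by blast
  then show ?thesis using act_superset_eq[of \<gamma> L] orb_subgroup[OF assms(1,2)] assms(4) by simp
qed

section \<open>The partition into pieces\<close>

lemma vertex_conj_mem: "\<C> \<in> vertex_conj F \<rho> \<longleftrightarrow> (\<exists>\<Lambda>. subgroup \<Lambda> zlattice \<and> \<C> = vertical (orb \<Lambda>))"
  unfolding vertex_conj_eq[OF F.group_axioms \<rho>] by blast

lemma countable_vertex_conj: "countable (vertex_conj F \<rho>)"
proof -
  have "vertex_conj F \<rho> \<subseteq> (\<lambda>\<Lambda>. vertical (orb \<Lambda>)) ` {\<Lambda>. subgroup \<Lambda> zlattice}"
    using vertex_conj_mem by blast
  then show ?thesis using countable_image[OF countable_subgroups_zlattice] by (rule countable_subset)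
qed

lemma kernel_Union: "perfect_kernel G = (\<Union>\<C>\<in>vertex_conj F \<rho>. kernel_piece F \<rho> \<C>)"
proof
  show "(\<Union>\<C>\<in>vertex_conj F \<rho>. kernel_piece F \<rho> \<C>) \<subseteq> perfect_kernel G" by (auto simp: kernel_piece_def)
  show "perfect_kernel G \<subseteq> (\<Union>\<C>\<in>vertex_conj F \<rho>. kernel_piece F \<rho> \<C>)"
  proof
    fix H assume "H \<in> perfect_kernel G"
    then have H: "subgroup H G" "\<not> finite_index (snd ` H) F" by (simp_all add: kernel_G)
    have "vertical (orb (lat H)) \<in> vertex_conj F \<rho>" using subgroup_fst_Int_V[OF H(1)] vertex_conj_mem by blast
    moreover have "H \<in> kernel_piece F \<rho> (vertical (orb (lat H)))" using H orb_refl kernel_piece_mem by blast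
    ultimately show "H \<in> (\<Union>\<C>\<in>vertex_conj F \<rho>. kernel_piece F \<rho> \<C>)" by (rule UN_I)
  qed
qed

lemma kernel_disjoint: "disjoint_family_on (kernel_piece F \<rho>) (vertex_conj F \<rho>)"
  unfolding disjoint_family_on_def
proof (intro ballI impI)
  fix \<C> \<C>' assume C: "\<C> \<in> vertex_conj F \<rho>" "\<C>' \<in> vertex_conj F \<rho>" "\<C> \<noteq> \<C>'"
  obtain \<Lambda> where \<Lambda>: "\<C> = vertical (orb \<Lambda>)" using C(1) vertex_conj_mem by blast
  obtain \<Lambda>' where \<Lambda>': "\<C>' = vertical (orb \<Lambda>')" using C(2) vertex_conj_mem by blast
  have False if H: "H \<in> kernel_piece F \<rho> \<C>" "H \<in> kernel_piece F \<rho> \<C>'" for H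
  proof -
    have "lat H \<in> orb \<Lambda>" "lat H \<in> orb \<Lambda>'" using H unfolding \<Lambda> \<Lambda>' kernel_piece_mem by blast+
    then have "orb \<Lambda> = orb \<Lambda>'" using orb_eq by metis
    then show False using C(3) \<Lambda> \<Lambda>' by simp
  qed
  then show "kernel_piece F \<rho> \<C> \<inter> kernel_piece F \<rho> \<C>' = {}" by blast
qed

text \<open>The lattice itself projects to the trivial group, which is cyclic and hence of infinite
  index. This shows that pieces are nonempty and supplies the approximating subgroups in
  \<open>closedin_piece_imp\<close>.\<close>

lemma vertical_in_piece:
  assumes \<Lambda>: "subgroup \<Lambda> zlattice" and L: "L \<in> orb \<Lambda>"
  shows "L \<times> {\<one>\<^bsub>F\<^esub>} \<in> kernel_piece F \<rho> (vertical (orb \<Lambda>))"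
proof -
  have sL: "subgroup L zlattice" using orb_subgroup[OF \<Lambda> L] .
  have "{\<one>\<^bsub>F\<^esub>} \<subseteq> stab L" using subgroup.one_closed[OF subgroup_lattice_stab] by blast
  then have "subgroup (L \<times> {\<one>\<^bsub>F\<^esub>}) G" by (rule subgroup_Times[OF sL F.triv_subgroup])
  moreover have "snd ` (L \<times> {\<one>\<^bsub>F\<^esub>}) = {\<one>\<^bsub>F\<^esub>}" using snd_Times[OF sL] .
  moreover have "\<not> finite_index {\<one>\<^bsub>F\<^esub>} F"
    using finite_index_noncyclic[OF F.triv_subgroup] F.cyclic_subgroup_trivial by blast
  moreover have "lat (L \<times> {\<one>\<^bsub>F\<^esub>}) = L" using Times_Int_V[of "{\<one>\<^bsub>F\<^esub>}" L] by simp
  ultimately show ?thesis unfolding kernel_piece_mem using L by simp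
qed

section \<open>Topology of the pieces\<close>

abbreviation "K \<equiv> subtopology (chabauty G) (perfect_kernel G)"

lemma closedin_perfect_kernel: "closedin (chabauty G) (perfect_kernel G)"
  unfolding perfect_kernel_def by (rule closedin_perfect_kernel_of)

lemma piece_subset: "kernel_piece F \<rho> \<C> \<subseteq> perfect_kernel G"
  by (auto simp: kernel_piece_def)

text \<open>If the lattice of \<open>H\<close> differs from \<open>L\<close>, one vector witnesses
  it, and prescribing membership of that vector gives an open neighbourhood of \<open>H\<close> off
  the fibre.\<close>

lemma closedin_fiber: "closedin K {H \<in> perfect_kernel G. lat H = L}"
proof -
  let ?U = "{H. subgroup H G \<and> lat H \<noteq> L}"
  have "openin (chabauty G) ?U"
    unfolding openin_chabauty_iff
  proof (intro conjI ballI)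
    fix H assume "H \<in> ?U"
    then obtain v where v: "(v \<in> lat H) \<noteq> (v \<in> L)" by blast
    have "H' \<in> ?U" if H': "subgroup H' G" "H' \<inter> {(v, \<one>\<^bsub>F\<^esub>)} = H \<inter> {(v, \<one>\<^bsub>F\<^esub>)}" for H'
    proof -
      have "(v, \<one>\<^bsub>F\<^esub>) \<in> H' \<longleftrightarrow> (v, \<one>\<^bsub>F\<^esub>) \<in> H" using H'(2) by blast
      then have "lat H' \<noteq> L" using v lat_mem by metis
      then show ?thesis using H'(1) by simp
    qed
    then show "\<exists>A. finite A \<and> A \<subseteq> carrier G \<and> (\<forall>H'. subgroup H' G \<longrightarrow> H' \<inter> A = H \<inter> A \<longrightarrow> H' \<in> ?U)"
      using F.one_closed by (intro exI[of _ "{(v, \<one>\<^bsub>F\<^esub>)}"]) (simp add: carrier_G)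
  qed blast
  then have "closedin (chabauty G) (topspace (chabauty G) - ?U)" by blast
  moreover have "{H \<in> perfect_kernel G. lat H = L} = (topspace (chabauty G) - ?U) \<inter> perfect_kernel G"
    using perfect_kernel_subset[of _ G] by (auto simp: topspace_chabauty)
  ultimately show ?thesis unfolding closedin_subtopology by blast
qed

lemma piece_Union_fibers:
  "kernel_piece F \<rho> (vertical (orb \<Lambda>)) = \<Union>((\<lambda>L. {H \<in> perfect_kernel G. lat H = L}) ` orb \<Lambda>)"
  unfolding kernel_piece_def vertical_mem by blast

lemma fsigma_piece:
  assumes "subgroup \<Lambda> zlattice"
  shows "fsigma_in K (kernel_piece F \<rho> (vertical (orb \<Lambda>)))"
  unfolding piece_Union_fibers
proof (rule fsigma_in_Union)
  have "orb \<Lambda> \<subseteq> {\<Lambda>. subgroup \<Lambda> zlattice}" using orb_subgroup[OF assms] by blast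
  then show "countable ((\<lambda>L. {H \<in> perfect_kernel G. lat H = L}) ` orb \<Lambda>)"
    by (intro countable_image countable_subset[OF _ countable_subgroups_zlattice])
qed (use closedin_fiber closed_imp_fsigma_in in blast)

lemma countable_exceptional: "countable (exceptional_piece F \<rho> (vertical (orb \<Lambda>)))"
proof -
  have "exceptional_piece F \<rho> (vertical (orb \<Lambda>)) \<subseteq> {H. fg_subgroup G H}"
  proof
    fix H assume "H \<in> exceptional_piece F \<rho> (vertical (orb \<Lambda>))"
    then show "H \<in> {H. fg_subgroup G H}"
      unfolding exceptional_piece_mem kernel_piece_mem using fg_subgroup_G by simp
  qed
  then show ?thesis
    using G.countable_fg_subgroups[OF countable_G[OF countable_finite[OF finite_A]]] by (rule countable_subset)
qed

text \<open>\<open>?T\<close> is open since containing a finitely generated subgroup is an open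
  condition, and it cuts \<open>?D\<close> out of the piece: there an overgroup has its projection
  between that of the exceptional subgroup and the common stabilizer, where finite generation and
  finite index pass upwards.\<close>

lemma openin_exceptional:
  assumes \<Lambda>: "subgroup \<Lambda> zlattice"
  shows "openin (subtopology K (kernel_piece F \<rho> (vertical (orb \<Lambda>)))) (exceptional_piece F \<rho> (vertical (orb \<Lambda>)))"
proof -
  let ?P = "kernel_piece F \<rho> (vertical (orb \<Lambda>))" and ?D = "exceptional_piece F \<rho> (vertical (orb \<Lambda>))"
  let ?T = "{H'. subgroup H' G \<and> (\<exists>H\<in>?D. H \<subseteq> H')}"
  have "openin (chabauty G) ?T"
    unfolding openin_chabauty_iff
  proof (intro conjI ballI)
    fix H' assume "H' \<in> ?T"
    then obtain H where H: "H \<in> ?D" "H \<subseteq> H'" by blast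
    then have "fg_subgroup G H" unfolding exceptional_piece_mem kernel_piece_mem using fg_subgroup_G by simp
    then obtain B where B: "finite B" "B \<subseteq> H" "H \<subseteq> carrier G" "generate G B = H" by (rule G.fg_subgroupE)
    have "M \<in> ?T" if M: "subgroup M G" "M \<inter> B = H' \<inter> B" for M
    proof -
      have "B \<subseteq> M" using M(2) B(2) H(2) by blast
      then have "H \<subseteq> M" using G.generate_subgroup_incl[OF _ M(1)] B(4) by metis
      then show ?thesis using M(1) H(1) by blast
    qed
    then show "\<exists>A. finite A \<and> A \<subseteq> carrier G \<and> (\<forall>M. subgroup M G \<longrightarrow> M \<inter> A = H' \<inter> A \<longrightarrow> M \<in> ?T)"
      using B(1) order_trans[OF B(2,3)] by (intro exI[of _ B]) simp
  qed blast
  moreover have "?D = ?T \<inter> (perfect_kernel G \<inter> ?P)"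
  proof
    show "?D \<subseteq> ?T \<inter> (perfect_kernel G \<inter> ?P)"
    proof
      fix H assume H: "H \<in> ?D"
      then have "H \<in> ?P" "subgroup H G" by (auto simp: exceptional_piece_mem kernel_piece_mem)
      then show "H \<in> ?T \<inter> (perfect_kernel G \<inter> ?P)" using H piece_subset by blast
    qed
    show "?T \<inter> (perfect_kernel G \<inter> ?P) \<subseteq> ?D"
    proof
      fix M assume M: "M \<in> ?T \<inter> (perfect_kernel G \<inter> ?P)"
      then obtain H where H: "H \<in> ?D" "H \<subseteq> M" by blast
      have P: "H \<in> ?P" "M \<in> ?P" using H(1) M exceptional_piece_mem by blast+
      have s: "subgroup H G" "lat H \<in> orb \<Lambda>" "subgroup M G" "lat M \<in> orb \<Lambda>" using P by (auto simp: kernel_piece_mem)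
      have "lat H \<subseteq> lat M" using H(2) by blast
      then have lat: "lat M = lat H" using orb_superset_eq[OF \<Lambda> s(2,4)] by blast
      let ?S = "stab (lat H)"
      have pM: "snd ` M \<subseteq> ?S" using proj_subset_stab[OF s(3)] lat by simp
      have HM: "snd ` H \<subseteq> snd ` M" using H(2) by (rule image_mono)
      have fgH: "fg_subgroup F (snd ` H)" and alt: "cyclic_subgroup F ?S \<or> finite_index (snd ` H) (F\<lparr>carrier := ?S\<rparr>)"
        using H(1) by (auto simp: exceptional_piece_mem)
      have "fg_subgroup F (snd ` M) \<and> (cyclic_subgroup F ?S \<or> finite_index (snd ` M) (F\<lparr>carrier := ?S\<rparr>))"
      proof (cases "cyclic_subgroup F ?S")
        case True
        then obtain t where "t \<in> carrier F" "?S = generate F {t}" by (auto simp: cyclic_subgroup_def)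
        then show ?thesis using F.fg_subgroup_of_cyclic[OF _ subgroup_proj[OF s(3)]] pM True by metis
      next
        case False
        then have fin: "finite_index (snd ` H) (F\<lparr>carrier := ?S\<rparr>)" using alt by blast
        interpret S: group "F\<lparr>carrier := ?S\<rparr>" using F.subgroup_imp_group[OF subgroup_lattice_stab] .
        have "fg_subgroup F (snd ` M)"
          using F.fg_subgroup_finite_index_over[OF subgroup_lattice_stab subgroup_proj[OF s(3)] pM fgH HM fin] .
        moreover have "finite_index (snd ` M) (F\<lparr>carrier := ?S\<rparr>)"
          using S.finite_index_mono[OF F.subgroup_incl[OF subgroup_proj[OF s(1)] subgroup_lattice_stab order_trans[OF HM pM]]
            F.subgroup_incl[OF subgroup_proj[OF s(3)] subgroup_lattice_stab pM] HM fin] .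
        ultimately show ?thesis by blast
      qed
      then show "M \<in> ?D" unfolding exceptional_piece_mem lat using P(2) by blast
    qed
  qed
  ultimately show ?thesis unfolding subtopology_subtopology openin_subtopology by blast
qed

lemma diff_mem:
  assumes nc: "\<not> cyclic_subgroup F (stab \<Lambda>)"
  shows "H \<in> kernel_piece F \<rho> (vertical (orb \<Lambda>)) - exceptional_piece F \<rho> (vertical (orb \<Lambda>)) \<longleftrightarrow>
    H \<in> kernel_piece F \<rho> (vertical (orb \<Lambda>)) \<and> inert H"
proof -
  have "\<not> cyclic_subgroup F (stab (lat H))" if "lat H \<in> orb \<Lambda>"
    using that nc cyclic_stab_act orb_mem by metis
  then show ?thesis unfolding Diff_iff exceptional_piece_mem kernel_piece_mem by blast
qed

text \<open>\<open>dense_orbit_exists\<close> approximates only subgroups over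
  \<open>\<Lambda>\<close> itself. A subgroup over another lattice of the orbit is conjugated back
  together with the finite set \<open>X\<close>, approximated there and conjugated forth.\<close>

lemma dense_orbit:
  assumes \<Lambda>: "subgroup \<Lambda> zlattice" and ne: "perfect_kernel (F\<lparr>carrier := stab \<Lambda>\<rparr>) \<noteq> {}"
  defines "Q \<equiv> kernel_piece F \<rho> (vertical (orb \<Lambda>)) - exceptional_piece F \<rho> (vertical (orb \<Lambda>))"
  shows "\<exists>H\<in>Q. subtopology K Q closure_of orbit G (conj_subgroup G) H = Q"
proof -
  have nc: "\<not> cyclic_subgroup F (stab \<Lambda>)" using perfect_kernel_cyclic[OF subgroup_lattice_stab] ne by metis
  have Q: "H \<in> Q \<longleftrightarrow> H \<in> kernel_piece F \<rho> (vertical (orb \<Lambda>)) \<and> inert H" for H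
    unfolding Q_def by (rule diff_mem[OF nc])
  obtain H0 where H0: "subgroup H0 G" "H0 \<inter> V = \<Lambda> \<times> {\<one>\<^bsub>F\<^esub>}" "snd ` H0 \<subseteq> stab \<Lambda>"
    "\<not> (fg_subgroup F (snd ` H0) \<and> finite_index (snd ` H0) (F\<lparr>carrier := stab \<Lambda>\<rparr>))" "\<not> finite_index (snd ` H0) F"
    and dense: "\<And>H X. subgroup H G \<Longrightarrow> H \<inter> V = \<Lambda> \<times> {\<one>\<^bsub>F\<^esub>} \<Longrightarrow> snd ` H \<subseteq> stab \<Lambda> \<Longrightarrow>
      \<not> (fg_subgroup F (snd ` H) \<and> finite_index (snd ` H) (F\<lparr>carrier := stab \<Lambda>\<rparr>)) \<Longrightarrow>
      finite X \<Longrightarrow> X \<subseteq> carrier G \<Longrightarrow> \<exists>g\<in>carrier G. conj_subgroup G g H0 \<inter> X = H \<inter> X"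
    using dense_orbit_exists[OF finite_A \<Lambda> nc] by metis
  have "lat H0 = \<Lambda>" using H0(2) by simp
  then have H0Q: "H0 \<in> Q" unfolding Q kernel_piece_mem using H0 orb_refl by simp
  let ?O = "orbit G (conj_subgroup G) H0"
  have inv: "conj_subgroup G g H \<in> Q" if "H \<in> Q" "g \<in> carrier G" for g H
  proof -
    have "conj_subgroup G (inv\<^bsub>G\<^esub> g) (conj_subgroup G g H) = H"
      using G.conj_subgroup_inv(1)[OF that(2)] that(1) subgroup.subset unfolding Q kernel_piece_mem by metis
    then show ?thesis
      using that conj_invariant_piece[of \<Lambda>] conj_invariant_exceptional[of \<Lambda>] G.inv_closed[OF that(2)]
      unfolding Q_def conj_invariant_def by (metis DiffD1 DiffD2 DiffI)
  qed
  have OQ: "?O \<subseteq> Q" unfolding orbit_def using inv[OF H0Q] by blast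
  have QK: "Q \<subseteq> perfect_kernel G" unfolding Q_def using piece_subset by blast
  have "Q \<subseteq> chabauty G closure_of ?O"
  proof
    fix H assume HQ: "H \<in> Q"
    have H: "subgroup H G" "lat H \<in> orb \<Lambda>" using HQ unfolding Q kernel_piece_mem by blast+
    obtain \<gamma> where \<gamma>: "\<gamma> \<in> carrier F" "lat H = lattice_act \<rho> \<gamma> \<Lambda>" using H(2) orb_mem by blast
    define g where "g = ((0 :: int ^ 'd), \<gamma>)"
    have g: "g \<in> carrier G" using \<gamma>(1) by (simp add: g_def carrier_G)
    note g = g G.inv_closed[OF g]
    define H1 where "H1 = conj_subgroup G (inv\<^bsub>G\<^esub> g) H"
    have H1Q: "H1 \<in> Q" unfolding H1_def by (rule inv[OF HQ g(2)])
    have sH1: "subgroup H1 G" unfolding H1_def by (rule G.subgroup_conj[OF g(2) H(1)])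
    have "snd (inv\<^bsub>G\<^esub> g) = inv\<^bsub>F\<^esub> \<gamma>" using proj.hom_inv[OF g(1)] by (simp add: g_def)
    then have lat1: "lat H1 = \<Lambda>"
      unfolding H1_def lat_conj[OF H(1) g(2)] \<gamma>(2) using lattice_act_inv(1)[OF \<gamma>(1)] by simp
    have H1: "H1 \<inter> V = \<Lambda> \<times> {\<one>\<^bsub>F\<^esub>}" using Int_V_eq[of H1] lat1 by simp
    have i1: "\<not> (fg_subgroup F (snd ` H1) \<and> finite_index (snd ` H1) (F\<lparr>carrier := stab \<Lambda>\<rparr>))"
      using H1Q unfolding Q lat1 by blast
    have p1: "snd ` H1 \<subseteq> stab \<Lambda>" using proj_subset_stab[OF sH1] lat1 by simp
    have HH1: "conj_subgroup G g H1 = H"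
      unfolding H1_def using G.conj_subgroup_inv(2)[OF g(1) subgroup.subset[OF H(1)]] .
    have "\<exists>H'\<in>?O. subgroup H' G \<and> H' \<inter> X = H \<inter> X" if X: "finite X" "X \<subseteq> carrier G" for X
    proof -
      let ?X = "conj_subgroup G (inv\<^bsub>G\<^esub> g) X"
      have Xc: "?X \<subseteq> carrier G" using G.conj_subgroup_carrier[OF g(2) X(2)] .
      have "finite ?X" using X(1) by (simp add: conj_subgroup_image)
      from dense[OF sH1 H1 p1 i1 this Xc] obtain h where h: "h \<in> carrier G" "conj_subgroup G h H0 \<inter> ?X = H1 \<inter> ?X" by blast
      have gX: "conj_subgroup G g ?X = X" using G.conj_subgroup_inv(2)[OF g(1) X(2)] .
      have H0c: "H0 \<subseteq> carrier G" "H1 \<subseteq> carrier G" using subgroup.subset H0(1) sH1 by blast+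
      have "conj_subgroup G (g \<otimes>\<^bsub>G\<^esub> h) H0 \<inter> X = conj_subgroup G g (conj_subgroup G h H0 \<inter> ?X)"
        unfolding G.conj_subgroup_Int[OF g(1) G.conj_subgroup_carrier[OF h(1) H0c(1)] Xc] gX
          G.conj_subgroup_mult[OF g(1) h(1) H0c(1)] ..
      also have "\<dots> = H \<inter> X"
        unfolding h(2) G.conj_subgroup_Int[OF g(1) H0c(2) Xc] gX HH1 ..
      finally have e: "conj_subgroup G (g \<otimes>\<^bsub>G\<^esub> h) H0 \<inter> X = H \<inter> X" .
      have gh: "g \<otimes>\<^bsub>G\<^esub> h \<in> carrier G" using g(1) h(1) by (rule G.m_closed)
      then have "conj_subgroup G (g \<otimes>\<^bsub>G\<^esub> h) H0 \<in> ?O" unfolding orbit_def by blast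
      then show ?thesis using e G.subgroup_conj[OF gh H0(1)] by (intro bexI[of _ "conj_subgroup G (g \<otimes>\<^bsub>G\<^esub> h) H0"] conjI)
    qed
    then show "H \<in> chabauty G closure_of ?O" unfolding in_closure_chabauty using H(1) by simp
  qed
  then have "subtopology (chabauty G) Q closure_of ?O = Q"
    unfolding closure_of_subtopology using OQ by (simp add: inf_absorb2 inf_absorb1)
  moreover have "perfect_kernel G \<inter> Q = Q" using QK by blast
  ultimately have "subtopology K Q closure_of ?O = Q" unfolding subtopology_subtopology by simp
  then show ?thesis using H0Q by (rule bexI)
qed

lemma closedin_piece:
  assumes fin: "finite_index (stab \<Lambda>) F"
  shows "closedin K (kernel_piece F \<rho> (vertical (orb \<Lambda>)))"
proof -
  have "finite (orb \<Lambda>)" using fin finite_orbit_iff by blast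
  then show ?thesis unfolding piece_Union_fibers using closedin_fiber by (intro closedin_Union) auto
qed

text \<open>Only finitely many lattices contain all multiples of \<open>m\<close>. A neighbourhood
  that contains generators of the lattice of \<open>H\<close> and excludes one vector of every
  larger candidate fixes the lattice completely.\<close>

lemma openin_piece:
  assumes \<Lambda>: "subgroup \<Lambda> zlattice" and fin: "finite_index \<Lambda> zlattice"
  shows "openin K (kernel_piece F \<rho> (vertical (orb \<Lambda>)))"
proof -
  let ?U = "{H. subgroup H G \<and> lat H \<in> orb \<Lambda>}"
  obtain m :: int where m: "m > 0" "\<And>v. m *s v \<in> \<Lambda>" using finite_index_zlattice_multiple[OF \<Lambda> fin] by metis
  define C where "C = {\<Lambda> :: (int ^ 'd) set. subgroup \<Lambda> zlattice \<and> (\<forall>v. m *s v \<in> \<Lambda>)}"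
  have finC: "finite C" unfolding C_def by (rule finite_subgroups_above[OF m(1)])
  have mact: "m *s v \<in> L" if L: "L \<in> orb \<Lambda>" for L v
  proof -
    obtain g where g: "g \<in> carrier F" "L = lattice_act \<rho> g \<Lambda>" using L orb_mem by blast
    have "v = \<rho> g *v (\<rho> (inv\<^bsub>F\<^esub> g) *v v)"
      using rho_mult_vec'[of g "inv\<^bsub>F\<^esub> g" v] g(1) rho_one_vec[of v] by simp
    then have "m *s v = \<rho> g *v (m *s (\<rho> (inv\<^bsub>F\<^esub> g) *v v))" by (metis matrix_vector_scale)
    then show ?thesis unfolding g(2) lattice_act_def using m(2) by (rule image_eqI)
  qed
  have "openin (chabauty G) ?U"
    unfolding openin_chabauty_iff
  proof (intro conjI ballI)
    fix H assume H: "H \<in> ?U"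
    let ?L = "lat H"
    have sL: "subgroup ?L zlattice" using H subgroup_fst_Int_V by blast
    obtain B where B: "finite B" "B \<subseteq> ?L" "generate zlattice B = ?L"
      using group.fg_subgroupE[OF group_zlattice fg_subgroup_zlattice[OF sL]] by metis
    \<comment> \<open>For \<open>M\<close> inside \<open>?L\<close> the value is arbitrary; it is
      used only for a strictly larger \<open>M\<close>.\<close>
    define sep where "sep M = (SOME v. v \<in> M \<and> v \<notin> ?L)" for M :: "(int ^ 'd) set"
    define Z where "Z = B \<union> sep ` C"
    have key: "lat M = ?L" if M: "subgroup M G" "M \<inter> Z \<times> {\<one>\<^bsub>F\<^esub>} = H \<inter> Z \<times> {\<one>\<^bsub>F\<^esub>}" for M
    proof -
      have mem: "v \<in> lat M \<longleftrightarrow> v \<in> ?L" if "v \<in> Z" for v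
      proof -
        have "(v, \<one>\<^bsub>F\<^esub>) \<in> M \<longleftrightarrow> (v, \<one>\<^bsub>F\<^esub>) \<in> H" using M(2) that by blast
        then show ?thesis unfolding lat_mem .
      qed
      have "B \<subseteq> lat M" using mem B(2) unfolding Z_def by blast
      then have LM: "?L \<subseteq> lat M" using group.generate_subgroup_incl[OF group_zlattice _ subgroup_fst_Int_V[OF M(1)]] B(3) by metis
      then have "lat M \<in> C" using mact[of ?L] H subgroup_fst_Int_V[OF M(1)] unfolding C_def by blast
      then have sepZ: "sep (lat M) \<in> Z" by (simp add: Z_def)
      show ?thesis
      proof (rule ccontr)
        assume "lat M \<noteq> ?L"
        then have "\<exists>v. v \<in> lat M \<and> v \<notin> ?L" using LM by blast
        then have "sep (lat M) \<in> lat M \<and> sep (lat M) \<notin> ?L" unfolding sep_def by (rule someI_ex)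
        then show False using mem[OF sepZ] by blast
      qed
    qed
    have "\<forall>M. subgroup M G \<longrightarrow> M \<inter> Z \<times> {\<one>\<^bsub>F\<^esub>} = H \<inter> Z \<times> {\<one>\<^bsub>F\<^esub>} \<longrightarrow> M \<in> ?U"
    proof (intro allI impI CollectI conjI)
      fix M assume M: "subgroup M G" "M \<inter> Z \<times> {\<one>\<^bsub>F\<^esub>} = H \<inter> Z \<times> {\<one>\<^bsub>F\<^esub>}"
      show "subgroup M G" by fact
      show "lat M \<in> orb \<Lambda>" unfolding key[OF M] using H by blast
    qed
    moreover have "finite (Z \<times> {\<one>\<^bsub>F\<^esub>})" using B(1) finC by (simp add: Z_def)
    moreover have "Z \<times> {\<one>\<^bsub>F\<^esub>} \<subseteq> carrier G" using F.one_closed by (auto simp: carrier_G)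
    ultimately show "\<exists>A. finite A \<and> A \<subseteq> carrier G \<and> (\<forall>M. subgroup M G \<longrightarrow> M \<inter> A = H \<inter> A \<longrightarrow> M \<in> ?U)"
      by (intro exI[of _ "Z \<times> {\<one>\<^bsub>F\<^esub>}"] conjI)
  qed blast
  moreover have "kernel_piece F \<rho> (vertical (orb \<Lambda>)) = ?U \<inter> perfect_kernel G"
    unfolding kernel_piece_def vertical_mem using perfect_kernel_subset[of _ G] by blast
  ultimately show ?thesis unfolding openin_subtopology by blast
qed

text \<open>An infinite orbit accumulates, by compactness, at a subgroup that cannot belong to it.\<close>

lemma closedin_piece_imp:
  assumes \<Lambda>: "subgroup \<Lambda> zlattice" and cl: "closedin K (kernel_piece F \<rho> (vertical (orb \<Lambda>)))"
  shows "finite_index (stab \<Lambda>) F"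
proof (rule ccontr)
  let ?P = "kernel_piece F \<rho> (vertical (orb \<Lambda>))"
  assume "\<not> finite_index (stab \<Lambda>) F"
  then have infO: "infinite (orb \<Lambda>)" using finite_orbit_iff by blast
  have clP: "closedin (chabauty G) ?P" using closedin_trans_full[OF cl closedin_perfect_kernel] .
  define z where "z = from_nat_into (UNIV :: (int ^ 'd) set)"
  have z: "\<exists>n. z n = v" for v
    unfolding z_def using from_nat_into_surj[OF countable_int_vec, of v] by auto
  \<comment> \<open>Each step keeps an infinite half of the family, on which membership of the
    vector \<open>z n\<close> is constant.\<close>
  have "\<exists>f. \<forall>n::nat. (infinite (f n) \<and> f n \<subseteq> orb \<Lambda>) \<and>
      (f (Suc n) \<subseteq> f n \<and> ((\<forall>L\<in>f (Suc n). z n \<in> L) \<or> (\<forall>L\<in>f (Suc n). z n \<notin> L)))"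
  proof (rule dependent_nat_choice)
    show "\<exists>x. infinite x \<and> x \<subseteq> orb \<Lambda>" using infO by blast
  next
    fix x n assume x: "infinite x \<and> x \<subseteq> orb \<Lambda>"
    have e: "{L\<in>x. z n \<in> L} \<union> {L\<in>x. z n \<notin> L} = x" by blast
    have "infinite {L\<in>x. z n \<in> L} \<or> infinite {L\<in>x. z n \<notin> L}"
    proof (rule ccontr)
      assume "\<not> ?thesis"
      then have "finite ({L\<in>x. z n \<in> L} \<union> {L\<in>x. z n \<notin> L})" by blast
      then show False using x unfolding e by blast
    qed
    then show "\<exists>y. (infinite y \<and> y \<subseteq> orb \<Lambda>) \<and> (y \<subseteq> x \<and> ((\<forall>L\<in>y. z n \<in> L) \<or> (\<forall>L\<in>y. z n \<notin> L)))"
    proof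
      assume "infinite {L\<in>x. z n \<in> L}"
      then show ?thesis using x by (intro exI[of _ "{L\<in>x. z n \<in> L}"]) auto
    next
      assume "infinite {L\<in>x. z n \<notin> L}"
      then show ?thesis using x by (intro exI[of _ "{L\<in>x. z n \<notin> L}"]) auto
    qed
  qed
  then obtain f where f: "\<And>n::nat. infinite (f n)" "\<And>n. f n \<subseteq> orb \<Lambda>" "\<And>n. f (Suc n) \<subseteq> f n"
    "\<And>n. (\<forall>L\<in>f (Suc n). z n \<in> L) \<or> (\<forall>L\<in>f (Suc n). z n \<notin> L)" by metis
  have mono: "f n \<subseteq> f m" if "m \<le> n" for m n using lift_Suc_antimono_le[of f, OF f(3) that] .
  define M where "M = {v. \<exists>N. \<forall>L\<in>f N. v \<in> L}"
  have dec: "\<exists>N. \<forall>L\<in>f N. v \<in> L \<longleftrightarrow> v \<in> M" for v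
  proof -
    obtain n where n: "z n = v" using z by blast
    show ?thesis
    proof (cases "v \<in> M")
      case True
      then obtain N where "\<forall>L\<in>f N. v \<in> L" by (auto simp: M_def)
      then show ?thesis using True by (intro exI[of _ N]) simp
    next
      case False
      then have "\<forall>L\<in>f (Suc n). v \<notin> L" using f(4)[of n] n by (auto simp: M_def)
      then show ?thesis using False by (intro exI[of _ "Suc n"]) simp
    qed
  qed
  have trace: "\<exists>N. \<forall>L\<in>f N. L \<inter> X = M \<inter> X" if "finite X" for X
    using that
  proof (induction X rule: finite_induct)
    case (insert v X)
    obtain N where N: "\<forall>L\<in>f N. L \<inter> X = M \<inter> X" using insert.IH by blast
    obtain N' where N': "\<forall>L\<in>f N'. v \<in> L \<longleftrightarrow> v \<in> M" using dec by blast
    have "L \<inter> insert v X = M \<inter> insert v X" if "L \<in> f (max N N')" for L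
    proof -
      have "L \<in> f N" "L \<in> f N'" using mono[of N "max N N'"] mono[of N' "max N N'"] that by auto
      then show ?thesis using N N' by blast
    qed
    then show ?case by (intro exI[of _ "max N N'"]) simp
  qed simp
  have sf: "subgroup L zlattice" if "L \<in> f n" for L n using orb_subgroup[OF \<Lambda>] f(2) that by blast
  have f_ne: "\<exists>L. L \<in> f n" for n using f(1)[of n] by (metis finite.emptyI ex_in_conv)
  have sM: "subgroup M zlattice"
  proof (rule subgroup_zlatticeI)
    show "0 \<in> M" unfolding M_def using subgroup_zlatticeD(1)[OF sf] by blast
    fix v w assume "v \<in> M" "w \<in> M"
    then obtain N N' where N: "\<forall>L\<in>f N. v \<in> L" "\<forall>L\<in>f N'. w \<in> L" by (auto simp: M_def)
    have "v - w \<in> L" if "L \<in> f (max N N')" for L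
    proof -
      have "L \<in> f N" "L \<in> f N'" using mono[of N "max N N'"] mono[of N' "max N N'"] that by auto
      then show ?thesis using N subgroup_zlatticeD(4)[OF sf] by blast
    qed
    then show "v - w \<in> M" unfolding M_def by blast
  qed
  have "{\<one>\<^bsub>F\<^esub>} \<subseteq> stab M" using subgroup.one_closed[OF subgroup_lattice_stab] by blast
  then have sMG: "subgroup (M \<times> {\<one>\<^bsub>F\<^esub>}) G" by (rule subgroup_Times[OF sM F.triv_subgroup])
  have "\<exists>H'\<in>?P. subgroup H' G \<and> H' \<inter> X = (M \<times> {\<one>\<^bsub>F\<^esub>}) \<inter> X" if X: "finite X" for X
  proof -
    have "finite (fst ` X)" using X by simp
    then obtain N where N: "\<forall>L\<in>f N. L \<inter> fst ` X = M \<inter> fst ` X" using trace by blast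
    obtain L where L: "L \<in> f N" using f_ne by blast
    have "L \<times> {\<one>\<^bsub>F\<^esub>} \<in> ?P" using vertical_in_piece[OF \<Lambda>] f(2) L by blast
    moreover from this have "subgroup (L \<times> {\<one>\<^bsub>F\<^esub>}) G" by (simp add: kernel_piece_mem)
    moreover have "(L \<times> {\<one>\<^bsub>F\<^esub>}) \<inter> X = (M \<times> {\<one>\<^bsub>F\<^esub>}) \<inter> X"
    proof -
      have "fst x \<in> L \<longleftrightarrow> fst x \<in> M" if "x \<in> X" for x using N L that by blast
      then show ?thesis by (auto simp: mem_Times_iff)
    qed
    ultimately show ?thesis by (intro bexI[of _ "L \<times> {\<one>\<^bsub>F\<^esub>}"] conjI)
  qed
  then have "M \<times> {\<one>\<^bsub>F\<^esub>} \<in> chabauty G closure_of ?P" unfolding in_closure_chabauty using sMG by simp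
  then have "M \<times> {\<one>\<^bsub>F\<^esub>} \<in> ?P" using closure_of_closedin[OF clP] by simp
  then have "lat (M \<times> {\<one>\<^bsub>F\<^esub>}) \<in> orb \<Lambda>" by (simp add: kernel_piece_mem)
  then have MO: "M \<in> orb \<Lambda>" using Times_Int_V[of "{\<one>\<^bsub>F\<^esub>}" M] by simp
  \<comment> \<open>\<open>M\<close> is finitely generated, so every lattice far enough in the
    families contains \<open>M\<close>. Lattices of one orbit are never properly nested, so an
    infinite family would consist of \<open>M\<close> alone.\<close>
  obtain B where B: "finite B" "B \<subseteq> M" "generate zlattice B = M"
    using group.fg_subgroupE[OF group_zlattice fg_subgroup_zlattice[OF sM]] by metis
  obtain N where N: "\<forall>L\<in>f N. L \<inter> B = M \<inter> B" using trace[OF B(1)] by blast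
  have "L = M" if L: "L \<in> f N" for L
  proof -
    have "B \<subseteq> L" using N L B(2) by blast
    then have "M \<subseteq> L" using group.generate_subgroup_incl[OF group_zlattice _ sf[OF L]] B(3) by metis
    then show ?thesis using orb_superset_eq[OF \<Lambda> MO] f(2) L by blast
  qed
  then have "f N \<subseteq> {M}" by blast
  then show False using f(1)[of N] finite_subset by blast
qed

text \<open>A cyclic stabilizer is finitely generated and of infinite index, against the assumption.
  Otherwise a finitely generated projection of finite index makes the stabilizer finitely generated,
  hence of finite index in the free group; then the projection has finite index there too and
  \<open>H\<close> is not in the perfect kernel.\<close>

lemma exceptional_empty:
  assumes \<Lambda>: "subgroup \<Lambda> zlattice" and S: "\<not> fg_subgroup F (stab \<Lambda>) \<or> finite_index (stab \<Lambda>) F"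
  shows "exceptional_piece F \<rho> (vertical (orb \<Lambda>)) = {}"
proof (rule ccontr)
  assume "exceptional_piece F \<rho> (vertical (orb \<Lambda>)) \<noteq> {}"
  then obtain H where "H \<in> exceptional_piece F \<rho> (vertical (orb \<Lambda>))" by blast
  then have H: "subgroup H G" "\<not> finite_index (snd ` H) F" "lat H \<in> orb \<Lambda>" "fg_subgroup F (snd ` H)"
    "cyclic_subgroup F (stab (lat H)) \<or> finite_index (snd ` H) (F\<lparr>carrier := stab (lat H)\<rparr>)"
    by (auto simp: exceptional_piece_mem kernel_piece_mem)
  obtain \<gamma> where \<gamma>: "\<gamma> \<in> carrier F" "lat H = lattice_act \<rho> \<gamma> \<Lambda>" using H(3) orb_mem by blast
  note sS = subgroup_lattice_stab[of \<Lambda>]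
  have st: "stab (lat H) = conj_subgroup F \<gamma> (stab \<Lambda>)" unfolding \<gamma>(2) by (rule stab_act[OF \<gamma>(1)])
  show False
  proof (cases "cyclic_subgroup F (stab (lat H))")
    case True
    then have c: "cyclic_subgroup F (stab \<Lambda>)" using cyclic_stab_act[OF \<gamma>(1)] \<gamma>(2) by simp
    then obtain s where "s \<in> carrier F" "stab \<Lambda> = generate F {s}" by (auto simp: cyclic_subgroup_def)
    then have "fg_subgroup F (stab \<Lambda>)" using F.fg_subgroupI[of "{s}"] by simp
    then show False using S finite_index_noncyclic[OF sS] c by blast
  next
    case False
    then have fin: "finite_index (snd ` H) (F\<lparr>carrier := stab (lat H)\<rparr>)" using H(5) by blast
    note pS = proj_subset_stab[OF H(1)] and sS' = subgroup_lattice_stab[of "lat H"]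
    have "fg_subgroup F (stab (lat H))"
      using F.fg_subgroup_finite_index_over[OF sS' sS' order_refl H(4) pS fin] .
    then have "fg_subgroup F (conj_subgroup F (inv\<^bsub>F\<^esub> \<gamma>) (conj_subgroup F \<gamma> (stab \<Lambda>)))"
      unfolding st using F.fg_subgroup_conj[OF F.inv_closed[OF \<gamma>(1)]] by blast
    then have "fg_subgroup F (stab \<Lambda>)" using F.conj_subgroup_inv(1)[OF \<gamma>(1) subgroup.subset[OF sS]] by simp
    then have "finite_index (stab \<Lambda>) F" using S by blast
    then have "finite_index (stab (lat H)) F" unfolding st finite_index_conj_F_iff[OF \<gamma>(1) sS] .
    then have "finite_index (snd ` H) F" using F.finite_index_trans[OF sS' subgroup_proj[OF H(1)] pS fin] by blast
    then show False using H(2) by blast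
  qed
qed

end

text \<open>A cyclic stabilizer has empty perfect kernel. Then every subgroup of the piece is
  exceptional, \<open>P - D\<close> is empty and contains no orbit at all; the dense orbit is
  therefore stated for a stabilizer with nonempty perfect kernel. That the pieces are nonempty is
  part of being a partition.\<close>

theorem theorem6p15:
  fixes r :: nat
    and \<rho> :: "nat fword \<Rightarrow> int ^ 'd ^ 'd"
  defines "F \<equiv> free_group {1..r}"
  defines "G \<equiv> semidirect F \<rho>"
  defines "K \<equiv> subtopology (chabauty G) (perfect_kernel G)"
  assumes r: "r \<ge> 2"
    and \<rho>: "\<rho> \<in> hom F GL_int"
  shows
    "countable (vertex_conj F \<rho>)
     \<and> perfect_kernel G = (\<Union>\<C>\<in>vertex_conj F \<rho>. kernel_piece F \<rho> \<C>)
     \<and> disjoint_family_on (kernel_piece F \<rho>) (vertex_conj F \<rho>)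
     \<and> (\<forall>\<C>\<in>vertex_conj F \<rho>.
          let P = kernel_piece F \<rho> \<C>; D = exceptional_piece F \<rho> \<C> in
            P \<noteq> {}
          \<and> conj_invariant G P
          \<and> fsigma_in K P
          \<and> countable D
          \<and> conj_invariant G D
          \<and> openin (subtopology K P) D
          \<and> (\<forall>\<Lambda>\<^sub>0. subgroup \<Lambda>\<^sub>0 zlattice \<and>
                 \<C> = {\<Lambda> \<times> {\<one>\<^bsub>F\<^esub>} | \<Lambda>. \<Lambda> \<in> orbit F (lattice_act \<rho>) \<Lambda>\<^sub>0} \<longrightarrow>
               (let S = lattice_stab F \<rho> \<Lambda>\<^sub>0 in
                 (perfect_kernel (F\<lparr>carrier := S\<rparr>) \<noteq> {} \<longrightarrow>
                    (\<exists>H\<in>P - D. subtopology K (P - D) closure_of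
                        orbit G (conj_subgroup G) H = P - D))
               \<and> (finite_index \<Lambda>\<^sub>0 zlattice \<longrightarrow> closedin K P \<and> openin K P)
               \<and> (closedin K P \<longleftrightarrow> finite_index S F)
               \<and> (\<not> finitely_generated (F\<lparr>carrier := S\<rparr>) \<or> finite_index S F \<longrightarrow> D = {}))))"
proof -
  interpret L: lattice_by_finite_rank_free "{1..r}" \<rho> 1 2
    using r \<rho> unfolding F_def by unfold_locales auto
  note unf = F_def G_def K_def
  have piece: "let P = kernel_piece F \<rho> \<C>; D = exceptional_piece F \<rho> \<C> in
            P \<noteq> {}
          \<and> conj_invariant G P
          \<and> fsigma_in K P
          \<and> countable D
          \<and> conj_invariant G D
          \<and> openin (subtopology K P) D
          \<and> (\<forall>\<Lambda>\<^sub>0. subgroup \<Lambda>\<^sub>0 zlattice \<and>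
                 \<C> = {\<Lambda> \<times> {\<one>\<^bsub>F\<^esub>} | \<Lambda>. \<Lambda> \<in> orbit F (lattice_act \<rho>) \<Lambda>\<^sub>0} \<longrightarrow>
               (let S = lattice_stab F \<rho> \<Lambda>\<^sub>0 in
                 (perfect_kernel (F\<lparr>carrier := S\<rparr>) \<noteq> {} \<longrightarrow>
                    (\<exists>H\<in>P - D. subtopology K (P - D) closure_of
                        orbit G (conj_subgroup G) H = P - D))
               \<and> (finite_index \<Lambda>\<^sub>0 zlattice \<longrightarrow> closedin K P \<and> openin K P)
               \<and> (closedin K P \<longleftrightarrow> finite_index S F)
               \<and> (\<not> finitely_generated (F\<lparr>carrier := S\<rparr>) \<or> finite_index S F \<longrightarrow> D = {})))"
    if \<C>: "\<C> \<in> vertex_conj F \<rho>" for \<C>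
    unfolding Let_def
  proof (intro conjI allI impI)
    obtain \<Lambda> where \<Lambda>: "subgroup \<Lambda> zlattice" "\<C> = L.vertical (L.orb \<Lambda>)"
      using \<C> L.vertex_conj_mem unfolding unf by blast
    show "kernel_piece F \<rho> \<C> \<noteq> {}"
      using L.vertical_in_piece[OF \<Lambda>(1) L.orb_refl] unfolding \<Lambda>(2) unf by blast
    show "conj_invariant G (kernel_piece F \<rho> \<C>)" unfolding \<Lambda>(2) unf by (rule L.conj_invariant_piece)
    show "fsigma_in K (kernel_piece F \<rho> \<C>)" unfolding \<Lambda>(2) unf by (rule L.fsigma_piece[OF \<Lambda>(1)])
    show "countable (exceptional_piece F \<rho> \<C>)" unfolding \<Lambda>(2) unf by (rule L.countable_exceptional)
    show "conj_invariant G (exceptional_piece F \<rho> \<C>)" unfolding \<Lambda>(2) unf by (rule L.conj_invariant_exceptional)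
    show "openin (subtopology K (kernel_piece F \<rho> \<C>)) (exceptional_piece F \<rho> \<C>)"
      unfolding \<Lambda>(2) unf by (rule L.openin_exceptional[OF \<Lambda>(1)])
  next
    fix \<Lambda>\<^sub>0
    assume "subgroup \<Lambda>\<^sub>0 zlattice \<and> \<C> = {\<Lambda> \<times> {\<one>\<^bsub>F\<^esub>} | \<Lambda>. \<Lambda> \<in> orbit F (lattice_act \<rho>) \<Lambda>\<^sub>0}"
    then have \<Lambda>: "subgroup \<Lambda>\<^sub>0 zlattice" "\<C> = L.vertical (L.orb \<Lambda>\<^sub>0)" unfolding unf by blast+
    show "\<exists>H\<in>kernel_piece F \<rho> \<C> - exceptional_piece F \<rho> \<C>.
        subtopology K (kernel_piece F \<rho> \<C> - exceptional_piece F \<rho> \<C>) closure_of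
          orbit G (conj_subgroup G) H = kernel_piece F \<rho> \<C> - exceptional_piece F \<rho> \<C>"
      if "perfect_kernel (F\<lparr>carrier := lattice_stab F \<rho> \<Lambda>\<^sub>0\<rparr>) \<noteq> {}"
      using L.dense_orbit[OF \<Lambda>(1)] that unfolding \<Lambda>(2) unf by blast
    show closed: "closedin K (kernel_piece F \<rho> \<C>) \<longleftrightarrow> finite_index (lattice_stab F \<rho> \<Lambda>\<^sub>0) F"
      using L.closedin_piece L.closedin_piece_imp[OF \<Lambda>(1)] unfolding \<Lambda>(2) unf by blast
    show "openin K (kernel_piece F \<rho> \<C>)" if "finite_index \<Lambda>\<^sub>0 zlattice"
      using L.openin_piece[OF \<Lambda>(1) that] unfolding \<Lambda>(2) unf .
    \<comment> \<open>A lattice of finite index has a stabilizer of finite index, so this half of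
      clopenness is an instance of the closedness criterion.\<close>
    show "closedin K (kernel_piece F \<rho> \<C>)" if fin: "finite_index \<Lambda>\<^sub>0 zlattice"
    proof -
      obtain m :: int where "m > 0" "\<And>v. m *s v \<in> \<Lambda>\<^sub>0" using finite_index_zlattice_multiple[OF \<Lambda>(1) fin] by metis
      then have "finite_index (lattice_stab F \<rho> \<Lambda>\<^sub>0) F" unfolding unf by (rule L.finite_index_stab[OF \<Lambda>(1)])
      then show ?thesis using closed by blast
    qed
    show "exceptional_piece F \<rho> \<C> = {}"
      if "\<not> finitely_generated (F\<lparr>carrier := lattice_stab F \<rho> \<Lambda>\<^sub>0\<rparr>) \<or> finite_index (lattice_stab F \<rho> \<Lambda>\<^sub>0) F"
      using that L.exceptional_empty[OF \<Lambda>(1)] L.F.finitely_generated_subgroup_iff[OF L.subgroup_lattice_stab]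
      unfolding \<Lambda>(2) unf by blast
  qed
  show ?thesis
    using L.countable_vertex_conj L.kernel_Union L.kernel_disjoint piece unfolding unf by blast
qed

end
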